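(* Let $(X,g)$ be a compact Riemannian manifold with $C^2$ boundary, let $\sigma\ge1$, and let $u$ be a real-valued solution of $$\tfrac12\Delta_gu=0\quad\text{in }X,\qquad\partial_{\nu_{\mathrm{out}}}u=\sigma u\quad\text{on }\partial X.$$ Write $d(x)=d(x,\partial X)$, choose $\rho_*>0$ such that $d$ is $C^2$ on $\mathcal C_{\rho_*}=\{x:d(x)\le\rho_*\}$, put $C_H=\|\Delta_gd\|_{L^\infty(\mathcal C_{\rho_*})}$, assume $C_H\rho_*\le\tfrac14$, and set $\rho_\sigma:=\min\{\rho_*,(4\sigma)^{-1}\}$. Then $$\sup_{\partial X}|u|\le2\sup_{\{d=\rho_\sigma\}}|u|,$$ and $$\|u\|_{L^2(\partial X)}^2\le4e^{C_H\rho_\sigma}\|u\|_{L^2(\{d=\rho_\sigma\})}^2\le6\|u\|_{L^2(\{d=\rho_\sigma\})}^2.$$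
   Context: $\nu_{\mathrm{out}}$ is the outward unit normal; $L^2$ norms on $\partial X$ and on the parallel hypersurface $\{d=\rho_\sigma\}$ are with respect to Riemannian surface measure. *)

theory Defs
  imports "HOL-Analysis.Analysis"
begin

section \<open>Maps of class C^k between Euclidean spaces\<close>

primrec Ck_on_open :: "nat \<Rightarrow> ('e::euclidean_space \<Rightarrow> 'b::real_normed_vector) \<Rightarrow> 'e set \<Rightarrow> bool"
where
  "Ck_on_open 0 f W \<longleftrightarrow> continuous_on W f"
| "Ck_on_open (Suc n) f W \<longleftrightarrow>
     (\<forall>x\<in>W. f differentiable (at x)) \<and>
     (\<forall>v. Ck_on_open n (\<lambda>x. frechet_derivative f (at x) v) W)"

text \<open>On a set that need not be open (for instance a relatively open subset of a half-space),
  C^k means that locally there is an extension of class C^k to an open set.\<close>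

definition Ck_on :: "nat \<Rightarrow> ('e::euclidean_space \<Rightarrow> 'b::real_normed_vector) \<Rightarrow> 'e set \<Rightarrow> bool" where
  "Ck_on n f S \<longleftrightarrow>
     (\<forall>x\<in>S. \<exists>W h. open W \<and> x \<in> W \<and> Ck_on_open n h W \<and> (\<forall>y\<in>S \<inter> W. h y = f y))"


section \<open>Riemannian manifolds with boundary of class C^2\<close>

text \<open>A chart is a pair of a domain \<open>U\<close> and a coordinate map \<open>\<phi>\<close>; only the values of \<open>\<phi>\<close> on \<open>U\<close>
  matter. The model space is the half-space \<open>{y. y $ k \<ge> 0}\<close> in \<open>real ^ 'n\<close>, where \<open>k\<close> is a
  distinguished coordinate, the field \<open>bcoord\<close>. The dimension of the manifold is \<open>CARD('n)\<close>,
  which may be any positive number. The field \<open>metric\<close> gives, for a chart \<open>c\<close> and a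
  point \<open>x\<close> of its domain, the matrix of components of the metric at \<open>x\<close> in the chart \<open>c\<close>.\<close>

type_synonym ('p, 'n) chart = "'p set \<times> ('p \<Rightarrow> real ^ 'n)"

record ('p, 'n) riem =
  carrier :: "'p set"
  atlas :: "('p, 'n) chart set"
  bcoord :: 'n
  metric :: "('p, 'n) chart \<Rightarrow> 'p \<Rightarrow> real ^ 'n ^ 'n"

abbreviation cdom :: "('p, 'n) chart \<Rightarrow> 'p set" where
  "cdom c \<equiv> fst c"

abbreviation coord :: "('p, 'n) chart \<Rightarrow> 'p \<Rightarrow> real ^ 'n" where
  "coord c \<equiv> snd c"

definition coord_inv :: "('p, 'n::finite) chart \<Rightarrow> real ^ 'n \<Rightarrow> 'p" where
  "coord_inv c = inv_into (cdom c) (coord c)"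

definition half_space :: "'n \<Rightarrow> (real ^ 'n::finite) set" where
  "half_space k = {y. 0 \<le> y $ k}"

definition is_chart :: "'p::t2_space set \<Rightarrow> 'n \<Rightarrow> ('p, 'n::finite) chart \<Rightarrow> bool" where
  "is_chart X k c \<longleftrightarrow>
     openin (top_of_set X) (cdom c) \<and>
     openin (top_of_set (half_space k)) (coord c ` cdom c) \<and>
     homeomorphism (cdom c) (coord c ` cdom c) (coord c) (coord_inv c)"

definition transition :: "('p, 'n::finite) chart \<Rightarrow> ('p, 'n) chart \<Rightarrow> real ^ 'n \<Rightarrow> real ^ 'n" where
  "transition c c' = coord c' \<circ> coord_inv c"

definition C2_compatible :: "('p, 'n::finite) chart \<Rightarrow> ('p, 'n) chart \<Rightarrow> bool" where
  "C2_compatible c c' \<longleftrightarrow>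
     Ck_on 2 (transition c c') (coord c ` (cdom c \<inter> cdom c')) \<and>
     Ck_on 2 (transition c' c) (coord c' ` (cdom c \<inter> cdom c'))"

definition C2_manifold_with_boundary :: "('p::t2_space, 'n::finite) riem \<Rightarrow> bool" where
  "C2_manifold_with_boundary M \<longleftrightarrow>
     (\<forall>c\<in>atlas M. is_chart (carrier M) (bcoord M) c) \<and>
     (\<Union>c\<in>atlas M. cdom c) = carrier M \<and>
     (\<forall>c\<in>atlas M. \<forall>c'\<in>atlas M. C2_compatible c c') \<and>
     (\<forall>c. is_chart (carrier M) (bcoord M) c \<and> (\<forall>c'\<in>atlas M. C2_compatible c c')
        \<longrightarrow> c \<in> atlas M)"

text \<open>The last clause of the next definition is the tensor transformation law. On a manifold of
  class C^2 the components of a metric can be at most of class C^1. No second countability is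
  demanded: it is automatic for the compact manifolds considered here.\<close>

definition riemannian_manifold_with_boundary :: "('p::t2_space, 'n::finite) riem \<Rightarrow> bool" where
  "riemannian_manifold_with_boundary M \<longleftrightarrow>
     C2_manifold_with_boundary M \<and>
     (\<forall>c\<in>atlas M. Ck_on 1 (\<lambda>y. metric M c (coord_inv c y)) (coord c ` cdom c)) \<and>
     (\<forall>c\<in>atlas M. \<forall>x\<in>cdom c.
        transpose (metric M c x) = metric M c x \<and>
        (\<forall>v. v \<noteq> 0 \<longrightarrow> v \<bullet> (metric M c x *v v) > 0)) \<and>
     (\<forall>c\<in>atlas M. \<forall>c'\<in>atlas M. \<forall>x\<in>cdom c \<inter> cdom c'. \<forall>v w.
        (let J = frechet_derivative (transition c c')
                   (at (coord c x) within coord c ` (cdom c \<inter> cdom c'))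
         in v \<bullet> (metric M c x *v w) = J v \<bullet> (metric M c' x *v J w)))"

definition boundary :: "('p, 'n::finite) riem \<Rightarrow> 'p set" where
  "boundary M = {x \<in> carrier M. \<exists>c\<in>atlas M. x \<in> cdom c \<and> coord c x $ bcoord M = 0}"

definition interior_of_mfd :: "('p, 'n::finite) riem \<Rightarrow> 'p set" where
  "interior_of_mfd M = carrier M - boundary M"

definition local_expr :: "('p, 'n::finite) chart \<Rightarrow> ('p \<Rightarrow> real) \<Rightarrow> real ^ 'n \<Rightarrow> real" where
  "local_expr c f = f \<circ> coord_inv c"

definition Ck_fun_on :: "('p, 'n::finite) riem \<Rightarrow> nat \<Rightarrow> ('p \<Rightarrow> real) \<Rightarrow> 'p set \<Rightarrow> bool" where
  "Ck_fun_on M n f S \<longleftrightarrow> (\<forall>c\<in>atlas M. Ck_on n (local_expr c f) (coord c ` (S \<inter> cdom c)))"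

text \<open>The quantities below that are computed in \<open>chart_at M x\<close> do not depend on the choice
  of the chart around \<open>x\<close>.\<close>

definition chart_at :: "('p, 'n::finite) riem \<Rightarrow> 'p \<Rightarrow> ('p, 'n) chart" where
  "chart_at M x = (SOME c. c \<in> atlas M \<and> x \<in> cdom c)"


section \<open>Laplace-Beltrami operator and normal derivative\<close>

text \<open>Derivatives are taken within the range of the chart, hence one-sided at boundary points.\<close>

definition partial_in :: "('p, 'n::finite) chart \<Rightarrow> 'n \<Rightarrow> (real ^ 'n \<Rightarrow> real) \<Rightarrow> real ^ 'n \<Rightarrow> real" where
  "partial_in c i h y = frechet_derivative h (at y within coord c ` cdom c) (axis i 1)"

definition laplacian_in :: "('p, 'n::finite) riem \<Rightarrow> ('p, 'n) chart \<Rightarrow> ('p \<Rightarrow> real) \<Rightarrow> 'p \<Rightarrow> real" where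
  "laplacian_in M c f x =
     (let G = (\<lambda>y. metric M c (coord_inv c y)) in
      1 / sqrt (det (metric M c x)) *
      (\<Sum>i\<in>UNIV. partial_in c i
         (\<lambda>y. sqrt (det (G y)) *
               (\<Sum>j\<in>UNIV. matrix_inv (G y) $ i $ j * partial_in c j (local_expr c f) y))
         (coord c x)))"

definition laplacian :: "('p, 'n::finite) riem \<Rightarrow> ('p \<Rightarrow> real) \<Rightarrow> 'p \<Rightarrow> real" where
  "laplacian M f x = laplacian_in M (chart_at M x) f x"

text \<open>In a boundary chart the tangent space of the boundary is \<open>{w. w $ bcoord M = 0}\<close>, and
  outward vectors have negative component \<open>bcoord M\<close>.\<close>

definition outward_unit_normal :: "('p, 'n::finite) riem \<Rightarrow> ('p, 'n) chart \<Rightarrow> 'p \<Rightarrow> real ^ 'n" where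
  "outward_unit_normal M c x =
     (THE v. v \<bullet> (metric M c x *v v) = 1 \<and>
             (\<forall>w. w $ bcoord M = 0 \<longrightarrow> v \<bullet> (metric M c x *v w) = 0) \<and>
             v $ bcoord M < 0)"

definition normal_derivative :: "('p, 'n::finite) riem \<Rightarrow> ('p \<Rightarrow> real) \<Rightarrow> 'p \<Rightarrow> real" where
  "normal_derivative M f x =
     (let c = chart_at M x in
      frechet_derivative (local_expr c f) (at (coord c x) within coord c ` cdom c)
        (outward_unit_normal M c x))"


section \<open>Riemannian distance\<close>

definition piecewise_C1_path :: "('p::t2_space, 'n::finite) riem \<Rightarrow> (real \<Rightarrow> 'p) \<Rightarrow> bool" where
  "piecewise_C1_path M \<gamma> \<longleftrightarrow>
     path \<gamma> \<and> path_image \<gamma> \<subseteq> carrier M \<and>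
     (\<forall>c\<in>atlas M. \<forall>a b. {a..b} \<subseteq> {0..1} \<and> \<gamma> ` {a..b} \<subseteq> cdom c
        \<longrightarrow> (coord c \<circ> \<gamma>) piecewise_C1_differentiable_on {a..b})"

definition speed :: "('p, 'n::finite) riem \<Rightarrow> (real \<Rightarrow> 'p) \<Rightarrow> real \<Rightarrow> real" where
  "speed M \<gamma> t =
     (let c = chart_at M (\<gamma> t); v = vector_derivative (coord c \<circ> \<gamma>) (at t)
      in sqrt (v \<bullet> (metric M c (\<gamma> t) *v v)))"

definition curve_length :: "('p, 'n::finite) riem \<Rightarrow> (real \<Rightarrow> 'p) \<Rightarrow> ennreal" where
  "curve_length M \<gamma> = (\<integral>\<^sup>+t\<in>{0..1}. ennreal (speed M \<gamma> t) \<partial>lborel)"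

text \<open>The manifold need not be connected, so the distance may be infinite.\<close>

definition riem_dist :: "('p::t2_space, 'n::finite) riem \<Rightarrow> 'p \<Rightarrow> 'p \<Rightarrow> ennreal" where
  "riem_dist M x y =
     (INF \<gamma>\<in>{\<gamma>. piecewise_C1_path M \<gamma> \<and> pathstart \<gamma> = x \<and> pathfinish \<gamma> = y}. curve_length M \<gamma>)"

definition bdist :: "('p::t2_space, 'n::finite) riem \<Rightarrow> 'p \<Rightarrow> ennreal" where
  "bdist M x = (INF y\<in>boundary M. riem_dist M x y)"

definition collar :: "('p::t2_space, 'n::finite) riem \<Rightarrow> real \<Rightarrow> 'p set" where
  "collar M \<rho> = {x \<in> carrier M. bdist M x \<le> ennreal \<rho>}"

definition parallel_hypersurface :: "('p::t2_space, 'n::finite) riem \<Rightarrow> real \<Rightarrow> 'p set" where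
  "parallel_hypersurface M \<rho> = {x \<in> carrier M. bdist M x = ennreal \<rho>}"

text \<open>Real-valued version, meaningful where \<open>bdist\<close> is finite, in particular on collars.\<close>

definition bdist_real :: "('p::t2_space, 'n::finite) riem \<Rightarrow> 'p \<Rightarrow> real" where
  "bdist_real M x = enn2real (bdist M x)"


section \<open>Essential supremum and surface measure\<close>

text \<open>The null sets of the Riemannian volume are the sets that are Lebesgue null in every chart.\<close>

definition null_in :: "('p, 'n::finite) riem \<Rightarrow> 'p set \<Rightarrow> bool" where
  "null_in M N \<longleftrightarrow> (\<forall>c\<in>atlas M. negligible (coord c ` (N \<inter> cdom c)))"

definition Linf_norm :: "('p, 'n::finite) riem \<Rightarrow> 'p set \<Rightarrow> ('p \<Rightarrow> real) \<Rightarrow> ennreal" where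
  "Linf_norm M S f = Inf {C. null_in M {x \<in> S. C < ennreal \<bar>f x\<bar>}}"

text \<open>Lebesgue measure of dimension \<open>CARD('n) - 1\<close> on the hyperplane \<open>{y. y $ k = a}\<close>.\<close>

definition hyperplane_lborel :: "'n \<Rightarrow> real \<Rightarrow> (real ^ 'n::finite) measure" where
  "hyperplane_lborel k a =
     distr (Pi\<^sub>M (UNIV - {k}) (\<lambda>_. lborel)) borel (\<lambda>z. \<chi> i. if i = k then a else z i)"

text \<open>A chart flattens \<open>S\<close> at level \<open>a\<close> if \<open>S\<close> is the slice \<open>{y. y $ bcoord M = a}\<close> in it;
  hypersurfaces of class C^2, including the boundary (with \<open>a = 0\<close>), are the sets covered by
  such charts.\<close>

definition slice_chart :: "('p, 'n::finite) riem \<Rightarrow> 'p set \<Rightarrow> ('p, 'n) chart \<Rightarrow> real \<Rightarrow> bool" where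
  "slice_chart M S c a \<longleftrightarrow>
     c \<in> atlas M \<and> S \<inter> cdom c = {x \<in> cdom c. coord c x $ bcoord M = a}"

text \<open>Determinant of the metric induced on a slice: the row and the column of index \<open>k\<close> are
  deleted, which is expressed by replacing them with those of the identity matrix.\<close>

definition tangential_det :: "'n \<Rightarrow> real ^ 'n ^ 'n::finite \<Rightarrow> real" where
  "tangential_det k G =
     det (\<chi> i j. if i = k \<or> j = k then (if i = j then 1 else 0) else G $ i $ j)"

text \<open>The Riemannian surface measure of a hypersurface \<open>S\<close> is the Borel measure on \<open>S\<close> that
  is \<open>sqrt (det g\<^sub>S) dz\<close> in every slice chart.\<close>

definition is_surface_measure ::
  "('p::t2_space, 'n::finite) riem \<Rightarrow> 'p set \<Rightarrow> 'p measure \<Rightarrow> bool" where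
  "is_surface_measure M S \<mu> \<longleftrightarrow>
     space \<mu> = S \<and> sets \<mu> = sets (restrict_space borel S) \<and>
     (\<forall>c a A. slice_chart M S c a \<and> A \<in> sets \<mu> \<and> A \<subseteq> cdom c \<longrightarrow>
        emeasure \<mu> A =
          (\<integral>\<^sup>+y\<in>coord c ` A. ennreal (sqrt (tangential_det (bcoord M) (metric M c (coord_inv c y))))
             \<partial>hyperplane_lborel (bcoord M) a))"

definition surface_measure :: "('p::t2_space, 'n::finite) riem \<Rightarrow> 'p set \<Rightarrow> 'p measure" where
  "surface_measure M S = (THE \<mu>. is_surface_measure M S \<mu>)"

text \<open>Square of the L^2 norm.\<close>

definition L2_norm_sq :: "'p measure \<Rightarrow> ('p \<Rightarrow> real) \<Rightarrow> ennreal" where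
  "L2_norm_sq \<mu> f = (\<integral>\<^sup>+x. ennreal ((f x)\<^sup>2) \<partial>\<mu>)"


section \<open>The boundary value problem\<close>

text \<open>Classical solutions: C^2 in the interior and C^1 up to the boundary. (With a boundary
  that is only C^2, second derivatives of solutions need not extend to the boundary.)\<close>

definition steklov_solution :: "('p::t2_space, 'n::finite) riem \<Rightarrow> real \<Rightarrow> ('p \<Rightarrow> real) \<Rightarrow> bool" where
  "steklov_solution M \<sigma> u \<longleftrightarrow>
     Ck_fun_on M 2 u (interior_of_mfd M) \<and> Ck_fun_on M 1 u (carrier M) \<and>
     (\<forall>x\<in>interior_of_mfd M. 1 / 2 * laplacian M u x = 0) \<and>
     (\<forall>x\<in>boundary M. normal_derivative M u x = \<sigma> * u x)"

end

theory Submission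
  imports Defs
begin

text \<open>Let \<open>d\<close> be the distance to the boundary. Both estimates compare the solution \<open>u\<close> with functions of \<open>d\<close> in the
  collar \<open>{d \<le> \<rho>}\<close>, where \<open>\<bar>\<nabla>d\<bar> = 1\<close> and \<open>\<bar>\<Delta>d\<bar> \<le> C\<close>; here \<open>\<rho> \<le> \<rho>_star\<close>, \<open>\<sigma> \<rho> \<le> 1/4\<close> and \<open>C \<rho>_star \<le> 1/4\<close>.

  Supremum (\<open>boundary_le_parallel\<close>). Put \<open>\<phi>(t) = 1 - \<kappa> (t + A t\<^sup>2)\<close> with \<open>\<kappa> = 4 \<sigma> / 3\<close> and \<open>A = C + 1 / (4 \<rho>_star)\<close>. Then
  \<open>\<phi>(d)\<close> is strictly superharmonic and at least \<open>1/2\<close>. Let \<open>\<lambda>\<close> be the maximum of \<open>u / \<phi>(d)\<close> over the collar. If \<open>\<lambda> > 0\<close>,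
  it is not attained where \<open>0 < d < \<rho>\<close>, since \<open>u - \<lambda> \<phi>(d)\<close> would be strictly subharmonic at a maximum, nor on the
  boundary, where the outward derivative \<open>\<sigma> u = \<sigma> \<lambda>\<close> of \<open>u\<close> is less than the outward derivative \<open>\<kappa> \<lambda>\<close> of \<open>\<lambda> \<phi>(d)\<close>. So
  it is attained where \<open>d = \<rho>\<close>, and there \<open>\<lambda> \<le> 2 u\<close>. The same holds for \<open>- u\<close>.

  Norm in \<open>L\<^sup>2\<close> (\<open>L2_bound\<close>). Put \<open>\<psi>(t) = (\<rho> - t) + C (\<rho>\<^sup>2 - t\<^sup>2)\<close>. The field \<open>2 \<psi>(d) u \<nabla>u - u\<^sup>2 \<psi>'(d) \<nabla>d\<close> has the
  divergence \<open>2 \<psi>(d) \<bar>\<nabla>u\<bar>\<^sup>2 - u\<^sup>2 (\<psi>''(d) + \<psi>'(d) \<Delta>d) \<ge> 0\<close>. So its flux through \<open>{d = t}\<close> in the direction of \<open>\<nabla>d\<close> is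
  nondecreasing in \<open>t\<close> (\<open>flux_mono\<close>). At \<open>t = 0\<close> the flux is \<open>1 - 2 \<sigma> \<psi>(0) \<ge> 3/8\<close> times the squared norm on the
  boundary, at \<open>t = \<rho>\<close> it is \<open>1 + 2 C \<rho>\<close> times the squared norm on the parallel hypersurface.

  What remains is to justify these computations on a manifold of class C^2, on which the distance is defined by
  paths. Near-minimal paths and chart segments give \<open>\<bar>\<nabla>d\<bar> \<ge> 1\<close> and \<open>\<bar>\<nabla>d\<bar> \<le> 1\<close> (\<open>gradient_lower_bound\<close>,
  \<open>gradient_upper_bound\<close>), hence charts with \<open>d\<close> as distinguished coordinate (\<open>collar_chart_exists\<close>), in which
  \<open>{d = t}\<close> is a slice with area density \<open>sqrt (det g)\<close>. The Laplacian is independent of the chart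
  (\<open>laplacian_in_change\<close>), so both the equation and the bound on \<open>\<Delta>d\<close> are available in collar charts. Surface
  measures exist by gluing (\<open>surface_measure_is\<close>). The flux is differentiated chart by chart with a partition of
  unity, whose derivatives cancel in the sum (\<open>Zf_sum\<close>).\<close>

abbreviation pdv :: "'n => (real ^ 'n::finite => 'b::real_normed_vector) => real ^ 'n => 'b" where
  "pdv i f y == frechet_derivative f (at y) (axis i 1)"

abbreviation unit_ind :: "'n => real ^ 'n::finite => 'b::zero_neq_one" where
  "unit_ind k y == indicator {0..1} (y $ k)"

notation scaleR (infixr "*R" 75)

section \<open>Calculus of maps of class C^k\<close>

lemma Ck_on_open_cong:
 assumes "open W" "!!x. x \<in> W ==> f x = g x"
 shows "Ck_on_open n f W \<longleftrightarrow> Ck_on_open n g W"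
 using assms(2)
proof (induction n arbitrary: f g)
 case 0
 then show ?case by (simp cong: continuous_on_cong)
next
 case (Suc n)
 have *: "(f has_derivative D) (at x) \<longleftrightarrow> (g has_derivative D) (at x)" if "x \<in> W" for x D
  using has_derivative_transform_within_open[OF _ assms(1) that] Suc.prems by metis
 then have fd: "frechet_derivative f (at x) = frechet_derivative g (at x)" if "x \<in> W" for x
  using that by (simp add: frechet_derivative_def)
 have "(ALL x:W. f differentiable at x) \<longleftrightarrow> (ALL x:W. g differentiable at x)"
  using * by (simp add: differentiable_def)
 moreover have "Ck_on_open n (%x. frechet_derivative f (at x) v) W
   \<longleftrightarrow> Ck_on_open n (%x. frechet_derivative g (at x) v) W" for v
  by (rule Suc.IH) (simp add: fd)
 ultimately show ?case by simp
qed

lemma Ck_on_open_subset: "Ck_on_open n f W ==> W' <= W ==> Ck_on_open n f W'"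
 by (induction n arbitrary: f) (auto intro: continuous_on_subset)

lemma Ck_on_open_SucI:
 assumes "open W" "!!x. x \<in> W ==> (f has_derivative f' x) (at x)"
  "!!v. Ck_on_open n (%x. f' x v) W"
 shows "Ck_on_open (Suc n) f W"
proof -
 have "frechet_derivative f (at x) = f' x" if "x \<in> W" for x
  using assms(2)[OF that] frechet_derivative_at by metis
 then have "Ck_on_open n (%x. frechet_derivative f (at x) v) W" for v
  using assms(3)[of v] by (subst Ck_on_open_cong[OF assms(1), where g = "%x. f' x v"]) auto
 then show ?thesis using assms(2) by (auto simp: differentiable_def)
qed

lemma Ck_on_open_SucD:
 assumes "Ck_on_open (Suc n) f W" "x \<in> W"
 shows "(f has_derivative frechet_derivative f (at x)) (at x)"
 using assms frechet_derivative_works by auto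

lemma Ck_on_open_lower: "Ck_on_open (Suc n) f W ==> Ck_on_open n f W"
proof (induction n arbitrary: f)
 case 0
 then show ?case
  by (auto intro!: continuous_at_imp_continuous_on differentiable_imp_continuous_within)
next
 case (Suc n)
 then show ?case by auto
qed

lemma Ck_on_open_mono: "Ck_on_open m f W ==> n <= m ==> Ck_on_open n f W"
proof (induction m)
 case (Suc m)
 then show ?case
  using Ck_on_open_lower by (metis le_Suc_eq)
qed (simp del: Ck_on_open.simps)

lemma Ck_on_open_continuous: "Ck_on_open n f W ==> continuous_on W f"
 using Ck_on_open_mono[of n f W 0] by simp

lemma Ck_on_open_const: "Ck_on_open n (%x. c) W"
 by (induction n arbitrary: c) auto

lemma Ck_on_open_linear:
 assumes "bounded_linear f" "open W"
 shows "Ck_on_open n f W"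
proof (cases n)
 case 0
 then show ?thesis
  using assms(1) linear_continuous_on by auto
next
 case (Suc m)
 then show ?thesis
  using Ck_on_open_SucI[OF assms(2), of f "%_. f"] bounded_linear_imp_has_derivative[OF assms(1)]
   Ck_on_open_const by blast
qed

lemma Ck_on_open_add:
 assumes "open W" "Ck_on_open n f W" "Ck_on_open n g W"
 shows "Ck_on_open n (%x. f x + g x) W"
 using assms(2,3)
proof (induction n arbitrary: f g)
 case 0
 then show ?case by (auto intro: continuous_on_add)
next
 case (Suc n)
 show ?case
 proof (rule Ck_on_open_SucI[OF assms(1)])
  show "((%x. f x + g x) has_derivative
    (%v. frechet_derivative f (at x) v + frechet_derivative g (at x) v)) (at x)"
   if "x \<in> W" for x
   using Suc.prems that by (intro has_derivative_add Ck_on_open_SucD)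
 qed (use Suc in auto)
qed

lemma Ck_on_open_sum:
 assumes "open W" "!!i. i \<in> I ==> Ck_on_open n (f i) W"
 shows "Ck_on_open n (%x. \<Sum>i\<in>I. f i x) W"
 using assms(2)
 by (induction I rule: infinite_finite_induct)
   (auto intro: Ck_on_open_const Ck_on_open_add[OF assms(1)])

lemma Ck_on_open_bilinear:
 assumes "bounded_bilinear B" "open W" "Ck_on_open n f W" "Ck_on_open n g W"
 shows "Ck_on_open n (%x. B (f x) (g x)) W"
 using assms(3,4)
proof (induction n arbitrary: f g)
 case 0
 then show ?case
  by (simp add: bounded_bilinear.continuous_on[OF assms(1)])
next
 case (Suc n)
 show ?case
 proof (rule Ck_on_open_SucI[OF assms(2)])
  show "((%x. B (f x) (g x)) has_derivative
    (%v. B (f x) (frechet_derivative g (at x) v) + B (frechet_derivative f (at x) v) (g x))) (at x)"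
   if "x \<in> W" for x
   using Suc.prems that
   by (intro bounded_bilinear.FDERIV[OF assms(1)] Ck_on_open_SucD)
  show "Ck_on_open n (%x. B (f x) (frechet_derivative g (at x) v)
      + B (frechet_derivative f (at x) v) (g x)) W" for v
   using Suc.prems by (intro Ck_on_open_add Suc.IH assms(2)) (auto intro: Ck_on_open_lower)
 qed
qed

lemmas Ck_on_open_mult = Ck_on_open_bilinear[OF bounded_bilinear_mult]
lemmas Ck_on_open_scaleR = Ck_on_open_bilinear[OF bounded_bilinear_scaleR]

lemma Ck_on_open_linear_comp:
 assumes "bounded_linear L" "open W" "Ck_on_open n f W"
 shows "Ck_on_open n (%x. L (f x)) W"
 using assms(3)
proof (induction n arbitrary: f)
 case 0
 then show ?case
  by (simp add: bounded_linear.continuous_on[OF assms(1)])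
next
 case (Suc n)
 show ?case
 proof (rule Ck_on_open_SucI[OF assms(2)])
  show "((%x. L (f x)) has_derivative (%v. L (frechet_derivative f (at x) v))) (at x)"
   if "x \<in> W" for x
   by (rule bounded_linear.has_derivative[OF assms(1) Ck_on_open_SucD[OF Suc.prems that]])
  show "Ck_on_open n (%x. L (frechet_derivative f (at x) v)) W" for v
   by (rule Suc.IH) (use Suc.prems in auto)
 qed
qed

lemma Ck_on_open_uminus:
 assumes "open W" "Ck_on_open n f W"
 shows "Ck_on_open n (%x. - f x) W"
 by (rule Ck_on_open_linear_comp[OF _ assms]) (rule bounded_linear_minus[OF bounded_linear_ident])

lemma Ck_on_open_diff:
 assumes "open W" "Ck_on_open n f W" "Ck_on_open n g W"
 shows "Ck_on_open n (%x. f x - g x) W"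
proof -
 from Ck_on_open_add[OF assms(1,2) Ck_on_open_uminus[OF assms(1,3)]] show ?thesis
  by (simp only: add_uminus_conv_diff)
qed

lemma Ck_on_open_prod:
 fixes f :: "'i => 'e::euclidean_space => real"
 assumes "open W" "!!i. i \<in> I ==> Ck_on_open n (f i) W"
 shows "Ck_on_open n (%x. \<Prod>i\<in>I. f i x) W"
 using assms(2)
proof (induction I rule: infinite_finite_induct)
 case (insert i F)
 have "Ck_on_open n (%x. f i x * (\<Prod>i\<in>F. f i x)) W"
  by (rule Ck_on_open_mult[OF assms(1)]) (use insert in auto)
 then show ?case using insert by simp
qed (simp_all add: Ck_on_open_const)

text \<open>The chain rule, expanded in a basis, so that the induction hypothesis applies to each summand.\<close>

lemma Ck_on_open_compose:
 fixes f :: "'e::euclidean_space => 'b::euclidean_space" and g :: "'b => 'c::real_normed_vector"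
 assumes "open W" "open W'" "f ` W <= W'" "Ck_on_open n f W" "Ck_on_open n g W'"
 shows "Ck_on_open n (%x. g (f x)) W"
 using assms(4,5)
proof (induction n arbitrary: g)
 case 0
 then show ?case using assms(3) continuous_on_compose2 by (metis Ck_on_open.simps(1))
next
 case (Suc n)
 let ?D = "%x v. \<Sum>b\<in>Basis. (frechet_derivative f (at x) v \<bullet> b) *R frechet_derivative g (at (f x)) b"
 show ?case
 proof (rule Ck_on_open_SucI[OF assms(1)])
  fix x assume x: "x \<in> W"
  then have fx: "f x \<in> W'" using assms(3) by auto
  have g': "(g has_derivative frechet_derivative g (at (f x))) (at (f x))"
   using Ck_on_open_SucD[OF Suc.prems(2) fx] .
  have D: "((%x. g (f x)) has_derivative (%v. frechet_derivative g (at (f x)) (frechet_derivative f (at x) v))) (at x)"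
   using has_derivative_compose[OF Ck_on_open_SucD[OF Suc.prems(1) x] g'] .
  have eq: "frechet_derivative g (at (f x)) w = (\<Sum>b\<in>Basis. (w \<bullet> b) *R frechet_derivative g (at (f x)) b)" for w
  proof -
   have l: "linear (frechet_derivative g (at (f x)))" using g' has_derivative_linear by blast
   have "frechet_derivative g (at (f x)) w = frechet_derivative g (at (f x)) (\<Sum>b\<in>Basis. (w \<bullet> b) *R b)"
    by (simp add: euclidean_representation)
   then show ?thesis by (simp add: linear_sum[OF l] linear_scale[OF l])
  qed
  show "((%x. g (f x)) has_derivative ?D x) (at x)"
   by (rule has_derivative_eq_rhs[OF D]) (rule ext, rule eq)
 next
  fix v
  have f: "Ck_on_open n f W" using Suc.prems(1) by (rule Ck_on_open_lower)
  show "Ck_on_open n (%x. ?D x v) W"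
   using Suc.prems f
   by (intro Ck_on_open_sum assms(1) Ck_on_open_scaleR Suc.IH
     Ck_on_open_linear_comp[OF bounded_linear_inner_left]) auto
 qed
qed

lemma Ck_on_open_inverse:
 assumes "open W" "Ck_on_open n f W" "!!x. x \<in> W ==> f x ~= (0::real)"
 shows "Ck_on_open n (%x. inverse (f x)) W"
 using assms(2,3)
proof (induction n)
 case 0
 then show ?case by (auto intro: continuous_on_inverse)
next
 case (Suc n)
 have "Ck_on_open n (%x. inverse (f x)) W" using Suc Ck_on_open_lower by blast
 moreover have "((%x. inverse (f x)) has_derivative
   (%v. - (inverse (f x) * frechet_derivative f (at x) v * inverse (f x)))) (at x)" if "x \<in> W" for x
  by (rule Deriv.has_derivative_inverse[OF _ Ck_on_open_SucD[OF Suc.prems(1) that]]) (use Suc.prems that in auto)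
 ultimately show ?case
  using Suc.prems(1)
  by (intro Ck_on_open_SucI[OF assms(1), where f' = "%x v. - (inverse (f x) * frechet_derivative f (at x) v * inverse (f x))"]
     Ck_on_open_mult Ck_on_open_uminus assms(1)) auto
qed

lemma Ck_on_open_divide:
 assumes "open W" "Ck_on_open n f W" "Ck_on_open n g W" "!!x. x \<in> W ==> g x ~= (0::real)"
 shows "Ck_on_open n (%x. f x / g x) W"
 using Ck_on_open_mult[OF assms(1,2) Ck_on_open_inverse[OF assms(1,3,4)]]
 by (simp add: divide_inverse)

lemma Ck_on_open_sqrt:
 assumes "open W" "Ck_on_open n f W" "!!x. x \<in> W ==> f x > (0::real)"
 shows "Ck_on_open n (%x. sqrt (f x)) W"
 using assms(2,3)
proof (induction n)
 case 0
 then show ?case by (auto intro: continuous_on_real_sqrt)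
next
 case (Suc n)
 have "Ck_on_open n (%x. sqrt (f x)) W" using Suc Ck_on_open_lower by blast
 then have "Ck_on_open n (%x. inverse (sqrt (f x))) W"
  using Suc.prems(2)
  by (intro Ck_on_open_inverse assms(1)) (simp_all add: less_imp_neq[symmetric])
 moreover have "((%x. sqrt (f x)) has_derivative
   (%v. frechet_derivative f (at x) v * (inverse (sqrt (f x)) / 2))) (at x)" if "x \<in> W" for x
  using DERIV_compose_FDERIV[OF DERIV_real_sqrt Ck_on_open_SucD[OF Suc.prems(1) that]] Suc.prems(2)[OF that]
  by auto
 ultimately show ?case
  using Suc.prems(1)
  by (intro Ck_on_open_SucI[OF assms(1), where f' = "%x v. frechet_derivative f (at x) v * (inverse (sqrt (f x)) / 2)"]
     Ck_on_open_mult Ck_on_open_linear_comp[OF bounded_linear_divide] assms(1)) auto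
qed

lemma Ck_on_open_vec_iff:
 fixes f :: "'e::euclidean_space => 'b::euclidean_space ^ 'n"
 assumes "open W"
 shows "Ck_on_open n f W \<longleftrightarrow> (ALL i. Ck_on_open n (%x. f x $ i) W)"
proof
 show "Ck_on_open n f W ==> ALL i. Ck_on_open n (%x. f x $ i) W"
  using Ck_on_open_linear_comp[OF bounded_linear_vec_nth assms] by blast
next
 assume *: "ALL i. Ck_on_open n (%x. f x $ i) W"
 have bl: "bounded_linear (axis i :: 'b => 'b ^ 'n)" for i
  by (rule linear_conv_bounded_linear[THEN iffD1], rule linearI) (auto simp: axis_def vec_eq_iff)
 have "f x = (SUM i:UNIV. axis i (f x $ i))" for x
  by (simp add: vec_eq_iff axis_def if_distrib if_distribR cong: if_cong)
 moreover have "Ck_on_open n (%x. SUM i:UNIV. axis i (f x $ i)) W"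
  using * by (intro Ck_on_open_sum assms Ck_on_open_linear_comp[OF bl]) auto
 ultimately show "Ck_on_open n f W" by simp
qed

lemma Ck_on_open_det:
 fixes A :: "'e::euclidean_space => real ^ 'n ^ 'n"
 assumes "open W" "!!i j. Ck_on_open n (%x. A x $ i $ j) W"
 shows "Ck_on_open n (%x. det (A x)) W"
 unfolding det_def
 by (intro Ck_on_open_sum Ck_on_open_mult Ck_on_open_const Ck_on_open_prod assms)


lemma has_real_derivative_along_line:
 fixes f :: "'e::real_normed_vector => real"
 assumes "(f has_derivative f') (at (p + a *R v))"
 shows "((%a. f (p + a *R v)) has_real_derivative f' v) (at a)"
proof -
 have "((%a. p + a *R v) has_derivative (%h. h *R v)) (at a)"
  by (auto intro!: derivative_eq_intros)
 from has_derivative_compose[OF this assms]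
 have "((%a. f (p + a *R v)) has_derivative (%h. f' (h *R v))) (at a)" .
 moreover have "f' (h *R v) = f' v * h" for h
  using has_derivative_linear[OF assms] by (simp add: linear_scale mult.commute)
 ultimately show ?thesis
  by (simp add: has_field_derivative_def)
qed

text \<open>Both iterated derivatives are limits of the same second difference quotient, by two
 applications of the mean value theorem.\<close>

lemma second_derivative_symmetric:
 fixes f :: "'e::euclidean_space => real"
 assumes W: "open W" and f: "Ck_on_open 2 f W" and y: "y \<in> W"
 shows "frechet_derivative (%x. frechet_derivative f (at x) v) (at y) w
    = frechet_derivative (%x. frechet_derivative f (at x) w) (at y) v"
proof -
 define D where "D v w x = frechet_derivative (%x. frechet_derivative f (at x) v) (at x) w" for v w x
 have f': "Ck_on_open (Suc (Suc 0)) f W" using f by (simp add: numeral_2_eq_2)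
 then have f1: "Ck_on_open (Suc 0) (%x. frechet_derivative f (at x) v) W" for v by simp
 have D0: "continuous_on W (D v w)" for v w using f1 unfolding D_def by simp
 have d1: "(f has_derivative frechet_derivative f (at x)) (at x)" if "x \<in> W" for x
  using Ck_on_open_SucD[OF f' that] .
 have d2: "((%x. frechet_derivative f (at x) v) has_derivative (%w. D v w x)) (at x)"
  if "x \<in> W" for x v
  using Ck_on_open_SucD[OF f1 that] unfolding D_def .
 have diff: "EX a b. 0 < a & a < s & 0 < b & b < s &
   f (y + s *R v + s *R w) - f (y + s *R v) - f (y + s *R w) + f y
    = s * s * D v w (y + a *R v + b *R w)"
  if s: "s > 0" and box: "!!a b. 0 <= a ==> a <= s ==> 0 <= b ==> b <= s ==> y + a *R v + b *R w \<in> W"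
  for s v w
 proof -
  let ?\<phi> = "%a. f (y + s *R w + a *R v) - f (y + a *R v)"
  let ?g = "%x. frechet_derivative f (at x) v"
  have "DERIV ?\<phi> a :> ?g (y + s *R w + a *R v) - ?g (y + a *R v)" if "0 <= a" "a <= s" for a
   using box[OF that, of s] box[OF that, of 0] s
   by (intro derivative_intros has_real_derivative_along_line d1) (auto simp: algebra_simps)
  from MVT2[OF s this] obtain a where a: "0 < a" "a < s"
   "?\<phi> s - ?\<phi> 0 = s * (?g (y + s *R w + a *R v) - ?g (y + a *R v))" by auto
  have "DERIV (%b. ?g (y + a *R v + b *R w)) b :> D v w (y + a *R v + b *R w)" if "0 <= b" "b <= s" for b
   using box[of a b] a that by (intro has_real_derivative_along_line d2) auto
  from MVT2[OF s this] obtain b where b: "0 < b" "b < s"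
   "?g (y + a *R v + s *R w) - ?g (y + a *R v) = s * D v w (y + a *R v + b *R w)" by auto
  have "?g (y + s *R w + a *R v) = ?g (y + a *R v + s *R w)" by (simp add: algebra_simps)
  with a b show ?thesis by (intro exI[of _ a] exI[of _ b]) (auto simp: algebra_simps)
 qed
 have "\<bar>D v w y - D w v y\<bar> < 2 * e" if e: "e > 0" for e
 proof -
  have "isCont (D v w) y" "isCont (D w v) y"
   using D0 W y continuous_on_eq_continuous_at by blast+
  then obtain d1 d2 where dd: "d1 > 0" "d2 > 0"
   "!!x. dist x y < d1 ==> dist (D v w x) (D v w y) < e"
   "!!x. dist x y < d2 ==> dist (D w v x) (D w v y) < e"
   using e unfolding continuous_at_eps_delta by metis
  obtain d3 where d3: "d3 > 0" "ball y d3 <= W" using W y open_contains_ball by blast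
  define d where "d = min d3 (min d1 d2)"
  define s where "s = d / (2 * (1 + norm v + norm w))"
  have d: "d > 0" using dd d3 by (simp add: d_def)
  have nn: "1 + norm v + norm w > 0" using norm_ge_zero[of v] norm_ge_zero[of w] by linarith
  have s: "s > 0" using d nn by (simp add: s_def)
  have near: "dist (y + a *R v + b *R w) y < d" if "0 <= a" "a <= s" "0 <= b" "b <= s" for a b
  proof -
   have "dist (y + a *R v + b *R w) y = norm (a *R v + b *R w)" by (simp add: dist_norm add.assoc)
   also have "... <= a * norm v + b * norm w"
    using norm_triangle_ineq[of "a *R v" "b *R w"] that by simp
   also have "... <= s * norm v + s * norm w" using that by (intro add_mono mult_right_mono) auto
   also have "... < s * (2 * (1 + norm v + norm w))"
    using s by (simp add: algebra_simps) (smt (verit) mult_nonneg_nonneg norm_ge_zero)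
   also have "... = d" using nn unfolding s_def by (simp add: field_simps)
   finally show ?thesis .
  qed
  then have inW: "y + a *R v + b *R w \<in> W" if "0 <= a" "a <= s" "0 <= b" "b <= s" for a b
   using that d3 by (force simp: d_def dist_commute)
  then have inW': "y + a *R w + b *R v \<in> W" if "0 <= a" "a <= s" "0 <= b" "b <= s" for a b
   using inW[of b a] that by (simp add: algebra_simps)
  obtain a b where ab: "0 < a" "a < s" "0 < b" "b < s"
   "f (y + s *R v + s *R w) - f (y + s *R v) - f (y + s *R w) + f y
    = s * s * D v w (y + a *R v + b *R w)"
   using diff[OF s inW] by blast
  obtain a' b' where ab': "0 < a'" "a' < s" "0 < b'" "b' < s"
   "f (y + s *R w + s *R v) - f (y + s *R w) - f (y + s *R v) + f y
    = s * s * D w v (y + a' *R w + b' *R v)"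
   using diff[OF s inW'] by blast
  have "s * s * D v w (y + a *R v + b *R w) = s * s * D w v (y + a' *R w + b' *R v)"
   using ab(5) ab'(5) by (simp add: algebra_simps)
  then have "D v w (y + a *R v + b *R w) = D w v (y + b' *R v + a' *R w)"
   using s by (simp add: algebra_simps)
  moreover have "dist (D v w (y + a *R v + b *R w)) (D v w y) < e"
   using near[of a b] ab dd(3) by (simp add: d_def)
  moreover have "dist (D w v (y + b' *R v + a' *R w)) (D w v y) < e"
   using near[of b' a'] ab' dd(4) by (simp add: d_def)
  ultimately show ?thesis by (simp add: dist_real_def)
 qed
 from this[of "\<bar>D v w y - D w v y\<bar> / 2"] have "D v w y = D w v y" by (cases "D v w y = D w v y") auto
 then show ?thesis by (simp add: D_def)
qed

text \<open>By Cramer's rule the derivative of the inverse \<open>g\<close> is a rational function of the derivative of \<open>f\<close> at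
 \<open>g y\<close>; this raises the regularity of \<open>g\<close> one step at a time.\<close>

lemma C2_inverse_function:
 fixes f :: "real ^ 'n::finite => real ^ 'n"
 assumes U: "open U" and f: "Ck_on_open 2 f U" and x0: "x0 \<in> U"
  and det0: "det (matrix (frechet_derivative f (at x0))) ~= 0"
 obtains U' V g where "open U'" "U' <= U" "x0 \<in> U'" "open V" "homeomorphism U' V f g"
  "Ck_on_open 2 g V"
proof -
 define f' where "f' x = frechet_derivative f (at x)" for x
 have f2: "Ck_on_open (Suc (Suc 0)) f U" using f by (simp add: numeral_2_eq_2)
 have der: "(f has_derivative f' x) (at x)" if "x \<in> U" for x
  using Ck_on_open_SucD[OF f2 that] by (simp add: f'_def)
 have C1: "Ck_on_open (Suc 0) (%x. f' x v) U" for v using f2 by (simp add: f'_def)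
 define B where "B x = Blinfun (f' x)" for x
 have B: "blinfun_apply (B x) = f' x" if "x \<in> U" for x
  using has_derivative_bounded_linear[OF der[OF that]] by (simp add: B_def bounded_linear_Blinfun_apply)
 have contB: "continuous_on U B"
 proof (rule continuous_on_blinfun_componentwise)
  show "continuous_on U (%x. blinfun_apply (B x) i)" for i
   using Ck_on_open_continuous[OF C1[of i]] B by (simp cong: continuous_on_cong)
 qed
 have lin: "linear (f' x)" if "x \<in> U" for x using der[OF that] has_derivative_linear by blast
 obtain h where h: "linear h" "h o f' x0 = id"
  using det0 lin[OF x0] det_nz_iff_inj[OF lin[OF x0]] linear_injective_left_inverse by (auto simp: f'_def)
 have "Blinfun h o\<^sub>L B x0 = id_blinfun"
  using h by (intro blinfun_eqI)
   (simp add: B x0 bounded_linear_Blinfun_apply linear_linear linear_conv_bounded_linear[symmetric] o_def fun_eq_iff)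
 then obtain U' V g g' where g: "open U'" "U' <= U" "x0 \<in> U'" "open V" "homeomorphism U' V f g"
  "!!y. y \<in> V ==> (g has_derivative (g' y)) (at y)"
  "!!y. y \<in> V ==> g' y = inv (blinfun_apply (B (g y)))"
  "!!y. y \<in> V ==> bij (blinfun_apply (B (g y)))"
  using inverse_function_theorem[OF U _ contB x0] der B by metis
 have gU: "g y \<in> U" if "y \<in> V" for y
  using g(2,5) that by (auto simp: homeomorphism_def)
 define A where "A y = matrix (f' (g y))" for y
 have bij: "bij (f' (g y))" and g'e: "g' y = inv (f' (g y))" if "y \<in> V" for y
  using g(7,8)[OF that] B[OF gU[OF that]] by simp_all
 have dA: "det (A y) ~= 0" if "y \<in> V" for y
  using bij[OF that] det_nz_iff_inj[OF lin[OF gU[OF that]]] by (simp add: A_def bij_is_inj)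
 have Aw: "A y *v w = f' (g y) w" if "y \<in> V" for y w
  using matrix_vector_mul(2)[OF lin[OF gU[OF that]]] by (simp add: A_def fun_eq_iff)
 let ?c = "%y v. (\<chi> k. det (\<chi> i j. if j = k then v $ i else A y $ i $ j) / det (A y))"
 have g': "g' y v = ?c y v" if "y \<in> V" for y v
 proof -
  have "f' (g y) (g' y v) = v" using bij[OF that] by (simp add: g'e[OF that] bij_is_surj surj_f_inv_f)
  then have "A y *v g' y v = v" using Aw that by simp
  then show ?thesis using cramer[OF dA[OF that]] by blast
 qed
 have step: "Ck_on_open n (%y. g' y v) V" if n: "n <= Suc 0" and "Ck_on_open n g V" for n v
 proof -
  have "A y $ i $ j = f' (g y) (axis j 1) $ i" for y i j by (simp add: A_def matrix_def)
  moreover have "Ck_on_open n (%y. f' (g y) (axis j 1) $ i) V" for i j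
   using gU that
   by (intro Ck_on_open_linear_comp[OF bounded_linear_vec_nth]
     Ck_on_open_compose[OF g(4) U _ _ Ck_on_open_mono[OF C1]] g(4)) auto
  ultimately have A: "Ck_on_open n (%y. A y $ i $ j) V" for i j by simp
  have "Ck_on_open n (%y. ?c y v) V"
   unfolding Ck_on_open_vec_iff[OF g(4)] vec_lambda_beta
  proof (intro allI Ck_on_open_divide Ck_on_open_det g(4) dA)
   show "Ck_on_open n (%x. (\<chi> i j. if j = k then v $ i else A x $ i $ j) $ i $ j) V" for i j k
    by (cases "j = k") (auto simp: A Ck_on_open_const)
  qed (auto simp: A)
  then show ?thesis using Ck_on_open_cong[OF g(4), of "%y. g' y v" "%y. ?c y v"] g' by blast
 qed
 have "Ck_on_open 0 g V" using g(5) by (simp add: homeomorphism_def)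
 then have "Ck_on_open (Suc 0) g V"
  using step[of 0] by (intro Ck_on_open_SucI[OF g(4) g(6)]) auto
 then have "Ck_on_open (Suc (Suc 0)) g V"
  using step[of "Suc 0"] by (intro Ck_on_open_SucI[OF g(4) g(6)]) (auto simp del: Ck_on_open.simps)
 then show thesis using that g by (simp add: numeral_2_eq_2 del: Ck_on_open.simps)
qed

section \<open>Positive definite matrices and Piola's identity\<close>

lemma
 assumes "invertible A"
 shows matrix_inv_right: "A ** matrix_inv A = mat 1"
  and matrix_inv_left: "matrix_inv A ** A = mat 1"
 using someI_ex[OF assms[unfolded invertible_def]] unfolding matrix_inv_def by auto

definition posdef :: "real ^ 'n ^ 'n::finite => bool" where
 "posdef G \<longleftrightarrow> transpose G = G & (ALL v. v ~= 0 --> v \<bullet> (G *v v) > 0)"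

lemma posdef_sym:
 assumes "posdef G" shows "G $ i $ j = G $ j $ i"
proof -
 have "transpose G $ j $ i = G $ i $ j" by (simp add: transpose_def)
 then show ?thesis using assms unfolding posdef_def by (elim conjE) simp
qed

lemma posdef_inner_commute: "posdef G ==> v \<bullet> (G *v w) = w \<bullet> (G *v v)"
 by (metis dot_lmul_matrix inner_commute posdef_def transpose_matrix_vector)

lemma posdef_nonneg: "posdef G ==> v \<bullet> (G *v v) >= 0"
 unfolding posdef_def by (cases "v = 0") (auto intro: less_imp_le)

lemma posdef_zero_iff: "posdef G ==> v \<bullet> (G *v v) = 0 \<longleftrightarrow> v = 0"
 unfolding posdef_def by (metis inner_zero_left less_irrefl)

lemma posdef_det_nz:
 assumes "posdef G" shows "det G ~= 0"
proof -
 have "inj ((*v) G)"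
 proof (rule injI)
  fix x y assume "G *v x = G *v y"
  then have "G *v (x - y) = 0" by (simp add: matrix_vector_mult_diff_distrib)
  then show "x = y" using posdef_zero_iff[OF assms, of "x - y"] by simp
 qed
 then show ?thesis
  using det_nz_iff_inj[of "(*v) G"] by simp
qed

text \<open>The determinant has no zero on the segment from the identity to \<open>G\<close>, along which matrices stay positive definite.\<close>

lemma posdef_det_pos:
 assumes "posdef G" shows "det G > 0"
proof (rule ccontr)
 assume "~ det G > 0"
 define H where "H t = (1 - t) *R mat 1 + t *R G" for t :: real
 have pos: "posdef (H t)" if "0 <= t" "t <= 1" for t
 proof -
  have "transpose (H t) = H t"
  proof -
   have "H t $ i $ j = H t $ j $ i" for i j
    using posdef_sym[OF assms, of i j] by (auto simp: H_def mat_def)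
   then show ?thesis by (simp add: transpose_def vec_eq_iff)
  qed
  moreover have "v \<bullet> (H t *v v) > 0" if "v ~= 0" for v
  proof -
   have e: "v \<bullet> (H t *v v) = (1 - t) * (v \<bullet> v) + t * (v \<bullet> (G *v v))"
    by (simp add: H_def matrix_vector_mult_add_rdistrib inner_add_right scaleR_matrix_vector_assoc[symmetric])
   have v: "v \<bullet> v > 0" "v \<bullet> (G *v v) > 0" using that assms unfolding posdef_def by auto
   show ?thesis
   proof (cases "t = 0")
    case False
    then have "t * (v \<bullet> (G *v v)) > 0" using v \<open>0 <= t\<close> by simp
    moreover have "(1 - t) * (v \<bullet> v) >= 0" using v \<open>t <= 1\<close> by simp
    ultimately show ?thesis unfolding e by linarith
   qed (use v e in simp)
  qed
  ultimately show ?thesis unfolding posdef_def by blast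
 qed
 have "continuous_on {0..1} (%t. det (H t))"
  unfolding det_def H_def by (auto intro!: continuous_intros)
 moreover have "det (H 1) <= 0" "0 <= det (H 0)"
  using \<open>~ det G > 0\<close> by (auto simp: H_def)
 ultimately obtain t where "0 <= t" "t <= 1" "det (H t) = 0"
  using IVT2'[of "%t. det (H t)" 1 0 0] by auto
 then show False using pos posdef_det_nz by blast
qed

lemma posdef_inv:
 assumes "posdef G"
 shows "G ** matrix_inv G = mat 1" "matrix_inv G ** G = mat 1"
  "G *v (matrix_inv G *v v) = v" "matrix_inv G *v (G *v v) = v"
proof -
 have "invertible G" using posdef_det_nz[OF assms] by (simp add: invertible_det_nz)
 then show "G ** matrix_inv G = mat 1" "matrix_inv G ** G = mat 1"
  by (simp_all add: matrix_inv_right matrix_inv_left)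
 then show "G *v (matrix_inv G *v v) = v" "matrix_inv G *v (G *v v) = v"
  by (simp_all add: matrix_vector_mul_assoc)
qed

lemma posdef_matrix_inv:
 assumes "posdef G" shows "posdef (matrix_inv G)"
 unfolding posdef_def
proof (intro conjI allI impI)
 have t: "transpose G = G" using assms by (simp add: posdef_def)
 have "transpose (matrix_inv G) ** G = mat 1"
  by (metis matrix_transpose_mul posdef_inv(1)[OF assms] t transpose_mat)
 then show "transpose (matrix_inv G) = matrix_inv G"
  by (metis matrix_mul_assoc matrix_mul_lid matrix_mul_rid posdef_inv(1)[OF assms])
next
 fix v :: "real ^ 'a" assume "v ~= 0"
 then have "matrix_inv G *v v ~= 0" using posdef_inv(3)[OF assms, of v] by auto
 then have "(matrix_inv G *v v) \<bullet> (G *v (matrix_inv G *v v)) > 0"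
  using assms by (simp add: posdef_def)
 then show "v \<bullet> (matrix_inv G *v v) > 0"
  by (simp add: posdef_inv(3)[OF assms] inner_commute)
qed

text \<open>Cauchy-Schwarz for a metric and its dual: the square of \<open>G\<^sup>-\<^sup>1 p - s v\<close> is nonnegative for the optimal \<open>s\<close>.\<close>

lemma posdef_Cauchy_Schwarz:
 assumes "posdef G"
 shows "(p \<bullet> v)^2 <= (p \<bullet> (matrix_inv G *v p)) * (v \<bullet> (G *v v))"
proof (cases "v = 0")
 case False
 define w where "w = matrix_inv G *v p"
 define a where "a = v \<bullet> (G *v v)"
 define b where "b = p \<bullet> v"
 define c where "c = p \<bullet> w"
 have Gw: "G *v w = p" by (simp add: w_def posdef_inv[OF assms])
 have a: "a > 0" using False assms by (simp add: a_def posdef_def)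
 have "0 <= (w - (b / a) *R v) \<bullet> (G *v (w - (b / a) *R v))"
  by (rule posdef_nonneg[OF assms])
 also have "... = c - 2 * (b / a) * b + (b / a) * (b / a) * a"
  using posdef_inner_commute[OF assms, of w v] Gw
  by (simp add: matrix_vector_mult_diff_distrib matrix_vector_mult_scaleR inner_diff_left inner_diff_right
    a_def[symmetric] b_def c_def inner_commute algebra_simps)
 finally have "b * b <= c * a" using a by (simp add: field_simps)
 then show ?thesis by (simp add: a_def b_def c_def w_def power2_eq_square)
qed simp

lemma matrix_inv_cramer:
 fixes G :: "real ^ 'n ^ 'n::finite"
 assumes "det G ~= 0"
 shows "matrix_inv G $ a $ b = det (\<chi> i j. if j = a then axis b 1 $ i else G $ i $ j) / det G"
proof -
 have "invertible G" using assms by (simp add: invertible_det_nz)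
 then have "G *v (matrix_inv G *v axis b 1) = axis b 1"
  by (simp add: matrix_vector_mul_assoc matrix_inv_right)
 then have "matrix_inv G *v axis b 1 = (\<chi> k'. det (\<chi> i j. if j = k' then axis b 1 $ i else G $ i $ j) / det G)"
  using cramer[OF assms] by blast
 then show ?thesis
  by (metis (no_types, lifting) column_def matrix_vector_mult_basis vec_lambda_beta)
qed

text \<open>By Cramer's rule the entry is a quotient whose numerator has a unit vector as column \<open>k\<close>; only permutations
 that fix \<open>k\<close> survive, so row \<open>k\<close> may be replaced as well. For a metric this relates \<open>g\<^sup>k\<^sup>k\<close> to the
 quotient of the area density of a slice and the volume density.\<close>

lemma matrix_inv_diagonal:
 fixes G :: "real ^ 'n ^ 'n::finite"
 assumes "det G ~= 0"
 shows "matrix_inv G $ k $ k = tangential_det k G / det G"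
proof -
 let ?N = "\<chi> i j. if j = k then axis k 1 $ i else G $ i $ j"
 let ?T = "\<chi> i j. if i = k \<or> j = k then (if i = j then 1 else 0) else G $ i $ j"
 have "(\<Prod>i\<in>UNIV. ?N $ i $ p i) = (\<Prod>i\<in>UNIV. ?T $ i $ p i)" if p: "p permutes UNIV" for p
 proof (cases "p k = k")
  case True
  then have "p i ~= k" if "i ~= k" for i using p that by (metis permutes_inj injD)
  then show ?thesis using True by (intro prod.cong) (auto simp: axis_def)
 next
  case False
  obtain j where j: "p j = k" using p by (metis permutes_surj surjD)
  then have "j ~= k" using False by auto
  then have "?N $ j $ p j = 0" "?T $ j $ p j = 0" using j by (auto simp: axis_def)
  then show ?thesis by (metis (no_types, lifting) UNIV_I finite prod_zero)
 qed
 then have "det ?N = det ?T" unfolding det_def by (intro sum.cong) auto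
 then show ?thesis using matrix_inv_cramer[OF assms, of k k] by (simp add: tangential_det_def)
qed

lemma Ck_on_open_matrix_inv:
 fixes G :: "'e::euclidean_space => real ^ 'n ^ 'n::finite"
 assumes "open W" "!!i j. Ck_on_open m (%x. G x $ i $ j) W" "!!x. x \<in> W ==> det (G x) ~= 0"
 shows "Ck_on_open m (%x. matrix_inv (G x) $ a $ b) W"
proof -
 have e: "Ck_on_open m (%x. (\<chi> i j. if j = a then axis b 1 $ i else G x $ i $ j) $ i $ j) W" for i j
  by (cases "j = a") (auto simp: assms(2) Ck_on_open_const)
 have "Ck_on_open m (%x. det (\<chi> i j. if j = a then axis b 1 $ i else G x $ i $ j) / det (G x)) W"
  by (intro Ck_on_open_divide assms Ck_on_open_det) (rule e)
 then show ?thesis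
  using Ck_on_open_cong[OF assms(1), of "%x. matrix_inv (G x) $ a $ b"
   "%x. det (\<chi> i j. if j = a then axis b 1 $ i else G x $ i $ j) / det (G x)"]
   matrix_inv_cramer[OF assms(3)] by auto
qed

text \<open>A positive semidefinite matrix is a sum of dyads \<open>w w\<^sup>T\<close>; completing the square splits one off
 at a time, so the induction is over the set of indices that carry the matrix.\<close>

lemma psd_nsd_contraction_aux:
 fixes A B :: "'n::finite => 'n => real"
 assumes "finite K" "!!i j. A i j = A j i" "!!i j. i ~: K ==> A i j = 0"
  "!!x. 0 <= (SUM i:UNIV. SUM j:UNIV. x i * x j * A i j)"
  "!!x. (SUM i:UNIV. SUM j:UNIV. x i * x j * B i j) <= 0"
 shows "(SUM i:UNIV. SUM j:UNIV. A i j * B i j) <= 0"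
 using assms(1-4)
proof (induction K arbitrary: A rule: finite_induct)
 case empty
 then show ?case by simp
next
 case (insert k K)
 have two: "0 <= s * s * A k k + 2 * s * t * A k j + t * t * A j j" if "j ~= k" for s t j
 proof -
  define x where "x i = (if i = k then s else if i = j then t else 0)" for i
  have x0: "x i = 0" if "i ~: {k, j}" for i using that by (simp add: x_def)
  have "(SUM i:UNIV. SUM l:UNIV. x i * x l * A i l) = (\<Sum>i\<in>{k,j}. \<Sum>l\<in>{k,j}. x i * x l * A i l)"
  proof -
   have "(SUM i:UNIV. SUM l:UNIV. x i * x l * A i l) = (\<Sum>i\<in>{k,j}. SUM l:UNIV. x i * x l * A i l)"
    by (rule sum.mono_neutral_right) (auto simp: x0)
   also have "... = (\<Sum>i\<in>{k,j}. \<Sum>l\<in>{k,j}. x i * x l * A i l)"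
    by (intro sum.cong refl sum.mono_neutral_right) (auto simp: x0)
   finally show ?thesis .
  qed
  also have "... = s * s * A k k + 2 * s * t * A k j + t * t * A j j"
   using that insert.prems(1)[of j k] by (simp add: x_def algebra_simps)
  finally show ?thesis using insert.prems(3)[of x] by simp
 qed
 show ?case
 proof (cases "A k k = 0")
  case True
  have "A k j = 0" for j
  proof (cases "j = k")
   case False
   have "0 <= 2 * s * A k j + A j j" for s using two[OF False, of s 1] True by simp
   from this[of "- (A j j + 1) / (2 * A k j)"] show ?thesis
    by (cases "A k j = 0") (auto simp: field_simps)
  qed (use True in simp)
  note Ak = this
  show ?thesis
  proof (rule insert.IH)
   show "A i j = A j i" for i j by (rule insert.prems(1))
   show "A i j = 0" if "i ~: K" for i j
    using that insert.prems(2)[of i j] Ak by (cases "i = k") auto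
   show "0 <= (SUM i:UNIV. SUM j:UNIV. x i * x j * A i j)" for x
    by (rule insert.prems(3))
  qed
 next
  case False
  have "0 <= A k k"
  proof -
   let ?x = "%i. if i = k then 1 else 0 :: real"
   have "(SUM j:UNIV. ?x i * ?x j * A i j) = (if i = k then A k k else 0)" for i
   proof -
    have "?x i * ?x j * A i j = (if j = k then ?x i * A i k else 0)" for j by auto
    then show ?thesis by simp
   qed
   then have "(SUM i:UNIV. SUM j:UNIV. ?x i * ?x j * A i j) = A k k" by simp
   then show ?thesis using insert.prems(3)[of ?x] by linarith
  qed
  with False have pos: "A k k > 0" by simp
  define A' where "A' i j = A i j - A k i * A k j / A k k" for i j
  have "(SUM i:UNIV. SUM j:UNIV. A' i j * B i j) <= 0"
  proof (rule insert.IH)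
   show "A' i j = A' j i" for i j using insert.prems(1)[of i j] by (simp add: A'_def mult.commute)
   show "A' i j = 0" if "i ~: K" for i j
   proof (cases "i = k")
    case True then show ?thesis using pos by (simp add: A'_def)
   next
    case False
    then show ?thesis using that insert.prems(2)[of i] insert.prems(1)[of i k] by (simp add: A'_def)
   qed
   fix x
   define r where "r = (SUM j:UNIV. x j * A k j) / A k k"
   define z where "z i = x i - (if i = k then r else 0)" for i
   have S: "(SUM j:UNIV. x j * A k j) = r * A k k" using pos by (simp add: r_def)
   have "(SUM i:UNIV. SUM j:UNIV. z i * z j * A i j)
     = (SUM i:UNIV. SUM j:UNIV. x i * x j * A i j) - 2 * r * (SUM j:UNIV. x j * A k j) + r * r * A k k"
   proof -
    have zs: "(SUM j:UNIV. z i * z j * A i j) = z i * ((SUM j:UNIV. x j * A i j) - r * A i k)" for i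
    proof -
     have "(SUM j:UNIV. z i * z j * A i j) = z i * (SUM j:UNIV. x j * A i j - (if j = k then r * A i k else 0))"
      unfolding sum_distrib_left by (intro sum.cong) (auto simp: z_def algebra_simps)
     then show ?thesis by (simp add: sum_subtractf)
    qed
    have "(SUM i:UNIV. SUM j:UNIV. z i * z j * A i j)
      = (SUM i:UNIV. x i * ((SUM j:UNIV. x j * A i j) - r * A i k) - (if i = k then r * ((SUM j:UNIV. x j * A k j) - r * A k k) else 0))"
     unfolding zs by (intro sum.cong) (auto simp: z_def left_diff_distrib)
    also have "... = (SUM i:UNIV. x i * ((SUM j:UNIV. x j * A i j) - r * A i k)) - r * ((SUM j:UNIV. x j * A k j) - r * A k k)"
     by (simp add: sum_subtractf)
    also have "(SUM i:UNIV. x i * ((SUM j:UNIV. x j * A i j) - r * A i k))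
     = (SUM i:UNIV. SUM j:UNIV. x i * x j * A i j) - r * (SUM j:UNIV. x j * A k j)"
    proof -
     have "x i * ((SUM j:UNIV. x j * A i j) - r * A i k)
       = (SUM j:UNIV. x i * x j * A i j) - r * (x i * A k i)" for i
      using insert.prems(1)[of i k] by (simp add: sum_distrib_left algebra_simps)
     then show ?thesis by (simp add: sum_subtractf sum_distrib_left)
    qed
    finally show ?thesis by (simp add: algebra_simps)
   qed
   also have "... = (SUM i:UNIV. SUM j:UNIV. x i * x j * A i j) - r * r * A k k"
    by (simp add: S)
   also have "... = (SUM i:UNIV. SUM j:UNIV. x i * x j * A' i j)"
   proof -
    have "(SUM i:UNIV. SUM j:UNIV. x i * x j * A' i j)
     = (SUM i:UNIV. SUM j:UNIV. x i * x j * A i j) - (SUM i:UNIV. SUM j:UNIV. (x i * A k i) * (x j * A k j)) / A k k"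
     by (simp add: A'_def algebra_simps sum_subtractf sum_divide_distrib)
    also have "(SUM i:UNIV. SUM j:UNIV. (x i * A k i) * (x j * A k j)) = (r * A k k) * (r * A k k)"
     unfolding S[symmetric] by (simp add: sum_product)
    finally show ?thesis using pos by simp
   qed
   finally show "0 <= (SUM i:UNIV. SUM j:UNIV. x i * x j * A' i j)"
    using insert.prems(3)[of z] by simp
  qed
  moreover have "(SUM i:UNIV. SUM j:UNIV. A i j * B i j) =
    (SUM i:UNIV. SUM j:UNIV. A' i j * B i j) + (SUM i:UNIV. SUM j:UNIV. A k i * A k j * B i j) / A k k"
   by (simp add: A'_def algebra_simps sum_subtractf sum_divide_distrib sum.distrib)
  moreover have "(SUM i:UNIV. SUM j:UNIV. A k i * A k j * B i j) / A k k <= 0"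
   using pos assms(5)[of "A k"] by (simp add: divide_nonpos_pos)
  ultimately show ?thesis by linarith
 qed
qed

lemma inner_matrix_vector_sum: "x \<bullet> (A *v y) = (SUM i:UNIV. SUM j:UNIV. x $ i * y $ j * A $ i $ j)"
 for A :: "real ^ 'n ^ 'm"
 by (simp add: inner_vec_def matrix_vector_mult_def sum_distrib_left mult_ac)

lemma posdef_nsd_contraction:
 fixes A :: "real ^ 'n ^ 'n::finite"
 assumes "posdef A" "!!x::real ^ 'n. (SUM i:UNIV. SUM j:UNIV. x $ i * x $ j * B i j) <= 0"
 shows "(SUM i:UNIV. SUM j:UNIV. A $ i $ j * B i j) <= 0"
proof (rule psd_nsd_contraction_aux[where K = UNIV])
 show "0 <= (SUM i:UNIV. SUM j:UNIV. x i * x j * A $ i $ j)" for x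
  using posdef_nonneg[OF assms(1), of "\<chi> i. x i"] by (simp add: inner_matrix_vector_sum)
 show "(SUM i:UNIV. SUM j:UNIV. x i * x j * B i j) <= 0" for x
  using assms(2)[of "\<chi> i. x i"] by simp
qed (auto intro: posdef_sym[OF assms(1)])

lemma has_derivative_det:
 fixes A :: "'e::real_normed_vector => real ^ 'n ^ 'n::finite"
 assumes "!!i j. ((%x. A x $ i $ j) has_derivative (%v. A' v i j)) (at y)"
 shows "((%x. det (A x)) has_derivative
  (%v. SUM m:UNIV. det (\<chi> i j. if i = m then A' v m j else A y $ i $ j))) (at y)"
proof -
 have "((%x. det (A x)) has_derivative
  (%v. \<Sum>p\<in>{p. p permutes UNIV}. of_int (sign p) *
    (SUM m:UNIV. A' v m (p m) * (\<Prod>i\<in>UNIV - {m}. A y $ i $ p i)))) (at y)"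
  unfolding det_def
  by (intro has_derivative_sum has_derivative_mult_right has_derivative_prod assms)
 moreover have "(\<Sum>p\<in>{p. p permutes UNIV}. of_int (sign p) *
    (SUM m:UNIV. A' v m (p m) * (\<Prod>i\<in>UNIV - {m}. A y $ i $ p i)))
   = (SUM m:UNIV. det (\<chi> i j. if i = m then A' v m j else A y $ i $ j))" for v
 proof -
  have "A' v m (p m) * (\<Prod>i\<in>UNIV - {m}. A y $ i $ p i)
    = (\<Prod>i\<in>UNIV. (\<chi> i j. if i = m then A' v m j else A y $ i $ j) $ i $ p i)" for m p
   by (subst prod.remove[of UNIV m]) (auto intro!: prod.cong)
  then show ?thesis
   unfolding det_def sum_distrib_left by (subst sum.swap) (simp only:)
 qed
 ultimately show ?thesis by simp
qed

lemma det_replace_row: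
 fixes A B :: "real ^ 'n ^ 'n::finite"
 shows "det (\<chi> i j. if i = m then (B ** A) $ m $ j else A $ i $ j) = B $ m $ m * det A"
proof -
 have "det (\<chi> i j. if i = m then (B ** A) $ m $ j else A $ i $ j)
   = det (\<chi> i. if i = m then (SUM l:UNIV. B $ m $ l *s A $ l) else A $ i)"
  by (rule arg_cong[where f = det]) (auto simp: vec_eq_iff matrix_matrix_mult_def)
 also have "... = (SUM l:UNIV. det (\<chi> i. if i = m then B $ m $ l *s A $ l else A $ i))"
  by (rule det_linear_row_sum) simp
 also have "... = (SUM l:UNIV. B $ m $ l * det (\<chi> i. if i = m then A $ l else A $ i))"
  by (intro sum.cong refl det_row_mul)
 also have "... = (SUM l:UNIV. if l = m then B $ m $ m * det A else 0)"
 proof (intro sum.cong refl)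
  fix l
  show "B $ m $ l * det (\<chi> i. if i = m then A $ l else A $ i) = (if l = m then B $ m $ m * det A else 0)"
  proof (cases "l = m")
   case True
   have "(\<chi> i. if i = m then A $ m else A $ i) = A" by (simp add: vec_eq_iff)
   then show ?thesis unfolding True by simp
  next
   case False
   have "det (\<chi> i. if i = m then A $ l else A $ i) = 0"
    by (rule det_identical_rows[OF False]) (auto simp: row_def vec_eq_iff False)
   then show ?thesis using False by simp
  qed
 qed
 finally show ?thesis by simp
qed


text \<open>Piola's identity: the columns of the cofactor matrix of a Jacobian are divergence free.
 Differentiating \<open>J W = \<bar>det J\<bar> (Z o tau)\<close> produces, besides the divergence of \<open>Z\<close>, two sums over second
 derivatives of \<open>tau\<close>; they cancel because second derivatives are symmetric.\<close>

lemma Piola_divergence: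
 fixes tau W Z :: "real ^ 'n::finite => real ^ 'n"
 defines "J == %x. matrix (frechet_derivative tau (at x))"
 assumes V: "open V" and tau: "Ck_on_open 2 tau V" and y: "y \<in> V" and d0: "det (J y) ~= 0"
  and W: "(W has_derivative W') (at y)" and Z: "(Z has_derivative Z') (at (tau y))"
  and JW: "!!x. x \<in> V ==> J x *v W x = \<bar>det (J x)\<bar> *R Z (tau x)"
 shows "(SUM i:UNIV. W' (axis i 1) $ i) = \<bar>det (J y)\<bar> * (SUM a:UNIV. Z' (axis a 1) $ a)"
proof -
 have tau2: "Ck_on_open (Suc (Suc 0)) tau V" using tau by (simp add: numeral_2_eq_2)
 have dertau: "(tau has_derivative frechet_derivative tau (at x)) (at x)" if "x \<in> V" for x
  using Ck_on_open_SucD[OF tau2 that] .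
 have Jv: "J x *v v = frechet_derivative tau (at x) v" if "x \<in> V" for x v
  using matrix_vector_mul(2)[OF has_derivative_linear[OF dertau[OF that]]] by (simp add: J_def fun_eq_iff)
 have tauc: "Ck_on_open 2 (%x. tau x $ a) V" for a
  using tau Ck_on_open_vec_iff[OF V] by blast
 have fdc: "frechet_derivative (%x. tau x $ a) (at x) v = frechet_derivative tau (at x) v $ a" if "x \<in> V" for a x v
  using frechet_derivative_at[OF bounded_linear.has_derivative[OF bounded_linear_vec_nth[of a] dertau[OF that]]]
  by (metis (no_types))
 have Jent: "J x $ a $ m = pdv m (%x. tau x $ a) x" if "x \<in> V" for x a m
  using fdc[OF that] by (simp add: J_def matrix_def)
 define H where "H a m v = frechet_derivative (%x. pdv m (%x. tau x $ a) x) (at y) v" for a m v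
 have "Ck_on_open (Suc 0) (%x. pdv m (%x. tau x $ a) x) V" for a m
  using tauc[of a] by (simp add: numeral_2_eq_2)
 from Ck_on_open_SucD[OF this y]
 have "((%x. pdv m (%x. tau x $ a) x) has_derivative H a m) (at y)" for a m
  by (simp add: H_def[abs_def])
 then have dJ: "((%x. J x $ a $ m) has_derivative H a m) (at y)" for a m
  by (rule has_derivative_transform_within_open[OF _ V y]) (simp add: Jent)
 have Hsym: "H a m (axis i 1) = H a i (axis m 1)" for a m i
  unfolding H_def by (rule second_derivative_symmetric[OF V tauc y])
 define Hm where "Hm v = (\<chi> a m. H a m v)" for v
 obtain K where K: "K ** J y = mat 1" "J y ** K = mat 1"
  using d0 unfolding invertible_det_nz[symmetric] invertible_def by blast
 define tr where "tr v = (SUM m:UNIV. (Hm v ** K) $ m $ m)" for v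
 have dd: "((%x. det (J x)) has_derivative (%v. tr v * det (J y))) (at y)"
 proof -
  have HK: "(Hm v ** K) ** J y = Hm v" for v
   by (simp add: matrix_mul_assoc[symmetric] K)
  have He: "Hm v $ a $ m = H a m v" for v a m by (simp add: Hm_def)
  have "det (\<chi> i j. if i = m then H m j v else J y $ i $ j) = (Hm v ** K) $ m $ m * det (J y)" for m v
   using det_replace_row[of m "Hm v ** K" "J y"] unfolding HK He .
  then show ?thesis
   using has_derivative_det[of J "%v i j. H i j v" y, OF dJ] by (simp add: tr_def sum_distrib_right)
 qed
 define s where "s = sgn (det (J y))"
 have s: "\<bar>det (J y)\<bar> = s * det (J y)" unfolding s_def by (simp add: abs_sgn mult.commute)
 have "isCont (%x. det (J x)) y" using has_derivative_continuous[OF dd] by simp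
 moreover have "open {d. sgn d = s}"
 proof (cases "det (J y) > 0")
  case True
  then have "{d. sgn d = s} = {0<..}" by (auto simp: s_def sgn_if split: if_splits)
  then show ?thesis by simp
 next
  case False
  then have "{d. sgn d = s} = {..<0}" using d0 by (auto simp: s_def sgn_if split: if_splits)
  then show ?thesis by simp
 qed
 ultimately obtain N where N: "open N" "y \<in> N" "!!x. x \<in> N ==> sgn (det (J x)) = s"
  unfolding continuous_at_open by (metis (mono_tags, lifting) mem_Collect_eq s_def)
 have eq: "J x *v W x = (s * det (J x)) *R Z (tau x)" if "x \<in> V Int N" for x
  using JW[of x] N(3)[of x] that by (simp add: abs_sgn mult.commute)
 have Wc: "((%x. W x $ m) has_derivative (%v. W' v $ m)) (at y)" for m
  by (rule bounded_linear.has_derivative[OF bounded_linear_vec_nth W])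
 have Ztau: "((%x. Z (tau x)) has_derivative (%v. Z' (J y *v v))) (at y)"
  using has_derivative_compose[OF dertau[OF y] Z] by (simp add: Jv[OF y])
 then have Ztauc: "((%x. Z (tau x) $ a) has_derivative (%v. Z' (J y *v v) $ a)) (at y)" for a
  by (rule bounded_linear.has_derivative[OF bounded_linear_vec_nth])
 have main: "Hm v *v W y + J y *v W' v
   = (s * (tr v * det (J y))) *R Z (tau y) + (s * det (J y)) *R Z' (J y *v v)" for v
 proof -
  have "(SUM m:UNIV. H a m v * W y $ m + J y $ a $ m * W' v $ m)
    = s * (tr v * det (J y)) * Z (tau y) $ a + s * det (J y) * Z' (J y *v v) $ a" for a
  proof -
   have 1: "((%x. SUM m:UNIV. J x $ a $ m * W x $ m) has_derivative
     (%v. SUM m:UNIV. J y $ a $ m * W' v $ m + H a m v * W y $ m)) (at y)"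
    by (intro has_derivative_sum has_derivative_mult dJ Wc)
   have 2: "((%x. s * det (J x) * Z (tau x) $ a) has_derivative
     (%v. (s * det (J y)) * Z' (J y *v v) $ a + (s * (tr v * det (J y))) * Z (tau y) $ a)) (at y)"
    by (intro has_derivative_mult has_derivative_mult_right dd Ztauc)
   have "(SUM m:UNIV. J x $ a $ m * W x $ m) = s * det (J x) * Z (tau x) $ a" if "x \<in> V Int N" for x
    using arg_cong[OF eq[OF that], of "%u. u $ a"] by (simp add: matrix_vector_mult_def)
   from has_derivative_transform_within_open[OF 1 open_Int[OF V N(1)] _ this] y N(2)
   have "((%x. s * det (J x) * Z (tau x) $ a) has_derivative
     (%v. SUM m:UNIV. J y $ a $ m * W' v $ m + H a m v * W y $ m)) (at y)"
    by simp
   from fun_cong[OF has_derivative_unique[OF this 2], of v] show ?thesis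
    by (simp add: add.commute)
  qed
  then show ?thesis
   by (simp add: vec_eq_iff matrix_vector_mult_def Hm_def sum.distrib)
 qed
 have KZ: "(s * det (J y)) *R (K *v Z (tau y)) = W y"
 proof -
  have "K *v (J y *v W y) = K *v ((s * det (J y)) *R Z (tau y))" using JW[OF y] s by simp
  then show ?thesis by (simp add: matrix_vector_mul_assoc K matrix_vector_mult_scaleR)
 qed
 have W'e: "W' v = - (K *v (Hm v *v W y)) + tr v *R W y + (s * det (J y)) *R (K *v Z' (J y *v v))" for v
 proof -
  have "K *v (J y *v W' v) = K *v (- (Hm v *v W y) + (s * (tr v * det (J y))) *R Z (tau y) + (s * det (J y)) *R Z' (J y *v v))"
   by (rule arg_cong[where f = "(*v) K"]) (simp only: add.assoc main[symmetric] minus_add_cancel)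
  then have "W' v = - (K *v (Hm v *v W y)) + (s * (tr v * det (J y))) *R (K *v Z (tau y)) + (s * det (J y)) *R (K *v Z' (J y *v v))"
   by (simp add: matrix_vector_mul_assoc[of K "J y"] K matrix_vector_mult_scaleR matrix_vector_right_distrib
     matrix_vector_mult_diff_distrib)
  moreover have "(s * (tr v * det (J y))) *R (K *v Z (tau y)) = tr v *R W y"
   unfolding KZ[symmetric] by (simp add: mult_ac)
  ultimately show ?thesis by simp
 qed
 have "(SUM i:UNIV. W' (axis i 1) $ i) = - (SUM i:UNIV. (K *v (Hm (axis i 1) *v W y)) $ i)
   + (SUM i:UNIV. tr (axis i 1) * W y $ i) + s * det (J y) * (SUM i:UNIV. (K *v Z' (J y *v axis i 1)) $ i)"
  by (simp add: W'e sum.distrib sum_negf sum_subtractf sum_distrib_left)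
 moreover have "(SUM i:UNIV. (K *v (Hm (axis i 1) *v W y)) $ i) = (SUM i:UNIV. tr (axis i 1) * W y $ i)"
 proof -
  have "(SUM i:UNIV. (K *v (Hm (axis i 1) *v W y)) $ i)
    = (SUM i:UNIV. SUM a:UNIV. SUM m:UNIV. K $ i $ a * H a m (axis i 1) * W y $ m)"
   by (simp add: matrix_vector_mult_def Hm_def sum_distrib_left mult.assoc)
  also have "... = (SUM i:UNIV. SUM m:UNIV. SUM a:UNIV. K $ i $ a * H a m (axis i 1) * W y $ m)"
   by (intro sum.cong refl sum.swap)
  also have "... = (SUM m:UNIV. SUM i:UNIV. SUM a:UNIV. K $ i $ a * H a m (axis i 1) * W y $ m)"
   by (rule sum.swap)
  also have "... = (SUM m:UNIV. SUM a:UNIV. SUM i:UNIV. H a i (axis m 1) * K $ i $ a * W y $ m)"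
   by (rule sum.cong[OF refl], subst sum.swap) (intro sum.cong refl, simp add: Hsym)
  also have "... = (SUM i:UNIV. tr (axis i 1) * W y $ i)"
   by (simp add: tr_def matrix_matrix_mult_def Hm_def sum_distrib_right)
  finally show ?thesis .
 qed
 moreover have "(SUM i:UNIV. (K *v Z' (J y *v axis i 1)) $ i) = (SUM a:UNIV. Z' (axis a 1) $ a)"
 proof -
  define Zm where "Zm = matrix Z'"
  have Zm: "Z' v = Zm *v v" for v
   using matrix_vector_mul(2)[OF has_derivative_linear[OF Z]] by (simp add: Zm_def fun_eq_iff)
  have tr: "(SUM i:UNIV. (A *v axis i 1) $ i) = trace A" for A :: "real ^ 'n ^ 'n"
   by (simp add: trace_def matrix_vector_mult_basis column_def)
  have "trace (K ** (Zm ** J y)) = trace Zm"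
   by (metis K(2) matrix_mul_assoc matrix_mul_rid trace_mul_sym)
  then show ?thesis
   using tr[of "K ** (Zm ** J y)"] tr[of Zm] by (simp add: Zm matrix_vector_mul_assoc)
 qed
 ultimately show ?thesis using s by simp
qed

section \<open>Charts, the boundary and changes of coordinates\<close>

lemma Ck_on_cong: "Ck_on n f S ==> (!!x. x \<in> S ==> f x = g x) ==> Ck_on n g S"
 unfolding Ck_on_def by (metis IntD1)

lemma Ck_on_subset:
 assumes "Ck_on n f S" "T <= S" shows "Ck_on n f T"
 unfolding Ck_on_def
proof
 fix x assume "x \<in> T"
 then obtain W h where "open W" "x \<in> W" "Ck_on_open n h W" "ALL y:S Int W. h y = f y"
  using assms unfolding Ck_on_def by blast
 then show "EX W h. open W & x \<in> W & Ck_on_open n h W & (ALL y:T Int W. h y = f y)"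
  using assms(2) by (intro exI[of _ W] exI[of _ h]) auto
qed

lemma Ck_on_mono:
 assumes "Ck_on m f S" "n <= m" shows "Ck_on n f S"
 unfolding Ck_on_def
proof
 fix x assume "x \<in> S"
 then obtain W h where "open W" "x \<in> W" "Ck_on_open m h W" "ALL y:S Int W. h y = f y"
  using assms unfolding Ck_on_def by blast
 then show "EX W h. open W & x \<in> W & Ck_on_open n h W & (ALL y:S Int W. h y = f y)"
  using Ck_on_open_mono[OF _ assms(2)] by (intro exI[of _ W] exI[of _ h]) auto
qed

lemma Ck_on_openI: "open W ==> Ck_on_open n f W ==> S <= W ==> Ck_on n f S"
 unfolding Ck_on_def by (intro ballI exI[of _ W] exI[of _ f]) auto

lemma at_within_Int_open: "y \<in> W ==> open W ==> at y within (S Int W) = at y within S"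
 by (rule at_within_nhd[of y W]) auto

lemma Ck_on_openD:
 assumes "Ck_on n f S" "open S"
 shows "Ck_on_open n f S"
proof -
 have local: "EX W. open W & x \<in> W & W <= S & Ck_on_open n f W" if x: "x \<in> S" for x
 proof -
  obtain W h where W: "open W" "x \<in> W" "Ck_on_open n h W" "ALL y:S Int W. h y = f y"
   using assms(1) x unfolding Ck_on_def by blast
  then have "Ck_on_open n h (S Int W)" using Ck_on_open_subset by blast
  then have "Ck_on_open n f (S Int W)"
   using Ck_on_open_cong[of "S Int W" h f n] W assms(2) by (simp add: open_Int)
  then show ?thesis using W x assms(2) by (intro exI[of _ "S Int W"]) auto
 qed
 have glue: "(!!x. x \<in> S ==> EX W. open W & x \<in> W & W <= S & Ck_on_open n f W) ==> Ck_on_open n f S" for f :: "'a => 'b"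
 proof (induction n arbitrary: f)
  case 0
  have "isCont f x" if x: "x \<in> S" for x
   using 0[OF x] continuous_on_eq_continuous_at by (metis Ck_on_open.simps(1))
  then show ?case by (simp add: continuous_at_imp_continuous_on)
 next
  case (Suc n)
  have "f differentiable at x" if "x \<in> S" for x
   using Suc.prems[OF that] by auto
  moreover have "Ck_on_open n (%x. frechet_derivative f (at x) v) S" for v
  proof (rule Suc.IH)
   fix x assume "x \<in> S"
   then obtain W where "open W" "x \<in> W" "W <= S" "Ck_on_open (Suc n) f W"
    using Suc.prems by blast
   then show "EX W. open W & x \<in> W & W <= S & Ck_on_open n (%x. frechet_derivative f (at x) v) W"
    by (intro exI[of _ W]) auto
  qed
  ultimately show ?case by simp
 qed
 show ?thesis by (rule glue[OF local])
qed

lemma Ck_on_compose: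
 fixes f :: "'e::euclidean_space => 'b::euclidean_space" and g :: "'b => 'c::real_normed_vector"
 assumes f: "Ck_on n f S" and g: "Ck_on n g T" and sub: "f ` S <= T"
 shows "Ck_on n (%x. g (f x)) S"
 unfolding Ck_on_def
proof
 fix x assume x: "x \<in> S"
 obtain W h where W: "open W" "x \<in> W" "Ck_on_open n h W" "ALL y:S Int W. h y = f y"
  using f x unfolding Ck_on_def by blast
 obtain W' h' where W': "open W'" "f x \<in> W'" "Ck_on_open n h' W'" "ALL y:T Int W'. h' y = g y"
  using g x sub unfolding Ck_on_def by blast
 define V where "V = W Int h -` W'"
 have V: "open V"
  using continuous_open_preimage[OF Ck_on_open_continuous[OF W(3)] W(1) W'(1)] by (simp add: V_def)
 have "Ck_on_open n (%x. h' (h x)) V"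
  by (rule Ck_on_open_compose[OF V W'(1) _ _ W'(3)]) (auto simp: V_def intro: Ck_on_open_subset[OF W(3)])
 moreover have "x \<in> V" using x W W' by (auto simp: V_def)
 moreover have "ALL y:S Int V. h' (h y) = g (f y)" using W(4) W'(4) sub by (auto simp: V_def)
 ultimately show "EX W h. open W & x \<in> W & Ck_on_open n h W & (ALL y:S Int W. h y = g (f y))"
  using V by blast
qed

lemma Ck_on_continuous: "Ck_on n f S ==> continuous_on S f"
 unfolding continuous_on_eq_continuous_within
proof
 fix x assume f: "Ck_on n f S" and x: "x \<in> S"
 obtain W h where W: "open W" "x \<in> W" "Ck_on_open n h W" "ALL y:S Int W. h y = f y"
  using f x unfolding Ck_on_def by blast
 have "isCont h x" using Ck_on_open_continuous[OF W(3)] W(1,2) continuous_on_eq_continuous_at by blast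
 then have "continuous (at x within S) h" by (rule continuous_at_imp_continuous_at_within)
 then show "continuous (at x within S) f"
  by (rule continuous_transform_within_openin[of _ _ _ "S Int W"]) (insert W x, auto simp: openin_open)
qed

lemma closed_half_space: "closed (half_space k)"
 unfolding half_space_def by (intro closed_Collect_le continuous_intros)

lemma convex_half_space: "convex (half_space k)"
 unfolding half_space_def by (auto simp: convex_def)

text \<open>A relatively open subset of a half-space contains a segment in every positive coordinate
 direction, which pins down derivatives within it.\<close>

lemma derivative_within_half_space_unique:
 fixes S :: "(real ^ 'n::finite) set"
 assumes S: "openin (top_of_set (half_space k)) S" and y: "y \<in> S"
  and "(f has_derivative f1) (at y within S)" "(f has_derivative f2) (at y within S)"
 shows "f1 = f2"
proof (rule frechet_derivative_unique_within[OF assms(3,4)])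
 obtain W where W: "open W" "S = half_space k Int W" using S by (auto simp: openin_open)
 obtain r where r: "r > 0" "ball y r <= W" using W y open_contains_ball by blast
 fix i :: "real ^ 'n" and e :: real assume i: "i \<in> Basis" and e: "0 < e"
 define d where "d = min e r / 2"
 have d: "0 < d" "d < e" "d < r" using e r by (auto simp: d_def)
 have "dist y (y + d *R i) < r" using d i by (simp add: dist_norm)
 then have "y + d *R i \<in> W" using r by auto
 moreover have "y + d *R i \<in> half_space k"
  using i y W(2) d by (auto simp: half_space_def Basis_vec_def axis_def)
 ultimately show "EX d. 0 < \<bar>d\<bar> & \<bar>d\<bar> < e & y + d *R i \<in> S"
  using d W by (intro exI[of _ d]) auto
qed

lemma frechet_within_half_space:
 fixes S :: "(real ^ 'n::finite) set"
 assumes "openin (top_of_set (half_space k)) S" "y \<in> S" "(f has_derivative f') (at y within S)"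
 shows "frechet_derivative f (at y within S) = f'"
 using derivative_within_half_space_unique[OF assms(1,2) _ assms(3)] assms(3)
  frechet_derivative_works differentiableI by metis

text \<open>Derivatives within a half-space are those of any local extension, by uniqueness.\<close>

lemma Ck_on_frechet_within:
 fixes S :: "(real ^ 'n::finite) set"
 assumes S: "openin (top_of_set (half_space k)) S" and f: "Ck_on (Suc n) f S"
 shows "y \<in> S ==> (f has_derivative frechet_derivative f (at y within S)) (at y within S)"
  and "Ck_on n (%y. frechet_derivative f (at y within S) v) S"
proof -
 have *: "EX W h. open W & x \<in> W & Ck_on_open (Suc n) h W &
   (ALL y:S Int W. (f has_derivative frechet_derivative h (at y)) (at y within S)
    & frechet_derivative f (at y within S) = frechet_derivative h (at y))" if x: "x \<in> S" for x
 proof -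
  obtain W h where W: "open W" "x \<in> W" "Ck_on_open (Suc n) h W" "ALL y:S Int W. h y = f y"
   using f x unfolding Ck_on_def by blast
  have d: "(f has_derivative frechet_derivative h (at y)) (at y within S)" if y: "y \<in> S Int W" for y
  proof -
   have "(h has_derivative frechet_derivative h (at y)) (at y within S)"
    using Ck_on_open_SucD[OF W(3)] y has_derivative_at_withinI by blast
   moreover have "at y within S = at y within (S Int W)"
    using y W(1) by (metis IntD2 at_within_Int_open)
   ultimately have "(h has_derivative frechet_derivative h (at y)) (at y within S Int W)" by simp
   then have "(f has_derivative frechet_derivative h (at y)) (at y within S Int W)"
    using W(4) y by (metis (no_types, lifting) has_derivative_transform)
   then show ?thesis using \<open>at y within S = at y within (S Int W)\<close> by simp
  qed
  moreover have "frechet_derivative f (at y within S) = frechet_derivative h (at y)" if y: "y \<in> S Int W" for y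
   using frechet_within_half_space[OF S _ d[OF y]] y by blast
  ultimately show ?thesis using W by blast
 qed
 show "y \<in> S ==> (f has_derivative frechet_derivative f (at y within S)) (at y within S)"
  using * by (metis IntI)
 show "Ck_on n (%y. frechet_derivative f (at y within S) v) S"
  unfolding Ck_on_def
 proof
  fix x assume "x \<in> S"
  from *[OF this] obtain W h where W: "open W" "x \<in> W" "Ck_on_open (Suc n) h W"
   "ALL y:S Int W. frechet_derivative f (at y within S) = frechet_derivative h (at y)" by blast
  then show "EX W h. open W & x \<in> W & Ck_on_open n h W &
    (ALL y:S Int W. h y = frechet_derivative f (at y within S) v)"
   by (intro exI[of _ W] exI[of _ "%y. frechet_derivative h (at y) v"]) auto
 qed
qed

locale riem_manifold =
 fixes M :: "('p::t2_space, 'n::finite) riem"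
 assumes riem: "riemannian_manifold_with_boundary M"
begin

abbreviation "X == carrier M"
abbreviation "kk == bcoord M"
abbreviation "HS == half_space (bcoord M)"

definition rng :: "('p, 'n) chart => (real ^ 'n) set" where
 "rng c = coord c ` cdom c"

definition ov :: "('p, 'n) chart => ('p, 'n) chart => (real ^ 'n) set" where
 "ov c c' = coord c ` (cdom c Int cdom c')"

lemmas riem_unfolded = riem[unfolded riemannian_manifold_with_boundary_def C2_manifold_with_boundary_def]

lemma atlas_chart: "ALL c:atlas M. is_chart X kk c"
 by (rule riem_unfolded[THEN conjunct1, THEN conjunct1])

lemma atlas_Union: "(\<Union>c\<in>atlas M. cdom c) = X"
 by (rule riem_unfolded[THEN conjunct1, THEN conjunct2, THEN conjunct1])

lemma atlas_compat: "ALL c:atlas M. ALL c':atlas M. C2_compatible c c'"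
 by (rule riem_unfolded[THEN conjunct1, THEN conjunct2, THEN conjunct2, THEN conjunct1])

lemma atlas_maximal: "ALL c. is_chart X kk c & (ALL c':atlas M. C2_compatible c c') --> c \<in> atlas M"
 by (rule riem_unfolded[THEN conjunct1, THEN conjunct2, THEN conjunct2, THEN conjunct2])

lemma metric_C1: "ALL c:atlas M. Ck_on 1 (%y. metric M c (coord_inv c y)) (coord c ` cdom c)"
 by (rule riem_unfolded[THEN conjunct2, THEN conjunct1])

lemma metric_pd: "ALL c:atlas M. ALL x:cdom c. transpose (metric M c x) = metric M c x &
  (ALL v. v ~= 0 --> v \<bullet> (metric M c x *v v) > 0)"
 by (rule riem_unfolded[THEN conjunct2, THEN conjunct2, THEN conjunct1])

lemma metric_tensor: "ALL c:atlas M. ALL c':atlas M. ALL x:cdom c Int cdom c'. ALL v w.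
    (let J = frechet_derivative (transition c c')
          (at (coord c x) within coord c ` (cdom c Int cdom c'))
     in v \<bullet> (metric M c x *v w) = J v \<bullet> (metric M c' x *v J w))"
 by (rule riem_unfolded[THEN conjunct2, THEN conjunct2, THEN conjunct2])

lemma atlasD:
 assumes "c \<in> atlas M"
 shows "openin (top_of_set X) (cdom c)" "openin (top_of_set HS) (rng c)"
  "homeomorphism (cdom c) (rng c) (coord c) (coord_inv c)" "cdom c <= X" "rng c <= HS"
proof -
 have "is_chart X kk c"
  using assms atlas_chart by blast
 then show "openin (top_of_set X) (cdom c)" "openin (top_of_set HS) (rng c)"
  "homeomorphism (cdom c) (rng c) (coord c) (coord_inv c)"
  by (auto simp: is_chart_def rng_def)
 then show "cdom c <= X" "rng c <= HS" using openin_imp_subset by blast+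
qed

lemma atlas_cover: "x \<in> X ==> EX c:atlas M. x \<in> cdom c"
 using atlas_Union by blast

lemma chart_at_atlas:
 assumes "x \<in> X" shows "chart_at M x \<in> atlas M" "x \<in> cdom (chart_at M x)"
 using someI_ex[of "%c. c \<in> atlas M & x \<in> cdom c"] atlas_cover[OF assms] unfolding chart_at_def by blast+

lemma coord_inv_coord [simp]: "c \<in> atlas M ==> x \<in> cdom c ==> coord_inv c (coord c x) = x"
 using atlasD(3) by (simp add: homeomorphism_def)

lemma coord_coord_inv [simp]: "c \<in> atlas M ==> y \<in> rng c ==> coord c (coord_inv c y) = y"
 using atlasD(3) by (simp add: homeomorphism_def)

lemma coord_in_rng [simp]: "x \<in> cdom c ==> coord c x \<in> rng c"
 by (simp add: rng_def)

lemma coord_inv_in [simp]: "c \<in> atlas M ==> y \<in> rng c ==> coord_inv c y \<in> cdom c"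
 by (auto simp: rng_def)

lemma coord_nonneg: "c \<in> atlas M ==> x \<in> cdom c ==> 0 <= coord c x $ kk"
 using subsetD[OF atlasD(5) coord_in_rng] by (auto simp: half_space_def)

lemma open_in_chart:
 assumes c: "c \<in> atlas M" and U: "openin (top_of_set X) U"
 shows "openin (top_of_set HS) (coord c ` (cdom c Int U))"
proof -
 obtain T where T: "open T" "U = X Int T" using U by (auto simp: openin_open)
 then have "cdom c Int U = cdom c Int T" using atlasD(4)[OF c] by auto
 then have "openin (top_of_set (cdom c)) (cdom c Int U)" using T by (simp add: openin_open_Int)
 then have "openin (top_of_set (rng c)) (coord c ` (cdom c Int U))"
  using homeomorphism_imp_open_map[OF atlasD(3)[OF c]] by blast
 then show ?thesis using atlasD(2)[OF c] openin_trans by blast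
qed

lemma ov_open: "c \<in> atlas M ==> c' \<in> atlas M ==> openin (top_of_set HS) (ov c c')"
 unfolding ov_def using open_in_chart atlasD(1) by blast

lemma ov_subset: "ov c c' <= rng c" by (auto simp: ov_def rng_def)

lemma ov_iff: "c \<in> atlas M ==> y \<in> ov c c' \<longleftrightarrow> y \<in> rng c & coord_inv c y \<in> cdom c'"
 by (auto simp: ov_def rng_def image_iff)

lemma transition_simps:
 assumes "c \<in> atlas M" "x \<in> cdom c"
 shows "transition c c' (coord c x) = coord c' x"
 using assms by (simp add: transition_def)

lemma transition_C2: "c \<in> atlas M ==> c' \<in> atlas M ==> Ck_on 2 (transition c c') (ov c c')"
 using atlas_compat unfolding C2_compatible_def ov_def by blast

lemma transition_in: "c \<in> atlas M ==> transition c c' ` ov c c' <= ov c' c"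
 by (auto simp: ov_def transition_def)

lemma transition_inverse: "c \<in> atlas M ==> c' \<in> atlas M ==> y \<in> ov c c' ==> transition c' c (transition c c' y) = y"
 by (auto simp: ov_def transition_def)

lemma coord_inv_transition: "c \<in> atlas M ==> c' \<in> atlas M ==> y \<in> ov c c' ==> coord_inv c' (transition c c' y) = coord_inv c y"
 by (auto simp: ov_def transition_def)

definition Jac :: "('p, 'n) chart => ('p, 'n) chart => 'p => real ^ 'n => real ^ 'n" where
 "Jac c c' x = frechet_derivative (transition c c') (at (coord c x) within ov c c')"

lemma Jac_derivative:
 assumes "c \<in> atlas M" "c' \<in> atlas M" "x \<in> cdom c" "x \<in> cdom c'"
 shows "(transition c c' has_derivative Jac c c' x) (at (coord c x) within ov c c')"
proof -
 have "Ck_on (Suc 0) (transition c c') (ov c c')"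
  using Ck_on_mono[OF transition_C2[OF assms(1,2)], of "Suc 0"] by simp
 from Ck_on_frechet_within(1)[OF ov_open[OF assms(1,2)] this, of "coord c x"]
 show ?thesis unfolding Jac_def using assms by (simp add: ov_def)
qed

lemma Jac_linear:
 assumes "c \<in> atlas M" "c' \<in> atlas M" "x \<in> cdom c" "x \<in> cdom c'"
 shows "linear (Jac c c' x)"
 using has_derivative_linear[OF Jac_derivative[OF assms]] .

lemma metric_law:
 assumes "c \<in> atlas M" "c' \<in> atlas M" "x \<in> cdom c" "x \<in> cdom c'"
 shows "v \<bullet> (metric M c x *v w) = Jac c c' x v \<bullet> (metric M c' x *v Jac c c' x w)"
 using metric_tensor assms unfolding Jac_def ov_def Let_def by blast

lemma metric_posdef: "c \<in> atlas M ==> x \<in> cdom c ==> posdef (metric M c x)"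
 using metric_pd unfolding posdef_def by blast

text \<open>Transitions preserve positive definite metrics, so they are immersions.\<close>

lemma Jac_inj:
 assumes "c \<in> atlas M" "c' \<in> atlas M" "x \<in> cdom c" "x \<in> cdom c'"
 shows "inj (Jac c c' x)"
proof -
 have l: "linear (Jac c c' x)" using Jac_linear[OF assms] .
 have "v = 0" if "Jac c c' x v = 0" for v
  using metric_law[OF assms, of v v] that posdef_zero_iff[OF metric_posdef[OF assms(1,3)], of v] by simp
 then show ?thesis using linear_injective_0[OF l] by blast
qed

lemma Jac_surj:
 assumes "c \<in> atlas M" "c' \<in> atlas M" "x \<in> cdom c" "x \<in> cdom c'"
 shows "surj (Jac c c' x)"
 using linear_injective_imp_surjective[OF Jac_linear[OF assms] Jac_inj[OF assms]] by simp

definition gloc :: "('p, 'n) chart => real ^ 'n => real ^ 'n ^ 'n" where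
 "gloc c y = metric M c (coord_inv c y)"

lemma gloc_C1: "c \<in> atlas M ==> Ck_on 1 (gloc c) (rng c)"
 using metric_C1 unfolding rng_def gloc_def[abs_def] by blast

lemma gloc_posdef: "c \<in> atlas M ==> y \<in> rng c ==> posdef (gloc c y)"
 by (simp add: gloc_def metric_posdef)

lemma gloc_continuous: "c \<in> atlas M ==> continuous_on (rng c) (gloc c)"
 using gloc_C1 Ck_on_continuous by blast


text \<open>Invariance of domain: near a point with positive distinguished coordinate the transition has an open image,
 which cannot touch the edge of the half-space.\<close>

lemma positive_coordinate_invariant:
 assumes c: "c \<in> atlas M" "c' \<in> atlas M" "x \<in> cdom c" "x \<in> cdom c'" and pos: "coord c x $ kk > 0"
 shows "coord c' x $ kk > 0"
proof -
 define P where "P = {y \<in> ov c c'. y $ kk > 0}"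
 obtain W where W: "open W" "ov c c' = HS Int W" using ov_open[OF c(1,2)] by (auto simp: openin_open)
 have "P = {y. y $ kk > 0} Int W" unfolding P_def W(2) half_space_def by auto
 moreover have "open {y::real^'n. y $ kk > 0}" by (intro open_Collect_less continuous_intros)
 ultimately have "open P" using W by auto
 moreover have "continuous_on P (transition c c')"
  using Ck_on_continuous[OF transition_C2[OF c(1,2)]] by (rule continuous_on_subset) (auto simp: P_def)
 moreover have "inj_on (transition c c') P"
  by (rule inj_on_inverseI[of _ "transition c' c"]) (insert transition_inverse[OF c(1,2)], auto simp: P_def)
 ultimately have o: "open (transition c c' ` P)" using invariance_of_domain by blast
 have "transition c c' ` P <= HS"
  using transition_in[OF c(1), of c'] ov_subset[of c' c] atlasD(5)[OF c(2)] by (force simp: P_def)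
 moreover have "coord c x \<in> P" using c pos by (auto simp: P_def ov_def)
 then have mem: "coord c' x \<in> transition c c' ` P" using transition_simps[OF c(1,3), of c'] by force
 obtain r where r: "r > 0" "ball (coord c' x) r <= transition c c' ` P"
  using o mem open_contains_ball by blast
 have "coord c' x - (r / 2) *R axis kk 1 \<in> ball (coord c' x) r"
  using r by (simp add: dist_norm)
 ultimately have "coord c' x - (r / 2) *R axis kk 1 \<in> HS" using r by blast
 then show ?thesis using r by (simp add: half_space_def)
qed

lemma boundary_iff:
 assumes c: "c \<in> atlas M" "x \<in> cdom c"
 shows "x \<in> boundary M \<longleftrightarrow> coord c x $ kk = 0"
proof
 assume "x \<in> boundary M"
 then obtain c' where c': "c' \<in> atlas M" "x \<in> cdom c'" "coord c' x $ kk = 0"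
  unfolding boundary_def by blast
 then have "~ coord c x $ kk > 0"
  using positive_coordinate_invariant[OF c(1) c'(1) c(2) c'(2)] by auto
 then show "coord c x $ kk = 0" using coord_nonneg[OF c] by simp
next
 assume "coord c x $ kk = 0"
 then show "x \<in> boundary M" using c atlasD(4)[OF c(1)] unfolding boundary_def by blast
qed

lemma interior_iff: "c \<in> atlas M ==> x \<in> cdom c ==> x \<in> interior_of_mfd M \<longleftrightarrow> coord c x $ kk > 0"
 using boundary_iff[of c x] coord_nonneg[of c x] atlasD(4)[of c] by (auto simp: interior_of_mfd_def)


text \<open>Differential of a function in a chart, one-sided at boundary points.\<close>

definition dif :: "('p, 'n) chart => ('p => real) => 'p => real ^ 'n => real" where
 "dif c f x = frechet_derivative (local_expr c f) (at (coord c x) within rng c)"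

definition dgrad :: "('p, 'n) chart => ('p => real) => 'p => real ^ 'n" where
 "dgrad c f x = (\<chi> i. dif c f x (axis i 1))"

definition diff_at :: "('p, 'n) chart => ('p => real) => 'p => bool" where
 "diff_at c f x \<longleftrightarrow> (local_expr c f has_derivative dif c f x) (at (coord c x) within rng c)"

lemma linear_dgrad:
 assumes "diff_at c f x" shows "dif c f x v = dgrad c f x \<bullet> v"
proof -
 have l: "linear (dif c f x)" using assms has_derivative_linear unfolding diff_at_def by blast
 have "v = (SUM i:UNIV. v $ i *R axis i 1)"
  using basis_expansion[of v] by (simp add: scalar_mult_eq_scaleR)
 then have "dif c f x v = dif c f x (SUM i:UNIV. v $ i *R axis i 1)" by (rule arg_cong)
 then show ?thesis
  by (simp add: linear_sum[OF l] linear_scale[OF l] dgrad_def inner_vec_def mult.commute)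
qed

lemma diff_atI:
 assumes "c \<in> atlas M" "x \<in> cdom c" "(local_expr c f has_derivative D) (at (coord c x) within rng c)"
 shows "diff_at c f x" "dif c f x = D"
 using frechet_within_half_space[OF atlasD(2)[OF assms(1)] coord_in_rng[OF assms(2)] assms(3)] assms(3)
 by (auto simp: diff_at_def dif_def)

lemma at_within_ov:
 assumes c: "c \<in> atlas M" "c' \<in> atlas M" "y \<in> ov c c'"
 shows "at y within ov c c' = at y within rng c"
proof -
 obtain W where W: "open W" "ov c c' = HS Int W" using ov_open[OF c(1,2)] by (auto simp: openin_open)
 then have "ov c c' = rng c Int W" using ov_subset[of c c'] atlasD(5)[OF c(1)] by auto
 then show ?thesis using W c(3) at_within_Int_open by (metis IntD2)
qed

lemma dif_change:
 assumes c: "c \<in> atlas M" "c' \<in> atlas M" "x \<in> cdom c" "x \<in> cdom c'" and d: "diff_at c' f x"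
 shows "diff_at c f x" "dif c f x v = dif c' f x (Jac c c' x v)"
proof -
 have y: "coord c x \<in> ov c c'" using c by (auto simp: ov_def)
 have "(local_expr c' f has_derivative dif c' f x) (at (transition c c' (coord c x)) within transition c c' ` ov c c')"
  using d transition_simps[OF c(1,3)] transition_in[OF c(1), of c'] ov_subset[of c' c]
  unfolding diff_at_def by (metis (no_types, lifting) has_derivative_subset subset_trans)
 from diff_chain_within[OF Jac_derivative[OF c(1-4)] this]
 have "(local_expr c' f o transition c c' has_derivative dif c' f x o Jac c c' x) (at (coord c x) within ov c c')" .
 then have "(local_expr c f has_derivative dif c' f x o Jac c c' x) (at (coord c x) within ov c c')"
  by (rule has_derivative_transform[rotated 2])
    (insert y coord_inv_transition[OF c(1,2)], auto simp: local_expr_def)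
 then have "(local_expr c f has_derivative dif c' f x o Jac c c' x) (at (coord c x) within rng c)"
  using at_within_ov[OF c(1,2) y] by simp
 from diff_atI[OF c(1,3) this] show "diff_at c f x" "dif c f x v = dif c' f x (Jac c c' x v)" by auto
qed

text \<open>The pairing \<open>g(\<nabla>f, \<nabla>h)\<close>.\<close>

definition Gam :: "('p, 'n) chart => ('p => real) => ('p => real) => 'p => real" where
 "Gam c f h x = dgrad c f x \<bullet> (matrix_inv (metric M c x) *v dgrad c h x)"

lemma Jac_gradient:
 assumes c: "c \<in> atlas M" "c' \<in> atlas M" "x \<in> cdom c" "x \<in> cdom c'"
  and p: "!!v. p \<bullet> v = p' \<bullet> Jac c c' x v"
 shows "Jac c c' x (matrix_inv (metric M c x) *v p) = matrix_inv (metric M c' x) *v p'"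
proof -
 let ?J = "Jac c c' x" and ?g = "metric M c x" and ?g' = "metric M c' x"
 have g: "posdef ?g" "posdef ?g'" using metric_posdef c by auto
 have "(?g' *v ?J (matrix_inv ?g *v p)) \<bullet> u = p' \<bullet> u" for u
 proof -
  obtain w where u: "u = ?J w" using Jac_surj[OF c] by (metis surjD)
  have "u \<bullet> (?g' *v ?J (matrix_inv ?g *v p)) = w \<bullet> (?g *v (matrix_inv ?g *v p))"
   unfolding u by (rule metric_law[OF c, symmetric])
  then show ?thesis using p[of w] posdef_inv(3)[OF g(1)] u by (simp add: inner_commute)
 qed
 then have "?g' *v ?J (matrix_inv ?g *v p) = p'" using vector_eq_rdot by blast
 then show ?thesis using posdef_inv(4)[OF g(2)] by metis
qed

lemma Gam_change:
 assumes c: "c \<in> atlas M" "c' \<in> atlas M" "x \<in> cdom c" "x \<in> cdom c'" and f: "diff_at c' f x" and h: "diff_at c' h x"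
 shows "Gam c f h x = Gam c' f h x"
proof -
 have p: "dgrad c f x \<bullet> v = dgrad c' f x \<bullet> Jac c c' x v" if "diff_at c' f x" for v f
  using dif_change(2)[OF c that, of v] linear_dgrad[OF dif_change(1)[OF c that], of v]
   linear_dgrad[OF that] by simp
 show ?thesis unfolding Gam_def p[OF f] Jac_gradient[OF c p[OF h]] ..
qed

end

section \<open>The Laplace-Beltrami operator in charts\<close>

context riem_manifold begin

lemma at_within_rng:
 assumes "open P" "P <= S" "y \<in> P" shows "at y within S = at y"
 using at_within_open_subset[OF assms(3,1,2)] .

text \<open>The gradient times the volume density; the Laplacian is the divergence of this field over the density.\<close>

definition Wf :: "('p, 'n) chart => ('p => real) => real ^ 'n => real ^ 'n" where
 "Wf c f y = sqrt (det (gloc c y)) *R (matrix_inv (gloc c y) *v dgrad c f (coord_inv c y))"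

lemma dgrad_partial:
 assumes "c \<in> atlas M" "y \<in> rng c"
 shows "dgrad c f (coord_inv c y) $ j = partial_in c j (local_expr c f) y"
 using assms by (simp add: dgrad_def dif_def partial_in_def rng_def[symmetric])

lemma Wf_component:
 assumes "c \<in> atlas M" "y \<in> rng c"
 shows "Wf c f y $ i = sqrt (det (gloc c y)) *
  (SUM j:UNIV. matrix_inv (gloc c y) $ i $ j * partial_in c j (local_expr c f) y)"
 using dgrad_partial[OF assms] by (simp add: Wf_def matrix_vector_mult_def)

lemma partial_C1:
 assumes c: "c \<in> atlas M" and P: "open P" "P <= rng c"
  and f: "Ck_on_open (Suc n) (local_expr c f) P"
 shows "Ck_on_open n (%y. partial_in c j (local_expr c f) y) P"
proof -
 have "Ck_on_open n (%y. pdv j (local_expr c f) y) P"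
  using f by simp
 then show ?thesis
  by (subst Ck_on_open_cong[OF P(1), where g = "%y. pdv j (local_expr c f) y"])
    (simp_all add: partial_in_def rng_def[symmetric] at_within_rng[OF P])
qed

lemma gloc_entry_C1:
 assumes c: "c \<in> atlas M" and P: "open P" "P <= rng c"
 shows "Ck_on_open 1 (%y. gloc c y $ i $ j) P"
proof -
 have "Ck_on_open 1 (gloc c) P" by (rule Ck_on_openD[OF Ck_on_subset[OF gloc_C1[OF c] P(2)] P(1)])
 then have "Ck_on_open 1 (%y. gloc c y $ i) P" using Ck_on_open_vec_iff[OF P(1)] by blast
 then show ?thesis using Ck_on_open_vec_iff[OF P(1), of 1 "%y. gloc c y $ i"] by blast
qed

lemma gloc_det_pos: "c \<in> atlas M ==> y \<in> rng c ==> det (gloc c y) > 0"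
 by (rule posdef_det_pos[OF gloc_posdef])

lemma sqrt_det_C1:
 assumes c: "c \<in> atlas M" and P: "open P" "P <= rng c"
 shows "Ck_on_open 1 (%y. sqrt (det (gloc c y))) P"
 by (intro Ck_on_open_sqrt Ck_on_open_det P(1) gloc_entry_C1[OF assms])
   (use P gloc_det_pos[OF c] in auto)

lemma ginv_C1:
 assumes c: "c \<in> atlas M" and P: "open P" "P <= rng c"
 shows "Ck_on_open 1 (%y. matrix_inv (gloc c y) $ i $ j) P"
 by (intro Ck_on_open_matrix_inv P(1) gloc_entry_C1[OF assms])
   (insert P gloc_det_pos[OF c], force)

lemma Wf_C1:
 assumes c: "c \<in> atlas M" and P: "open P" "P <= rng c"
  and f: "Ck_on_open 2 (local_expr c f) P"
 shows "Ck_on_open 1 (%y. Wf c f y $ i) P"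
proof -
 have "Ck_on_open 1 (%y. partial_in c j (local_expr c f) y) P" for j
  by (rule partial_C1[OF c P]) (use f in \<open>simp only: One_nat_def numeral_2_eq_2\<close>)
 then have "Ck_on_open 1 (%y. sqrt (det (gloc c y)) *
  (SUM j:UNIV. matrix_inv (gloc c y) $ i $ j * partial_in c j (local_expr c f) y)) P"
  by (intro Ck_on_open_mult Ck_on_open_sum P(1) sqrt_det_C1[OF c P] ginv_C1[OF c P])
 then show ?thesis
  by (subst Ck_on_open_cong[OF P(1)]) (use Wf_component[OF c] P(2) in auto)
qed

lemma laplacian_in_eq:
 assumes c: "c \<in> atlas M" and P: "open P" "P <= rng c" and y: "y \<in> P"
 shows "laplacian_in M c f (coord_inv c y)
  = 1 / sqrt (det (gloc c y)) * (SUM i:UNIV. pdv i (%y. Wf c f y $ i) y)"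
proof -
 have yr: "y \<in> rng c" using P y by auto
 have "partial_in c i (%y. sqrt (det (metric M c (coord_inv c y))) *
    (SUM j:UNIV. matrix_inv (metric M c (coord_inv c y)) $ i $ j * partial_in c j (local_expr c f) y)) y
   = pdv i (%y. Wf c f y $ i) y" for i
 proof -
  let ?F = "%y. sqrt (det (metric M c (coord_inv c y))) *
    (SUM j:UNIV. matrix_inv (metric M c (coord_inv c y)) $ i $ j * partial_in c j (local_expr c f) y)"
  have e: "?F z = Wf c f z $ i" if "z \<in> P" for z
   using Wf_component[OF c, of z f i] that P(2) unfolding gloc_def by auto
  have "(?F has_derivative D) (at y) \<longleftrightarrow> ((%y. Wf c f y $ i) has_derivative D) (at y)" for D
   using has_derivative_transform_within_open[OF _ P(1) y, of ?F D _ "%y. Wf c f y $ i"]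
    has_derivative_transform_within_open[OF _ P(1) y, of "%y. Wf c f y $ i" D _ ?F] e by auto
  then have "frechet_derivative ?F (at y) = frechet_derivative (%y. Wf c f y $ i) (at y)"
   unfolding frechet_derivative_def by simp
  then show ?thesis
   unfolding partial_in_def rng_def[symmetric] at_within_rng[OF P y] by simp
 qed
 then show ?thesis
  unfolding laplacian_in_def Let_def using yr c by (simp add: gloc_def)
qed

lemma laplacian_in_continuous:
 assumes c: "c \<in> atlas M" and P: "open P" "P <= rng c"
  and f: "Ck_on_open 2 (local_expr c f) P"
 shows "continuous_on P (%y. laplacian_in M c f (coord_inv c y))"
proof -
 have "continuous_on P (%y. pdv i (%y. Wf c f y $ i) y)" for i
  using Wf_C1[OF c P f, of i] by simp
 moreover have "continuous_on P (%y. sqrt (det (gloc c y)))"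
  using Ck_on_open_continuous[OF sqrt_det_C1[OF c P]] .
 moreover have "continuous_on P (%y. det (gloc c y))"
  by (rule Ck_on_open_continuous[OF Ck_on_open_det[OF P(1) gloc_entry_C1[OF c P]]])
 moreover have "sqrt (det (gloc c y)) ~= 0" if "y \<in> P" for y
  using gloc_det_pos[OF c, of y] that P(2) by auto
 ultimately have "continuous_on P (%y. 1 / sqrt (det (gloc c y)) * (SUM i:UNIV. pdv i (%y. Wf c f y $ i) y))"
  by (intro continuous_intros) auto
 then show ?thesis
  by (rule continuous_on_eq) (simp add: laplacian_in_eq[OF c P])
qed

lemma Jac_det:
 assumes c: "c \<in> atlas M" "c' \<in> atlas M" "x \<in> cdom c" "x \<in> cdom c'"
 shows "det (metric M c x) = (det (matrix (Jac c c' x)))^2 * det (metric M c' x)"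
  and "det (matrix (Jac c c' x)) ~= 0"
proof -
 define A where "A = matrix (Jac c c' x)"
 let ?J = A
 have J: "Jac c c' x v = ?J *v v" for v
  using matrix_vector_mul(2)[OF Jac_linear[OF c]] unfolding A_def by (rule fun_cong[OF sym])
 have "v \<bullet> (metric M c x *v w) = v \<bullet> ((transpose ?J ** metric M c' x ** ?J) *v w)" for v w
  unfolding metric_law[OF c] J
  using dot_lmul_matrix[of v "transpose ?J" "metric M c' x *v (?J *v w)"]
  by (simp add: matrix_vector_mul_assoc matrix_mul_assoc del: transpose_matrix_vector)
 then have "metric M c x *v w = (transpose ?J ** metric M c' x ** ?J) *v w" for w
  using vector_eq_ldot by blast
 then have "metric M c x = transpose ?J ** metric M c' x ** ?J" by (simp add: matrix_eq)
 then show "det (metric M c x) = (det (matrix (Jac c c' x)))^2 * det (metric M c' x)"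
  unfolding A_def[symmetric] by (simp add: det_mul power2_eq_square)
 show "det (matrix (Jac c c' x)) ~= 0"
  using det_nz_iff_inj[OF Jac_linear[OF c]] Jac_inj[OF c] by simp
qed

lemma interior_part_open:
 assumes c: "c \<in> atlas M" and N: "openin (top_of_set X) N"
 shows "open {y \<in> rng c. coord_inv c y \<in> N & y $ kk > 0}"
proof -
 obtain W where W: "open W" "coord c ` (cdom c Int N) = HS Int W"
  using open_in_chart[OF c N] by (auto simp: openin_open)
 have "{y \<in> rng c. coord_inv c y \<in> N & y $ kk > 0} = (HS Int W) Int {y. y $ kk > 0}"
  unfolding W(2)[symmetric] using c by (auto simp: rng_def)
 also have "... = W Int {y. y $ kk > 0}" by (auto simp: half_space_def)
 finally have e: "{y \<in> rng c. coord_inv c y \<in> N & y $ kk > 0} = W Int {y. y $ kk > 0}" .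
 show ?thesis unfolding e by (intro open_Int W(1) open_Collect_less continuous_intros)
qed

lemma local_expr_C2_interior:
 assumes c: "c \<in> atlas M" and N: "openin (top_of_set X) N" and f: "Ck_fun_on M n f N"
 shows "Ck_on_open n (local_expr c f) {y \<in> rng c. coord_inv c y \<in> N & y $ kk > 0}"
proof (rule Ck_on_openD[OF _ interior_part_open[OF c N]])
 have "Ck_on n (local_expr c f) (coord c ` (N Int cdom c))"
  using f c unfolding Ck_fun_on_def by blast
 then show "Ck_on n (local_expr c f) {y \<in> rng c. coord_inv c y \<in> N & y $ kk > 0}"
  by (rule Ck_on_subset) (insert c, force simp: rng_def)
qed

text \<open>Densitized gradients in two charts are related by the Piola transform of the transition, hence so are
 their divergences.\<close>

lemma laplacian_in_change:
 assumes c: "c \<in> atlas M" "c' \<in> atlas M" "x \<in> cdom c" "x \<in> cdom c'"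
  and N: "openin (top_of_set X) N" "x \<in> N" and f: "Ck_fun_on M 2 f N"
  and pos: "coord c x $ kk > 0"
 shows "laplacian_in M c f x = laplacian_in M c' f x"
proof -
 define P where "P = {y \<in> rng c. coord_inv c y \<in> N Int cdom c' & y $ kk > 0}"
 define P' where "P' = {y \<in> rng c'. coord_inv c' y \<in> N & y $ kk > 0}"
 let ?y = "coord c x" and ?tau = "transition c c'"
 have oP: "open P" unfolding P_def
  by (intro interior_part_open c openin_Int N(1) atlasD(1))
 have oP': "open P'" unfolding P'_def by (rule interior_part_open[OF c(2) N(1)])
 have sub: "P <= rng c" "P' <= rng c'" by (auto simp: P_def P'_def)
 have Pov: "P <= ov c c'" unfolding P_def using ov_iff[OF c(1)] by blast
 have yP: "?y \<in> P" using c N pos by (simp add: P_def)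
 have tauy: "?tau ?y = coord c' x" by (rule transition_simps[OF c(1,3)])
 have y'P: "?tau ?y \<in> P'" unfolding tauy
  using c N positive_coordinate_invariant[OF c pos] by (simp add: P'_def)
 have "Ck_on_open 2 (local_expr c f) {y \<in> rng c. coord_inv c y \<in> N & y $ kk > 0}"
  by (rule local_expr_C2_interior[OF c(1) N(1) f])
 then have fP: "Ck_on_open 2 (local_expr c f) P"
  by (rule Ck_on_open_subset) (auto simp: P_def)
 have fP': "Ck_on_open 2 (local_expr c' f) P'"
  unfolding P'_def by (rule local_expr_C2_interior[OF c(2) N(1) f])
 have tau2: "Ck_on_open 2 ?tau P"
  by (rule Ck_on_openD[OF Ck_on_subset[OF transition_C2[OF c(1,2)] Pov] oP])
 have J: "frechet_derivative ?tau (at y) = Jac c c' (coord_inv c y)" if "y \<in> P" for y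
  using that c(1) by (simp add: Jac_def at_within_rng[OF oP Pov] P_def)
 let ?W' = "%v. \<chi> i. frechet_derivative (%y. Wf c f y $ i) (at ?y) v"
 let ?Z' = "%v. \<chi> i. frechet_derivative (%y. Wf c' f y $ i) (at (?tau ?y)) v"
 have vec: "(F has_derivative (%v. \<chi> i. D i v)) (at y)"
  if "!!i. ((%y. F y $ i) has_derivative D i) (at y)" for F :: "real^'n => real^'n" and D and y :: "real ^ 'n"
  unfolding has_derivative_componentwise_within[of F]
  using that by (auto simp: Basis_vec_def inner_axis)
 have W: "(Wf c f has_derivative ?W') (at ?y)"
 proof (rule vec)
  show "((%y. Wf c f y $ i) has_derivative frechet_derivative (%y. Wf c f y $ i) (at ?y)) (at ?y)" for i
   by (rule Ck_on_open_SucD[OF Wf_C1[OF c(1) oP sub(1) fP, unfolded One_nat_def] yP])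
 qed
 have Z: "(Wf c' f has_derivative ?Z') (at (?tau ?y))"
 proof (rule vec)
  show "((%y. Wf c' f y $ i) has_derivative frechet_derivative (%y. Wf c' f y $ i) (at (?tau ?y))) (at (?tau ?y))" for i
   by (rule Ck_on_open_SucD[OF Wf_C1[OF c(2) oP' sub(2) fP', unfolded One_nat_def] y'P])
 qed
 have dJ: "det (gloc c y) = (det (matrix (frechet_derivative ?tau (at y))))^2 * det (gloc c' (?tau y))"
  "det (matrix (frechet_derivative ?tau (at y))) ~= 0" if y: "y \<in> P" for y
 proof -
  have m: "coord_inv c y \<in> cdom c" "coord_inv c y \<in> cdom c'" using y c(1) by (auto simp: P_def)
  show "det (gloc c y) = (det (matrix (frechet_derivative ?tau (at y))))^2 * det (gloc c' (?tau y))"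
   "det (matrix (frechet_derivative ?tau (at y))) ~= 0"
   using Jac_det[OF c(1,2) m] J[OF y] coord_inv_transition[OF c(1,2), of y] Pov y
   by (auto simp: gloc_def)
 qed
 have rel: "matrix (frechet_derivative ?tau (at y)) *v Wf c f y
   = \<bar>det (matrix (frechet_derivative ?tau (at y)))\<bar> *R Wf c' f (?tau y)" if y: "y \<in> P" for y
 proof -
  let ?x = "coord_inv c y"
  have m: "?x \<in> cdom c" "?x \<in> cdom c'" using y c(1) by (auto simp: P_def)
  have x': "coord_inv c' (?tau y) = ?x" using coord_inv_transition[OF c(1,2), of y] Pov y by auto
  have yc: "coord c ?x = y" using y c(1) by (simp add: P_def)
  have y': "coord c' ?x \<in> P'"
   using y m c(2) positive_coordinate_invariant[OF c(1,2) m] yc by (simp add: P_def P'_def)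
  have "diff_at c' f ?x"
   unfolding diff_at_def
  proof -
   have "Ck_on_open (Suc 0) (local_expr c' f) P'" using Ck_on_open_mono[OF fP', of "Suc 0"] by simp
   from Ck_on_open_SucD[OF this y'] have "(local_expr c' f has_derivative frechet_derivative (local_expr c' f) (at (coord c' ?x))) (at (coord c' ?x) within rng c')"
    by (rule has_derivative_at_withinI)
   from diff_atI(1)[OF c(2) m(2) this] show "(local_expr c' f has_derivative dif c' f ?x) (at (coord c' ?x) within rng c')"
    unfolding diff_at_def .
  qed
  then have "dgrad c f ?x \<bullet> v = dgrad c' f ?x \<bullet> Jac c c' ?x v" for v
   using dif_change(2)[OF c(1,2) m, of f v] linear_dgrad[OF dif_change(1)[OF c(1,2) m], of f v]
    linear_dgrad by simp
  from Jac_gradient[OF c(1,2) m this]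
  have g: "Jac c c' ?x (matrix_inv (gloc c y) *v dgrad c f ?x) = matrix_inv (gloc c' (?tau y)) *v dgrad c' f ?x"
   by (simp add: gloc_def x')
  have lin: "linear (Jac c c' ?x)" by (rule Jac_linear[OF c(1,2) m])
  have Jm: "matrix (Jac c c' ?x) *v v = Jac c c' ?x v" for v
   using matrix_vector_mul(2)[OF lin] by (metis (no_types))
  have "sqrt (det (gloc c y)) = \<bar>det (matrix (Jac c c' ?x))\<bar> * sqrt (det (gloc c' (?tau y)))"
   using dJ(1)[OF y] J[OF y] by (simp add: real_sqrt_mult)
  then show ?thesis
   unfolding J[OF y] Jm Wf_def linear_scale[OF lin] g x' by simp
 qed
 have "(SUM i:UNIV. ?W' (axis i 1) $ i) = \<bar>det (matrix (frechet_derivative ?tau (at ?y)))\<bar> * (SUM i:UNIV. ?Z' (axis i 1) $ i)"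
  by (rule Piola_divergence[OF oP tau2 yP dJ(2)[OF yP] W Z rel])
 moreover have "sqrt (det (gloc c ?y)) = \<bar>det (matrix (frechet_derivative ?tau (at ?y)))\<bar> * sqrt (det (gloc c' (?tau ?y)))"
  using dJ(1)[OF yP] by (simp add: real_sqrt_mult)
 moreover have "coord_inv c ?y = x" "coord_inv c' (?tau ?y) = x" using c tauy by simp_all
 ultimately show ?thesis
  using laplacian_in_eq[OF c(1) oP sub(1) yP, of f] laplacian_in_eq[OF c(2) oP' sub(2) y'P, of f] dJ(2)[OF yP]
  by (simp add: field_simps)
qed

text \<open>The atlas is maximal, so a chart may be composed with a diffeomorphism of class C^2.\<close>

lemma new_chart:
 assumes c: "c \<in> atlas M" and U: "openin (top_of_set X) U" "U <= cdom c"
  and V: "openin (top_of_set HS) V" and hom: "homeomorphism (coord c ` U) V \<psi> \<theta>"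
  and \<psi>: "Ck_on 2 \<psi> (coord c ` U)" and \<theta>: "Ck_on 2 \<theta> V"
 shows "(U, %x. \<psi> (coord c x)) \<in> atlas M"
proof -
 define d where "d = (U, %x. \<psi> (coord c x))"
 have im: "(%x. \<psi> (coord c x)) ` U = V"
  using homeomorphism_image1[OF hom] by (simp add: image_image)
 have hU: "homeomorphism U (coord c ` U) (coord c) (coord_inv c)"
  by (rule homeomorphism_of_subsets[OF atlasD(3)[OF c] U(2) subset_refl refl])
 have "homeomorphism U V (\<psi> o coord c) (coord_inv c o \<theta>)"
  by (rule homeomorphism_compose[OF hU hom])
 then have h1: "homeomorphism U V (coord d) (%z. coord_inv c (\<theta> z))" by (simp add: d_def o_def)
 have inj: "inj_on (coord d) U"
  by (rule inj_on_inverseI[of _ "%z. coord_inv c (\<theta> z)"]) (rule homeomorphism_apply1[OF h1])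
 have cinv: "coord_inv d z = coord_inv c (\<theta> z)" if "z \<in> V" for z
 proof -
  have "coord_inv c (\<theta> z) \<in> U" "coord d (coord_inv c (\<theta> z)) = z"
   using homeomorphism_image2[OF h1] homeomorphism_apply2[OF h1] that by blast+
  then show ?thesis
   using inv_into_f_f[OF inj, of "coord_inv c (\<theta> z)"]
   by (simp add: d_def coord_inv_def[of "(U, %x. \<psi> (coord c x))"])
 qed
 have "homeomorphism U V (coord d) (coord_inv d)"
  by (rule homeomorphism_cong[OF h1]) (use cinv in auto)
 then have "is_chart X kk d"
  using U V im by (simp add: is_chart_def d_def)
 moreover have "C2_compatible d c'" if c': "c' \<in> atlas M" for c'
 proof -
  have \<theta>V: "\<theta> z \<in> coord c ` U" if "z \<in> V" for z using homeomorphism_image2[OF hom] that by blast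
  have VU: "\<psi> (coord c x) \<in> V" if "x \<in> U" for x using im that by blast
  have \<theta>\<psi>: "\<theta> (\<psi> (coord c x)) = coord c x" if "x \<in> U" for x using homeomorphism_apply1[OF hom] that by blast
  let ?S = "coord d ` (U Int cdom c')"
  have SV: "?S <= V" using VU by (auto simp: d_def)
  have "Ck_on 2 (%z. transition c c' (\<theta> z)) ?S"
  proof (rule Ck_on_compose[OF Ck_on_subset[OF \<theta> SV] transition_C2[OF c c']])
   show "\<theta> ` ?S <= ov c c'" using \<theta>\<psi> U(2) by (auto simp: d_def ov_def)
  qed
  then have 1: "Ck_on 2 (transition d c') ?S"
   by (rule Ck_on_cong) (insert SV cinv, auto simp: transition_def)
  let ?T = "coord c' ` (U Int cdom c')"
  have "Ck_on 2 (%z. \<psi> (transition c' c z)) ?T"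
  proof (rule Ck_on_compose[OF _ \<psi>])
   show "Ck_on 2 (transition c' c) ?T"
    by (rule Ck_on_subset[OF transition_C2[OF c' c]]) (insert U(2), auto simp: ov_def)
   show "transition c' c ` ?T <= coord c ` U" using c' by (auto simp: transition_def)
  qed
  then have 2: "Ck_on 2 (transition c' d) ?T"
   by (rule Ck_on_cong) (auto simp: transition_def d_def)
  show ?thesis using 1 2 unfolding C2_compatible_def by (simp add: d_def)
 qed
 ultimately show ?thesis using atlas_maximal unfolding d_def by blast
qed

end

section \<open>Length of paths\<close>

context riem_manifold begin

definition gnorm :: "('p, 'n) chart => 'p => real ^ 'n => real" where
 "gnorm c x v = sqrt (v \<bullet> (metric M c x *v v))"

text \<open>The path \<open>gam\<close> is continuously differentiable near the time \<open>t\<close>, with velocity \<open>D\<close> in the chart \<open>c\<close>.\<close>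

definition reg :: "(real => 'p) => real => ('p, 'n) chart => real => (real => real ^ 'n) => bool" where
 "reg gam t c e D \<longleftrightarrow> c \<in> atlas M & e > 0 & continuous_on (ball t e) D &
   (ALL s:ball t e. gam s \<in> cdom c & ((coord c o gam) has_vector_derivative D s) (at s))"

lemma reg_coord_continuous:
 assumes "reg gam t c e D" shows "continuous_on (ball t e) (coord c o gam)"
proof (intro continuous_at_imp_continuous_on ballI)
 fix s assume "s \<in> ball t e"
 then have "((coord c o gam) has_vector_derivative D s) (at s)" using assms by (simp add: reg_def)
 then show "isCont (coord c o gam) s" by (rule has_vector_derivative_continuous)
qed

lemma reg_path_continuous:
 assumes r: "reg gam t c e D" shows "continuous_on (ball t e) gam"
proof -
 have c: "c \<in> atlas M" using r by (simp add: reg_def)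
 have "continuous_on (ball t e) (%s. coord_inv c ((coord c o gam) s))"
  using r by (intro continuous_on_compose2[OF homeomorphism_cont2[OF atlasD(3)[OF c]] reg_coord_continuous[OF r]])
   (auto simp: reg_def)
 then show ?thesis
  by (rule continuous_on_eq) (insert r, auto simp: reg_def)
qed

lemma velocity_change:
 assumes c: "c \<in> atlas M" "c' \<in> atlas M" and e: "e > 0"
  and cont: "continuous_on (ball t e) gam" and X: "gam ` ball t e <= X"
  and in_c: "gam t \<in> cdom c" "gam t \<in> cdom c'"
  and v: "((coord c o gam) has_vector_derivative v) (at t)"
 shows "((coord c' o gam) has_vector_derivative Jac c c' (gam t) v) (at t)"
proof -
 have "openin (top_of_set X) (cdom c Int cdom c')" by (intro openin_Int atlasD(1) c)
 then obtain T where T: "open T" "cdom c Int cdom c' = X Int T" by (auto simp: openin_open)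
 define N where "N = ball t e Int gam -` T"
 have N: "open N" using continuous_open_preimage[OF cont open_ball T(1)] by (simp add: N_def)
 have tN: "t \<in> N" using T(2) in_c e by (auto simp: N_def)
 have inN: "gam s \<in> cdom c Int cdom c'" if "s \<in> N" for s
  unfolding T(2) using that X by (auto simp: N_def)
 have "((coord c o gam) has_derivative (%h. h *R v)) (at t within N)"
  using v has_derivative_at_withinI unfolding has_vector_derivative_def by blast
 moreover have "(transition c c' has_derivative Jac c c' (gam t)) (at ((coord c o gam) t) within (coord c o gam) ` N)"
  using Jac_derivative[OF c in_c] unfolding o_apply
  by (rule has_derivative_subset) (insert inN, auto simp: ov_def)
 ultimately have "(transition c c' o (coord c o gam) has_derivative Jac c c' (gam t) o (%h. h *R v)) (at t within N)"
  by (rule diff_chain_within)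
 then have "(transition c c' o (coord c o gam) has_derivative (%h. h *R Jac c c' (gam t) v)) (at t)"
  using linear_scale[OF Jac_linear[OF c in_c]] at_within_open[OF tN N] by (simp add: o_def)
 then have "((coord c' o gam) has_derivative (%h. h *R Jac c c' (gam t) v)) (at t)"
  by (rule has_derivative_transform_within_open[OF _ N tN]) (use inN transition_simps[OF c(1)] in auto)
 then show ?thesis by (simp add: has_vector_derivative_def)
qed

lemma gnorm_change:
 assumes "c \<in> atlas M" "c' \<in> atlas M" "x \<in> cdom c" "x \<in> cdom c'"
 shows "gnorm c' x (Jac c c' x v) = gnorm c x v"
 unfolding gnorm_def metric_law[OF assms] ..

text \<open>The speed is defined by a chart that varies with the time in an uncontrolled way; the metric norm of a
 velocity does not depend on the chart.\<close>

lemma reg_speed: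
 assumes r: "reg gam t c e D" and s: "s \<in> ball t e"
 shows "speed M gam s = gnorm c (gam s) (D s)"
proof -
 let ?c = "chart_at M (gam s)"
 have c: "c \<in> atlas M" and sc: "gam s \<in> cdom c" and d: "((coord c o gam) has_vector_derivative D s) (at s)"
  using r s by (auto simp: reg_def)
 have X: "gam ` ball t e <= X" using r atlasD(4)[OF c] by (auto simp: reg_def)
 have c': "?c \<in> atlas M" "gam s \<in> cdom ?c"
  using chart_at_atlas[of "gam s"] X s by blast+
 obtain e' where e': "e' > 0" "ball s e' <= ball t e" using openE[OF open_ball s] by blast
 have "((coord ?c o gam) has_vector_derivative Jac c ?c (gam s) (D s)) (at s)"
  by (rule velocity_change[OF c c'(1) e'(1) _ _ sc c'(2) d])
    (use e' X continuous_on_subset[OF reg_path_continuous[OF r]] in auto)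
 then have "vector_derivative (coord ?c o gam) (at s) = Jac c ?c (gam s) (D s)" by (rule vector_derivative_at)
 then show ?thesis
  unfolding speed_def Let_def using gnorm_change[OF c c'(1) sc c'(2)] by (simp add: gnorm_def)
qed

lemma gnorm_continuous:
 assumes c: "c \<in> atlas M" and "continuous_on S \<eta>" "continuous_on S v" "\<eta> ` S <= rng c"
 shows "continuous_on S (%s. gnorm c (coord_inv c (\<eta> s)) (v s))"
proof -
 have G: "continuous_on S (%s. gloc c (\<eta> s))"
  using continuous_on_compose2[OF gloc_continuous[OF c] assms(2,4)] .
 have "continuous_on S (%s. v s \<bullet> (\<chi> i. SUM j:UNIV. gloc c (\<eta> s) $ i $ j * v s $ j))"
  by (intro continuous_intros assms(3) G)
 then show ?thesis
  unfolding gnorm_def gloc_def[symmetric] matrix_vector_mult_def by (rule continuous_on_real_sqrt)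
qed

lemma reg_speed_isCont:
 assumes r: "reg gam t c e D" shows "isCont (speed M gam) t"
proof -
 have c: "c \<in> atlas M" and e: "e > 0" using r by (auto simp: reg_def)
 have "continuous_on (ball t e) (%s. gnorm c (coord_inv c ((coord c o gam) s)) (D s))"
  by (rule gnorm_continuous[OF c reg_coord_continuous[OF r]]) (insert r, auto simp: reg_def)
 then have "continuous_on (ball t e) (speed M gam)"
  by (rule continuous_on_eq) (insert reg_speed[OF r] r c, auto simp: reg_def)
 then show ?thesis using e continuous_on_eq_continuous_at by (metis centre_in_ball open_ball)
qed

lemma reg_affine:
 assumes m: "m > 0" and r: "reg gam (m * t + q) c e D"
  and eq: "!!s. s \<in> ball t d ==> gam2 s = gam (m * s + q)" and d: "d > 0"
 shows "reg gam2 t c (min d (e / m)) (%s. m *R D (m * s + q))"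
  and "speed M gam2 t = m * speed M gam (m * t + q)"
proof -
 let ?e = "min d (e / m)"
 have e: "e > 0" and c: "c \<in> atlas M" using r by (auto simp: reg_def)
 have im: "m * s + q \<in> ball (m * t + q) e" if "s \<in> ball t ?e" for s
 proof -
  have "\<bar>m * t + q - (m * s + q)\<bar> = m * \<bar>t - s\<bar>" using m by (simp add: abs_mult right_diff_distrib[symmetric])
  also have "... < e" using that m by (simp add: dist_real_def pos_less_divide_eq mult.commute)
  finally show ?thesis by (simp add: dist_real_def)
 qed
 show 1: "reg gam2 t c ?e (%s. m *R D (m * s + q))"
  unfolding reg_def
 proof (intro conjI ballI)
  have D: "continuous_on (ball (m * t + q) e) D" using r by (simp add: reg_def)
  have "continuous_on (ball t ?e) (%s. m * s + q)" by (intro continuous_intros)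
  then have "continuous_on (ball t ?e) (%s. D (m * s + q))"
   by (rule continuous_on_compose2[OF D]) (use im in blast)
  then show "continuous_on (ball t ?e) (%s. m *R D (m * s + q))"
   by (intro continuous_intros)
  fix s assume s: "s \<in> ball t ?e"
  then have s': "s \<in> ball t d" by auto
  show "gam2 s \<in> cdom c" using eq[OF s'] im[OF s] r by (simp add: reg_def)
  have "((coord c o gam) has_vector_derivative D (m * s + q)) (at (m * s + q))"
   using r im[OF s] by (simp add: reg_def)
  moreover have "((%s. m * s + q) has_real_derivative m) (at s)" by (auto intro!: derivative_eq_intros)
  ultimately have "((coord c o gam) o (%s. m * s + q) has_vector_derivative m *R D (m * s + q)) (at s)"
   by (intro vector_diff_chain_at) (simp_all add: has_real_derivative_iff_has_vector_derivative)
  then show "((coord c o gam2) has_vector_derivative m *R D (m * s + q)) (at s)"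
   by (rule has_vector_derivative_transform_within_open[OF _ open_ball s']) (use eq in auto)
 qed (use c e d m in auto)
 have "speed M gam2 t = gnorm c (gam2 t) (m *R D (m * t + q))" by (rule reg_speed[OF 1]) (use e d m in auto)
 also have "gam2 t = gam (m * t + q)" using eq d by auto
 also have "gnorm c (gam (m * t + q)) (m *R D (m * t + q)) = m * gnorm c (gam (m * t + q)) (D (m * t + q))"
  using m by (simp add: gnorm_def matrix_vector_mult_scaleR real_sqrt_mult mult.assoc[symmetric])
 also have "gnorm c (gam (m * t + q)) (D (m * t + q)) = speed M gam (m * t + q)"
  by (rule reg_speed[OF r, symmetric]) (use e in auto)
 finally show "speed M gam2 t = m * speed M gam (m * t + q)" .
qed

lemma path_near:
 assumes p: "path gam" "path_image gam <= X" and t: "t \<in> {0..1}" and c: "c \<in> atlas M" "gam t \<in> cdom c"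
 obtains d where "d > 0" "!!s. s \<in> {0..1} ==> \<bar>s - t\<bar> < d ==> gam s \<in> cdom c"
proof -
 obtain T where T: "open T" "cdom c = X Int T" using atlasD(1)[OF c(1)] by (auto simp: openin_open)
 have "continuous_on {0..1} gam" using p by (simp add: path_def)
 then obtain A where A: "open A" "A Int {0..1} = gam -` T Int {0..1}"
  using continuous_on_open_invariant[of "{0..1}" gam] T(1) by metis
 have "t \<in> A" using A(2) t c(2) T(2) by auto
 then obtain d where d: "d > 0" "ball t d <= A" using A(1) open_contains_ball by blast
 show thesis
 proof (rule that[OF d(1)])
  fix s assume s: "s \<in> {0..1}" "\<bar>s - t\<bar> < d"
  then have "s \<in> A" using d by (auto simp: dist_real_def abs_minus_commute)
  then have "gam s \<in> T" using A(2) s(1) by auto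
  moreover have "gam s \<in> X" using p(2) s(1) by (auto simp: path_image_def)
  ultimately show "gam s \<in> cdom c" using T(2) by auto
 qed
qed

text \<open>By compactness finitely many charts cover the path, each with finitely many exceptional times.\<close>

lemma reg_cofinite:
 assumes gam: "piecewise_C1_path M gam"
 obtains E where "finite E" "ALL t:{0<..<1} - E. EX c e D. reg gam t c e D"
proof -
 have p: "path gam" "path_image gam <= X" using gam by (auto simp: piecewise_C1_path_def)
 define P where "P a b \<longleftrightarrow> (EX E. finite E & (ALL t:{a<..<b} Int {0<..<1} - E. EX c e D. reg gam t c e D))" for a b
 have "P 0 1"
 proof (rule Bolzano)
  fix a b c assume "P a b" "P b c" "a <= b" "b <= c"
  then obtain E1 E2 where E: "finite E1" "finite E2"
   "ALL t:{a<..<b} Int {0<..<1} - E1. EX c e D. reg gam t c e D"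
   "ALL t:{b<..<c} Int {0<..<1} - E2. EX c e D. reg gam t c e D"
   unfolding P_def by blast
  show "P a c" unfolding P_def
  proof (intro exI[of _ "E1 Un E2 Un {b}"] conjI ballI)
   fix t assume t: "t \<in> {a<..<c} Int {0<..<1} - (E1 Un E2 Un {b})"
   then consider "t < b" | "t > b" by fastforce
   then show "EX c e D. reg gam t c e D" using t E by cases auto
  qed (use E in auto)
 next
  fix x :: real assume x: "0 <= x" "x <= 1"
  then have "gam x \<in> X" using p(2) by (auto simp: path_image_def)
  then obtain c where c: "c \<in> atlas M" "gam x \<in> cdom c" using atlas_cover by blast
  obtain d where d: "d > 0" "!!s. s \<in> {0..1} ==> \<bar>s - x\<bar> < d ==> gam s \<in> cdom c"
   using path_near[OF p _ c] x by auto
  show "EX d>0. ALL a b. a <= x & x <= b & b - a < d --> P a b"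
  proof (intro exI[of _ d] conjI allI impI d(1))
   fix a b assume ab: "a <= x & x <= b & b - a < d"
   define a' where "a' = max a 0"
   define b' where "b' = min b 1"
   have "{a'..b'} <= {0..1}" "gam ` {a'..b'} <= cdom c"
    using ab x by (auto simp: a'_def b'_def intro!: d(2))
   then have "(coord c o gam) piecewise_C1_differentiable_on {a'..b'}"
    using gam c(1) unfolding piecewise_C1_path_def by blast
   then obtain S where S: "finite S" "(coord c o gam) C1_differentiable_on ({a'..b'} - S)"
    unfolding piecewise_C1_differentiable_on_def by blast
   then obtain D where D: "!!s. s \<in> {a'..b'} - S ==> ((coord c o gam) has_vector_derivative D s) (at s)"
    "continuous_on ({a'..b'} - S) D" unfolding C1_differentiable_on_def by blast
   have "EX c e D. reg gam t c e D" if t: "t \<in> {a<..<b} Int {0<..<1} - S" for t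
   proof -
    have "open ({a'<..<b'} - S)" using S(1) by (simp add: finite_imp_closed open_Diff)
    moreover have "t \<in> {a'<..<b'} - S" using t by (auto simp: a'_def b'_def)
    ultimately obtain e where e: "e > 0" "ball t e <= {a'<..<b'} - S"
     using open_contains_ball by blast
    have sub: "s \<in> {a'..b'} - S" if "s \<in> ball t e" for s
     using subsetD[OF e(2) that] by auto
    have "reg gam t c e D"
     unfolding reg_def
    proof (intro conjI ballI c(1) e(1))
     show "continuous_on (ball t e) D" using D(2) by (rule continuous_on_subset) (use sub in blast)
     fix s assume s: "s \<in> ball t e"
     show "((coord c o gam) has_vector_derivative D s) (at s)" by (rule D(1)[OF sub[OF s]])
     show "gam s \<in> cdom c" using \<open>gam ` {a'..b'} <= cdom c\<close> sub[OF s] by auto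
    qed
    then show ?thesis by blast
   qed
   then show "P a b" unfolding P_def using S(1) by blast
  qed
 qed simp
 then show thesis using that unfolding P_def by auto
qed

definition len :: "(real => 'p) => real => real => ennreal" where
 "len gam a b = (\<integral>\<^sup>+t\<in>{a..b}. ennreal (speed M gam t) \<partial>lborel)"

lemma curve_length_len: "curve_length M gam = len gam 0 1"
 by (simp add: curve_length_def len_def)

text \<open>The speed is continuous at regular times.\<close>

lemma speed_measurable:
 assumes E: "finite E" "ALL t:{a<..<b} - E. EX c e D. reg gam t c e D"
 shows "(%t. ennreal (speed M gam t) * indicator ({a<..<b} - E) t) \<in> borel_measurable borel"
  and "len gam a b = (\<integral>\<^sup>+t. ennreal (speed M gam t) * indicator ({a<..<b} - E) t \<partial>lborel)"
  and "(%t. indicator ({a<..<b} - E) t * speed M gam t) \<in> borel_measurable borel"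
proof -
 have o: "open ({a<..<b} - E)" using E(1) by (simp add: finite_imp_closed open_Diff)
 have "continuous_on ({a<..<b} - E) (speed M gam)"
  using E(2) reg_speed_isCont by (intro continuous_at_imp_continuous_on) blast
 then have "(%t. indicator ({a<..<b} - E) t *R speed M gam t) \<in> borel_measurable borel"
  by (intro borel_measurable_continuous_on_indicator) (use o in auto)
 then show m: "(%t. indicator ({a<..<b} - E) t * speed M gam t) \<in> borel_measurable borel" by simp
 then have "(%t. ennreal (indicator ({a<..<b} - E) t * speed M gam t)) \<in> borel_measurable borel" by measurable
 moreover have "ennreal (indicator ({a<..<b} - E) t * speed M gam t) = ennreal (speed M gam t) * indicator ({a<..<b} - E) t" for t
  by (auto simp: indicator_def)
 ultimately show "(%t. ennreal (speed M gam t) * indicator ({a<..<b} - E) t) \<in> borel_measurable borel" by simp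
 have ae: "AE t in lborel. t ~: E Un {a, b}"
  by (rule AE_not_in) (simp add: finite_imp_null_set_lborel E(1))
 show "len gam a b = (\<integral>\<^sup>+t. ennreal (speed M gam t) * indicator ({a<..<b} - E) t \<partial>lborel)"
  unfolding len_def
  by (rule nn_integral_cong_AE, rule eventually_mono[OF ae]) (auto simp: indicator_def)
qed

lemma len_add:
 assumes E: "finite E" "ALL t:{a<..<b} - E. EX c e D. reg gam t c e D" and s: "a <= s" "s <= b"
 shows "len gam a b = len gam a s + len gam s b"
proof -
 have r1: "ALL t:{a<..<s} - E. EX c e D. reg gam t c e D" using E(2) s by auto
 have r2: "ALL t:{s<..<b} - E. EX c e D. reg gam t c e D" using E(2) s by auto
 have ae: "AE t in lborel. t ~= s" by (rule AE_lborel_singleton)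
 have "len gam a b = (\<integral>\<^sup>+t. ennreal (speed M gam t) * indicator ({a<..<s} - E) t
   + ennreal (speed M gam t) * indicator ({s<..<b} - E) t \<partial>lborel)"
  by (subst speed_measurable(2)[OF E], rule nn_integral_cong_AE, rule eventually_mono[OF ae])
   (insert s, auto simp: indicator_def)
 also have "... = len gam a s + len gam s b"
  by (simp add: speed_measurable[OF E(1) r1] speed_measurable[OF E(1) r2] nn_integral_add)
 finally show ?thesis .
qed

lemma len_affine:
 assumes E: "finite E" "ALL t:{m * a + q<..<m * b + q} - E. EX c e D. reg gam t c e D"
  and m: "m > 0" and eq: "!!s. s \<in> {a<..<b} ==> gam2 s = gam (m * s + q)"
 shows "len gam2 a b = len gam (m * a + q) (m * b + q)"
proof -
 define F where "F = (%t. (t - q) / m) ` E"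
 have F: "finite F" using E by (simp add: F_def)
 have F_iff: "s \<in> F \<longleftrightarrow> m * s + q \<in> E" for s
  using m by (auto simp: F_def image_iff field_simps)
 have r0: "EX c e D. reg gam2 s c e D" and sp: "speed M gam2 s = m * speed M gam (m * s + q)"
  if s: "s \<in> {a<..<b} - F" for s
 proof -
  have "m * s + q \<in> {m * a + q<..<m * b + q} - E" using s m F_iff by auto
  then obtain c e D where reg: "reg gam (m * s + q) c e D" using E(2) by blast
  obtain d where d: "d > 0" "ball s d <= {a<..<b}"
   using openE[of "{a<..<b}" s] s by auto
  have eq': "gam2 t = gam (m * t + q)" if "t \<in> ball s d" for t using eq that d by auto
  show "EX c e D. reg gam2 s c e D" "speed M gam2 s = m * speed M gam (m * s + q)"
   using reg_affine[OF m reg eq' d(1)] by blast+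
 qed
 have r: "ALL s:{a<..<b} - F. EX c e D. reg gam2 s c e D" using r0 by blast
 have "len gam (m * a + q) (m * b + q) = ennreal \<bar>m\<bar> * (\<integral>\<^sup>+s. ennreal (speed M gam (q + m * s)) *
   indicator ({m * a + q<..<m * b + q} - E) (q + m * s) \<partial>lborel)"
  unfolding speed_measurable(2)[OF E]
  by (rule nn_integral_real_affine) (use speed_measurable(1)[OF E] m in auto)
 also have "... = (\<integral>\<^sup>+s. ennreal m * (ennreal (speed M gam (q + m * s)) *
   indicator ({m * a + q<..<m * b + q} - E) (q + m * s)) \<partial>lborel)"
 proof -
  have "(%s. ennreal (speed M gam (q + m * s)) * indicator ({m * a + q<..<m * b + q} - E) (q + m * s)) \<in> borel_measurable borel"
   using measurable_compose[OF _ speed_measurable(1)[OF E], of "%s. q + m * s" borel] by simp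
  then show ?thesis using m by (simp add: nn_integral_cmult)
 qed
 also have "... = (\<integral>\<^sup>+s. ennreal (speed M gam2 s) * indicator ({a<..<b} - F) s \<partial>lborel)"
 proof (intro nn_integral_cong)
  fix s
  show "ennreal m * (ennreal (speed M gam (q + m * s)) * indicator ({m * a + q<..<m * b + q} - E) (q + m * s))
    = ennreal (speed M gam2 s) * indicator ({a<..<b} - F) s"
   using sp[of s] m F_iff[of s] by (auto simp: indicator_def add.commute ennreal_mult')
 qed
 also have "... = len gam2 a b" by (rule speed_measurable(2)[OF F r, symmetric])
 finally show ?thesis ..
qed

lemma speed_nonneg: "reg gam t c e D ==> speed M gam t >= 0"
 using reg_speed[of gam t c e D t] posdef_nonneg[OF metric_posdef]
 by (auto simp: reg_def gnorm_def)

text \<open>It is applied to the coordinates of a path and to the distance function along it.\<close>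

lemma len_bound:
 fixes F :: "real => 'v::euclidean_space"
 assumes E: "finite E" "ALL t:{a<..<b} - E. EX c e D. reg gam t c e D" and ab: "a <= b"
  and F: "continuous_on {a..b} F" "!!t. t \<in> {a<..<b} - E ==> (F has_vector_derivative F' t) (at t)"
  and le: "!!t. t \<in> {a<..<b} - E ==> norm (F' t) <= B * speed M gam t" and B: "B > 0"
 shows "ennreal (norm (F b - F a)) <= ennreal B * len gam a b"
proof (cases "len gam a b = \<infinity>")
 case True
 then show ?thesis using B by (simp add: ennreal_mult_top)
next
 case False
 define I where "I = {a<..<b} - E"
 define g where "g t = B * (indicator I t * speed M gam t)" for t
 have sp0: "speed M gam t >= 0" if "t \<in> I" for t using E(2) that speed_nonneg unfolding I_def by blast
 have g0: "g t >= 0" for t using sp0 B by (auto simp: g_def indicator_def)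
 have gm: "g \<in> borel_measurable lborel"
  using speed_measurable(3)[OF E] unfolding g_def[abs_def] I_def by measurable
 have gi: "(\<integral>\<^sup>+t. ennreal (g t) \<partial>lborel) = ennreal B * len gam a b"
 proof -
  have "ennreal (g t) = ennreal B * (ennreal (speed M gam t) * indicator I t)" for t
   using B by (auto simp: g_def indicator_def ennreal_mult')
  then show ?thesis
   using speed_measurable(1)[OF E] speed_measurable(2)[OF E] by (simp add: I_def nn_integral_cmult)
 qed
 then have int: "integrable lborel g"
  using False B g0 gm by (intro integrableI_nonneg) (auto simp: ennreal_mult_less_top top.not_eq_extremum)
 then have gint: "(g has_integral (LINT t|lborel. g t)) UNIV" by (rule has_integral_integral_lborel)
 have gR: "ennreal (LINT t|lborel. g t) = ennreal B * len gam a b"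
  using nn_integral_eq_integral[OF int] g0 gi by simp
 have gr: "(%t. if t \<in> {a..b} then g t else 0) = g"
  by (auto simp: g_def I_def indicator_def fun_eq_iff)
 have gab: "(g has_integral (LINT t|lborel. g t)) {a..b}"
  using gint has_integral_restrict_UNIV[of "{a..b}" g] unfolding gr by blast
 have F': "(F' has_integral (F b - F a)) {a..b}"
  by (rule fundamental_theorem_of_calculus_interior_strong[OF E(1) ab _ F(1)]) (use F(2) in auto)
 define F2 where "F2 t = (if t \<in> I then F' t else 0)" for t
 have "(F2 has_integral (F b - F a)) {a..b}"
  by (rule has_integral_spike_finite[OF _ _ F', of "E Un {a, b}"]) (insert E(1), auto simp: F2_def I_def)
 moreover have "norm (F2 t) <= g t" for t
  using le[of t] by (auto simp: F2_def g_def I_def indicator_def)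
 ultimately have "norm (F b - F a) <= (LINT t|lborel. g t)"
  using integral_norm_bound_integral[of F2 "{a..b}" g] gab by (auto simp: has_integral_iff)
 then show ?thesis unfolding gR[symmetric] by (rule ennreal_leI)
qed

end

section \<open>Paths to the boundary\<close>

lemma piecewise_C1_cong_open:
 assumes f: "f piecewise_C1_differentiable_on S" and U: "open U" "S <= U" and eq: "!!x. x \<in> U ==> f x = g x"
 shows "g piecewise_C1_differentiable_on S"
proof -
 obtain T D where T: "continuous_on S f" "finite T" "!!x. x \<in> S - T ==> (f has_vector_derivative D x) (at x)"
  "continuous_on (S - T) D"
  using f unfolding piecewise_C1_differentiable_on_def C1_differentiable_on_def by blast
 have "(g has_vector_derivative D x) (at x)" if "x \<in> S - T" for x
  by (rule has_vector_derivative_transform_within_open[OF T(3)[OF that] U(1)]) (use that U(2) eq in auto)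
 moreover have "continuous_on S g"
  by (rule continuous_on_eq[OF T(1)]) (use U(2) eq in auto)
 ultimately show ?thesis
  using T(2,4) unfolding piecewise_C1_differentiable_on_def C1_differentiable_on_def by blast
qed

lemma piecewise_C1_empty: "f piecewise_C1_differentiable_on {}"
 by (auto simp: piecewise_C1_differentiable_on_def)

lemma piecewise_C1_affine_interval:
 fixes m :: real
 assumes "m > 0" "f piecewise_C1_differentiable_on {m * a + q..m * b + q}"
 shows "(%x. f (m * x + q)) piecewise_C1_differentiable_on {a..b}"
proof (cases "a <= b")
 case True
 then have "(%x. m * x + q) ` {a..b} = {m * a + q..m * b + q}"
  using assms(1) image_affinity_atLeastAtMost[of m q a b] by auto
 then show ?thesis using piecewise_C1_differentiable_affine[of f m q "{a..b}"] assms(2) by (simp add: o_def)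
qed (simp add: piecewise_C1_empty)

context riem_manifold begin

lemma PC1_D:
 assumes "piecewise_C1_path M gam"
 shows "path gam" "path_image gam <= X"
  "!!c a b. c \<in> atlas M ==> 0 <= a ==> b <= 1 ==> gam ` {a..b} <= cdom c
   ==> (coord c o gam) piecewise_C1_differentiable_on {a..b}"
proof -
 show "path gam" "path_image gam <= X" using assms by (auto simp: piecewise_C1_path_def)
 fix c a b assume "c \<in> atlas M" "0 <= a" "b <= 1" "gam ` {a..b} <= cdom c"
 moreover from this have "{a..b} <= {0..1}" by auto
 ultimately show "(coord c o gam) piecewise_C1_differentiable_on {a..b}"
  using assms unfolding piecewise_C1_path_def by blast
qed

lemma PC1_I:
 assumes "path gam" "path_image gam <= X"
  "!!c a b. c \<in> atlas M ==> 0 <= a ==> a <= b ==> b <= 1 ==> gam ` {a..b} <= cdom c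
   ==> (coord c o gam) piecewise_C1_differentiable_on {a..b}"
 shows "piecewise_C1_path M gam"
 unfolding piecewise_C1_path_def
proof (intro conjI assms(1,2) ballI allI impI)
 fix c and a b :: real assume c: "c \<in> atlas M" and ab: "{a..b} <= {0..1} & gam ` {a..b} <= cdom c"
 show "(coord c o gam) piecewise_C1_differentiable_on {a..b}"
 proof (cases "a <= b")
  case True
  then show ?thesis using ab by (intro assms(3) c) auto
 qed (simp add: piecewise_C1_empty)
qed

lemma PC1_subpath:
 assumes g: "piecewise_C1_path M gam" and s: "0 <= s" "s < 1"
 shows "piecewise_C1_path M (%t. gam ((1 - s) * t + s))"
proof (rule PC1_I)
 let ?a = "%t. (1 - s) * t + s"
 have im: "?a t \<in> {0..1}" if "t \<in> {0..1}" for t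
 proof -
  have "(1 - s) * (1 - t) >= 0" "(1 - s) * t >= 0"
   using that s by (auto intro!: mult_nonneg_nonneg)
  moreover have "(1 - s) * t + s = 1 - (1 - s) * (1 - t)" by (simp add: algebra_simps)
  ultimately show ?thesis unfolding atLeastAtMost_iff using s(1) by linarith
 qed
 have "continuous_on {0..1} gam" using PC1_D(1)[OF g] by (simp add: path_def)
 then show "path (%t. gam (?a t))"
  unfolding path_def by (rule continuous_on_compose2) (insert im, auto intro!: continuous_intros)
 show "path_image (%t. gam (?a t)) <= X"
  using PC1_D(2)[OF g] im by (force simp: path_image_def)
 fix c and a b :: real assume c: "c \<in> atlas M" and ab: "0 <= a" "a <= b" "b <= 1" and U: "(%t. gam (?a t)) ` {a..b} <= cdom c"
 have e: "?a ` {a..b} = {?a a..?a b}"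
  using s ab image_affinity_atLeastAtMost[of "1 - s" s a b] by auto
 have "(coord c o gam) piecewise_C1_differentiable_on {?a a..?a b}"
 proof (rule PC1_D(3)[OF g c])
  show "0 <= ?a a" "?a b <= 1" using im[of a] im[of b] ab by auto
  show "gam ` {?a a..?a b} <= cdom c" unfolding e[symmetric] using U by auto
 qed
 then have "(%x. (coord c o gam) (?a x)) piecewise_C1_differentiable_on {a..b}"
  by (rule piecewise_C1_affine_interval[rotated]) (use s in auto)
 then show "(coord c o (%t. gam (?a t))) piecewise_C1_differentiable_on {a..b}" by (simp add: o_def)
qed

lemma bdist_le_len:
 assumes "piecewise_C1_path M gam" "gam 1 \<in> boundary M"
 shows "bdist M (gam 0) <= len gam 0 1"
 unfolding bdist_def riem_dist_def
 by (rule INF_lower2[OF assms(2)], rule INF_lower2[of gam])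
   (insert assms(1), auto simp: pathstart_def pathfinish_def curve_length_len)

lemma bdist_less_path:
 assumes "bdist M x < r"
 obtains gam where "piecewise_C1_path M gam" "gam 0 = x" "gam 1 \<in> boundary M" "len gam 0 1 < r"
 using assms unfolding bdist_def riem_dist_def INF_less_iff
 by (auto simp: pathstart_def pathfinish_def curve_length_len)

lemma bdist_boundary:
 assumes "x \<in> boundary M" shows "bdist M x = 0"
proof -
 have "piecewise_C1_path M (%_. x)"
 proof (rule PC1_I)
  show "path_image (%_::real. x) <= X" using assms by (auto simp: path_image_def boundary_def)
  show "(coord c o (%_. x)) piecewise_C1_differentiable_on {a..b}" for c and a b :: real
   by (simp add: o_def piecewise_C1_differentiable_const)
 qed (simp add: path_def)
 from bdist_le_len[OF this assms] have "bdist M x <= len (%_. x) 0 1" .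
 also have "speed M (%_. x) t = 0" for t by (simp add: speed_def Let_def o_def)
 then have "len (%_. x) 0 1 = 0" by (simp add: len_def)
 finally show ?thesis by simp
qed

text \<open>The rest of a path to the boundary competes in the distance of the point where it starts.\<close>

lemma bdist_along_path:
 assumes g: "piecewise_C1_path M gam" and e: "gam 1 \<in> boundary M" and s: "0 <= s" "s <= 1"
 shows "bdist M (gam s) + len gam 0 s <= len gam 0 1"
proof (cases "s = 1")
 case True
 then show ?thesis using bdist_boundary[OF e] by simp
next
 case False
 then have s1: "s < 1" using s by simp
 obtain E where E: "finite E" "ALL t:{0<..<1} - E. EX c e D. reg gam t c e D" using reg_cofinite[OF g] by blast
 have "bdist M (gam s) <= len (%t. gam ((1 - s) * t + s)) 0 1"
  using bdist_le_len[OF PC1_subpath[OF g s(1) s1]] e by simp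
 also have "... = len gam ((1 - s) * 0 + s) ((1 - s) * 1 + s)"
  by (rule len_affine[OF E(1)]) (use E(2) s s1 in auto)
 finally show ?thesis using len_add[OF E s] by (simp add: add.commute add_mono)
qed

definition seg :: "('p, 'n) chart => real ^ 'n => real ^ 'n => real => 'p" where
 "seg c y0 y1 t = coord_inv c (y0 + t *R (y1 - y0))"

lemma seg_in:
 assumes "convex S" "S <= rng c" "y0 \<in> S" "y1 \<in> S" "t \<in> {0..1}"
 shows "y0 + t *R (y1 - y0) \<in> S"
 using assms convexD_alt[of S y0 y1 t] by (simp add: algebra_simps)

lemma seg_reg:
 assumes c: "c \<in> atlas M" and S: "convex S" "S <= rng c" "y0 \<in> S" "y1 \<in> S" and t: "0 < t" "t < 1"
 shows "reg (seg c y0 y1) t c (min t (1 - t)) (%_. y1 - y0)"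
 unfolding reg_def
proof (intro conjI ballI c)
 fix s assume s: "s \<in> ball t (min t (1 - t))"
 then have s01: "s \<in> {0<..<1}" by (auto simp: dist_real_def)
 have r: "y0 + s *R (y1 - y0) \<in> rng c" if "s \<in> {0..1}" for s using seg_in[OF S that] S(2) by blast
 show "seg c y0 y1 s \<in> cdom c" using r s01 c by (auto simp: seg_def)
 have "((%s. y0 + s *R (y1 - y0)) has_vector_derivative y1 - y0) (at s)"
  by (auto intro!: derivative_eq_intros)
 then show "((coord c o seg c y0 y1) has_vector_derivative y1 - y0) (at s)"
  by (rule has_vector_derivative_transform_within_open[OF _ _ s01]) (insert r c, auto simp: seg_def)
qed (use t in auto)

lemma seg_continuous:
 assumes c: "c \<in> atlas M" and S: "convex S" "S <= rng c" "y0 \<in> S" "y1 \<in> S"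
 shows "continuous_on {0..1} (seg c y0 y1)"
 unfolding seg_def
proof (rule continuous_on_compose2[OF homeomorphism_cont2[OF atlasD(3)[OF c]]])
 show "continuous_on {0..1} (%t. y0 + t *R (y1 - y0))" by (intro continuous_intros)
 show "(%t. y0 + t *R (y1 - y0)) ` {0..1} <= rng c" using seg_in[OF S] S(2) by blast
qed

lemma seg_PC1:
 assumes c: "c \<in> atlas M" and S: "convex S" "S <= rng c" "y0 \<in> S" "y1 \<in> S"
 shows "piecewise_C1_path M (seg c y0 y1)"
proof (rule PC1_I)
 let ?l = "%t. y0 + t *R (y1 - y0)"
 have r: "?l t \<in> rng c" if "t \<in> {0..1}" for t using seg_in[OF S that] S(2) by blast
 have inc: "seg c y0 y1 t \<in> cdom c" if "t \<in> {0..1}" for t using r[OF that] c by (simp add: seg_def)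
 show "path (seg c y0 y1)" using seg_continuous[OF assms] by (simp add: path_def)
 show "path_image (seg c y0 y1) <= X" using inc atlasD(4)[OF c] by (auto simp: path_image_def)
 fix c' and a b :: real
 assume c': "c' \<in> atlas M" and ab: "0 <= a" "a <= b" "b <= 1" and U: "seg c y0 y1 ` {a..b} <= cdom c'"
 have l_ov: "?l t \<in> ov c c'" if "t \<in> {a..b}" for t
  using that U r[of t] ab ov_iff[OF c] by (auto simp: seg_def)
 let ?D = "%t. frechet_derivative (transition c c') (at (?l t) within ov c c') (y1 - y0)"
 have "continuous_on (ov c c') (%y. frechet_derivative (transition c c') (at y within ov c c') (y1 - y0))"
  by (rule Ck_on_continuous[OF Ck_on_frechet_within(2)[OF ov_open[OF c c'], of 0]])
    (use Ck_on_mono[OF transition_C2[OF c c'], of "Suc 0"] in simp)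
 then have Dc: "continuous_on {a..b} ?D"
  by (rule continuous_on_compose2) (insert l_ov, auto intro!: continuous_intros)
 have der: "((coord c' o seg c y0 y1) has_vector_derivative ?D t) (at t)" if t: "t \<in> {a..b} - {a, b}" for t
 proof -
  have t01: "0 < t" "t < 1" using t ab by auto
  have R: "reg (seg c y0 y1) t c (min t (1 - t)) (%_. y1 - y0)" by (rule seg_reg[OF assms t01])
  have in1: "seg c y0 y1 t \<in> cdom c" "seg c y0 y1 t \<in> cdom c'" using inc[of t] U t t01 by auto
  have "((coord c' o seg c y0 y1) has_vector_derivative Jac c c' (seg c y0 y1 t) (y1 - y0)) (at t)"
  proof (rule velocity_change[OF c c' _ reg_path_continuous[OF R] _ in1])
   show "seg c y0 y1 ` ball t (min t (1 - t)) <= X" using R atlasD(4)[OF c] by (auto simp: reg_def)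
   show "((coord c o seg c y0 y1) has_vector_derivative y1 - y0) (at t)" using R by (simp add: reg_def)
  qed (use t01 in auto)
  moreover have "coord c (seg c y0 y1 t) = ?l t" using r[of t] t01 c by (simp add: seg_def)
  ultimately show ?thesis by (simp add: Jac_def)
 qed
 have "continuous_on {a..b} (coord c' o seg c y0 y1)"
 proof (rule continuous_on_compose)
  show "continuous_on {a..b} (seg c y0 y1)"
   by (rule continuous_on_subset[OF seg_continuous[OF assms]]) (use ab in auto)
  show "continuous_on (seg c y0 y1 ` {a..b}) (coord c')"
   by (rule continuous_on_subset[OF homeomorphism_cont1[OF atlasD(3)[OF c']] U])
 qed
 then show "(coord c' o seg c y0 y1) piecewise_C1_differentiable_on {a..b}"
  unfolding piecewise_C1_differentiable_on_def C1_differentiable_on_def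
  by (intro conjI exI[of _ "{a, b}"] exI[of _ ?D] ballI der continuous_on_subset[OF Dc]) auto
qed

lemma seg_len:
 assumes c: "c \<in> atlas M" and S: "convex S" "S <= rng c" "y0 \<in> S" "y1 \<in> S"
  and L: "!!y. y \<in> S ==> gnorm c (coord_inv c y) (y1 - y0) <= L"
 shows "len (seg c y0 y1) 0 1 <= ennreal L"
proof -
 have "len (seg c y0 y1) 0 1 = (\<integral>\<^sup>+t. ennreal (speed M (seg c y0 y1) t) * indicator ({0<..<1} - {}) t \<partial>lborel)"
 proof (rule speed_measurable(2))
  show "ALL t:{0<..<1} - {}. EX c' e D. reg (seg c y0 y1) t c' e D"
  proof
   fix t :: real assume "t \<in> {0<..<1} - {}"
   then show "EX c' e D. reg (seg c y0 y1) t c' e D" using seg_reg[OF assms(1-5), of t] by (meson DiffD1 greaterThanLessThan_iff)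
  qed
 qed simp
 also have "... <= (\<integral>\<^sup>+t. ennreal L * indicator {0..1::real} t \<partial>lborel)"
 proof (rule nn_integral_mono)
  fix t
  show "ennreal (speed M (seg c y0 y1) t) * indicator ({0<..<1} - {}) t <= ennreal L * indicator {0..1} t"
  proof (cases "t \<in> {0<..<1}")
   case True
   then have "speed M (seg c y0 y1) t = gnorm c (seg c y0 y1 t) (y1 - y0)"
    by (intro reg_speed[OF seg_reg[OF assms(1-5)]]) auto
   also have "... <= L" unfolding seg_def by (rule L, rule seg_in[OF S]) (use True in auto)
   finally show ?thesis using True by (simp add: ennreal_leI)
  qed auto
 qed
 also have "... = ennreal L" by (simp add: nn_integral_cmult)
 finally show ?thesis .
qed

lemma PC1_join:
 assumes g1: "piecewise_C1_path M gam1" and g2: "piecewise_C1_path M gam2" and eq: "gam1 1 = gam2 0"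
 shows "piecewise_C1_path M (gam1 +++ gam2)"
proof (rule PC1_I)
 have eq': "pathfinish gam1 = pathstart gam2" using eq by (simp add: pathfinish_def pathstart_def)
 show "path (gam1 +++ gam2)" using path_join_imp[OF PC1_D(1)[OF g1] PC1_D(1)[OF g2] eq'] .
 show "path_image (gam1 +++ gam2) <= X"
  using path_image_join_subset[of gam1 gam2] PC1_D(2)[OF g1] PC1_D(2)[OF g2] by blast
 fix c and a b :: real assume c: "c \<in> atlas M" and ab: "0 <= a" "a <= b" "b <= 1" and U: "(gam1 +++ gam2) ` {a..b} <= cdom c"
 let ?f = "%x. (coord c o gam1) (2 * x + 0)" and ?g = "%x. (coord c o gam2) (2 * x + (- 1))"
 have f: "?f piecewise_C1_differentiable_on {a'..b'}" if "0 <= a'" "b' <= 1 / 2" "{a'..b'} <= {a..b}" for a' b'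
 proof (rule piecewise_C1_affine_interval, simp, rule PC1_D(3)[OF g1 c])
  show "gam1 ` {2 * a' + 0..2 * b' + 0} <= cdom c"
  proof
   fix z assume "z \<in> gam1 ` {2 * a' + 0..2 * b' + 0}"
   then obtain t where t: "2 * a' <= t" "t <= 2 * b'" "z = gam1 t" by auto
   then have "t / 2 \<in> {a..b}" "t / 2 <= 1 / 2" using that by auto
   then have "(gam1 +++ gam2) (t / 2) \<in> cdom c" using U by blast
   then show "z \<in> cdom c" using t \<open>t / 2 <= 1 / 2\<close> by (simp add: joinpaths_def)
  qed
 qed (use that in auto)
 have g: "?g piecewise_C1_differentiable_on {a'..b'}" if "1 / 2 <= a'" "b' <= 1" "{a'..b'} <= {a..b}" for a' b'
 proof (rule piecewise_C1_affine_interval, simp, rule PC1_D(3)[OF g2 c])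
  show "gam2 ` {2 * a' + (- 1)..2 * b' + (- 1)} <= cdom c"
  proof
   fix z assume "z \<in> gam2 ` {2 * a' + (- 1)..2 * b' + (- 1)}"
   then obtain t where t: "2 * a' - 1 <= t" "t <= 2 * b' - 1" "z = gam2 t" by auto
   then have m: "(t + 1) / 2 \<in> {a'..b'}" by auto
   then have J: "(gam1 +++ gam2) ((t + 1) / 2) \<in> cdom c" using U that(3) by blast
   show "z \<in> cdom c"
   proof (cases "t = 0")
    case True
    then show ?thesis using J t(3) eq by (simp add: joinpaths_def)
   next
    case False
    then have "~ (t + 1) / 2 <= 1 / 2" using m that(1) by auto
    moreover have "2 * ((t + 1) / 2) - 1 = t" by (simp add: field_simps)
    ultimately show ?thesis using J t(3) by (simp add: joinpaths_def del: times_divide_eq_right)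
   qed
  qed
 qed (use that in auto)
 have e: "coord c o (gam1 +++ gam2) = (%x. if x <= 1 / 2 then ?f x else ?g x)"
  by (auto simp: joinpaths_def fun_eq_iff)
 consider "b < 1 / 2" | "a > 1 / 2" | "a <= 1 / 2" "1 / 2 <= b" by linarith
 then show "(coord c o (gam1 +++ gam2)) piecewise_C1_differentiable_on {a..b}"
 proof cases
  case 1
  show ?thesis unfolding e
   by (rule piecewise_C1_cong_open[OF f, of a b "{..<1/2}"]) (use 1 ab in auto)
 next
  case 2
  show ?thesis unfolding e
   by (rule piecewise_C1_cong_open[OF g, of a b "{1/2<..}"]) (use 2 ab in auto)
 next
  case 3
  show ?thesis unfolding e
   by (rule piecewise_C1_differentiable_cases[OF f g]) (use 3 ab eq in auto)
 qed
qed

lemma len_join: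
 assumes g1: "piecewise_C1_path M gam1" and g2: "piecewise_C1_path M gam2" and eq: "gam1 1 = gam2 0"
 shows "len (gam1 +++ gam2) 0 1 = len gam1 0 1 + len gam2 0 1"
proof -
 obtain E where E: "finite E" "ALL t:{0<..<1} - E. EX c e D. reg (gam1 +++ gam2) t c e D"
  using reg_cofinite[OF PC1_join[OF assms]] by blast
 obtain E1 where E1: "finite E1" "ALL t:{0<..<1} - E1. EX c e D. reg gam1 t c e D" using reg_cofinite[OF g1] by blast
 obtain E2 where E2: "finite E2" "ALL t:{0<..<1} - E2. EX c e D. reg gam2 t c e D" using reg_cofinite[OF g2] by blast
 have "len (gam1 +++ gam2) 0 1 = len (gam1 +++ gam2) 0 (1 / 2) + len (gam1 +++ gam2) (1 / 2) 1"
  by (rule len_add[OF E]) auto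
 also have "len (gam1 +++ gam2) 0 (1 / 2) = len gam1 (2 * 0 + 0) (2 * (1 / 2) + 0)"
  by (rule len_affine[OF E1(1)]) (insert E1(2), auto simp: joinpaths_def)
 also have "len (gam1 +++ gam2) (1 / 2) 1 = len gam2 (2 * (1 / 2) + (- 1)) (2 * 1 + (- 1))"
  by (rule len_affine[OF E2(1)]) (insert E2(2), auto simp: joinpaths_def)
 finally show ?thesis by simp
qed

text \<open>The segment, followed by a path to the boundary, competes in the distance of its starting point.\<close>

lemma bdist_segment:
 assumes c: "c \<in> atlas M" and S: "convex S" "S <= rng c" "y0 \<in> S" "y1 \<in> S"
  and L: "!!y. y \<in> S ==> gnorm c (coord_inv c y) (y1 - y0) <= L"
 shows "bdist M (coord_inv c y0) <= ennreal L + bdist M (coord_inv c y1)"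
proof (rule ennreal_le_epsilon)
 fix e :: real assume fin: "ennreal L + bdist M (coord_inv c y1) < top" and e: "e > 0"
 then have "bdist M (coord_inv c y1) < top" by auto
 then obtain r where r: "bdist M (coord_inv c y1) = ennreal r" "r >= 0"
  by (cases "bdist M (coord_inv c y1)") auto
 then have "bdist M (coord_inv c y1) < bdist M (coord_inv c y1) + ennreal e"
  using e by (simp add: ennreal_plus[symmetric] ennreal_less_iff del: ennreal_plus)
 then obtain gam where g: "piecewise_C1_path M gam" "gam 0 = coord_inv c y1" "gam 1 \<in> boundary M"
  "len gam 0 1 < bdist M (coord_inv c y1) + ennreal e" by (rule bdist_less_path)
 have s: "piecewise_C1_path M (seg c y0 y1)" by (rule seg_PC1[OF assms(1-5)])
 have eq: "seg c y0 y1 1 = gam 0" using g(2) by (simp add: seg_def)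
 have "bdist M ((seg c y0 y1 +++ gam) 0) <= len (seg c y0 y1 +++ gam) 0 1"
  by (rule bdist_le_len[OF PC1_join[OF s g(1) eq]]) (use g in \<open>simp add: joinpaths_def\<close>)
 also have "... = len (seg c y0 y1) 0 1 + len gam 0 1" by (rule len_join[OF s g(1) eq])
 also have "... <= ennreal L + (bdist M (coord_inv c y1) + ennreal e)"
  by (intro add_mono seg_len[OF assms] less_imp_le[OF g(4)])
 finally show "bdist M (coord_inv c y0) <= ennreal L + bdist M (coord_inv c y1) + ennreal e"
  by (simp add: joinpaths_def seg_def add.assoc)
qed

end

section \<open>Regularity and gradient of the distance to the boundary\<close>

context riem_manifold begin

lemma gnorm_scale: "gnorm c x (r *R v) = \<bar>r\<bar> * gnorm c x v"
proof -
 have "(r *R v) \<bullet> (metric M c x *v (r *R v)) = r^2 * (v \<bullet> (metric M c x *v v))"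
  by (simp add: matrix_vector_mult_scaleR power2_eq_square)
 then show ?thesis by (simp add: gnorm_def real_sqrt_mult)
qed

lemma gnorm_nonneg: "c \<in> atlas M ==> x \<in> cdom c ==> gnorm c x v >= 0"
 using posdef_nonneg[OF metric_posdef] by (simp add: gnorm_def)

lemma gnorm_pos: "c \<in> atlas M ==> x \<in> cdom c ==> v ~= 0 ==> gnorm c x v > 0"
 using metric_posdef[of c x] by (simp add: gnorm_def posdef_def)

lemma gnorm_joint_continuous:
 assumes c: "c \<in> atlas M"
 shows "continuous_on (rng c \<times> UNIV) (%p. gnorm c (coord_inv c (fst p)) (snd p))"
proof -
 have G: "continuous_on (rng c \<times> UNIV) (%p::(real^'n)\<times>(real^'n). gloc c (fst p))"
  by (rule continuous_on_compose2[OF gloc_continuous[OF c]]) (auto intro!: continuous_intros)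
 have "continuous_on (rng c \<times> UNIV) (%p. snd p \<bullet> (\<chi> i. SUM j:UNIV. gloc c (fst p) $ i $ j * snd p $ j))"
  by (intro continuous_intros G)
 then show ?thesis
  unfolding gnorm_def gloc_def[symmetric] matrix_vector_mult_def by (rule continuous_on_real_sqrt)
qed

text \<open>Compactness of the product of \<open>K\<close> with the unit sphere.\<close>

lemma gnorm_bounds:
 assumes c: "c \<in> atlas M" and K: "compact K" "K <= rng c"
 obtains a b where "a > 0" "b > 0"
  "!!y v. y \<in> K ==> a * norm v <= gnorm c (coord_inv c y) v"
  "!!y v. y \<in> K ==> gnorm c (coord_inv c y) v <= b * norm v"
proof (cases "K = {}")
 case True
 then show ?thesis using that[of 1 1] by simp
next
 case False
 let ?P = "K \<times> sphere (0::real^'n) 1"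
 let ?g = "%p. gnorm c (coord_inv c (fst p)) (snd p)"
 have comp: "compact ?P" using K(1) by (intro compact_Times compact_sphere)
 have ne: "?P ~= {}" using False by simp
 have cont: "continuous_on ?P ?g"
  by (rule continuous_on_subset[OF gnorm_joint_continuous[OF c]]) (use K in auto)
 obtain p where p: "p \<in> ?P" "!!q. q \<in> ?P ==> ?g p <= ?g q" using continuous_attains_inf[OF comp ne cont] by blast
 obtain p' where p': "p' \<in> ?P" "!!q. q \<in> ?P ==> ?g q <= ?g p'" using continuous_attains_sup[OF comp ne cont] by blast
 have inK: "coord_inv c y \<in> cdom c" if "y \<in> K" for y using that K(2) c by auto
 have "?g p > 0" using p(1) inK by (intro gnorm_pos c) auto
 moreover have "?g p' > 0" using p'(1) inK by (intro gnorm_pos c) auto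
 moreover have "?g p * norm v <= gnorm c (coord_inv c y) v & gnorm c (coord_inv c y) v <= ?g p' * norm v" if y: "y \<in> K" for y v
 proof (cases "v = 0")
  case False
  have e: "gnorm c (coord_inv c y) v = norm v * ?g (y, v /\<^sub>R norm v)"
   using gnorm_scale[of c "coord_inv c y" "norm v" "v /\<^sub>R norm v"] False by simp
  have "(y, v /\<^sub>R norm v) \<in> ?P" using y False by simp
  from p(2)[OF this] p'(2)[OF this] show ?thesis unfolding e by (simp add: mult.commute mult_left_mono)
 qed (simp add: gnorm_def)
 ultimately show thesis using that[of "?g p" "?g p'"] by blast
qed

lemma chart_half_ball:
 assumes c: "c \<in> atlas M" and x: "x \<in> cdom c" and W: "open W" "coord c x \<in> W"
 obtains r where "r > 0" "cball (coord c x) r Int HS <= rng c Int W"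
proof -
 obtain V where V: "open V" "rng c = HS Int V" using atlasD(2)[OF c] by (auto simp: openin_open)
 have "coord c x \<in> V Int W" using V x W coord_in_rng[OF x] by auto
 then obtain r where "r > 0" "cball (coord c x) r <= V Int W"
  using open_contains_cball[of "V Int W"] V(1) W(1) by blast
 then show thesis using that V(2) by blast
qed

lemma chart_open_preimage:
 assumes c: "c \<in> atlas M" and W: "open W"
 shows "openin (top_of_set X) {z \<in> cdom c. coord c z \<in> W}"
proof -
 have "openin (top_of_set (cdom c)) (cdom c Int coord c -` W)"
  using continuous_openin_preimage_gen[OF homeomorphism_cont1[OF atlasD(3)[OF c]] W] .
 then have "openin (top_of_set X) (cdom c Int coord c -` W)" using atlasD(1)[OF c] openin_trans by blast
 moreover have "cdom c Int coord c -` W = {z \<in> cdom c. coord c z \<in> W}" by auto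
 ultimately show ?thesis by simp
qed

lemma bdist_local_Lipschitz:
 assumes x: "x \<in> X"
 obtains c r b where "c \<in> atlas M" "x \<in> cdom c" "r > 0" "b > 0"
  "!!z w. z \<in> cdom c ==> coord c z \<in> ball (coord c x) r ==> w \<in> cdom c ==> coord c w \<in> ball (coord c x) r
    ==> bdist M z <= ennreal (b * norm (coord c w - coord c z)) + bdist M w"
proof -
 obtain c where c: "c \<in> atlas M" "x \<in> cdom c" using atlas_cover[OF x] by blast
 obtain r where r: "r > 0" "cball (coord c x) r Int HS <= rng c" using chart_half_ball[OF c open_UNIV] by auto
 have comp: "compact (cball (coord c x) r Int HS)" using closed_half_space by (intro compact_Int_closed) auto
 obtain a b where b: "b > 0" "!!y v. y \<in> cball (coord c x) r Int HS ==> gnorm c (coord_inv c y) v <= b * norm v"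
  using gnorm_bounds[OF c(1) comp r(2)] by metis
 show thesis
 proof (rule that[OF c r(1) b(1)])
  fix z w assume zw: "z \<in> cdom c" "coord c z \<in> ball (coord c x) r" "w \<in> cdom c" "coord c w \<in> ball (coord c x) r"
  have "bdist M (coord_inv c (coord c z)) <= ennreal (b * norm (coord c w - coord c z)) + bdist M (coord_inv c (coord c w))"
   by (rule bdist_segment[OF c(1) _ r(2)])
    (insert zw b(2) coord_nonneg[OF c(1)] convex_half_space, auto simp: half_space_def intro!: convex_Int)
  then show "bdist M z <= ennreal (b * norm (coord c w - coord c z)) + bdist M w" using zw c by simp
 qed
qed

lemma bdist_locally_uniform:
 assumes x: "x \<in> X" and e: "e > 0"
 obtains T where "openin (top_of_set X) T" "x \<in> T"
  "!!z. z \<in> T ==> bdist M z <= ennreal e + bdist M x & bdist M x <= ennreal e + bdist M z"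
proof -
 obtain c s b where c: "c \<in> atlas M" "x \<in> cdom c" "s > 0" "b > 0" and
  lip: "!!z w. z \<in> cdom c ==> coord c z \<in> ball (coord c x) s ==> w \<in> cdom c ==> coord c w \<in> ball (coord c x) s
    ==> bdist M z <= ennreal (b * norm (coord c w - coord c z)) + bdist M w"
  using bdist_local_Lipschitz[OF x] by metis
 let ?T = "{z \<in> cdom c. coord c z \<in> ball (coord c x) (min s (e / b))}"
 have "bdist M z <= ennreal e + bdist M x & bdist M x <= ennreal e + bdist M z" if z: "z \<in> ?T" for z
 proof -
  have "norm (coord c x - coord c z) < e / b" using z by (simp add: dist_norm)
  then have "b * norm (coord c x - coord c z) <= e" using c(4) by (simp add: pos_less_divide_eq mult.commute)
  then have "ennreal (b * norm (coord c x - coord c z)) <= ennreal e" by (rule ennreal_leI)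
  moreover have "bdist M z <= ennreal (b * norm (coord c x - coord c z)) + bdist M x"
   "bdist M x <= ennreal (b * norm (coord c x - coord c z)) + bdist M z"
   using lip[of z x] lip[of x z] z c by (auto simp: norm_minus_commute)
  ultimately show ?thesis by (meson add_right_mono order_trans)
 qed
 moreover have "openin (top_of_set X) ?T" by (rule chart_open_preimage[OF c(1)]) simp
 moreover have "x \<in> ?T" using c e by simp
 ultimately show thesis using that[of ?T] by blast
qed

lemma bdist_sublevel_open: "openin (top_of_set X) {x \<in> X. bdist M x < r}"
proof (subst openin_subopen, intro ballI)
 fix x assume "x \<in> {x \<in> X. bdist M x < r}"
 then have x: "x \<in> X" "bdist M x < r" by auto
 have "EX e>0. ennreal e + bdist M x < r"
 proof (cases r)
  case (real t)
  obtain p where p: "bdist M x = ennreal p" "p >= 0" using x(2) by (cases "bdist M x") auto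
  then have "p < t" using x(2) real by (simp add: ennreal_less_iff)
  then show ?thesis using real p
   by (intro exI[of _ "(t - p) / 2"]) (simp add: ennreal_plus[symmetric] ennreal_less_iff field_simps del: ennreal_plus)
 next
  case top
  then show ?thesis using x(2) by (intro exI[of _ 1]) (simp add: ennreal_add_less_top)
 qed
 then obtain e where e: "e > 0" "ennreal e + bdist M x < r" by blast
 obtain T where T: "openin (top_of_set X) T" "x \<in> T" "!!z. z \<in> T ==> bdist M z <= ennreal e + bdist M x"
  using bdist_locally_uniform[OF x(1) e(1)] by metis
 then show "EX T. openin (top_of_set X) T & x \<in> T & T <= {x \<in> X. bdist M x < r}"
  using e(2) openin_imp_subset[OF T(1)] by (intro exI[of _ T]) (auto intro: le_less_trans)
qed

lemma bdist_superlevel_open: "openin (top_of_set X) {x \<in> X. ennreal r < bdist M x}"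
proof (subst openin_subopen, intro ballI)
 fix x assume "x \<in> {x \<in> X. ennreal r < bdist M x}"
 then have x: "x \<in> X" "ennreal r < bdist M x" by auto
 have "EX e>0. ennreal e + ennreal r < bdist M x"
 proof (cases "bdist M x")
  case (real p)
  define r' where "r' = max r 0"
  have rr: "ennreal r = ennreal r'" by (simp add: r'_def ennreal_neg max_def)
  have "r' < p" using x(2) real unfolding rr by (simp add: ennreal_less_iff r'_def)
  then show ?thesis using real unfolding rr
   by (intro exI[of _ "(p - r') / 2"]) (simp add: ennreal_plus[symmetric] ennreal_less_iff r'_def field_simps del: ennreal_plus)
 next
  case top
  then show ?thesis by (intro exI[of _ 1]) (simp add: ennreal_add_less_top)
 qed
 then obtain e where e: "e > 0" "ennreal e + ennreal r < bdist M x" by blast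
 obtain T where T: "openin (top_of_set X) T" "x \<in> T" "!!z. z \<in> T ==> bdist M x <= ennreal e + bdist M z"
  using bdist_locally_uniform[OF x(1) e(1)] by metis
 have "ennreal r < bdist M z" if "z \<in> T" for z
  using T(3)[OF that] e(2) add_left_mono[of "bdist M z" "ennreal r" "ennreal e"] by (meson not_le order_trans)
 then show "EX T. openin (top_of_set X) T & x \<in> T & T <= {x \<in> X. ennreal r < bdist M x}"
  using T openin_imp_subset[OF T(1)] by (intro exI[of _ T]) auto
qed

text \<open>A path to the boundary leaves every small coordinate ball around an interior point; a near-minimal one is
 stopped at its first exit.\<close>

lemma near_minimal_exit:
 assumes c: "c \<in> atlas M" "x \<in> cdom c" and R: "R > 0" "cball (coord c x) R <= rng c Int {y. y $ kk > 0}"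
  and fin: "bdist M x = ennreal d" "d >= 0" and e: "e > 0"
 obtains gam s where "piecewise_C1_path M gam" "gam 0 = x" "0 < s" "s <= 1"
  "!!t. t \<in> {0..s} ==> gam t \<in> cdom c & coord c (gam t) \<in> cball (coord c x) R"
  "norm (coord c (gam s) - coord c x) = R"
  "bdist M (gam s) + len gam 0 s <= ennreal (d + e)"
proof -
 have "bdist M x < ennreal (d + e)" using fin e by (simp add: ennreal_less_iff)
 then obtain gam where g: "piecewise_C1_path M gam" "gam 0 = x" "gam 1 \<in> boundary M" "len gam 0 1 < ennreal (d + e)"
  by (rule bdist_less_path)
 have cont: "continuous_on {0..1} gam" using PC1_D(1)[OF g(1)] by (simp add: path_def)
 have gX: "gam ` {0..1} <= X" using PC1_D(2)[OF g(1)] by (simp add: path_image_def)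
 define U where "U = {z \<in> cdom c. coord c z \<in> ball (coord c x) R}"
 have "openin (top_of_set X) U" unfolding U_def by (rule chart_open_preimage[OF c(1)]) simp
 then obtain O' where O: "open O'" "U = X Int O'" by (auto simp: openin_open)
 define T where "T = {0..1} Int gam -` (- O')"
 have "closed T" unfolding T_def by (rule continuous_closed_preimage[OF cont]) (use O in auto)
 moreover have "1 \<in> T"
 proof -
  have "gam 1 ~: U"
  proof
   assume "gam 1 \<in> U"
   then have u: "gam 1 \<in> cdom c" "coord c (gam 1) \<in> cball (coord c x) R" by (auto simp: U_def)
   then have "coord c (gam 1) $ kk > 0" using R(2) by blast
   then show False using boundary_iff[OF c(1) u(1)] g(3) by simp
  qed
  moreover have "gam 1 \<in> X" using gX by auto
  ultimately show ?thesis using O by (auto simp: T_def)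
 qed
 moreover have "bdd_below T" by (auto simp: T_def)
 ultimately have sT: "Inf T \<in> T" using closed_contains_Inf by blast
 define s where "s = Inf T"
 have s01: "0 <= s" "s <= 1" using sT by (auto simp: s_def T_def)
 have before: "gam t \<in> U" if "t \<in> {0..<s}" for t
 proof -
  have "t ~: T" using that \<open>bdd_below T\<close> cInf_lower[of t T] unfolding s_def by auto
  moreover have "gam t \<in> X" "t \<in> {0..1}" using gX that s01 by auto
  ultimately show ?thesis using O by (auto simp: T_def)
 qed
 have "x \<in> U" using c R by (simp add: U_def)
 have "s ~= 0"
 proof
  assume "s = 0"
  then have "x ~: O'" using sT g(2) by (simp add: T_def s_def)
  then show False using \<open>x \<in> U\<close> O by simp
 qed
 then have s0: "s > 0" using s01 by simp
 define L where "L = coord_inv c ` cball (coord c x) R"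
 have cL: "compact L" unfolding L_def
  by (rule compact_continuous_image[OF continuous_on_subset[OF homeomorphism_cont2[OF atlasD(3)[OF c(1)]]]]) (use R in auto)
 have UL: "z \<in> L" if "z \<in> U" for z
  unfolding L_def using that c(1) by (intro image_eqI[of _ _ "coord c z"]) (auto simp: U_def)
 have sL: "gam s \<in> L"
 proof -
  have "closed ({0..s} Int gam -` L)"
   by (rule continuous_closed_preimage) (insert cont s01 cL compact_imp_closed, auto intro: continuous_on_subset)
  moreover have "{0..<s} <= {0..s} Int gam -` L" using before UL by auto
  ultimately have "closure {0..<s} <= {0..s} Int gam -` L" by (rule closure_minimal[rotated])
  moreover have "s \<in> closure {0..<s}" using s0 by (simp add: closure_atLeastLessThan)
  ultimately show ?thesis by blast
 qed
 have Lin: "z \<in> cdom c & coord c z \<in> cball (coord c x) R" if "z \<in> L" for z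
  using that R(2) c(1) by (auto simp: L_def)
 have "gam s ~: U" using sT O by (simp add: T_def s_def)
 then have nR: "norm (coord c (gam s) - coord c x) = R"
  using Lin[OF sL] by (auto simp: U_def dist_norm norm_minus_commute)
 show thesis
 proof (rule that[OF g(1,2) s0 s01(2) _ nR])
  show "gam t \<in> cdom c & coord c (gam t) \<in> cball (coord c x) R" if "t \<in> {0..s}" for t
  proof (cases "t = s")
   case True
   then show ?thesis using Lin[OF sL] by simp
  next
   case False
   then show ?thesis using Lin[OF UL[OF before[of t]]] that by auto
  qed
  show "bdist M (gam s) + len gam 0 s <= ennreal (d + e)"
   using bdist_along_path[OF g(1,3) s01] g(4) by simp
 qed
qed

lemma exit_path_facts:
 assumes c: "c \<in> atlas M" and g: "piecewise_C1_path M gam" and s: "0 < s" "s <= 1"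
  and in_c: "!!t. t \<in> {0..s} ==> gam t \<in> cdom c"
 obtains E D where "finite E" "ALL t:{0<..<s} - E. EX c e D. reg gam t c e D"
  "continuous_on {0..s} (%t. coord c (gam t))"
  "!!t. t \<in> {0<..<s} - E ==> ((%t. coord c (gam t)) has_vector_derivative D t) (at t) & speed M gam t = gnorm c (gam t) (D t)"
proof -
 obtain E where E: "finite E" "ALL t:{0<..<1} - E. EX c e D. reg gam t c e D" using reg_cofinite[OF g] by blast
 have "continuous_on {0..s} gam"
  using PC1_D(1)[OF g] s by (auto simp: path_def intro: continuous_on_subset)
 then have cont: "continuous_on {0..s} (%t. coord c (gam t))"
  by (rule continuous_on_compose2[OF homeomorphism_cont1[OF atlasD(3)[OF c]]]) (use in_c in auto)
 have "EX v. ((%t. coord c (gam t)) has_vector_derivative v) (at t) & speed M gam t = gnorm c (gam t) v" if t: "t \<in> {0<..<s} - E" for t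
 proof -
  have "t \<in> {0<..<1} - E" using t s by auto
  then obtain c' e D where r: "reg gam t c' e D" using E(2) by blast
  have c': "c' \<in> atlas M" "e > 0" "gam t \<in> cdom c'" using r by (auto simp: reg_def)
  have tc: "gam t \<in> cdom c" using in_c t by auto
  have "((coord c o gam) has_vector_derivative Jac c' c (gam t) (D t)) (at t)"
  proof (rule velocity_change[OF c'(1) c c'(2) reg_path_continuous[OF r] _ c'(3) tc])
   show "gam ` ball t e <= X" using r atlasD(4)[OF c'(1)] by (auto simp: reg_def)
   show "((coord c' o gam) has_vector_derivative D t) (at t)" using r by (simp add: reg_def)
  qed
  moreover have "speed M gam t = gnorm c' (gam t) (D t)" by (rule reg_speed[OF r]) (use c' in auto)
  ultimately show ?thesis using gnorm_change[OF c'(1) c c'(3) tc] by (auto simp: o_def)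
 qed
 then obtain D where "!!t. t \<in> {0<..<s} - E ==> ((%t. coord c (gam t)) has_vector_derivative D t) (at t) & speed M gam t = gnorm c (gam t) (D t)"
  by metis
 moreover have "ALL t:{0<..<s} - E. EX c e D. reg gam t c e D" using E(2) s by auto
 ultimately show thesis using that[OF E(1) _ cont] by blast
qed

text \<open>A near-minimal path has spent a definite length when it leaves the ball, so its exit point is closer to the
 boundary.\<close>

lemma closer_point_nearby:
 assumes c: "c \<in> atlas M" "x \<in> cdom c" and R: "R > 0" "cball (coord c x) R <= rng c Int {y. y $ kk > 0}"
  and fin: "bdist M x < top"
 obtains z where "z \<in> cdom c" "norm (coord c z - coord c x) = R" "bdist M z < bdist M x"
proof -
 obtain d where d: "bdist M x = ennreal d" "d >= 0" using fin by (cases "bdist M x") auto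
 obtain a b where a: "a > 0" "!!y v. y \<in> cball (coord c x) R ==> a * norm v <= gnorm c (coord_inv c y) v"
  using gnorm_bounds[OF c(1) compact_cball, of "coord c x" R] R(2) by (metis le_inf_iff)
 have e: "a * R / 2 > 0" using a R by simp
 obtain gam s where g: "piecewise_C1_path M gam" "gam 0 = x" "0 < s" "s <= 1"
  "!!t. t \<in> {0..s} ==> gam t \<in> cdom c & coord c (gam t) \<in> cball (coord c x) R"
  "norm (coord c (gam s) - coord c x) = R" "bdist M (gam s) + len gam 0 s <= ennreal (d + a * R / 2)"
  using near_minimal_exit[OF c R d e] by metis
 obtain E D where E: "finite E" "ALL t:{0<..<s} - E. EX c e D. reg gam t c e D"
  "continuous_on {0..s} (%t. coord c (gam t))"
  "!!t. t \<in> {0<..<s} - E ==> ((%t. coord c (gam t)) has_vector_derivative D t) (at t) & speed M gam t = gnorm c (gam t) (D t)"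
  using exit_path_facts[OF c(1) g(1,3,4)] g(5) by metis
 have "ennreal (norm (coord c (gam s) - coord c (gam 0))) <= ennreal (1 / a) * len gam 0 s"
 proof (rule len_bound[OF E(1,2) _ E(3)])
  fix t assume t: "t \<in> {0<..<s} - E"
  show "((%t. coord c (gam t)) has_vector_derivative D t) (at t)" using E(4)[OF t] by blast
  have "a * norm (D t) <= gnorm c (coord_inv c (coord c (gam t))) (D t)" using g(5)[of t] t by (intro a(2)) auto
  then show "norm (D t) <= 1 / a * speed M gam t" using E(4)[OF t] g(5)[of t] t c(1) a(1) by (simp add: field_simps)
 qed (use g a in auto)
 then have "ennreal R <= ennreal (1 / a) * len gam 0 s" using g(2,6) by simp
 then have "ennreal a * ennreal R <= ennreal a * (ennreal (1 / a) * len gam 0 s)" by (rule mult_left_mono) simp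
 also have "... = len gam 0 s" using a(1) by (simp add: mult.assoc[symmetric] ennreal_mult[symmetric])
 finally have l: "ennreal (a * R) <= len gam 0 s" using a R by (simp add: ennreal_mult)
 have F: "bdist M (gam s) + ennreal (a * R) <= ennreal (d + a * R / 2)"
  using add_left_mono[OF l, of "bdist M (gam s)"] g(7) by (rule order_trans)
 have "bdist M (gam s) < ennreal d"
 proof (cases "bdist M (gam s)")
  case (real q)
  then show ?thesis
   using F e d(2) by (simp add: ennreal_plus[symmetric] ennreal_less_iff del: ennreal_plus)
 next
  case top
  then show ?thesis using F by (simp add: top_unique)
 qed
 then show thesis using that[of "gam s"] g(5)[of s] g(3,6) d(1) by auto
qed

text \<open>At distance zero no point nearby could be closer.\<close>

lemma bdist_interior_pos:
 assumes "x \<in> interior_of_mfd M" shows "bdist M x > 0"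
proof (rule ccontr)
 assume "~ bdist M x > 0"
 then have b0: "bdist M x = 0" by simp
 obtain c where c: "c \<in> atlas M" "x \<in> cdom c"
  using atlas_cover[of x] assms unfolding interior_of_mfd_def by blast
 have pos: "coord c x \<in> {y. y $ kk > 0}" using interior_iff[OF c] assms by simp
 have o: "open {y::real^'n. y $ kk > 0}" by (intro open_Collect_less continuous_intros)
 obtain r where r: "r > 0" "cball (coord c x) r Int HS <= rng c" using chart_half_ball[OF c open_UNIV] by auto
 obtain r' where r': "r' > 0" "cball (coord c x) r' <= {y. y $ kk > 0}" using o pos open_contains_cball by blast
 have "cball (coord c x) (min r r') <= rng c Int {y. y $ kk > 0}"
  using r r' by (fastforce simp: half_space_def)
 then show False using closer_point_nearby[OF c, of "min r r'"] r r' b0 by auto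
qed

text \<open>If the gradient of \<open>h\<close> had norm at most \<open>\<theta> < 1\<close> near \<open>x\<close>, then along a near-minimal path from \<open>x\<close> the distance
 would decrease by at most \<open>\<theta>\<close> times the length, whereas it decreases by the length up to a small error.
 The hypothesis asks for an extension \<open>h\<close> of the distance from \<open>{d \<le> \<rho>}\<close> only, because the distance may fail to be
 differentiable at points with \<open>d = \<rho>\<close>.\<close>

lemma gradient_lower_bound:
 assumes c: "c \<in> atlas M" "x \<in> cdom c" and pos: "coord c x $ kk > 0"
  and W: "open W" "coord c x \<in> W" and h: "Ck_on_open 1 h W"
  and hd: "!!z. z \<in> cdom c ==> coord c z \<in> W ==> bdist M z <= ennreal \<rho> ==> bdist M z = ennreal (h (coord c z)) & h (coord c z) >= 0"
  and x: "bdist M x <= ennreal \<rho>"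
 defines "p == \<chi> i. pdv i h (coord c x)"
 shows "p \<bullet> (matrix_inv (metric M c x) *v p) >= 1"
proof (rule ccontr)
 let ?y = "coord c x"
 assume "~ ?thesis"
 then have lt: "p \<bullet> (matrix_inv (metric M c x) *v p) < 1" by simp
 define P where "P y = (\<chi> i. pdv i h y)" for y
 define Q where "Q y = P y \<bullet> (matrix_inv (gloc c y) *v P y)" for y
 define V where "V = W Int {y \<in> rng c. coord_inv c y \<in> X & y $ kk > 0}"
 have Vo: "open V" unfolding V_def using interior_part_open[OF c(1), of X] W(1) by auto
 have Vr: "V <= rng c" by (auto simp: V_def)
 have yV: "?y \<in> V" using c W pos atlasD(4)[OF c(1)] by (auto simp: V_def)
 have hder: "(h has_derivative (%v. P y \<bullet> v)) (at y)" if "y \<in> W" for y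
 proof -
  have d: "(h has_derivative frechet_derivative h (at y)) (at y)"
   using Ck_on_open_SucD[OF h[unfolded One_nat_def] that] .
  then have l: "linear (frechet_derivative h (at y))" by (rule has_derivative_linear)
  have "frechet_derivative h (at y) v = P y \<bullet> v" for v
  proof -
   have "v = (SUM i:UNIV. v $ i *R axis i 1)" using basis_expansion[of v] by (simp add: scalar_mult_eq_scaleR)
   then have "frechet_derivative h (at y) v = frechet_derivative h (at y) (SUM i:UNIV. v $ i *R axis i 1)" by (rule arg_cong)
   then show ?thesis by (simp add: linear_sum[OF l] linear_scale[OF l] P_def inner_vec_def mult.commute)
  qed
  then have "frechet_derivative h (at y) = (%v. P y \<bullet> v)" by blast
  then show ?thesis using d by simp
 qed
 have Pc: "continuous_on V (%y. P y $ i)" for i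
  using h by (auto simp: P_def V_def intro: continuous_on_subset)
 have Gc: "continuous_on V (%y. matrix_inv (gloc c y) $ i $ j)" for i j
  using Ck_on_open_continuous[OF ginv_C1[OF c(1) Vo Vr]] .
 have "continuous_on V (%y. SUM i:UNIV. SUM j:UNIV. P y $ i * P y $ j * matrix_inv (gloc c y) $ i $ j)"
  by (intro continuous_intros Pc Gc)
 then have "continuous_on V Q" by (simp add: Q_def[abs_def] inner_matrix_vector_sum)
 moreover have "Q ?y < 1" using lt c by (simp add: Q_def P_def p_def gloc_def)
 \<comment> \<open>strictly between \<open>Q ?y\<close> and \<open>1\<close>, and positive\<close>
 define q where "q = max ((Q ?y + 1) / 2) (1 / 4)"
 have q: "0 < q" "q < 1" "Q ?y < q" using \<open>Q ?y < 1\<close> by (auto simp: q_def max_def)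
 ultimately have "open (V Int Q -` {..<q})" using continuous_open_preimage[OF _ Vo open_lessThan] by blast
 moreover have "?y \<in> V Int Q -` {..<q}" using yV q by simp
 ultimately obtain R where R: "R > 0" "cball ?y R <= V Int Q -` {..<q}" using open_contains_cball by blast
 have sub: "cball ?y R <= rng c Int {y. y $ kk > 0}" using R(2) by (auto simp: V_def)
 obtain a b where a: "a > 0" "!!y v. y \<in> cball ?y R ==> a * norm v <= gnorm c (coord_inv c y) v"
  using gnorm_bounds[OF c(1) compact_cball, of ?y R] sub by (metis le_inf_iff)
 define \<theta> where "\<theta> = sqrt q"
 have \<theta>: "0 < \<theta>" "\<theta> < 1" using q by (auto simp: \<theta>_def)
 have slope: "\<bar>P y \<bullet> v\<bar> <= \<theta> * gnorm c (coord_inv c y) v" if y: "y \<in> cball ?y R" for y v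
 proof -
  have yr: "y \<in> rng c" "Q y <= q" using y R(2) sub by force+
  have g: "posdef (gloc c y)" using gloc_posdef[OF c(1) yr(1)] .
  have "(P y \<bullet> v)^2 <= Q y * (v \<bullet> (gloc c y *v v))" unfolding Q_def by (rule posdef_Cauchy_Schwarz[OF g])
  also have "... <= q * (v \<bullet> (gloc c y *v v))" by (intro mult_right_mono yr(2) posdef_nonneg[OF g])
  finally have "sqrt ((P y \<bullet> v)^2) <= sqrt (q * (v \<bullet> (gloc c y *v v)))" by (rule real_sqrt_le_mono)
  then show ?thesis by (simp add: real_sqrt_mult \<theta>_def gnorm_def gloc_def)
 qed
 obtain d where d: "bdist M x = ennreal d" "d >= 0" using hd[OF c(2) W(2) x] by blast
 have "ennreal d = ennreal (h ?y)" "h ?y >= 0" using hd[OF c(2) W(2) x] d by auto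
 then have hx: "h ?y = d" using d(2) by simp
 define e where "e = (1 - \<theta>) * (a * R) / 2"
 have aR: "a * R > 0" using a R by simp
 then have "(1 - \<theta>) * (a * R) < 1 * (a * R)" using \<theta> by (intro mult_strict_right_mono) auto
 then have e: "e > 0" "e < a * R" using \<theta> aR unfolding e_def by auto
 obtain gam s where g: "piecewise_C1_path M gam" "gam 0 = x" "0 < s" "s <= 1"
  "!!t. t \<in> {0..s} ==> gam t \<in> cdom c & coord c (gam t) \<in> cball ?y R"
  "norm (coord c (gam s) - ?y) = R" "bdist M (gam s) + len gam 0 s <= ennreal (d + e)"
  using near_minimal_exit[OF c R(1) sub d e(1)] by metis
 obtain E D where E: "finite E" "ALL t:{0<..<s} - E. EX c e D. reg gam t c e D"
  "continuous_on {0..s} (%t. coord c (gam t))"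
  "!!t. t \<in> {0<..<s} - E ==> ((%t. coord c (gam t)) has_vector_derivative D t) (at t) & speed M gam t = gnorm c (gam t) (D t)"
  using exit_path_facts[OF c(1) g(1,3,4)] g(5) by metis
 have "ennreal (norm (coord c (gam s) - coord c (gam 0))) <= ennreal (1 / a) * len gam 0 s"
 proof (rule len_bound[OF E(1,2) _ E(3)])
  fix t assume t: "t \<in> {0<..<s} - E"
  show "((%t. coord c (gam t)) has_vector_derivative D t) (at t)" using E(4)[OF t] by blast
  have "a * norm (D t) <= gnorm c (coord_inv c (coord c (gam t))) (D t)" using g(5)[of t] t by (intro a(2)) auto
  then show "norm (D t) <= 1 / a * speed M gam t" using E(4)[OF t] g(5)[of t] t c(1) a(1) by (simp add: field_simps)
 qed (use g a in auto)
 then have L1: "ennreal R <= ennreal (1 / a) * len gam 0 s" using g(2,6) by simp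
 have "ennreal (norm (h (coord c (gam s)) - h (coord c (gam 0)))) <= ennreal \<theta> * len gam 0 s"
 proof (rule len_bound[OF E(1,2), where F' = "%t. P (coord c (gam t)) \<bullet> D t"])
  have W': "coord c (gam t) \<in> W" if "t \<in> {0..s}" for t using g(5)[OF that] R(2) by (auto simp: V_def)
  show "continuous_on {0..s} (%t. h (coord c (gam t)))"
   by (rule continuous_on_compose2[OF Ck_on_open_continuous[OF h] E(3)]) (use W' in auto)
  fix t assume t: "t \<in> {0<..<s} - E"
  then have t': "t \<in> {0..s}" by auto
  have "((%t. coord c (gam t)) has_derivative (%u. u *R D t)) (at t)"
   using E(4)[OF t] by (simp add: has_vector_derivative_def)
  from has_derivative_compose[OF this hder[OF W'[OF t']]]
  show "((%t. h (coord c (gam t))) has_vector_derivative P (coord c (gam t)) \<bullet> D t) (at t)"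
   by (simp add: has_vector_derivative_def)
  show "norm (P (coord c (gam t)) \<bullet> D t) <= \<theta> * speed M gam t"
   using slope[of "coord c (gam t)" "D t"] g(5)[OF t'] E(4)[OF t] c(1) by simp
 qed (use g \<theta> in auto)
 then have L2: "ennreal \<bar>h (coord c (gam s)) - d\<bar> <= ennreal \<theta> * len gam 0 s" using g(2) hx by simp
 have "len gam 0 s <= bdist M (gam s) + len gam 0 s" by (simp add: add_increasing)
 then have "len gam 0 s < top" using g(7) by (metis ennreal_less_top order_le_less_trans)
 then obtain l where l: "len gam 0 s = ennreal l" "l >= 0" by (cases "len gam 0 s") auto
 have "bdist M (gam s) <= bdist M (gam s) + len gam 0 s" by (simp add: add_increasing2)
 then have "bdist M (gam s) < top" using g(7) by (metis ennreal_less_top order_le_less_trans)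
 then obtain q' where q': "bdist M (gam s) = ennreal q'" "q' >= 0" by (cases "bdist M (gam s)") auto
 have 1: "q' + l <= d + e" using g(7) l q' e d by (simp add: ennreal_plus[symmetric] del: ennreal_plus)
 have "R <= (1 / a) * l" using L1 l a(1) by (simp add: ennreal_mult[symmetric])
 then have 2: "a * R <= l" using a(1) by (simp add: field_simps)
 have "\<bar>h (coord c (gam s)) - d\<bar> <= \<theta> * l" using L2 l \<theta> by (simp add: ennreal_mult[symmetric])
 then have 3: "h (coord c (gam s)) >= d - \<theta> * l" by linarith
 have "q' <= d" using 1 2 e(2) by linarith
 then have "bdist M (gam s) <= ennreal \<rho>" using q' d x by (metis ennreal_leI order_trans)
 moreover have "gam s \<in> cdom c" "coord c (gam s) \<in> W" using g(5)[of s] g(3) R(2) by (auto simp: V_def)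
 ultimately have "ennreal q' = ennreal (h (coord c (gam s)))" "h (coord c (gam s)) >= 0" using hd q'(1) by auto
 then have "h (coord c (gam s)) = q'" using q'(2) by simp
 then have "d - \<theta> * l + l <= d + e" using 1 3 by linarith
 then have "(1 - \<theta>) * l <= e" by (simp add: algebra_simps)
 moreover have "(1 - \<theta>) * l >= (1 - \<theta>) * (a * R)" using 2 \<theta> by (intro mult_left_mono) auto
 ultimately show False using e \<theta> a R by (simp add: e_def)
qed

text \<open>Along a segment the distance grows at most by the metric length, so \<open>p \<bullet> v\<close> is at most the metric norm of \<open>v\<close>;
 this is applied to the gradient \<open>v = G\<^sup>-\<^sup>1 p\<close>.\<close>

lemma gradient_upper_bound:
 assumes c: "c \<in> atlas M" and V: "open V" "V <= rng c" "y \<in> V"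
  and h: "(h has_derivative (%v. p \<bullet> v)) (at y)"
  and hd: "!!z. z \<in> V ==> bdist M (coord_inv c z) = ennreal (h z) & h z >= 0"
 shows "p \<bullet> (matrix_inv (gloc c y) *v p) <= 1"
proof -
 let ?x = "coord_inv c y"
 have yr: "y \<in> rng c" using V by auto
 have slope: "p \<bullet> v <= gnorm c ?x v" for v
 proof (rule ccontr)
  assume "~ ?thesis"
  define L where "L = (p \<bullet> v + gnorm c ?x v) / 2"
  have L: "gnorm c ?x v < L" "L < p \<bullet> v" using \<open>~ p \<bullet> v <= gnorm c ?x v\<close> by (auto simp: L_def)
  have "continuous_on (rng c) (%z. gnorm c (coord_inv c z) v)"
   by (rule gnorm_continuous[OF c]) (auto intro!: continuous_intros)
  then have "continuous_on V (%z. gnorm c (coord_inv c z) v)" using V continuous_on_subset by blast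
  from continuous_open_preimage[OF this V(1) open_lessThan[of L]]
  have "open (V Int (%z. gnorm c (coord_inv c z) v) -` {..<L})" .
  then obtain r where r: "r > 0" "ball y r <= V Int (%z. gnorm c (coord_inv c z) v) -` {..<L}"
   using V L open_contains_ball by (metis (no_types, lifting) IntI lessThan_iff vimage_eq)
  have "((%t. h (y + t *R v)) has_real_derivative p \<bullet> v) (at 0)"
   using has_real_derivative_along_line[of h "%v. p \<bullet> v" y 0 v] h by simp
  then have "((%t. h (y + t *R v) - L * t) has_real_derivative p \<bullet> v - L) (at 0)"
   by (auto intro!: derivative_eq_intros)
  from DERIV_pos_inc_right[OF this] L obtain d where
   d: "d > 0" "!!t. 0 < t ==> t < d ==> h y < h (y + t *R v) - L * t" by auto
  define B where "B = r / (1 + norm v)"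
  define t where "t = min d B / 2"
  have nv: "1 + norm v > 0" using norm_ge_zero[of v] by linarith
  have B: "B > 0" using r nv by (simp add: B_def)
  have t: "0 < t" "t < d" "t < B" using d B by (auto simp: t_def)
  then have "t < r / (1 + norm v)" by (simp add: B_def)
  then have "t * (1 + norm v) < r" using nv by (simp add: pos_less_divide_eq)
  then have "t * norm v < r" using t(1) by (simp add: distrib_left)
  then have tb: "y + t *R v \<in> ball y r" using t by (simp add: dist_norm)
  have "bdist M (coord_inv c (y + t *R v)) <= ennreal (t * L) + bdist M (coord_inv c y)"
  proof (rule bdist_segment[OF c convex_ball, of y r])
   show "ball y r <= rng c" using r V by auto
   show "gnorm c (coord_inv c z) (y - (y + t *R v)) <= t * L" if "z \<in> ball y r" for z
    using gnorm_scale[of c "coord_inv c z" "- t" v] r(2) that t(1) by (auto simp: mult_left_mono less_imp_le)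
  qed (use tb r in auto)
  moreover have "y + t *R v \<in> V" "y \<in> V" using tb r V by auto
  moreover have "L >= 0" using L(1) gnorm_nonneg[OF c, of ?x v] yr c by simp
  ultimately have "h (y + t *R v) <= t * L + h y" using hd t
   by (simp add: ennreal_plus[symmetric] del: ennreal_plus)
  then show False using d(2)[OF t(1,2)] by (simp add: mult.commute)
 qed
 define w where "w = matrix_inv (gloc c y) *v p"
 define q where "q = p \<bullet> w"
 have g: "posdef (gloc c y)" using gloc_posdef[OF c yr] .
 have "gnorm c ?x w = sqrt q"
  using posdef_inv(3)[OF g] by (simp add: gnorm_def gloc_def[symmetric] w_def q_def inner_commute)
 then have "q <= sqrt q" using slope[of w] by (simp add: q_def)
 moreover have "q >= 0" using posdef_nonneg[OF posdef_matrix_inv[OF g], of p] by (simp add: q_def w_def)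
 ultimately have "q <= 1"
 proof (cases "q > 1")
  case True
  then have "sqrt q < sqrt (q^2)" by (intro real_sqrt_less_mono) (simp add: power2_eq_square)
  then show ?thesis using \<open>q <= sqrt q\<close> True by simp
 qed simp
 then show ?thesis by (simp add: q_def w_def)
qed

end

section \<open>Collar charts\<close>

context riem_manifold begin

lemma ginv_continuous:
 assumes c: "c \<in> atlas M"
 shows "continuous_on (rng c) (%y. matrix_inv (gloc c y) $ a $ b)"
proof -
 have G: "continuous_on (rng c) (%y. gloc c y $ i $ j)" for i j
  by (intro continuous_intros gloc_continuous[OF c])
 have dp: "det (gloc c y) ~= 0" if "y \<in> rng c" for y using gloc_det_pos[OF c that] by simp
 have D: "continuous_on (rng c) (%y. det (gloc c y))"
  unfolding det_def by (intro continuous_intros G)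
 have e: "continuous_on (rng c) (%y. (\<chi> i j. if j = a then axis b 1 $ i else gloc c y $ i $ j) $ i $ j)" for i j
  by (cases "j = a") (auto intro: G)
 have N: "continuous_on (rng c) (%y. det (\<chi> i j. if j = a then axis b 1 $ i else gloc c y $ i $ j))"
  unfolding det_def by (intro continuous_on_sum continuous_on_mult continuous_on_const continuous_on_prod e)
 have "continuous_on (rng c) (%y. det (\<chi> i j. if j = a then axis b 1 $ i else gloc c y $ i $ j) / det (gloc c y))"
  by (rule continuous_on_divide[OF N D]) (use dp in auto)
 then show ?thesis
  by (rule continuous_on_eq) (simp add: matrix_inv_cramer[OF dp])
qed

text \<open>Collar charts: a half-ball in which the distinguished coordinate is the distance to the boundary, up to
 the value \<open>\<rho>\<close>.\<close>

definition ccoord :: "real => ('p, 'n) chart => real ^ 'n => real => bool" where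
 "ccoord \<rho> c z0 r \<longleftrightarrow> c \<in> atlas M & r > 0 & rng c = ball z0 r Int HS &
   (ALL x:cdom c. bdist M x <= ennreal \<rho> \<longleftrightarrow> coord c x $ kk <= \<rho>) &
   (ALL x:cdom c. coord c x $ kk <= \<rho> --> bdist M x = ennreal (coord c x $ kk))"

text \<open>Straightening: if \<open>h\<close> is a local extension of the distance whose differential does not vanish,
 \<open>h\<close> can be used as the distinguished coordinate. That this coordinate is at most \<open>\<rho>\<close> only at points of distance at
 most \<open>\<rho>\<close> follows from connectedness: on the convex set where it is less than \<open>\<rho>\<close>, a distance less than \<open>\<rho>\<close> is an
 open and closed condition.\<close>

lemma straightened_chart:
 assumes c: "c \<in> atlas M" "x \<in> cdom c" and \<rho>: "\<rho> > 0" and x: "bdist M x <= ennreal \<rho>"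
  and U0: "open U0" "coord c x \<in> U0" "U0 Int HS <= rng c" and h: "Ck_on_open 2 h U0"
  and sgn: "!!y. y \<in> U0 ==> y $ kk >= 0 \<longleftrightarrow> h y >= 0"
  and hd: "!!z. z \<in> cdom c ==> coord c z \<in> U0 ==> bdist M z <= ennreal \<rho> ==> bdist M z = ennreal (h (coord c z))"
  and j: "pdv j h (coord c x) ~= 0"
 obtains d z0 r where "ccoord \<rho> d z0 r" "x \<in> cdom d" "coord d x = z0"
proof -
 let ?y0 = "coord c x"
 define Psi where "Psi y = (\<chi> i. if i = kk then h y else if i = j then y $ kk else y $ i)" for y :: "real ^ 'n"
 have Psi2: "Ck_on_open 2 Psi U0"
  unfolding Ck_on_open_vec_iff[OF U0(1)]
 proof
  fix i
  have l: "Ck_on_open 2 (%y::real^'n. y $ i) U0" for i by (rule Ck_on_open_linear[OF bounded_linear_vec_nth U0(1)])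
  show "Ck_on_open 2 (%y. Psi y $ i) U0"
   by (cases "i = kk"; cases "i = j") (simp_all only: Psi_def vec_lambda_beta if_True if_False h l simp_thms)
 qed
 have Psi2': "Ck_on_open (Suc (Suc 0)) Psi U0" using Psi2 by (simp only: numeral_2_eq_2)
 let ?D = "frechet_derivative Psi (at ?y0)"
 have DPsi: "(Psi has_derivative ?D) (at ?y0)" by (rule Ck_on_open_SucD[OF Psi2' U0(2)])
 have lin: "linear ?D" by (rule has_derivative_linear[OF DPsi])
 have dh: "(h has_derivative frechet_derivative h (at ?y0)) (at ?y0)"
  by (rule Ck_on_open_SucD[OF h[unfolded numeral_2_eq_2] U0(2)])
 have comp: "((%y. Psi y $ i) has_derivative (%v. ?D v $ i)) (at ?y0)" for i
  by (rule bounded_linear.has_derivative[OF bounded_linear_vec_nth DPsi])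
 have Dk: "?D v $ kk = frechet_derivative h (at ?y0) v" for v
  using has_derivative_unique[OF comp[of kk]] dh by (simp add: Psi_def fun_eq_iff)
 have Di: "?D v $ i = (if i = j then v $ kk else v $ i)" if "i ~= kk" for i v
 proof -
  have "((%y. Psi y $ i) has_derivative (%v. if i = j then v $ kk else v $ i)) (at ?y0)"
   using that by (cases "i = j") (auto simp: Psi_def intro!: bounded_linear_imp_has_derivative bounded_linear_vec_nth)
  from has_derivative_unique[OF comp this] show ?thesis by (simp add: fun_eq_iff)
 qed
 have "inj ?D" unfolding linear_injective_0[OF lin]
 proof (intro allI impI)
  fix v assume v: "?D v = 0"
  have vk: "v $ i = 0" if "i ~= j" for i
   using v Di[of i v] Di[of j v] that by (cases "i = kk") (auto simp: vec_eq_iff)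
  then have "v = v $ j *R axis j 1" by (auto simp: vec_eq_iff axis_def)
  then have "frechet_derivative h (at ?y0) v = v $ j * pdv j h ?y0"
   using linear_scale[OF has_derivative_linear[OF dh], of "v $ j" "axis j 1"] by simp
  then have "v $ j = 0" using j Dk[of v] v by simp
  then show "v = 0" using vk by (metis vec_eq_iff zero_index)
 qed
 then have "det (matrix ?D) ~= 0" using det_nz_iff_inj[OF lin] by simp
 from C2_inverse_function[OF U0(1) Psi2 U0(2) this]
 obtain U' V g where g: "open U'" "U' <= U0" "?y0 \<in> U'" "open V" "homeomorphism U' V Psi g" "Ck_on_open 2 g V" .
 define z0 where "z0 = Psi ?y0"
 have "z0 \<in> V" using g(3) homeomorphism_image1[OF g(5)] by (auto simp: z0_def)
 then obtain r where r: "r > 0" "ball z0 r <= V" using g(4) open_contains_ball by blast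
 define V' where "V' = ball z0 r Int HS"
 have oU: "open (U' Int Psi -` ball z0 r)"
  by (rule continuous_open_preimage[OF homeomorphism_cont1[OF g(5)] g(1) open_ball])
 define U where "U = {z \<in> cdom c. coord c z \<in> U' Int Psi -` ball z0 r}"
 have Uo: "openin (top_of_set X) U" unfolding U_def by (rule chart_open_preimage[OF c(1) oU])
 have Uc: "U <= cdom c" by (auto simp: U_def)
 have U1: "coord c ` U = {y \<in> U'. Psi y \<in> ball z0 r & y \<in> HS}"
 proof
  show "coord c ` U <= {y \<in> U'. Psi y \<in> ball z0 r & y \<in> HS}"
   using coord_nonneg[OF c(1)] by (auto simp: U_def half_space_def)
  show "{y \<in> U'. Psi y \<in> ball z0 r & y \<in> HS} <= coord c ` U"
  proof
   fix y assume y: "y \<in> {y \<in> U'. Psi y \<in> ball z0 r & y \<in> HS}"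
   then have "y \<in> rng c" using g(2) U0(3) by auto
   then show "y \<in> coord c ` U" using y c(1) by (intro image_eqI[of _ _ "coord_inv c y"]) (auto simp: U_def)
  qed
 qed
 have Psik: "Psi y $ kk = h y" for y by (simp add: Psi_def)
 have im: "Psi ` (coord c ` U) = V'"
 proof
  show "Psi ` (coord c ` U) <= V'"
   unfolding U1 using sgn g(2) by (auto simp: V'_def half_space_def Psik)
  show "V' <= Psi ` (coord c ` U)"
  proof
   fix z assume z: "z \<in> V'"
   then have "z \<in> V" using r by (auto simp: V'_def)
   then have gz: "g z \<in> U'" "Psi (g z) = z"
    using homeomorphism_image2[OF g(5)] homeomorphism_apply2[OF g(5)] by auto
   then have "g z \<in> HS" using z sgn[of "g z"] g(2) Psik[of "g z"] by (auto simp: V'_def half_space_def)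
   then show "z \<in> Psi ` (coord c ` U)" unfolding U1 using gz z by (intro image_eqI[of _ _ "g z"]) (auto simp: V'_def)
  qed
 qed
 have hom: "homeomorphism (coord c ` U) V' Psi g"
  by (rule homeomorphism_of_subsets[OF g(5) _ _ im]) (insert U1 r, auto simp: V'_def)
 define d where "d = (U, %x. Psi (coord c x))"
 have dA: "d \<in> atlas M" unfolding d_def
 proof (rule new_chart[OF c(1) Uo Uc _ hom])
  show "openin (top_of_set HS) V'" unfolding V'_def by (auto simp: openin_open)
  show "Ck_on 2 Psi (coord c ` U)" by (rule Ck_on_openI[OF U0(1) Psi2]) (use U1 g(2) in auto)
  show "Ck_on 2 g V'" by (rule Ck_on_openI[OF g(4,6)]) (insert r, auto simp: V'_def)
 qed
 have rd: "rng d = V'" unfolding rng_def d_def using im by (simp add: image_image)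
 have dk: "coord d w $ kk = h (coord c w)" for w by (simp add: d_def Psik)
 have xU: "x \<in> cdom d" using c g(3) r(1) by (simp add: d_def U_def z0_def)
 have dx: "coord d x = z0" by (simp add: d_def z0_def)
 have val: "bdist M w = ennreal (coord d w $ kk)" if "w \<in> cdom d" "bdist M w <= ennreal \<rho>" for w
  unfolding dk using hd[of w] that g(2) by (auto simp: d_def U_def)
 have val': "coord d w $ kk <= \<rho>" if "w \<in> cdom d" "bdist M w <= ennreal \<rho>" for w
  using val[OF that] that(2) \<rho> coord_nonneg[OF dA that(1)] by simp
 have val'': "coord d w $ kk < \<rho>" if "w \<in> cdom d" "bdist M w < ennreal \<rho>" for w

  using val[OF that(1) less_imp_le[OF that(2)]] that(2) \<rho> coord_nonneg[OF dA that(1)] by (simp add: ennreal_less_iff)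
 define A where "A = {z \<in> V'. z $ kk < \<rho>}"
 have Acd: "coord_inv d z \<in> cdom d" "coord d (coord_inv d z) = z" if "z \<in> V'" for z using dA that rd by auto
 have "convex A"
 proof -
  have "A = (ball z0 r Int HS) Int {z. z $ kk < \<rho>}" by (auto simp: A_def V'_def)
  moreover have "convex {z::real^'n. z $ kk < \<rho>}"
  proof -
   have "{z::real^'n. z $ kk < \<rho>} = {z. axis kk 1 \<bullet> z < \<rho>}" by (simp add: inner_axis')
   then show ?thesis by (simp add: convex_halfspace_lt)
  qed
  ultimately show ?thesis by (simp add: convex_Int convex_half_space)
 qed
 then have Ac: "connected A" by (rule convex_connected)
 have open_in_A: "openin (top_of_set A) {z \<in> A. coord_inv d z \<in> S}" if S: "openin (top_of_set X) S" for S
 proof -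
  obtain T where T: "open T" "S = X Int T" using S by (auto simp: openin_open)
  have "continuous_on A (coord_inv d)"
   by (rule continuous_on_subset[OF homeomorphism_cont2[OF atlasD(3)[OF dA]]]) (auto simp: A_def rd)
  then have "openin (top_of_set A) (A Int coord_inv d -` T)" by (rule continuous_openin_preimage_gen[OF _ T(1)])
  moreover have "A Int coord_inv d -` T = {z \<in> A. coord_inv d z \<in> S}"
   using T(2) Acd(1) atlasD(4)[OF dA] by (auto simp: A_def)
  ultimately show ?thesis by simp
 qed
 define A1 where "A1 = {z \<in> A. coord_inv d z \<in> {w \<in> X. bdist M w < ennreal \<rho>}}"
 define A2 where "A2 = {z \<in> A. coord_inv d z \<in> {w \<in> X. ennreal \<rho> < bdist M w}}"
 have o1: "openin (top_of_set A) A1" unfolding A1_def by (rule open_in_A[OF bdist_sublevel_open])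
 have o2: "openin (top_of_set A) A2" unfolding A2_def by (rule open_in_A[OF bdist_superlevel_open])
 have "A - A1 = A2"
 proof -
  have "bdist M (coord_inv d z) ~= ennreal \<rho>" if "z \<in> A" for z
  proof
   assume e: "bdist M (coord_inv d z) = ennreal \<rho>"
   have z: "z \<in> V'" using that by (simp add: A_def)
   have "ennreal \<rho> = ennreal (z $ kk)" using val[OF Acd(1)[OF z]] e Acd(2)[OF z] by simp
   moreover have "z $ kk >= 0" using z by (simp add: V'_def half_space_def)
   ultimately have "z $ kk = \<rho>" using \<rho> by simp
   then show False using that by (simp add: A_def)
  qed
  moreover have "coord_inv d z \<in> X" if "z \<in> A" for z using that Acd(1)[of z] atlasD(4)[OF dA] by (auto simp: A_def)
  ultimately show ?thesis unfolding A1_def A2_def using linorder_neqE by fastforce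
 qed
 then have "closedin (top_of_set A) A1"
  using o2 by (simp add: closedin_def A1_def)
 moreover have "A1 ~= {}"
 proof -
  have "EX w:cdom d. bdist M w < ennreal \<rho>"
  proof (cases "bdist M x < ennreal \<rho>")
   case True
   then show ?thesis using xU by blast
  next
   case False
   then have e: "bdist M x = ennreal \<rho>" using x by simp
   then have "z0 $ kk = \<rho>" using val[OF xU x] dx \<rho> coord_nonneg[OF dA xU] by simp
   have "cball z0 (min r \<rho> / 2) <= rng d Int {y. y $ kk > 0}"
   proof
    fix y assume "y \<in> cball z0 (min r \<rho> / 2)"
    then have n: "norm (y - z0) <= min r \<rho> / 2" by (simp add: dist_norm norm_minus_commute)
    have "\<bar>(y - z0) $ kk\<bar> <= norm (y - z0)" by (rule component_le_norm_cart)
    then have "y $ kk > 0" using n \<open>z0 $ kk = \<rho>\<close> \<rho> r(1) by (auto simp: min_def split: if_splits)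
    moreover have "y \<in> ball z0 r" using n r(1) by (auto simp: dist_norm norm_minus_commute min_def split: if_splits)
    ultimately show "y \<in> rng d Int {y. y $ kk > 0}" unfolding rd V'_def half_space_def by auto
   qed
   then show ?thesis
    using closer_point_nearby[OF dA xU, of "min r \<rho> / 2"] dx r(1) \<rho> e by (metis ennreal_less_top half_gt_zero min_less_iff_conj)
  qed
  then obtain w where w: "w \<in> cdom d" "bdist M w < ennreal \<rho>" by blast
  then have "coord d w \<in> A1"
   using val''[OF w] dA rd atlasD(4)[OF dA] coord_in_rng[OF w(1)] by (auto simp: A1_def A_def)
  then show ?thesis by blast
 qed
 ultimately have A1: "A1 = A" using Ac o1 unfolding connected_clopen by blast
 have conv: "bdist M w <= ennreal \<rho>" if w: "w \<in> cdom d" "coord d w $ kk <= \<rho>" for w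
 proof (cases "coord d w $ kk < \<rho>")
  case True
  then have "coord d w \<in> A1" unfolding A1 A_def using w(1) rd coord_in_rng[OF w(1)] by auto
  then show ?thesis using dA w(1) by (auto simp: A1_def)
 next
  case False
  then have wk: "coord d w $ kk = \<rho>" using w by simp
  show ?thesis
  proof (rule ccontr)
   assume "~ ?thesis"
   then have "w \<in> {w \<in> X. ennreal \<rho> < bdist M w}" using w(1) atlasD(4)[OF dA] by auto
   from open_in_chart[OF dA bdist_superlevel_open, of \<rho>]
   obtain T where T: "open T" "coord d ` (cdom d Int {w \<in> X. ennreal \<rho> < bdist M w}) = HS Int T" by (auto simp: openin_open)
   let ?z = "coord d w"
   have zV: "?z \<in> V'" using coord_in_rng[OF w(1)] rd by simp
   have "?z \<in> HS Int T" unfolding T(2)[symmetric] using w(1) \<open>w \<in> {w \<in> X. _}\<close> by auto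
   then have "?z \<in> ball z0 r Int T" using zV by (simp add: V'_def)
   then obtain s where s: "s > 0" "ball ?z s <= ball z0 r Int T" using open_contains_ball[of "ball z0 r Int T"] T(1) by blast
   define t where "t = min s \<rho> / 2"
   have t: "0 < t" "t < s" "t < \<rho>" using s \<rho> by (auto simp: t_def)
   define z' where "z' = ?z - t *R axis kk 1"
   have "z' \<in> ball ?z s" using t by (simp add: z'_def dist_norm)
   moreover have z'k: "z' $ kk = \<rho> - t" by (simp add: z'_def wk)
   moreover have "z' \<in> HS" using z'k t by (simp add: half_space_def)
   ultimately have z': "z' \<in> HS Int T" "z' \<in> A" using s t by (auto simp: A_def V'_def)
   obtain w' where w': "w' \<in> cdom d" "ennreal \<rho> < bdist M w'" "z' = coord d w'"
    using z'(1) unfolding T(2)[symmetric] by auto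
   have "z' \<in> A1" using z'(2) A1 by simp
   then have "bdist M w' < ennreal \<rho>" using w' dA by (simp add: A1_def)
   then show False using w'(2) by simp
  qed
 qed
 have "ccoord \<rho> d z0 r"
  unfolding ccoord_def using dA r(1) rd conv val val' by (auto simp: V'_def)
 then show thesis using that xU dx by blast
qed

text \<open>A local extension \<open>h\<close> of the distance has a nonzero differential at interior points, by the lower bound on
 its gradient. At a boundary point the bound survives in the limit while the tangential derivatives vanish; so
 the derivative in the distinguished direction is positive, and \<open>h\<close> has the sign of that coordinate.\<close>

lemma collar_chart_exists:
 assumes \<rho>: "\<rho> > 0" and C2: "Ck_fun_on M 2 (bdist_real M) (collar M \<rho>)"
  and x: "x \<in> X" "bdist M x <= ennreal \<rho>"
 obtains d z0 r where "ccoord \<rho> d z0 r" "x \<in> cdom d" "coord d x = z0"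
proof -
 obtain c where c: "c \<in> atlas M" "x \<in> cdom c" using atlas_cover[OF x(1)] by blast
 let ?y0 = "coord c x"
 have "Ck_on 2 (local_expr c (bdist_real M)) (coord c ` (collar M \<rho> Int cdom c))"
  using C2 c(1) unfolding Ck_fun_on_def by blast
 moreover have y0c: "?y0 \<in> coord c ` (collar M \<rho> Int cdom c)" using x c by (auto simp: collar_def)
 ultimately obtain W h where W: "open W" "?y0 \<in> W" "Ck_on_open 2 h W"
  "ALL y:coord c ` (collar M \<rho> Int cdom c) Int W. h y = local_expr c (bdist_real M) y"
  unfolding Ck_on_def by meson
 have hd: "bdist M z = ennreal (h (coord c z)) & h (coord c z) >= 0"
  if z: "z \<in> cdom c" "coord c z \<in> W" "bdist M z <= ennreal \<rho>" for z
 proof -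
  have "z \<in> collar M \<rho> Int cdom c" using z atlasD(4)[OF c(1)] by (auto simp: collar_def)
  then have "h (coord c z) = bdist_real M z" using W(4) z c(1) by (simp add: local_expr_def)
  moreover have "bdist M z < top" using z(3) by (metis ennreal_less_top order_le_less_trans)
  ultimately show ?thesis by (simp add: bdist_real_def ennreal_enn2real less_top)
 qed
 have h1: "Ck_on_open 1 h W" by (rule Ck_on_open_mono[OF W(3)]) simp
 obtain R0 where R0: "R0 > 0" "cball ?y0 R0 Int HS <= rng c Int W" using chart_half_ball[OF c W(1,2)] .
 define p where "p y = (\<chi> i. pdv i h y)" for y
 show thesis
 proof (cases "?y0 $ kk > 0")
  case True
  have "p ?y0 \<bullet> (matrix_inv (metric M c x) *v p ?y0) >= 1"
   unfolding p_def by (rule gradient_lower_bound[OF c True W(1,2) h1 hd x(2)])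
  then have "p ?y0 ~= 0" by auto
  then obtain j where j: "pdv j h ?y0 ~= 0" by (auto simp: p_def vec_eq_iff)
  have xi: "x \<in> interior_of_mfd M" using interior_iff[OF c] True by simp
  then have "h ?y0 > 0" using bdist_interior_pos[OF xi] hd[OF c(2) W(2) x(2)] by (auto simp: order_le_less)
  define U0 where "U0 = (ball ?y0 R0 Int {y. y $ kk > 0}) Int (W Int h -` {0<..})"
  have "open (W Int h -` {0<..})"
   by (rule continuous_open_preimage[OF Ck_on_open_continuous[OF W(3)] W(1)]) simp
  moreover have "open {y::real^'n. y $ kk > 0}" by (intro open_Collect_less continuous_intros)
  ultimately have U0: "open U0" unfolding U0_def by (simp add: open_Int)
  show thesis
  proof (rule straightened_chart[OF c \<rho> x(2) U0, of h j])
   show "?y0 \<in> U0" using True W(2) \<open>h ?y0 > 0\<close> R0(1) by (simp add: U0_def)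
   show "U0 Int HS <= rng c" using R0(2) by (force simp: U0_def)
   show "Ck_on_open 2 h U0" by (rule Ck_on_open_subset[OF W(3)]) (auto simp: U0_def)
   show "!!z. z \<in> cdom c ==> coord c z \<in> U0 ==> bdist M z <= ennreal \<rho> ==> bdist M z = ennreal (h (coord c z))"
    using hd by (simp add: U0_def)
  qed (insert j that, auto simp: U0_def)
 next
  case False
  then have y0: "?y0 $ kk = 0" using coord_nonneg[OF c] by simp
  have bx: "x \<in> boundary M" using boundary_iff[OF c] y0 by simp
  have "openin (top_of_set HS) (coord c ` (cdom c Int {w \<in> X. bdist M w < ennreal \<rho>}))"
   by (rule open_in_chart[OF c(1) bdist_sublevel_open])
  then obtain T where T: "open T" "coord c ` (cdom c Int {w \<in> X. bdist M w < ennreal \<rho>}) = HS Int T" by (auto simp: openin_open)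
  have "?y0 \<in> HS Int T" unfolding T(2)[symmetric] using x c \<rho> bdist_boundary[OF bx] by auto
  then obtain R1 where R1: "R1 > 0" "ball ?y0 R1 <= T Int W" using open_contains_ball[of "T Int W"] T(1) W(1,2) by blast
  define R where "R = min R0 R1"
  have R: "R > 0" using R0 R1 by (simp add: R_def)
  have BW: "ball ?y0 R <= W" using R1 by (auto simp: R_def)
  have Br: "ball ?y0 R Int HS <= rng c" using R0 by (auto simp: R_def)
  have hb: "bdist M (coord_inv c y) = ennreal (h y) & h y >= 0 & bdist M (coord_inv c y) < ennreal \<rho>" if y: "y \<in> ball ?y0 R Int HS" for y
  proof -
   have "y \<in> HS Int T" using y R1 by (auto simp: R_def)
   then obtain w where w: "w \<in> cdom c" "bdist M w < ennreal \<rho>" "y = coord c w" unfolding T(2)[symmetric] by auto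
   then show ?thesis using hd[of w] y BW c(1) by auto
  qed
  have h0: "h y = 0" if "y \<in> ball ?y0 R" "y $ kk = 0" for y
  proof -
   have y: "y \<in> ball ?y0 R Int HS" using that by (simp add: half_space_def)
   then have yr: "y \<in> rng c" using Br by auto
   have "coord_inv c y \<in> boundary M" using boundary_iff[OF c(1), of "coord_inv c y"] yr c(1) that(2) by simp
   from bdist_boundary[OF this] show ?thesis using hb[OF y] by (simp add: ennreal_eq_0_iff)
  qed
  have hder: "(h has_derivative frechet_derivative h (at y)) (at y)" if "y \<in> W" for y
   by (rule Ck_on_open_SucD[OF h1[unfolded One_nat_def] that])
  let ?l = "%t. ?y0 + t *R axis kk 1"
  have lB: "?l t \<in> ball ?y0 R Int HS" if "t \<in> {0..R / 2}" for t
   using that y0 R by (auto simp: dist_norm half_space_def)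
  have pt: "p (?l t) \<bullet> (matrix_inv (gloc c (?l t)) *v p (?l t)) >= 1" if t: "t \<in> {0<..R/2}" for t
  proof -
   have m: "?l t \<in> ball ?y0 R Int HS" using lB t by simp
   then have r: "?l t \<in> rng c" using Br by blast
   have w: "coord_inv c (?l t) \<in> cdom c" "coord c (coord_inv c (?l t)) = ?l t" using r c(1) by auto
   have "(\<chi> i. pdv i h (coord c (coord_inv c (?l t)))) \<bullet>
     (matrix_inv (metric M c (coord_inv c (?l t))) *v (\<chi> i. pdv i h (coord c (coord_inv c (?l t))))) >= 1"
    by (rule gradient_lower_bound[OF c(1) w(1) _ W(1) _ h1 hd])
     (insert w t y0 m BW hb[OF m], auto intro: less_imp_le)
   then show ?thesis by (simp add: p_def w gloc_def)
  qed
  have pc: "continuous_on W (%y. p y $ i)" for i using h1 by (simp add: p_def)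
  have lc: "continuous_on {0..R/2} ?l" by (intro continuous_intros)
  have c1: "continuous_on {0..R/2} (%t. p (?l t) $ i)" for i
   by (rule continuous_on_compose2[OF pc lc]) (use lB BW in blast)
  have c2: "continuous_on {0..R/2} (%t. matrix_inv (gloc c (?l t)) $ i $ j)" for i j
   by (rule continuous_on_compose2[OF ginv_continuous[OF c(1)] lc]) (use lB Br in blast)
  have "continuous_on {0..R/2} (%t. SUM i:UNIV. SUM j:UNIV. p (?l t) $ i * p (?l t) $ j * matrix_inv (gloc c (?l t)) $ i $ j)"
   by (intro continuous_intros c1 c2)
  then have "continuous_on (closure {0<..<R/2}) (%t. p (?l t) \<bullet> (matrix_inv (gloc c (?l t)) *v p (?l t)))"
   using R by (simp add: inner_matrix_vector_sum closure_greaterThanLessThan)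
  then have "p (?l 0) \<bullet> (matrix_inv (gloc c (?l 0)) *v p (?l 0)) >= 1"
   by (rule continuous_ge_on_closure) (insert pt R, auto simp: closure_greaterThanLessThan)
  then have pne: "p ?y0 ~= 0" by auto
  have lin0: "linear (frechet_derivative h (at ?y0))" by (rule has_derivative_linear[OF hder[OF W(2)]])
  have tang: "pdv i h ?y0 = 0" if i: "i ~= kk" for i
  proof -
   have "((%t. h (?y0 + t *R axis i 1)) has_real_derivative pdv i h ?y0) (at 0)"
    by (rule has_real_derivative_along_line) (simp add: hder W(2))
   moreover have "((%t. h (?y0 + t *R axis i 1)) has_real_derivative 0) (at 0)"
   proof (rule DERIV_cong_ev[THEN iffD2, OF refl _ refl, OF _ DERIV_const[of 0]])
    show "\<forall>\<^sub>F t in nhds 0. h (?y0 + t *R axis i 1) = 0"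
     unfolding eventually_nhds
    proof (intro exI[of _ "ball 0 R"] conjI ballI)
     fix t assume "t \<in> ball (0::real) R"
     then show "h (?y0 + t *R axis i 1) = 0"
     proof (intro h0)
      show "?y0 + t *R axis i 1 \<in> ball ?y0 R" using \<open>t \<in> ball 0 R\<close> by (simp add: dist_norm)
      show "(?y0 + t *R axis i 1) $ kk = 0" using i y0 by (simp add: axis_def)
     qed
    qed (use R in auto)
   qed
   ultimately show ?thesis by (rule DERIV_unique)
  qed
  have pk: "pdv kk h ?y0 ~= 0"
  proof
   assume "pdv kk h ?y0 = 0"
   then have "pdv i h ?y0 = 0" for i using tang by (cases "i = kk") auto
   then show False using pne by (simp add: p_def vec_eq_iff)
  qed
  have dk: "((%t. h (y + t *R axis kk 1)) has_real_derivative pdv kk h (y + t *R axis kk 1)) (at t)"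
   if "y + t *R axis kk 1 \<in> W" for y t
   by (rule has_real_derivative_along_line) (rule hder[OF that])
  have pkpos: "pdv kk h ?y0 > 0"
  proof (rule ccontr)
   assume "~ ?thesis"
   then have neg: "pdv kk h ?y0 < 0" using pk by simp
   have "((%t. h (?l t)) has_real_derivative pdv kk h ?y0) (at 0)" using dk[of ?y0 0] W(2) by simp
   from DERIV_neg_dec_right[OF this neg] obtain s where s: "s > 0" "!!t. 0 < t ==> t < s ==> h (?l t) < h ?y0" by auto
   define t where "t = min s R / 2"
   have t: "0 < t" "t < s" "t <= R / 2" using s R by (auto simp: t_def)
   have "h (?l t) >= 0" using hb[OF lB[of t]] t by simp
   moreover have "h ?y0 = 0" by (rule h0) (use R y0 in auto)
   ultimately show False using s(2)[OF t(1,2)] by simp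
  qed
  have "continuous_on W (%y. pdv kk h y)" using h1 by simp
  from continuous_open_preimage[OF this W(1) open_greaterThan[of 0]]
  have "open (W Int (%y. pdv kk h y) -` {0<..})" .
  moreover have "?y0 \<in> W Int (%y. pdv kk h y) -` {0<..}" using W(2) pkpos by simp
  ultimately obtain R2 where R2: "R2 > 0" "ball ?y0 R2 <= W Int (%y. pdv kk h y) -` {0<..}"
   using open_contains_ball by blast
  define U0 where "U0 = ball ?y0 (min R R2)"
  have sg: "y $ kk >= 0 \<longleftrightarrow> h y >= 0" if y: "y \<in> U0" for y
  proof (cases "y $ kk >= 0")
   case True
   then have "y \<in> ball ?y0 R Int HS" using y by (auto simp: U0_def half_space_def)
   then show ?thesis using hb True by blast
  next
   case False
   define b where "b = - (y $ kk)"
   have b: "b > 0" using False by (simp add: b_def)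
   have mem: "y + t *R axis kk 1 \<in> U0" if t: "0 <= t" "t <= b" for t
   proof -
    have "norm (y + t *R axis kk 1 - ?y0) <= norm (y - ?y0)"
    proof (rule norm_le_componentwise_cart)
     show "norm ((y + t *R axis kk 1 - ?y0) $ i) <= norm ((y - ?y0) $ i)" for i
      using t y0 by (cases "i = kk") (auto simp: b_def axis_def)
    qed
    then show ?thesis using y by (simp add: U0_def dist_norm norm_minus_commute)
   qed
   have "!!t. 0 <= t ==> t <= b ==> ((%t. h (y + t *R axis kk 1)) has_real_derivative
     pdv kk h (y + t *R axis kk 1)) (at t)"
    using mem R2 by (intro dk) (auto simp: U0_def)
   from MVT2[OF b this] obtain t where t: "0 < t" "t < b"
    "h (y + b *R axis kk 1) - h (y + 0 *R axis kk 1) = (b - 0) * pdv kk h (y + t *R axis kk 1)" by blast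
   have "y + t *R axis kk 1 \<in> ball ?y0 R2" using mem[of t] t by (simp add: U0_def)
   then have "pdv kk h (y + t *R axis kk 1) > 0" using R2(2) by auto
   then have "h (y + b *R axis kk 1) - h y > 0" using t(3) b by simp
   moreover have "h (y + b *R axis kk 1) = 0"
    by (rule h0) (insert mem[of b] b, auto simp: U0_def b_def)
   ultimately show ?thesis using False by simp
  qed
  show thesis
  proof (rule straightened_chart[OF c \<rho> x(2), of U0 h kk])
   show "open U0" "?y0 \<in> U0" using R R2 by (auto simp: U0_def)
   show "U0 Int HS <= rng c" using Br by (auto simp: U0_def)
   show "Ck_on_open 2 h U0" by (rule Ck_on_open_subset[OF W(3)]) (insert BW, auto simp: U0_def)
   show "!!z. z \<in> cdom c ==> coord c z \<in> U0 ==> bdist M z <= ennreal \<rho> ==> bdist M z = ennreal (h (coord c z))"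
    using hd BW by (auto simp: U0_def)
  qed (use sg pk that in auto)
 qed
qed

text \<open>The distinguished coordinate is the distance, whose gradient has norm one where \<open>0 < d < \<rho>\<close>; the extreme values
 follow by continuity.\<close>

lemma ccoord_inverse_metric:
 assumes d: "ccoord \<rho> d z0 r" and \<rho>: "\<rho> > 0" and z: "z \<in> rng d" "z $ kk <= \<rho>"
 shows "matrix_inv (gloc d z) $ kk $ kk = 1"
proof -
 have dA: "d \<in> atlas M" and rd: "rng d = ball z0 r Int HS"
  and val: "!!x. x \<in> cdom d ==> bdist M x <= ennreal \<rho> \<longleftrightarrow> coord d x $ kk <= \<rho>"
   "!!x. x \<in> cdom d ==> coord d x $ kk <= \<rho> ==> bdist M x = ennreal (coord d x $ kk)"
  using d by (auto simp: ccoord_def)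
 have ax: "axis kk 1 \<bullet> (A *v axis kk 1) = A $ kk $ kk" for A :: "real ^ 'n ^ 'n"
  by (simp add: inner_axis' matrix_vector_mult_basis column_def)
 have hder: "((%y. y $ kk) has_derivative (%v. axis kk 1 \<bullet> v)) (at y)" for y :: "real ^ 'n"
  by (simp add: inner_axis' bounded_linear_imp_has_derivative bounded_linear_vec_nth)
 have fd: "(\<chi> i. pdv i (%y::real^'n. y $ kk) y) = axis kk 1" for y
 proof -
  have "frechet_derivative (%y::real^'n. y $ kk) (at y) = (%v. axis kk 1 \<bullet> v)"
   by (rule frechet_derivative_at[OF hder, symmetric])
  then show ?thesis by (simp add: vec_eq_iff inner_axis') (simp add: axis_def)
 qed
 have inner: "matrix_inv (gloc d y) $ kk $ kk = 1" if y: "y \<in> rng d" "0 < y $ kk" "y $ kk < \<rho>" for y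
 proof (rule antisym)
  let ?x = "coord_inv d y"
  have x: "?x \<in> cdom d" "coord d ?x = y" using y dA by auto
  have "axis kk 1 \<bullet> (matrix_inv (metric M d ?x) *v axis kk 1) >= (1::real)"
   unfolding fd[of "coord d ?x", symmetric]
  proof (rule gradient_lower_bound[OF dA x(1) _ open_UNIV])
   show "Ck_on_open 1 (%y::real^'n. y $ kk) UNIV" by (rule Ck_on_open_linear[OF bounded_linear_vec_nth open_UNIV])
   show "bdist M w = ennreal (coord d w $ kk) & 0 <= coord d w $ kk" if "w \<in> cdom d" "bdist M w <= ennreal \<rho>" for w
    using val that coord_nonneg[OF dA that(1)] by simp
   show "bdist M ?x <= ennreal \<rho>" using val(1)[OF x(1)] x(2) y by simp
  qed (use x y in auto)
  then show "1 <= matrix_inv (gloc d y) $ kk $ kk" by (simp add: ax gloc_def)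
  let ?V = "ball z0 r Int {y. 0 < y $ kk} Int {y. y $ kk < \<rho>}"
  have "axis kk 1 \<bullet> (matrix_inv (gloc d y) *v axis kk 1) <= (1::real)"
  proof (rule gradient_upper_bound[OF dA, of ?V])
   show "open ?V" by (intro open_Int open_ball open_Collect_less continuous_intros)
   show V: "?V <= rng d" unfolding rd by (auto simp: half_space_def)
   show "bdist M (coord_inv d w) = ennreal (w $ kk) & 0 <= w $ kk" if "w \<in> ?V" for w
    using val(2)[of "coord_inv d w"] that V dA by auto
  qed (use y rd hder in auto)
  then show "matrix_inv (gloc d y) $ kk $ kk <= 1" by (simp add: ax)
 qed
 have zb: "z \<in> ball z0 r" "z $ kk >= 0" using z rd by (auto simp: half_space_def)
 obtain s where s: "s > 0" "ball z s <= ball z0 r" using openE[OF open_ball zb(1)] by blast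
 define e where "e = min s \<rho> / 2"
 have e: "e > 0" "e < s" "e < \<rho>" using s \<rho> by (auto simp: e_def)
 \<comment> \<open>the sign of a step in the distinguished direction that leads from \<open>z\<close> into the open slab\<close>
 define \<sigma> where "\<sigma> = (if z $ kk < \<rho> / 2 then 1 else - 1 :: real)"
 let ?l = "%t. z + (t * \<sigma>) *R axis kk 1"
 define e' where "e' = min e (\<rho> / 4)"
 have e': "e' > 0" "e' < s" "e' < \<rho> / 2" using e \<rho> by (auto simp: e'_def)
 have lk: "?l t $ kk = z $ kk + t * \<sigma>" for t by simp
 have lb: "?l t \<in> ball z s" if "0 <= t" "t <= e'" for t using that e' by (auto simp: dist_norm \<sigma>_def)
 have lr: "?l t \<in> rng d" if "0 <= t" "t <= e'" for t
 proof -
  have "?l t \<in> ball z0 r" using lb[OF that] s(2) by blast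
  moreover have "?l t $ kk >= 0" unfolding lk using that zb e' by (auto simp: \<sigma>_def)
  ultimately show ?thesis unfolding rd half_space_def by blast
 qed
 have "continuous_on {0..e'} (%t. matrix_inv (gloc d (?l t)) $ kk $ kk)"
 proof (rule continuous_on_compose2[OF ginv_continuous[OF dA]])
  show "continuous_on {0..e'} ?l" by (intro continuous_intros)
  show "?l ` {0..e'} <= rng d" using lr by auto
 qed
 then have cc: "continuous_on (closure {0<..<e'}) (%t. matrix_inv (gloc d (?l t)) $ kk $ kk)"
  using e' by (simp add: closure_greaterThanLessThan)
 have "matrix_inv (gloc d (?l 0)) $ kk $ kk = 1"
 proof (rule continuous_constant_on_closure[OF cc])
  fix t assume "t \<in> {0<..<e'}"
  then show "matrix_inv (gloc d (?l t)) $ kk $ kk = 1"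
   by (intro inner lr) (insert zb z e', auto simp: \<sigma>_def)
 qed (insert e', auto simp: closure_greaterThanLessThan)
 then show ?thesis by simp
qed

end

section \<open>Integration over coordinate hyperplanes\<close>

text \<open>Change of variables is carried out over a well-ordered index type; this copy of an arbitrary finite index
 type carries a well-order.\<close>

typedef (overloaded) ('n::finite) widx = "UNIV :: 'n set" by auto

instantiation widx :: (finite) wellorder
begin

definition less_eq_widx :: "'a widx => 'a widx => bool" where
 "x <= y \<longleftrightarrow> to_nat_on (UNIV :: 'a set) (Rep_widx x) <= to_nat_on (UNIV :: 'a set) (Rep_widx y)"

definition less_widx :: "'a widx => 'a widx => bool" where
 "x < y \<longleftrightarrow> to_nat_on (UNIV :: 'a set) (Rep_widx x) < to_nat_on (UNIV :: 'a set) (Rep_widx y)"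

instance
proof
 fix x y :: "'a widx"
 have inj: "inj_on (to_nat_on (UNIV :: 'a set)) UNIV" by (simp add: countable_finite inj_on_to_nat_on)
 show "x <= y ==> y <= x ==> x = y"
  using injD[OF inj, of "Rep_widx x" "Rep_widx y"] by (simp add: less_eq_widx_def Rep_widx_inject)
 show "(!!x. (!!y. y < x ==> P y) ==> P x) ==> P a" for P and a :: "'a widx"
  by (rule measure_induct_rule[of "%x. to_nat_on (UNIV :: 'a set) (Rep_widx x)"]) (simp add: less_widx_def)
qed (auto simp: less_eq_widx_def less_widx_def)

end

instance widx :: (finite) finite
proof
 have "finite (range (Abs_widx :: 'a => 'a widx))" by (rule finite_imageI[OF finite])
 moreover have "(UNIV :: 'a widx set) <= range (Abs_widx :: 'a => 'a widx)"
 proof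
  fix x :: "'a widx" show "x \<in> range Abs_widx" using Rep_widx_inverse[of x] by (metis rangeI)
 qed
 ultimately show "finite (UNIV :: 'a widx set)" by (rule finite_subset[rotated])
qed

definition to_w :: "real ^ 'n::finite => real ^ 'n widx" where "to_w y = (\<chi> i. y $ Rep_widx i)"
definition of_w :: "real ^ 'n widx => real ^ 'n::finite" where "of_w z = (\<chi> i. z $ Abs_widx i)"

lemma Rep_Abs_widx [simp]: "Rep_widx (Abs_widx i) = i" by (simp add: Abs_widx_inverse)

lemma to_of_w [simp]: "to_w (of_w z) = z" "of_w (to_w y) = y"
 by (simp_all add: to_w_def of_w_def vec_eq_iff Rep_widx_inverse)

lemma bij_widx: "bij Abs_widx" "bij Rep_widx"
 by (rule o_bij[of Rep_widx], simp_all add: fun_eq_iff Rep_widx_inverse)+ (rule o_bij[of Abs_widx], simp_all add: fun_eq_iff Rep_widx_inverse)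

lemma linear_w: "linear to_w" "linear of_w"
 by (auto intro!: linearI simp: to_w_def of_w_def vec_eq_iff)

lemma bounded_linear_w: "bounded_linear to_w" "bounded_linear of_w"
 using linear_w linear_conv_bounded_linear by blast+

lemma prod_Basis_cart: "(\<Prod>b\<in>Basis. f b) = (\<Prod>i\<in>UNIV. f (axis i 1))" for f :: "real ^ 'n::finite => 'a::comm_monoid_mult"
proof -
 have B: "(Basis :: (real ^ 'n) set) = (%i. axis i 1) ` UNIV" by (auto simp: Basis_vec_def)
 have inj: "inj (%i. axis i (1::real) :: real ^ 'n)" by (auto intro!: injI simp: axis_eq_axis)
 show ?thesis unfolding B by (subst prod.reindex[OF inj]) simp
qed

lemma measurable_w [measurable]: "to_w \<in> borel_measurable borel" "of_w \<in> borel_measurable borel"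
 using bounded_linear_w by (auto intro!: borel_measurable_continuous_onI linear_continuous_on)

lemma lborel_to_w: "(lborel :: (real ^ ('n::finite) widx) measure) = distr lborel borel to_w"
proof (rule lborel_eqI)
 fix l u :: "real ^ 'n widx" assume le: "!!b. b \<in> Basis ==> l \<bullet> b <= u \<bullet> b"
 have le': "l $ i <= u $ i" for i using le[of "axis i 1"] by (simp add: inner_axis)
 have pre: "to_w -` box l u = box (of_w l) (of_w u :: real ^ 'n)"
 proof -
  have "(ALL i. l $ i < y $ Rep_widx i & y $ Rep_widx i < u $ i) \<longleftrightarrow> (ALL i. l $ Abs_widx i < y $ i & y $ i < u $ Abs_widx i)" for y :: "real ^ 'n"
   by (metis Rep_Abs_widx Rep_widx_inverse)
  then show ?thesis by (auto simp: mem_box_cart to_w_def of_w_def)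
 qed
 have "emeasure (distr lborel borel to_w) (box l u) = emeasure lborel (box (of_w l) (of_w u :: real ^ 'n))"
  by (subst emeasure_distr) (auto simp: pre)
 also have "... = ennreal (\<Prod>i\<in>UNIV. u $ Abs_widx i - l $ Abs_widx (i :: 'n))"
 proof (subst emeasure_lborel_box)
  fix b :: "real ^ 'n" assume "b \<in> Basis"
  then obtain i where "b = axis i 1" by (auto simp: Basis_vec_def)
  then show "of_w l \<bullet> b <= of_w u \<bullet> b" using le' by (simp add: of_w_def inner_axis)
 qed (simp add: prod_Basis_cart of_w_def inner_axis)
 also have "(\<Prod>i\<in>UNIV. u $ Abs_widx i - l $ Abs_widx (i :: 'n)) = (\<Prod>i\<in>UNIV. u $ i - l $ i)"
  by (rule prod.reindex_bij_betw[OF bij_widx(1), of "%i. u $ i - l $ i"])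
 finally show "emeasure (distr lborel borel to_w) (box l u) = ennreal (\<Prod>b\<in>Basis. (u - l) \<bullet> b)"
  by (simp add: prod_Basis_cart inner_axis)
qed simp

lemma nn_integral_to_w:
 assumes "f \<in> borel_measurable borel"
 shows "(\<integral>\<^sup>+z. f z \<partial>(lborel :: (real ^ ('n::finite) widx) measure)) = (\<integral>\<^sup>+y. f (to_w y) \<partial>lborel)"
 using assms by (subst lborel_to_w, subst nn_integral_distr) auto

lemma det_w:
 fixes A :: "real ^ 'n::finite ^ 'n"
 shows "det (\<chi> i j. A $ Rep_widx i $ Rep_widx j) = det A"
proof -
 let ?f = "%\<pi> x. Abs_widx (\<pi> (Rep_widx x)) :: 'n widx"
 have inv: "inv_into UNIV Abs_widx x = Rep_widx x" for x :: "'n widx"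
  by (metis Rep_Abs_widx bij_betw_inv_into_right bij_widx(1) UNIV_I)
 have bij: "bij_betw ?f {\<pi>. \<pi> permutes UNIV} {\<pi>. \<pi> permutes UNIV}"
 proof -
  have "(%\<pi> x. if x \<in> UNIV then Abs_widx (\<pi> (inv_into UNIV Abs_widx x)) else x) = ?f"
   by (simp add: inv fun_eq_iff)
  with bij_betw_permutations[OF bij_widx(1)] show ?thesis by (rule back_subst)
 qed
 have sgn: "sign (?f \<pi>) = sign \<pi>" if "\<pi> permutes UNIV" for \<pi> :: "'n => 'n"
 proof -
  have "map_permutation UNIV Abs_widx \<pi> = ?f \<pi>"
   using bij_is_surj[OF bij_widx(1)] by (auto simp: map_permutation_def restrict_id_def fun_eq_iff inv)
  then show ?thesis using sign_map_permutation[of Abs_widx UNIV \<pi>] that bij_is_inj[OF bij_widx(1)] by simp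
 qed
 have "det (\<chi> i j. A $ Rep_widx i $ Rep_widx j)
   = (\<Sum>\<pi>\<in>{\<pi>. \<pi> permutes UNIV}. of_int (sign (?f \<pi>)) * (\<Prod>i\<in>UNIV. A $ Rep_widx i $ Rep_widx (?f \<pi> i)))"
  unfolding det_def by (subst sum.reindex_bij_betw[OF bij, symmetric]) simp
 also have "... = (\<Sum>\<pi>\<in>{\<pi>. \<pi> permutes UNIV}. of_int (sign \<pi>) * (\<Prod>i\<in>UNIV. A $ i $ \<pi> i))"
 proof (intro sum.cong refl)
  fix \<pi> :: "'n => 'n" assume "\<pi> \<in> {\<pi>. \<pi> permutes UNIV}"
  then have "of_int (sign (?f \<pi>)) = (of_int (sign \<pi>) :: real)" using sgn by simp
  moreover have "(\<Prod>i\<in>UNIV. A $ Rep_widx i $ Rep_widx (?f \<pi> i)) = (\<Prod>i\<in>UNIV. A $ i $ \<pi> i)"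
   using prod.reindex_bij_betw[OF bij_widx(2), of "%i. A $ i $ \<pi> i"] by simp
  ultimately show "of_int (sign (?f \<pi>)) * (\<Prod>i\<in>UNIV. A $ Rep_widx i $ Rep_widx (?f \<pi> i))
   = of_int (sign \<pi>) * (\<Prod>i\<in>UNIV. A $ i $ \<pi> i)" by simp
 qed
 finally show ?thesis by (simp add: det_def)
qed

lemma nn_integral_eq_absolute_integral:
 fixes h :: "'a::euclidean_space => real"
 assumes S: "S \<in> sets borel" and h: "!!x. x \<in> S ==> h x >= 0" and m: "(%x. indicator S x * h x) \<in> borel_measurable borel"
 shows "(\<integral>\<^sup>+x. ennreal (indicator S x * h x) \<partial>lborel) =
  (if h absolutely_integrable_on S then ennreal (integral S h) else \<infinity>)"
proof -
 have nn: "indicator S x * h x >= 0" for x using h by (auto simp: indicator_def)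
 have iff: "h absolutely_integrable_on S \<longleftrightarrow> integrable lborel (%x. indicator S x * h x)"
  unfolding set_integrable_def using integrable_completion[of "%x. indicator S x * h x" lborel] m by simp
 show ?thesis
 proof (cases "h absolutely_integrable_on S")
  case True
  then have i: "integrable lborel (%x. indicator S x * h x)" using iff by simp
  have "(\<integral>\<^sup>+x. ennreal (indicator S x * h x) \<partial>lborel) = ennreal (LBINT x. indicator S x * h x)"
   by (rule nn_integral_eq_integral[OF i]) (simp add: nn)
  also have "(LBINT x. indicator S x * h x) = integral S h"
   using set_borel_integral_eq_integral(2)[of S h] i by (simp add: set_integrable_def set_lebesgue_integral_def)
  finally show ?thesis using True by simp
 next
  case False
  then have "~ (\<integral>\<^sup>+x. ennreal (indicator S x * h x) \<partial>lborel) < \<infinity>"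
   using iff m nn by (auto simp: integrable_iff_bounded)
  then show ?thesis using False by (simp add: less_top[symmetric])
 qed
qed

lemma nn_change_of_variables_w:
 fixes g :: "real ^ 'm::{finite,wellorder} => real ^ 'm::_" and f :: "real ^ 'm::_ => real"
 assumes S: "S \<in> sets borel" "g ` S \<in> sets borel"
  and der: "!!x. x \<in> S ==> (g has_derivative g' x) (at x within S)" and inj: "inj_on g S"
  and f: "!!y. f y >= 0" "(%y. indicator (g ` S) y * f y) \<in> borel_measurable borel"
  and m: "(%x. indicator S x * (\<bar>det (matrix (g' x))\<bar> * f (g x))) \<in> borel_measurable borel"
 shows "(\<integral>\<^sup>+x. ennreal (indicator S x * (\<bar>det (matrix (g' x))\<bar> * f (g x))) \<partial>lborel)
   = (\<integral>\<^sup>+y. ennreal (indicator (g ` S) y * f y) \<partial>lborel)"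
proof -
 have SL: "S \<in> sets lebesgue" using S(1) by simp
 have *: "(%x. \<bar>det (matrix (g' x))\<bar> * f (g x)) absolutely_integrable_on S &
    integral S (%x. \<bar>det (matrix (g' x))\<bar> * f (g x)) = b
   \<longleftrightarrow> f absolutely_integrable_on (g ` S) & integral (g ` S) f = b" for b
  using has_absolute_integral_change_of_variables[OF SL der inj, of "%y. vec (f y) :: real ^ 1" "vec b"]
  unfolding absolutely_integrable_on_1_iff integral_on_1_eq by (simp add: vec_eq_iff)
 show ?thesis
  using *[of "integral S (%x. \<bar>det (matrix (g' x))\<bar> * f (g x))"] *[of "integral (g ` S) f"]
  by (subst (1 2) nn_integral_eq_absolute_integral) (auto simp: S f m)
qed

lemma nn_change_of_variables:
 fixes g :: "real ^ 'n::finite => real ^ 'n" and f :: "real ^ 'n => real"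
 assumes S: "S \<in> sets borel" "g ` S \<in> sets borel"
  and der: "!!x. x \<in> S ==> (g has_derivative g' x) (at x within S)" and inj: "inj_on g S"
  and f: "!!y. f y >= 0" "(%y. indicator (g ` S) y * f y) \<in> borel_measurable borel"
  and m: "(%x. indicator S x * (\<bar>det (matrix (g' x))\<bar> * f (g x))) \<in> borel_measurable borel"
 shows "(\<integral>\<^sup>+x. ennreal (indicator S x * (\<bar>det (matrix (g' x))\<bar> * f (g x))) \<partial>lborel)
   = (\<integral>\<^sup>+y. ennreal (indicator (g ` S) y * f y) \<partial>lborel)"
proof -
 let ?S = "to_w ` S" and ?g = "%z. to_w (g (of_w z))" and ?g' = "%z v. to_w (g' (of_w z) (of_w v))"
 let ?f = "%z. f (of_w z)"
 have im: "to_w ` A = of_w -` A" for A :: "(real ^ 'n) set"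
  by (auto simp: image_iff) (metis to_of_w(1))
 have meas: "to_w ` A \<in> sets borel" if "A \<in> sets borel" for A :: "(real ^ 'n) set"
  using measurable_sets[OF measurable_w(2) that] by (simp add: im)
 have gim: "?g ` ?S = to_w ` (g ` S)" by (simp add: image_image)
 have ind: "indicator (to_w ` A) z = (indicator A (of_w z) :: real)" for A :: "(real ^ 'n) set" and z
  unfolding im by (simp add: indicator_def)
 have ofw: "of_w ` ?S = S" by (simp add: image_image)
 have der': "(?g has_derivative ?g' z) (at z within ?S)" if z: "z \<in> ?S" for z
 proof -
  have "of_w z \<in> S" using z by auto
  have 1: "(of_w has_derivative of_w) (at z within ?S)"
   by (rule bounded_linear_imp_has_derivative[OF bounded_linear_w(2)])
  have 2: "(g has_derivative g' (of_w z)) (at (of_w z) within of_w ` ?S)" unfolding ofw by (rule der) fact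
  from diff_chain_within[OF 1 2]
  have "((%z. g (of_w z)) has_derivative (%v. g' (of_w z) (of_w v))) (at z within ?S)" by (simp add: o_def)
  from bounded_linear.has_derivative[OF bounded_linear_w(1) this] show ?thesis .
 qed
 have det: "det (matrix (?g' z)) = det (matrix (g' (of_w z)))" if "z \<in> ?S" for z
 proof -
  have ax: "of_w (axis j 1) = axis (Rep_widx j) (1::real)" for j :: "'n widx"
   by (auto simp: of_w_def axis_def vec_eq_iff Rep_widx_inverse)
  have "matrix (?g' z) = (\<chi> i j. matrix (g' (of_w z)) $ Rep_widx i $ Rep_widx j)"
   by (simp add: matrix_def vec_eq_iff ax to_w_def)
  then show ?thesis by (simp only: det_w)
 qed
 let ?m = "%x. indicator S x * (\<bar>det (matrix (g' x))\<bar> * f (g x))"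
 have me: "indicator ?S z * (\<bar>det (matrix (?g' z))\<bar> * ?f (?g z)) = ?m (of_w z)" for z
  using det[of z] ind[of S z] by (cases "z \<in> ?S") (auto simp: indicator_def)
 have mb: "(%z. ?m (of_w z)) \<in> borel_measurable borel" using measurable_compose[OF measurable_w(2) m] .
 have fb: "(%z. indicator (g ` S) (of_w z) * f (of_w z)) \<in> borel_measurable borel"
  using measurable_compose[OF measurable_w(2) f(2)] .
 have main: "(\<integral>\<^sup>+z. ennreal (indicator ?S z * (\<bar>det (matrix (?g' z))\<bar> * ?f (?g z))) \<partial>lborel)
   = (\<integral>\<^sup>+y. ennreal (indicator (?g ` ?S) y * ?f y) \<partial>lborel)"
 proof (rule nn_change_of_variables_w)
  show "inj_on ?g ?S" using inj by (auto simp: inj_on_def) (metis to_of_w(2))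
  show "?S \<in> sets borel" "?g ` ?S \<in> sets borel" unfolding gim using S by (auto intro: meas)
  show "(%z. indicator (?g ` ?S) z * ?f z) \<in> borel_measurable borel" unfolding gim ind by (rule fb)
  show "(%z. indicator ?S z * (\<bar>det (matrix (?g' z))\<bar> * ?f (?g z))) \<in> borel_measurable borel"
   unfolding me by (rule mb)
 qed (use f der' in auto)
 have "(\<integral>\<^sup>+z. ennreal (?m (of_w z)) \<partial>lborel)
   = (\<integral>\<^sup>+z. ennreal (indicator (g ` S) (of_w z) * f (of_w z)) \<partial>lborel)"
  using main[unfolded me, unfolded gim ind] .
 then show ?thesis
  by (subst (asm) (1 2) nn_integral_to_w) (use mb fb in auto)
qed

lemma lborel_PiM: "(lborel :: (real ^ 'n::finite) measure) = distr (Pi\<^sub>M UNIV (%_. lborel)) borel (%z. \<chi> i. z i)"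
proof (rule lborel_eqI)
 interpret product_sigma_finite "%_::'n. lborel :: real measure" by standard
 have comp: "(%z. (\<chi> i. (z i :: real))) \<in> borel_measurable (Pi\<^sub>M (UNIV :: 'n set) (%_. lborel))"
 proof (subst borel_measurable_euclidean_space, intro ballI)
  fix b :: "real ^ 'n" assume "b \<in> Basis"
  then obtain j where b: "b = axis j 1" by (auto simp: Basis_vec_def)
  have "(%z. z j) \<in> measurable (Pi\<^sub>M (UNIV :: 'n set) (%_. lborel :: real measure)) lborel"
   by (rule measurable_component_singleton) simp
  then show "(%z. (\<chi> i. z i) \<bullet> b) \<in> borel_measurable (Pi\<^sub>M (UNIV :: 'n set) (%_. lborel :: real measure))"
   by (simp add: b inner_axis)
 qed
 fix l u :: "real ^ 'n" assume le: "!!b. b \<in> Basis ==> l \<bullet> b <= u \<bullet> b"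
 show "emeasure (distr (Pi\<^sub>M UNIV (%_. lborel)) borel (%z. \<chi> i. z i)) (box l u) = ennreal (\<Prod>b\<in>Basis. (u - l) \<bullet> b)"
 proof -
  have le': "l $ i <= u $ i" for i using le[of "axis i 1"] by (simp add: inner_axis)
  have "(%z. \<chi> i. z i) -` box l u Int space (Pi\<^sub>M (UNIV :: 'n set) (%_. lborel)) = (\<Pi>\<^sub>E i\<in>UNIV. {l $ i<..<u $ i})"
   by (auto simp: mem_box_cart space_PiM PiE_iff)
  then have "emeasure (distr (Pi\<^sub>M UNIV (%_. lborel)) borel (%z. \<chi> i. z i)) (box l u)
    = emeasure (Pi\<^sub>M (UNIV :: 'n set) (%_. lborel)) (\<Pi>\<^sub>E i\<in>UNIV. {l $ i<..<u $ i})"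
   using comp by (subst emeasure_distr) auto
  also have "... = (\<Prod>i\<in>UNIV. emeasure lborel {l $ i<..<u $ i})" by (rule emeasure_PiM) auto
  also have "... = ennreal (\<Prod>i\<in>UNIV. u $ i - l $ i)" using le' by (simp add: prod_ennreal)
  finally show ?thesis by (simp add: prod_Basis_cart inner_axis)
 qed
qed simp

definition upd :: "'n => real => real ^ 'n::finite => real ^ 'n" where
 "upd k a y = (\<chi> i. if i = k then a else y $ i)"

lemma upd_simps [simp]: "upd k a y $ k = a" "i ~= k ==> upd k a y $ i = y $ i" "upd k a (upd k b y) = upd k a y"
 "y $ k = a ==> upd k a y = y"
 by (auto simp: upd_def vec_eq_iff)

lemma upd_has_derivative:
 fixes y :: "real ^ 'n::finite"
 shows "((%y. upd k a y) has_derivative (%v. upd k 0 v)) (at y within S)"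
proof -
 have l: "linear (upd k 0 :: real ^ 'n => real ^ 'n)" by (auto intro!: linearI simp: upd_def vec_eq_iff)
 have "upd k a y = upd k 0 y + axis k a" for y :: "real ^ 'n" by (auto simp: upd_def vec_eq_iff axis_def)
 then have e: "upd k a = (%y :: real ^ 'n. upd k 0 y + axis k a)" by blast
 show ?thesis unfolding e
  using l by (intro has_derivative_add_const bounded_linear_imp_has_derivative) (simp add: linear_conv_bounded_linear)
qed

lemma continuous_upd: "continuous_on S (upd k a)"
 unfolding continuous_on_eq_continuous_within
 by (intro ballI has_derivative_continuous[OF upd_has_derivative])

lemma measurable_upd [measurable]: "upd k a \<in> borel_measurable borel"
 by (rule borel_measurable_continuous_onI[OF continuous_upd])

lemma measurable_vec_nth [measurable]: "(%y :: real ^ 'n::finite. y $ k) \<in> borel_measurable borel"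
 by (intro borel_measurable_continuous_onI continuous_intros)

text \<open>Fubini: an integral over a coordinate hyperplane is an integral over a slab of height one. In this form
 change of variables, differentiation under the integral sign and translation invariance apply to it.\<close>

lemma nn_integral_hyperplane:
 fixes F :: "real ^ 'n::finite => ennreal"
 assumes F: "F \<in> borel_measurable borel"
 shows "(\<integral>\<^sup>+y. F y \<partial>hyperplane_lborel k a) = (\<integral>\<^sup>+y. unit_ind k y * F (upd k a y) \<partial>lborel)"
proof -
 interpret product_sigma_finite "%_::'n. lborel :: real measure" by standard
 let ?P = "Pi\<^sub>M (UNIV - {k}) (%_. lborel :: real measure)"
 let ?Q = "Pi\<^sub>M UNIV (%_::'n. lborel :: real measure)"
 have m1: "(%z. \<chi> i. if i = k then a else z i) \<in> borel_measurable ?P"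
 proof (subst borel_measurable_euclidean_space, intro ballI)
  fix b :: "real ^ 'n" assume "b \<in> Basis"
  then obtain j where b: "b = axis j 1" by (auto simp: Basis_vec_def)
  show "(%z. (\<chi> i. if i = k then a else z i) \<bullet> b) \<in> borel_measurable ?P"
  proof (cases "j = k")
   case False
   then have "(%z. z j) \<in> measurable ?P lborel" by (intro measurable_component_singleton) simp
   then show ?thesis using False by (simp add: b inner_axis)
  qed (simp add: b inner_axis)
 qed
 have comp: "(%z. (\<chi> i. (z i :: real))) \<in> borel_measurable ?Q"
 proof (subst borel_measurable_euclidean_space, intro ballI)
  fix b :: "real ^ 'n" assume "b \<in> Basis"
  then obtain j where b: "b = axis j 1" by (auto simp: Basis_vec_def)
  have "(%z. z j) \<in> measurable ?Q lborel" by (rule measurable_component_singleton) simp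
  then show "(%z. (\<chi> i. z i) \<bullet> b) \<in> borel_measurable ?Q" by (simp add: b inner_axis)
 qed
 let ?G = "%y. unit_ind k y * F (upd k a y)"
 have G: "?G \<in> borel_measurable borel" using F by measurable
 have "(\<integral>\<^sup>+y. ?G y \<partial>lborel) = (\<integral>\<^sup>+z. ?G (\<chi> i. z i) \<partial>?Q)"
  by (subst lborel_PiM, subst nn_integral_distr) (use comp G in auto)
 also have "?Q = Pi\<^sub>M (insert k (UNIV - {k})) (%_. lborel)" by (simp add: insert_absorb)
 also have "(\<integral>\<^sup>+z. ?G (\<chi> i. z i) \<partial>Pi\<^sub>M (insert k (UNIV - {k})) (%_. lborel))
   = (\<integral>\<^sup>+x. (\<integral>\<^sup>+t. ?G (\<chi> i. (x(k := t)) i) \<partial>lborel) \<partial>?P)"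
 proof (rule product_nn_integral_insert)
  have "(%z. ?G (\<chi> i. z i)) \<in> borel_measurable ?Q" using measurable_compose[OF comp G] .
  then show "(%z. ?G (\<chi> i. z i)) \<in> borel_measurable (Pi\<^sub>M (insert k (UNIV - {k})) (%_. lborel))"
   by (simp add: insert_absorb)
 qed auto
 also have "... = (\<integral>\<^sup>+x. F (\<chi> i. if i = k then a else x i) \<partial>?P)"
 proof (intro nn_integral_cong)
  fix x
  have "upd k a (\<chi> i. (x(k := t)) i) = (\<chi> i. if i = k then a else x i)" for t
   by (auto simp: upd_def vec_eq_iff)
  then have "(\<integral>\<^sup>+t. ?G (\<chi> i. (x(k := t)) i) \<partial>lborel)
    = (\<integral>\<^sup>+t. F (\<chi> i. if i = k then a else x i) * indicator {0..1::real} t \<partial>lborel)"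
   by (simp add: mult.commute)
  also have "... = F (\<chi> i. if i = k then a else x i)" by (subst nn_integral_cmult_indicator) auto
  finally show "(\<integral>\<^sup>+t. ?G (\<chi> i. (x(k := t)) i) \<partial>lborel) = F (\<chi> i. if i = k then a else x i)" .
 qed
 also have "... = (\<integral>\<^sup>+y. F y \<partial>hyperplane_lborel k a)"
  unfolding hyperplane_lborel_def by (subst nn_integral_distr) (use m1 F in auto)
 finally show ?thesis ..
qed

section \<open>Surface integrals in slice charts\<close>

lemma inner_tangential:
 fixes G :: "real ^ 'n ^ 'n::finite"
 shows "v \<bullet> ((\<chi> i j. if i = k \<or> j = k then (if i = j then 1 else 0) else G $ i $ j) *v w)
  = v $ k * w $ k + upd k 0 v \<bullet> (G *v upd k 0 w)"
proof -
 let ?T = "\<chi> i j. if i = k \<or> j = k then (if i = j then (1::real) else 0) else G $ i $ j"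
 have row: "(?T *v w) $ i = (if i = k then w $ k else (G *v upd k 0 w) $ i)" for i
 proof (cases "i = k")
  case True
  have "(if k = j then 1 else 0) * w $ j = (if k = j then w $ j else 0)" for j by simp
  then show ?thesis by (simp add: matrix_vector_mult_def True)
 next
  case False
  then show ?thesis
   by (simp add: matrix_vector_mult_def upd_def) (intro sum.cong refl, auto)
 qed
 have "v \<bullet> (?T *v w) = (SUM i:UNIV. (if i = k then v $ k * w $ k else 0) + upd k 0 v $ i * (G *v upd k 0 w) $ i)"
  unfolding inner_vec_def row by (intro sum.cong refl) (auto simp: upd_def)
 then show ?thesis by (simp add: sum.distrib inner_vec_def)
qed

lemma upd_add: "upd k (a + b) (v + w) = upd k a v + upd k b w"
 by (simp add: upd_def vec_eq_iff)

lemma upd_scale: "upd k (r * a) (r *R v) = r *R upd k a v"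
 by (simp add: upd_def vec_eq_iff)

context riem_manifold begin

text \<open>Density of the induced measure of a slice.\<close>

definition cw :: "('p, 'n) chart => real ^ 'n => real" where
 "cw c y = sqrt (tangential_det kk (gloc c y))"

definition slab :: "('p, 'n) chart => real => (real ^ 'n) set" where
 "slab c a = {y \<in> rng c. y $ kk = a}"

lemma tangential_det_pos: "c \<in> atlas M ==> y \<in> rng c ==> tangential_det kk (gloc c y) > 0"
proof -
 assume c: "c \<in> atlas M" "y \<in> rng c"
 have g: "posdef (gloc c y)" by (rule gloc_posdef[OF c])
 have "matrix_inv (gloc c y) $ kk $ kk = axis kk 1 \<bullet> (matrix_inv (gloc c y) *v axis kk 1)"
  by (simp add: inner_axis' matrix_vector_mult_basis column_def)
 also have "... > 0" using posdef_matrix_inv[OF g] by (simp add: posdef_def)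
 finally show ?thesis
  using matrix_inv_diagonal[OF posdef_det_nz[OF g], of kk] posdef_det_pos[OF g] by (simp add: zero_less_divide_iff)
qed

lemma cw_nonneg: "c \<in> atlas M ==> y \<in> rng c ==> cw c y >= 0"
 using tangential_det_pos[of c y] by (simp add: cw_def)

lemma cw_continuous:
 assumes c: "c \<in> atlas M" shows "continuous_on (rng c) (cw c)"
proof -
 have e: "continuous_on (rng c) (%y. (\<chi> i j. if i = kk \<or> j = kk then (if i = j then 1 else 0) else gloc c y $ i $ j) $ i $ j)" for i j
  by (cases "i = kk \<or> j = kk") (auto intro!: continuous_intros gloc_continuous[OF c])
 have "continuous_on (rng c) (%y. tangential_det kk (gloc c y))"
  unfolding tangential_det_def det_def
  by (intro continuous_on_sum continuous_on_mult continuous_on_const continuous_on_prod e)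
 then show ?thesis unfolding cw_def[abs_def] by (rule continuous_on_real_sqrt)
qed

lemma HS_relative_borel: "openin (top_of_set HS) U ==> U \<in> sets borel"
 using closed_half_space[of kk] by (auto simp: openin_open intro!: sets.Int)

lemma rng_borel: "c \<in> atlas M ==> rng c \<in> sets borel"
 using HS_relative_borel atlasD(2) by blast

lemma slab_borel: "c \<in> atlas M ==> slab c a \<in> sets borel"
proof -
 assume c: "c \<in> atlas M"
 have "slab c a = rng c Int {y. y $ kk = a}" by (auto simp: slab_def)
 moreover have "closed {y::real^'n. y $ kk = a}" by (intro closed_Collect_eq continuous_intros)
 ultimately show ?thesis using rng_borel[OF c] by simp
qed

lemma slice_chartD:
 assumes "slice_chart M S c a"
 shows "c \<in> atlas M" "!!y. y \<in> slab c a ==> coord_inv c y \<in> S" "!!x. x \<in> cdom c ==> x \<in> S \<longleftrightarrow> coord c x \<in> slab c a"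
proof -
 show c: "c \<in> atlas M" using assms by (simp add: slice_chart_def)
 have S: "S Int cdom c = {x \<in> cdom c. coord c x $ kk = a}" using assms by (simp add: slice_chart_def)
 show "coord_inv c y \<in> S" if "y \<in> slab c a" for y
 proof -
  have "coord_inv c y \<in> {x \<in> cdom c. coord c x $ kk = a}" using that c by (simp add: slab_def)
  then show ?thesis unfolding S[symmetric] by simp
 qed
 show "x \<in> S \<longleftrightarrow> coord c x \<in> slab c a" if "x \<in> cdom c" for x
  using S that by (auto simp: slab_def)
qed

lemma slab_measurable:
 fixes G :: "'p => ennreal"
 assumes s: "slice_chart M S c a" and G: "G \<in> borel_measurable (restrict_space borel S)"
 shows "(%y. indicator (slab c a) y * G (coord_inv c y) * ennreal (cw c y)) \<in> borel_measurable borel"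
proof -
 note c = slice_chartD(1)[OF s]
 have sub: "slab c a <= rng c" by (auto simp: slab_def)
 have "coord_inv c \<in> borel_measurable (restrict_space borel (slab c a))"
  by (rule borel_measurable_continuous_on_restrict[OF continuous_on_subset[OF homeomorphism_cont2[OF atlasD(3)[OF c]] sub]])
 then have "coord_inv c \<in> measurable (restrict_space borel (slab c a)) (restrict_space borel S)"
  by (intro measurable_restrict_space2) (insert slice_chartD(2)[OF s], auto simp: space_restrict_space)
 from measurable_compose[OF this G]
 have "(%y. G (coord_inv c y)) \<in> borel_measurable (restrict_space borel (slab c a))" .
 moreover have "cw c \<in> borel_measurable (restrict_space borel (slab c a))"
  by (rule borel_measurable_continuous_on_restrict[OF continuous_on_subset[OF cw_continuous[OF c] sub]])
 ultimately have "(%y. G (coord_inv c y) * ennreal (cw c y)) \<in> borel_measurable (restrict_space borel (slab c a))"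
  by measurable
 then have "(%y. G (coord_inv c y) * ennreal (cw c y) * indicator (slab c a) y) \<in> borel_measurable borel"
  by (subst (asm) borel_measurable_restrict_space_iff_ennreal) (use slab_borel[OF c] in auto)
 then show ?thesis by (simp add: mult_ac)
qed

lemma slab_measurable_real:
 fixes F :: "'p => real"
 assumes s: "slice_chart M S c a" and F: "F \<in> borel_measurable (restrict_space borel S)"
 shows "(%y. indicator (slab c a) y * (F (coord_inv c y) * cw c y)) \<in> borel_measurable borel"
proof -
 note c = slice_chartD(1)[OF s]
 have sub: "slab c a <= rng c" by (auto simp: slab_def)
 have "coord_inv c \<in> borel_measurable (restrict_space borel (slab c a))"
  by (rule borel_measurable_continuous_on_restrict[OF continuous_on_subset[OF homeomorphism_cont2[OF atlasD(3)[OF c]] sub]])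
 then have "coord_inv c \<in> measurable (restrict_space borel (slab c a)) (restrict_space borel S)"
  by (intro measurable_restrict_space2) (insert slice_chartD(2)[OF s], auto simp: space_restrict_space)
 from measurable_compose[OF this F]
 have "(%y. F (coord_inv c y)) \<in> borel_measurable (restrict_space borel (slab c a))" .
 moreover have "cw c \<in> borel_measurable (restrict_space borel (slab c a))"
  by (rule borel_measurable_continuous_on_restrict[OF continuous_on_subset[OF cw_continuous[OF c] sub]])
 ultimately have "(%y. F (coord_inv c y) * cw c y) \<in> borel_measurable (restrict_space borel (slab c a))"
  by measurable
 then have "(%y. indicator (slab c a) y *R (F (coord_inv c y) * cw c y)) \<in> borel_measurable borel"
  by (subst (asm) borel_measurable_restrict_space_iff) (use slab_borel[OF c] in auto)
 then show ?thesis by simp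
qed

text \<open>Integral of \<open>G\<close> over the slice at level \<open>a\<close> with respect to the induced measure.\<close>

definition sl :: "('p, 'n) chart => real => ('p => ennreal) => ennreal" where
 "sl c a G = (\<integral>\<^sup>+y. indicator (slab c a) y * G (coord_inv c y) * ennreal (cw c y) \<partial>hyperplane_lborel kk a)"

text \<open>The part of a slice that lies in both charts, thickened to height one in the distinguished direction.\<close>

definition hatset :: "('p, 'n) chart => real => ('p, 'n) chart => (real ^ 'n) set" where
 "hatset c a c' = {y. y $ kk \<in> {0..1} & upd kk a y \<in> slab c a Int ov c c'}"

lemma slice_transition:
 assumes s: "slice_chart M S c a" "slice_chart M S c' a'" and y: "y \<in> slab c a Int ov c c'"
 shows "transition c c' y \<in> slab c' a' Int ov c' c"
proof -
 note c = slice_chartD(1)[OF s(1)] slice_chartD(1)[OF s(2)]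
 have x: "coord_inv c y \<in> cdom c'" "coord_inv c y \<in> S"
  using y ov_iff[OF c(1)] slice_chartD(2)[OF s(1)] by blast+
 have e: "transition c c' y = coord c' (coord_inv c y)" by (simp add: transition_def)
 have "coord c' (coord_inv c y) \<in> slab c' a'" using slice_chartD(3)[OF s(2) x(1)] x(2) by simp
 moreover have "transition c c' y \<in> ov c' c" using transition_in[OF c(1), of c'] y by blast
 ultimately show ?thesis using e by simp
qed

lemma Jac_tangential:
 assumes s: "slice_chart M S c a" "slice_chart M S c' a'" and y: "y \<in> slab c a Int ov c c'" and v: "v $ kk = 0"
 shows "Jac c c' (coord_inv c y) v $ kk = 0"
proof -
 note c = slice_chartD(1)[OF s(1)] slice_chartD(1)[OF s(2)]
 obtain W where W: "open W" "ov c c' = HS Int W" using ov_open[OF c] by (auto simp: openin_open)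
 have yk: "y $ kk = a" "y \<in> rng c" using y by (auto simp: slab_def)
 have x: "coord_inv c y \<in> cdom c" "coord_inv c y \<in> cdom c'" using y ov_iff[OF c(1)] yk c by auto
 let ?l = "%t. y + t *R v"
 have "open (?l -` W)" by (intro open_vimage W(1) continuous_intros)
 moreover have y0: "0 \<in> ?l -` W" using y W(2) by auto
 ultimately obtain U where U: "open U" "0 \<in> U" "U = ?l -` W" by blast
 have lov: "?l t \<in> slab c a Int ov c c'" if "t \<in> U" for t
 proof -
  have "?l t \<in> HS" using yk v subsetD[OF atlasD(5)[OF c(1)] yk(2)] by (simp add: half_space_def)
  then have "?l t \<in> ov c c'" using that U(3) W(2) by auto
  moreover have "?l t \<in> rng c" using calculation ov_subset by blast
  ultimately show ?thesis using yk v by (auto simp: slab_def)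
 qed
 have "(?l has_derivative (%t. t *R v)) (at 0 within U)" by (auto intro!: derivative_eq_intros)
 moreover have "(transition c c' has_derivative Jac c c' (coord_inv c y)) (at (?l 0) within ?l ` U)"
 proof -
  have "(transition c c' has_derivative Jac c c' (coord_inv c y)) (at y within ov c c')"
   using Jac_derivative[OF c x] c(1) yk(2) by simp
  moreover have "?l ` U <= ov c c'" using lov by blast
  ultimately have "(transition c c' has_derivative Jac c c' (coord_inv c y)) (at y within ?l ` U)"
   by (rule has_derivative_subset)
  then show ?thesis by simp
 qed
 ultimately have "(transition c c' o ?l has_derivative Jac c c' (coord_inv c y) o (%t. t *R v)) (at 0 within U)"
  by (rule diff_chain_within)
 then have "((%t. (transition c c' o ?l) t $ kk) has_derivative (%t. (Jac c c' (coord_inv c y) o (%t. t *R v)) t $ kk)) (at 0 within U)"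
  by (rule bounded_linear.has_derivative[OF bounded_linear_vec_nth])
 then have d: "((%t. transition c c' (?l t) $ kk) has_derivative (%t. Jac c c' (coord_inv c y) (t *R v) $ kk)) (at 0)"
  using at_within_open[OF U(2,1)] by (simp add: o_def)
 have "((%t. transition c c' (?l t) $ kk) has_derivative (%t. 0)) (at 0)"
 proof (rule has_derivative_transform_within_open[OF has_derivative_const[of a'] U(1,2)])
  show "a' = transition c c' (?l t) $ kk" if "t \<in> U" for t
   using slice_transition[OF s lov[OF that]] by (simp add: slab_def)
 qed
 from fun_cong[OF has_derivative_unique[OF d this], of 1] show ?thesis by simp
qed

text \<open>The transition maps slice to slice, and its tangential derivative is an isometry of the induced metrics;
 extended by the identity in the distinguished direction it becomes a square matrix.\<close>

lemma slice_density_change: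
 assumes s: "slice_chart M S c a" "slice_chart M S c' a'" and y: "y \<in> slab c a Int ov c c'"
 defines "J == Jac c c' (coord_inv c y)"
 shows "cw c y = \<bar>det (matrix (%v. upd kk (v $ kk) (J (upd kk 0 v))))\<bar> * cw c' (transition c c' y)"
proof -
 note c = slice_chartD(1)[OF s(1)] slice_chartD(1)[OF s(2)]
 have yr: "y \<in> rng c" using y by (auto simp: slab_def)
 have x: "coord_inv c y \<in> cdom c" "coord_inv c y \<in> cdom c'" using y ov_iff[OF c(1)] yr c by auto
 have x': "coord_inv c' (transition c c' y) = coord_inv c y" using coord_inv_transition[OF c] y by blast
 have lin: "linear J" unfolding J_def by (rule Jac_linear[OF c x])
 define Jt where "Jt v = upd kk (v $ kk) (J (upd kk 0 v))" for v
 have lt: "linear Jt"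
 proof (rule linearI)
  have u: "upd kk 0 (v + w) = upd kk 0 v + upd kk 0 w" "upd kk 0 (r *R v) = r *R upd kk 0 v"
   for v w :: "real ^ 'n" and r
   using upd_add[of kk 0 0 v w] upd_scale[of kk r 0 v] by simp_all
  show "Jt (v + w) = Jt v + Jt w" for v w
   unfolding Jt_def u linear_add[OF lin] by (simp add: upd_add)
  show "Jt (r *R v) = r *R Jt v" for r v
   unfolding Jt_def u linear_scale[OF lin] by (simp add: upd_scale)
 qed
 let ?T = "%G. \<chi> i j. if i = kk \<or> j = kk then (if i = j then (1::real) else 0) else G $ i $ j"
 define A where "A = matrix Jt"
 have A: "Jt v = A *v v" for v using matrix_vector_mul(2)[OF lt] unfolding A_def by (rule fun_cong[OF sym])
 have tang: "J (upd kk 0 v) $ kk = 0" for v unfolding J_def by (rule Jac_tangential[OF s y]) simp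
 have "v \<bullet> (?T (gloc c y) *v w) = Jt v \<bullet> (?T (gloc c' (transition c c' y)) *v Jt w)" for v w
 proof -
  have "upd kk 0 (Jt v) = J (upd kk 0 v)" for v using tang[of v] by (simp add: Jt_def)
  moreover have "Jt v $ kk = v $ kk" for v by (simp add: Jt_def)
  ultimately show ?thesis
   unfolding inner_tangential using metric_law[OF c x] by (simp add: gloc_def x' J_def)
 qed
 then have "v \<bullet> (?T (gloc c y) *v w) = v \<bullet> ((transpose A ** ?T (gloc c' (transition c c' y)) ** A) *v w)" for v w
  unfolding A using dot_lmul_matrix[of v "transpose A" "?T (gloc c' (transition c c' y)) *v (A *v w)"]
  by (simp add: matrix_vector_mul_assoc matrix_mul_assoc del: transpose_matrix_vector)
 then have "?T (gloc c y) *v w = (transpose A ** ?T (gloc c' (transition c c' y)) ** A) *v w" for w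
  using vector_eq_ldot by blast
 then have "?T (gloc c y) = transpose A ** ?T (gloc c' (transition c c' y)) ** A" unfolding matrix_eq by blast
 then have "tangential_det kk (gloc c y) = (det A)^2 * tangential_det kk (gloc c' (transition c c' y))"
  unfolding tangential_det_def by (simp add: det_mul power2_eq_square)
 then have "cw c y = \<bar>det A\<bar> * cw c' (transition c c' y)" by (simp add: cw_def real_sqrt_mult)
 then show ?thesis unfolding A_def Jt_def[abs_def] .
qed

lemma sl_hat:
 assumes s: "slice_chart M S c a" and c': "c' \<in> atlas M" and F: "F \<in> borel_measurable (restrict_space borel S)" "!!x. F x >= (0::real)"
  "!!x. x \<in> cdom c ==> x ~: cdom c' ==> F x = 0"
 shows "sl c a (%x. ennreal (F x)) = (\<integral>\<^sup>+y. ennreal (indicator (hatset c a c') y * (F (coord_inv c (upd kk a y)) * cw c (upd kk a y))) \<partial>lborel)"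
  and "(%y. indicator (hatset c a c') y * (F (coord_inv c (upd kk a y)) * cw c (upd kk a y))) \<in> borel_measurable borel"
  and "hatset c a c' \<in> sets borel"
proof -
 note c = slice_chartD(1)[OF s]
 have "sl c a (%x. ennreal (F x)) = (\<integral>\<^sup>+y. unit_ind kk y * (indicator (slab c a) (upd kk a y) * ennreal (F (coord_inv c (upd kk a y))) * ennreal (cw c (upd kk a y))) \<partial>lborel)"
  unfolding sl_def by (rule nn_integral_hyperplane) (rule slab_measurable[OF s], use F(1) in measurable)
 also have "... = (\<integral>\<^sup>+y. ennreal (indicator (hatset c a c') y * (F (coord_inv c (upd kk a y)) * cw c (upd kk a y))) \<partial>lborel)"
 proof (intro nn_integral_cong)
  fix y
  let ?u = "upd kk a y"
  show "unit_ind kk y * (indicator (slab c a) ?u * ennreal (F (coord_inv c ?u)) * ennreal (cw c ?u))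
    = ennreal (indicator (hatset c a c') y * (F (coord_inv c ?u) * cw c ?u))"
  proof (cases "y $ kk \<in> {0..1} & ?u \<in> slab c a")
   case True
   then have r: "?u \<in> rng c" by (simp add: slab_def)
   show ?thesis
   proof (cases "?u \<in> ov c c'")
    case True
    then show ?thesis using \<open>y $ kk \<in> {0..1} & ?u \<in> slab c a\<close> F(2)[of "coord_inv c ?u"] cw_nonneg[OF c r]
     by (simp add: hatset_def ennreal_mult)
   next
    case False
    then have "F (coord_inv c ?u) = 0" using ov_iff[OF c] r c by (intro F(3)) auto
    then show ?thesis by simp
   qed
  qed (auto simp: hatset_def)
 qed
 finally show "sl c a (%x. ennreal (F x)) = (\<integral>\<^sup>+y. ennreal (indicator (hatset c a c') y * (F (coord_inv c (upd kk a y)) * cw c (upd kk a y))) \<partial>lborel)" .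
 have o: "ov c c' \<in> sets borel" by (rule HS_relative_borel[OF ov_open[OF c c']])
 have h: "hatset c a c' = (%y. y $ kk) -` {0..1} Int upd kk a -` (slab c a Int ov c c')" by (auto simp: hatset_def)
 show hb: "hatset c a c' \<in> sets borel" unfolding h
  using measurable_sets[OF measurable_vec_nth[of kk], of "{0..1}"] measurable_sets[OF measurable_upd[of kk a], of "slab c a Int ov c c'"]
   slab_borel[OF c] o by auto
 have e: "indicator (hatset c a c') y * (F (coord_inv c (upd kk a y)) * cw c (upd kk a y))
   = indicator (hatset c a c') y * (indicator (slab c a) (upd kk a y) * (F (coord_inv c (upd kk a y)) * cw c (upd kk a y)))" for y
  by (auto simp: hatset_def indicator_def)
 have "(%y. indicator (slab c a) (upd kk a y) * (F (coord_inv c (upd kk a y)) * cw c (upd kk a y))) \<in> borel_measurable borel"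
  by (rule measurable_compose[OF measurable_upd slab_measurable_real[OF s F(1)]])
 then show "(%y. indicator (hatset c a c') y * (F (coord_inv c (upd kk a y)) * cw c (upd kk a y))) \<in> borel_measurable borel"
  unfolding e using hb by measurable
qed

text \<open>Change of variables in full dimension, for the transition between the slices extended by the identity in the
 distinguished coordinate.\<close>

lemma sl_change:
 assumes s: "slice_chart M S c a" "slice_chart M S c' a'"
  and F: "F \<in> borel_measurable (restrict_space borel S)" "!!x. F x >= (0::real)"
  "!!x. x ~: cdom c Int cdom c' ==> F x = 0"
 shows "sl c a (%x. ennreal (F x)) = sl c' a' (%x. ennreal (F x))"
proof -
 note c = slice_chartD(1)[OF s(1)] slice_chartD(1)[OF s(2)]
 let ?H = "hatset c a c'" and ?H' = "hatset c' a' c"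
 let ?T = "%y. upd kk (y $ kk) (transition c c' (upd kk a y))"
 let ?T' = "%z. upd kk (z $ kk) (transition c' c (upd kk a' z))"
 let ?D = "%y v. upd kk (v $ kk) (Jac c c' (coord_inv c (upd kk a y)) (upd kk 0 v))"
 define f where "f z = (if upd kk a' z \<in> rng c' then F (coord_inv c' (upd kk a' z)) * cw c' (upd kk a' z) else 0)" for z
 have TH: "?T y \<in> ?H'" "upd kk a' (?T y) = transition c c' (upd kk a y)" "?T' (?T y) = y" if y: "y \<in> ?H" for y
 proof -
  have u: "upd kk a y \<in> slab c a Int ov c c'" "y $ kk \<in> {0..1}" using y by (auto simp: hatset_def)
  have t: "transition c c' (upd kk a y) \<in> slab c' a' Int ov c' c" by (rule slice_transition[OF s u(1)])
  then have k: "transition c c' (upd kk a y) $ kk = a'" by (simp add: slab_def)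
  show e: "upd kk a' (?T y) = transition c c' (upd kk a y)" using k by simp
  show "?T y \<in> ?H'" unfolding hatset_def using t u(2) e by simp
  have "transition c' c (transition c c' (upd kk a y)) = upd kk a y" using transition_inverse[OF c] u(1) by blast
  then show "?T' (?T y) = y" unfolding e by simp
 qed
 have TH': "?T' z \<in> ?H" "?T (?T' z) = z" if z: "z \<in> ?H'" for z
 proof -
  have u: "upd kk a' z \<in> slab c' a' Int ov c' c" "z $ kk \<in> {0..1}" using z by (auto simp: hatset_def)
  have t: "transition c' c (upd kk a' z) \<in> slab c a Int ov c c'" by (rule slice_transition[OF s(2,1) u(1)])
  then have k: "transition c' c (upd kk a' z) $ kk = a" by (simp add: slab_def)
  have e: "upd kk a (?T' z) = transition c' c (upd kk a' z)" using k by simp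
  show "?T' z \<in> ?H" unfolding hatset_def using t u(2) e by simp
  have "transition c c' (transition c' c (upd kk a' z)) = upd kk a' z" using transition_inverse[OF c(2,1)] u(1) by blast
  then show "?T (?T' z) = z" unfolding e by simp
 qed
 have im: "?T ` ?H = ?H'" using TH(1) TH' by force
 have inj: "inj_on ?T ?H" by (rule inj_on_inverseI[of _ ?T']) (rule TH(3))
 have der: "(?T has_derivative ?D y) (at y within ?H)" if y: "y \<in> ?H" for y
 proof -
  have u: "upd kk a y \<in> slab c a Int ov c c'" using y by (auto simp: hatset_def)
  then have r: "upd kk a y \<in> rng c" by (simp add: slab_def)
  have x: "coord_inv c (upd kk a y) \<in> cdom c" "coord_inv c (upd kk a y) \<in> cdom c'" using u r ov_iff[OF c(1)] c by auto
  have "(transition c c' has_derivative Jac c c' (coord_inv c (upd kk a y))) (at (upd kk a y) within upd kk a ` ?H)"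
  proof -
   have "(transition c c' has_derivative Jac c c' (coord_inv c (upd kk a y))) (at (upd kk a y) within ov c c')"
    using Jac_derivative[OF c x] c(1) r by simp
   moreover have "upd kk a ` ?H <= ov c c'" by (auto simp: hatset_def)
   ultimately show ?thesis by (rule has_derivative_subset)
  qed
  from diff_chain_within[OF upd_has_derivative this]
  have 1: "((%y. transition c c' (upd kk a y)) has_derivative (%v. Jac c c' (coord_inv c (upd kk a y)) (upd kk 0 v))) (at y within ?H)"
   by (simp add: o_def)
  have 2: "((%y. upd kk 0 (transition c c' (upd kk a y))) has_derivative (%v. upd kk 0 (Jac c c' (coord_inv c (upd kk a y)) (upd kk 0 v)))) (at y within ?H)"
   using diff_chain_within[OF 1 upd_has_derivative] by (simp add: o_def)
  have l: "bounded_linear (%y::real^'n. axis kk (y $ kk) :: real ^ 'n)"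
   by (rule linear_conv_bounded_linear[THEN iffD1], rule linearI) (auto simp: axis_def vec_eq_iff)
  have e: "upd kk b w = upd kk 0 w + axis kk b" for b and w :: "real ^ 'n" by (auto simp: upd_def vec_eq_iff axis_def)
  show ?thesis
   by (subst (1 2) e) (intro has_derivative_add 2 bounded_linear_imp_has_derivative l)
 qed
 have key: "indicator ?H y * (\<bar>det (matrix (?D y))\<bar> * f (?T y)) = indicator ?H y * (F (coord_inv c (upd kk a y)) * cw c (upd kk a y))" for y
 proof (cases "y \<in> ?H")
  case True
  then have u: "upd kk a y \<in> slab c a Int ov c c'" by (auto simp: hatset_def)
  have t: "transition c c' (upd kk a y) \<in> slab c' a' Int ov c' c" by (rule slice_transition[OF s u])
  then have "transition c c' (upd kk a y) \<in> rng c'" by (simp add: slab_def)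
  moreover have "coord_inv c' (transition c c' (upd kk a y)) = coord_inv c (upd kk a y)" using coord_inv_transition[OF c] u by blast
  ultimately have "f (?T y) = F (coord_inv c (upd kk a y)) * cw c' (transition c c' (upd kk a y))"
   unfolding f_def TH(2)[OF True] by simp
  then show ?thesis using slice_density_change[OF s u] by simp
 qed simp
 have F0: "x \<in> cdom c ==> x ~: cdom c' ==> F x = 0" "x \<in> cdom c' ==> x ~: cdom c ==> F x = 0" for x using F(3)[of x] by auto
 have h: "(%y. indicator ?H y * (F (coord_inv c (upd kk a y)) * cw c (upd kk a y))) \<in> borel_measurable borel" "?H \<in> sets borel"
  by (rule sl_hat(2,3)[OF s(1) c(2) F(1,2)], rule F0, assumption+)+
 have h': "(%y. indicator ?H' y * (F (coord_inv c' (upd kk a' y)) * cw c' (upd kk a' y))) \<in> borel_measurable borel" "?H' \<in> sets borel"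
  by (rule sl_hat(2,3)[OF s(2) c(1) F(1,2)], rule F0, assumption+)+
 have f': "indicator ?H' z * f z = indicator ?H' z * (F (coord_inv c' (upd kk a' z)) * cw c' (upd kk a' z))" for z
  by (auto simp: f_def hatset_def slab_def indicator_def)
 have "(\<integral>\<^sup>+y. ennreal (indicator ?H y * (\<bar>det (matrix (?D y))\<bar> * f (?T y))) \<partial>lborel)
   = (\<integral>\<^sup>+z. ennreal (indicator (?T ` ?H) z * f z) \<partial>lborel)"
 proof (rule nn_change_of_variables[OF _ _ der inj])
  show "?H \<in> sets borel" by (rule h(2))
  show "?T ` ?H \<in> sets borel" unfolding im by (rule h'(2))
  show "f y >= 0" for y unfolding f_def using F(2) cw_nonneg[OF c(2)] by auto
  show "(%y. indicator (?T ` ?H) y * f y) \<in> borel_measurable borel" unfolding im f' by (rule h'(1))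
  show "(%y. indicator ?H y * (\<bar>det (matrix (?D y))\<bar> * f (?T y))) \<in> borel_measurable borel" unfolding key by (rule h(1))
 qed
 then have eq: "(\<integral>\<^sup>+y. ennreal (indicator ?H y * (F (coord_inv c (upd kk a y)) * cw c (upd kk a y))) \<partial>lborel)
   = (\<integral>\<^sup>+z. ennreal (indicator ?H' z * (F (coord_inv c' (upd kk a' z)) * cw c' (upd kk a' z))) \<partial>lborel)"
  unfolding key im f' .
 have H1: "sl c a (%x. ennreal (F x)) = (\<integral>\<^sup>+y. ennreal (indicator ?H y * (F (coord_inv c (upd kk a y)) * cw c (upd kk a y))) \<partial>lborel)"
  by (rule sl_hat(1)[OF s(1) c(2) F(1,2)]) (rule F0)
 have H1': "sl c' a' (%x. ennreal (F x)) = (\<integral>\<^sup>+z. ennreal (indicator ?H' z * (F (coord_inv c' (upd kk a' z)) * cw c' (upd kk a' z))) \<partial>lborel)"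
  by (rule sl_hat(1)[OF s(2) c(1) F(1,2)]) (rule F0)
 show ?thesis unfolding H1 H1' by (rule eq)
qed

end

section \<open>Existence of the surface measure\<close>

context riem_manifold begin

lemma coord_image_borel_indicator:
 assumes s: "slice_chart M S c a" and A: "A <= S" "A <= cdom c"
 shows "indicator (coord c ` A) y = (indicator (slab c a) y * indicator A (coord_inv c y) :: ennreal)"
proof -
 note c = slice_chartD(1)[OF s]
 have "y \<in> coord c ` A \<longleftrightarrow> y \<in> slab c a & coord_inv c y \<in> A"
 proof
  assume "y \<in> coord c ` A"
  then obtain x where x: "x \<in> A" "y = coord c x" by blast
  then show "y \<in> slab c a & coord_inv c y \<in> A" using A c slice_chartD(3)[OF s, of x] by auto
 next
  assume "y \<in> slab c a & coord_inv c y \<in> A"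
  then show "y \<in> coord c ` A" using c by (intro image_eqI[of _ _ "coord_inv c y"]) (auto simp: slab_def)
 qed
 then show ?thesis by (auto simp: indicator_def)
qed

lemma surface_measure_formula_iff:
 assumes s: "slice_chart M S c a" and A: "A <= S" "A <= cdom c"
 shows "(\<integral>\<^sup>+y\<in>coord c ` A. ennreal (sqrt (tangential_det kk (metric M c (coord_inv c y)))) \<partial>hyperplane_lborel kk a)
   = sl c a (indicator A)"
 unfolding sl_def coord_image_borel_indicator[OF assms] cw_def gloc_def
 by (intro nn_integral_cong) (simp add: mult_ac)

lemma sl_zero: "(!!x. x \<in> cdom c ==> G x = 0) ==> c \<in> atlas M ==> sl c a G = 0"
proof -
 assume G: "!!x. x \<in> cdom c ==> G x = 0" and c: "c \<in> atlas M"
 have "indicator (slab c a) y * G (coord_inv c y) * ennreal (cw c y) = 0" for y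
  using G[of "coord_inv c y"] c by (auto simp: indicator_def slab_def)
 then have "sl c a G = (\<integral>\<^sup>+y. 0 \<partial>hyperplane_lborel kk a)" unfolding sl_def by (intro nn_integral_cong)
 then show ?thesis by simp
qed

lemma sl_cong:
 assumes "c \<in> atlas M" "!!x. x \<in> cdom c ==> G x = G' x"
 shows "sl c a G = sl c a G'"
 unfolding sl_def using assms by (intro nn_integral_cong) (auto simp: indicator_def slab_def)

lemma hyperplane_sets [simp]: "sets (hyperplane_lborel k a) = sets borel"
 by (simp add: hyperplane_lborel_def)

lemma sl_measurable:
 assumes s: "slice_chart M S c a" and G: "G \<in> borel_measurable (restrict_space borel S)"
 shows "(%y. indicator (slab c a) y * G (coord_inv c y) * ennreal (cw c y)) \<in> borel_measurable (hyperplane_lborel kk a)"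
 using slab_measurable[OF assms] measurable_cong_sets[OF hyperplane_sets refl] by blast

lemma sl_add:
 assumes s: "slice_chart M S c a" and "G \<in> borel_measurable (restrict_space borel S)" "G' \<in> borel_measurable (restrict_space borel S)"
 shows "sl c a (%x. G x + G' x) = sl c a G + sl c a G'"
proof -
 have "sl c a (%x. G x + G' x) = (\<integral>\<^sup>+y. indicator (slab c a) y * G (coord_inv c y) * ennreal (cw c y)
   + indicator (slab c a) y * G' (coord_inv c y) * ennreal (cw c y) \<partial>hyperplane_lborel kk a)"
  unfolding sl_def by (intro nn_integral_cong) (simp add: algebra_simps)
 also have "... = sl c a G + sl c a G'"
  unfolding sl_def by (rule nn_integral_add) (rule sl_measurable[OF s assms(2)], rule sl_measurable[OF s assms(3)])
 finally show ?thesis .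
qed

lemma sl_cmult:
 assumes s: "slice_chart M S c a" and "G \<in> borel_measurable (restrict_space borel S)"
 shows "sl c a (%x. r * G x) = r * sl c a G"
proof -
 have "sl c a (%x. r * G x) = (\<integral>\<^sup>+y. r * (indicator (slab c a) y * G (coord_inv c y) * ennreal (cw c y)) \<partial>hyperplane_lborel kk a)"
  unfolding sl_def by (intro nn_integral_cong) (simp add: mult_ac)
 also have "... = r * sl c a G"
  unfolding sl_def by (rule nn_integral_cmult[OF sl_measurable[OF s assms(2)]])
 finally show ?thesis .
qed

lemma sl_suminf:
 assumes s: "slice_chart M S c a" and "!!n::nat. G n \<in> borel_measurable (restrict_space borel S)"
 shows "sl c a (%x. \<Sum>n. G n x) = (\<Sum>n. sl c a (G n))"
proof -
 have "sl c a (%x. \<Sum>n. G n x) = (\<integral>\<^sup>+y. (\<Sum>n. indicator (slab c a) y * G n (coord_inv c y) * ennreal (cw c y)) \<partial>hyperplane_lborel kk a)"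
  unfolding sl_def by (intro nn_integral_cong) (simp add: ennreal_suminf_cmult ennreal_suminf_multc mult.assoc)
 also have "... = (\<Sum>n. sl c a (G n))"
  unfolding sl_def by (rule nn_integral_suminf[OF sl_measurable[OF s assms(2)]])
 finally show ?thesis .
qed

lemma slice_cover_sets:
 fixes c :: "nat => ('p, 'n) chart"
 assumes S: "S <= X" and s: "!!i. i < N ==> slice_chart M S (c i) (a i)" and i: "i < N"
 shows "S Int cdom (c i) \<in> sets (restrict_space borel S)"
proof -
 obtain T where T: "open T" "cdom (c i) = X Int T"
  using atlasD(1)[OF slice_chartD(1)[OF s[OF i]]] by (auto simp: openin_open)
 then have "S Int cdom (c i) = S Int T" using S by auto
 then show ?thesis using T(1) by (auto simp: sets_restrict_space)
qed

lemma emeasure_surface_measure: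
 assumes "is_surface_measure M S mu" "slice_chart M S c a" "A \<in> sets mu" "A <= cdom c" "A <= S"
 shows "emeasure mu A = sl c a (indicator A)"
proof -
 have "ALL c a A. slice_chart M S c a & A \<in> sets mu & A <= cdom c -->
    emeasure mu A =
     (\<integral>\<^sup>+y\<in>coord c ` A. ennreal (sqrt (tangential_det kk (metric M c (coord_inv c y)))) \<partial>hyperplane_lborel kk a)"
  using assms(1) by (simp add: is_surface_measure_def)
 from this[THEN spec, THEN spec, THEN spec, of c a A] assms(2-4) show ?thesis
  using surface_measure_formula_iff[OF assms(2,5,4)] by simp
qed

text \<open>Cut \<open>S\<close> into disjoint Borel pieces, each in one of the charts, and add up the slice integrals; since slice
 integrals do not depend on the chart, the sum has the required form in every slice chart. Any other such measure
 agrees with it on the pieces.\<close>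

lemma surface_measure_is:
 fixes c :: "nat => ('p, 'n) chart"
 assumes S: "S <= X" and s: "!!i. i < N ==> slice_chart M S (c i) (a i)" and cover: "S <= (\<Union>i<N. cdom (c i))"
 shows "is_surface_measure M S (surface_measure M S)"
proof -
 let ?B = "restrict_space (borel :: 'p measure) S"
 have spB: "space ?B = S" by (simp add: space_restrict_space)
 define P where "P i = S Int cdom (c i) - (\<Union>j<i. S Int cdom (c j))" for i
 have Pm: "P i \<in> sets ?B" if "i < N" for i
  unfolding P_def using that slice_cover_sets[OF S s] by (intro sets.Diff sets.finite_UN) auto
 have Pc: "P i <= cdom (c i)" "P i <= S" for i by (auto simp: P_def)
 have Pd: "disjoint_family_on P {..<N}"
 proof -
  have "P m Int P n = {}" if "m < n" for m n using that by (auto simp: P_def)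
  then show ?thesis unfolding disjoint_family_on_def by (metis Int_commute nat_neq_iff)
 qed
 have PU: "(\<Union>i<N. P i) = S"
 proof
  show "S <= (\<Union>i<N. P i)"
  proof
   fix x assume x: "x \<in> S"
   then obtain i where i: "i < N" "x \<in> cdom (c i)" using cover by blast
   define m where "m = (LEAST i. x \<in> cdom (c i))"
   have "x \<in> cdom (c m)" unfolding m_def by (rule LeastI[of _ i]) (rule i(2))
   moreover have "m <= i" unfolding m_def by (rule Least_le) (rule i(2))
   moreover have "x ~: cdom (c j)" if "j < m" for j using that not_less_Least unfolding m_def by blast
   ultimately show "x \<in> (\<Union>i<N. P i)" using x i(1) by (auto simp: P_def intro!: bexI[of _ m])
  qed
 qed (auto simp: P_def)
 have im: "indicator A \<in> borel_measurable ?B" if "A \<in> sets ?B" for A :: "'p set" using that by simp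
 define muf where "muf A = (\<Sum>i<N. sl (c i) (a i) (indicator (A Int P i)))" for A
 have Asub: "A <= S" if "A \<in> sets ?B" for A using sets.sets_into_space[OF that] spB by simp
 have muf: "muf A = sl d b (indicator A)" if d: "slice_chart M S d b" and A: "A \<in> sets ?B" "A <= cdom d" for A d b
 proof -
  have APm: "A Int P i \<in> sets ?B" if "i < N" for i using A(1) Pm[OF that] by auto
  have "sl (c i) (a i) (indicator (A Int P i)) = sl d b (indicator (A Int P i))" if i: "i < N" for i
  proof -
   have "sl (c i) (a i) (%x. ennreal (indicator (A Int P i) x)) = sl d b (%x. ennreal (indicator (A Int P i) x))"
   proof (rule sl_change[OF s[OF i] d])
    show "(indicator (A Int P i) :: 'p => real) \<in> borel_measurable (restrict_space borel S)" using APm[OF i] by simp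
    show "indicator (A Int P i) x = (0::real)" if "x ~: cdom (c i) Int cdom d" for x
     using Pc[of i] A(2) that by (auto simp: indicator_def)
   qed simp
   then show ?thesis by (simp add: ennreal_indicator)
  qed
  then have "muf A = (\<Sum>i<N. sl d b (indicator (A Int P i)))" unfolding muf_def by simp
  also have "... = sl d b (%x. \<Sum>i<N. indicator (A Int P i) x)"
  proof -
   have "(\<Sum>i\<in>I. sl d b (indicator (A Int P i))) = sl d b (%x. \<Sum>i\<in>I. indicator (A Int P i) x)" if "finite I" "I <= {..<N}" for I
    using that
   proof (induction I rule: finite_induct)
    case empty
    then show ?case using sl_zero[OF _ slice_chartD(1)[OF d], of "%x. 0"] by simp
   next
    case (insert i I)
    have "sl d b (%x. indicator (A Int P i) x + (\<Sum>i\<in>I. indicator (A Int P i) x)) = sl d b (indicator (A Int P i)) + sl d b (%x. \<Sum>i\<in>I. indicator (A Int P i) x)"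
     by (rule sl_add[OF d]) (insert insert APm im, auto intro!: borel_measurable_sum)
    then show ?case using insert by simp
   qed
   then show ?thesis by simp
  qed
  also have "... = sl d b (indicator A)"
  proof (rule sl_cong[OF slice_chartD(1)[OF d]])
   fix x
   show "(\<Sum>i<N. indicator (A Int P i) x) = (indicator A x :: ennreal)"
   proof (cases "x \<in> A")
    case True
    then have "x \<in> (\<Union>i<N. P i)" using PU Asub[OF A(1)] by auto
    then obtain i where i: "i < N" "x \<in> P i" by blast
    have "x ~: P j" if "j < N" "j ~= i" for j using Pd i that unfolding disjoint_family_on_def by blast
    then have "(\<Sum>i<N. indicator (A Int P i) x) = (\<Sum>j<N. if j = i then 1 else 0 :: ennreal)"
     using i True by (intro sum.cong) (auto simp: indicator_def)
    then show ?thesis using i True by simp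
   qed simp
  qed
  finally show ?thesis .
 qed
 define mu where "mu = measure_of S (sets ?B) muf"
 have setsmu: "sets mu = sets ?B" unfolding mu_def
  using sets.sigma_sets_eq[of ?B] sets.space_closed[of ?B] spB by (simp add: sets_measure_of)
 have spacemu: "space mu = S" unfolding mu_def using sets.space_closed[of ?B] spB by (simp add: space_measure_of)
 have em: "emeasure mu A = muf A" if A: "A \<in> sets ?B" for A
  unfolding mu_def
 proof (rule emeasure_measure_of_sigma)
  show "sigma_algebra S (sets ?B)" using sets.sigma_algebra_axioms[of ?B] spB by simp
  show "positive (sets ?B) muf"
   unfolding positive_def muf_def using sl_zero slice_chartD(1)[OF s] by simp
  show "countably_additive (sets ?B) muf"
  proof (rule countably_additiveI)
   fix F :: "nat => 'p set" assume F: "range F <= sets ?B" "disjoint_family F" "\<Union> (range F) \<in> sets ?B"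
   have "(\<Sum>n. muf (F n)) = (\<Sum>i<N. \<Sum>n. sl (c i) (a i) (indicator (F n Int P i)))"
    unfolding muf_def by (rule suminf_sum) simp
   also have "... = muf (\<Union> (range F))"
    unfolding muf_def
   proof (intro sum.cong refl)
    fix i assume "i \<in> {..<N}"
    then have i: "i < N" by simp
    have "(\<Sum>n. sl (c i) (a i) (indicator (F n Int P i))) = sl (c i) (a i) (%x. \<Sum>n. indicator (F n Int P i) x)"
     by (rule sl_suminf[OF s[OF i], symmetric]) (use F Pm[OF i] im in auto)
    also have "... = sl (c i) (a i) (indicator (\<Union> (range F) Int P i))"
    proof (rule sl_cong[OF slice_chartD(1)[OF s[OF i]]])
     fix x
     have "disjoint_family (%n. F n Int P i)" using F(2) by (auto simp: disjoint_family_on_def)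
     moreover have "(\<Union>n. F n Int P i) = \<Union> (range F) Int P i" by auto
     ultimately show "(\<Sum>n. indicator (F n Int P i) x) = (indicator (\<Union> (range F) Int P i) x :: ennreal)"
      using suminf_indicator[of "%n. F n Int P i" x] by metis
    qed
    finally show "(\<Sum>n. sl (c i) (a i) (indicator (F n Int P i))) = sl (c i) (a i) (indicator (\<Union> (range F) Int P i))" .
   qed
   finally show "(\<Sum>n. muf (F n)) = muf (\<Union> (range F))" .
  qed
 qed (rule A)
 have ismu: "is_surface_measure M S mu"
  unfolding is_surface_measure_def
 proof (intro conjI allI impI spacemu setsmu)
  fix d b A assume h: "slice_chart M S d b & A \<in> sets mu & A <= cdom d"
  then have A: "A \<in> sets ?B" using setsmu by simp
  show "emeasure mu A = (\<integral>\<^sup>+y\<in>coord d ` A. ennreal (sqrt (tangential_det kk (metric M d (coord_inv d y)))) \<partial>hyperplane_lborel kk b)"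
   using surface_measure_formula_iff[of S d b A] h Asub[OF A] em[OF A] muf[of d b A] A by simp
 qed
 have unique: "\<nu> = mu" if nu: "is_surface_measure M S \<nu>" for \<nu>
 proof (rule measure_eqI)
  have sn: "sets \<nu> = sets ?B" using nu by (simp add: is_surface_measure_def)
  then show "sets \<nu> = sets mu" using setsmu by simp
  fix A assume "A \<in> sets \<nu>"
  then have A: "A \<in> sets ?B" using sn by simp
  have e: "emeasure \<nu> (A Int P i) = sl (c i) (a i) (indicator (A Int P i))" if i: "i < N" for i
  proof -
   have "A Int P i \<in> sets \<nu>" using A Pm[OF i] sn by auto
   moreover have "A Int P i <= cdom (c i)" "A Int P i <= S" using Pc[of i] by blast+
   ultimately show ?thesis
    by (intro emeasure_surface_measure[OF nu s[OF i]])
  qed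
  have "A = (\<Union>i<N. A Int P i)" using PU Asub[OF A] by auto
  then have "emeasure \<nu> A = emeasure \<nu> (\<Union>i<N. A Int P i)" by simp
  also have "... = (\<Sum>i<N. emeasure \<nu> (A Int P i))"
  proof (rule sum_emeasure[symmetric])
   show "(%i. A Int P i) ` {..<N} <= sets \<nu>" using A Pm sn by auto
   show "disjoint_family_on (%i. A Int P i) {..<N}" using Pd unfolding disjoint_family_on_def by blast
  qed simp
  also have "... = muf A" unfolding muf_def using e by simp
  finally show "emeasure \<nu> A = emeasure mu A" using em[OF A] by simp
 qed
 have "surface_measure M S = mu" unfolding surface_measure_def by (rule the_equality) (rule ismu, rule unique)
 then show ?thesis using ismu by simp
qed

lemma nn_integral_surface:
 assumes mu: "is_surface_measure M S mu" and S: "S <= X" and s: "slice_chart M S c a"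
  and G: "G \<in> borel_measurable (restrict_space borel S)"
 shows "(\<integral>\<^sup>+x. G x * indicator (cdom c) x \<partial>mu) = sl c a G"
proof -
 have setsmu: "sets mu = sets (restrict_space borel S)" and spacemu: "space mu = S"
  using mu by (simp_all add: is_surface_measure_def)
 note c = slice_chartD(1)[OF s]
 have Q: "S Int cdom c \<in> sets mu" using slice_cover_sets[OF S, of 1 "%_. c" "%_. a" 0] s setsmu by simp
 have mb: "borel_measurable (restrict_space borel S) = (borel_measurable mu :: ('p => ennreal) set)"
  by (rule measurable_cong_sets) (simp_all add: setsmu)
 have indQ: "(indicator (cdom c) :: 'p => ennreal) \<in> borel_measurable mu"
 proof -
  have "(indicator (S Int cdom c) :: 'p => ennreal) \<in> borel_measurable mu" using Q by simp
  moreover have "(indicator (S Int cdom c) :: 'p => ennreal) \<in> borel_measurable mu \<longleftrightarrow> (indicator (cdom c) :: 'p => ennreal) \<in> borel_measurable mu"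
   by (rule measurable_cong) (auto simp: spacemu indicator_def)
  ultimately show ?thesis by simp
 qed
 have "G \<in> borel_measurable mu" using G mb by simp
 then show ?thesis
 proof (induction rule: borel_measurable_induct)
  case (cong f g)
  have "(\<integral>\<^sup>+x. g x * indicator (cdom c) x \<partial>mu) = (\<integral>\<^sup>+x. f x * indicator (cdom c) x \<partial>mu)"
   by (intro nn_integral_cong) (simp add: cong(3))
  moreover have "sl c a g = sl c a f"
   unfolding sl_def using cong(3) slice_chartD(2)[OF s] spacemu by (intro nn_integral_cong) (auto simp: indicator_def)
  ultimately show ?case using cong by simp
 next
  case (set A)
  have AS: "A <= S" using sets.sets_into_space[OF set] spacemu by simp
  have "A Int (S Int cdom c) \<in> sets mu" using set Q by blast
  moreover have "A Int (S Int cdom c) = A Int cdom c" using AS by auto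
  ultimately have m: "A Int cdom c \<in> sets mu" by simp
  have "(\<integral>\<^sup>+x. indicator A x * indicator (cdom c) x \<partial>mu) = emeasure mu (A Int cdom c)"
   using m unfolding indicator_inter_arith[symmetric] by (rule nn_integral_indicator)
  also have "... = sl c a (indicator (A Int cdom c))"
   by (rule emeasure_surface_measure[OF mu s m]) (use AS in auto)
  also have "... = sl c a (indicator A)" by (rule sl_cong[OF c]) (auto simp: indicator_def)
  finally show ?case .
 next
  case (mult u r)
  have "(\<integral>\<^sup>+x. r * u x * indicator (cdom c) x \<partial>mu) = r * (\<integral>\<^sup>+x. u x * indicator (cdom c) x \<partial>mu)"
   using mult indQ by (simp add: mult.assoc nn_integral_cmult)
  then show ?case using sl_cmult[OF s, of u r] mult mb by simp
 next
  case (add u v)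
  have "(\<integral>\<^sup>+x. (v x + u x) * indicator (cdom c) x \<partial>mu) = (\<integral>\<^sup>+x. v x * indicator (cdom c) x \<partial>mu) + (\<integral>\<^sup>+x. u x * indicator (cdom c) x \<partial>mu)"
   using add indQ by (simp add: distrib_right nn_integral_add)
  then show ?case using sl_add[OF s, of v u] add mb by simp
 next
  case (seq U)
  have "(\<integral>\<^sup>+x. (SUP i. U i) x * indicator (cdom c) x \<partial>mu) = (\<integral>\<^sup>+x. (SUP i. U i x * indicator (cdom c) x) \<partial>mu)"
   by (intro nn_integral_cong) (simp add: SUP_mult_right_ennreal image_comp)
  also have "... = (SUP i. \<integral>\<^sup>+x. U i x * indicator (cdom c) x \<partial>mu)"
   by (rule nn_integral_monotone_convergence_SUP)
    (insert seq indQ, auto simp: incseq_def le_fun_def intro!: mult_right_mono)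
  also have "... = (SUP i. sl c a (U i))" using seq.IH by simp
  also have "... = (\<integral>\<^sup>+y. (SUP i. indicator (slab c a) y * U i (coord_inv c y) * ennreal (cw c y)) \<partial>hyperplane_lborel kk a)"
   unfolding sl_def
  proof (rule nn_integral_monotone_convergence_SUP[symmetric])
   show "incseq (%i y. indicator (slab c a) y * U i (coord_inv c y) * ennreal (cw c y))"
    using seq(3) by (auto simp: incseq_def le_fun_def intro!: mult_right_mono mult_left_mono)
   show "(%y. indicator (slab c a) y * U i (coord_inv c y) * ennreal (cw c y)) \<in> borel_measurable (hyperplane_lborel kk a)" for i
    by (rule sl_measurable[OF s]) (use seq(1) mb in simp)
  qed
  also have "... = sl c a (SUP i. U i)"
   unfolding sl_def by (intro nn_integral_cong) (simp add: SUP_mult_right_ennreal SUP_mult_left_ennreal image_comp)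
  finally show ?case .
 qed
qed

text \<open>Integrand over \<open>\<real>\<^sup>n\<close> that represents a surface integral in a slice chart.\<close>

definition ci :: "('p, 'n) chart => real => ('p => real) => real ^ 'n => real" where
 "ci c a F y = unit_ind kk y * (indicator (slab c a) (upd kk a y) * (F (coord_inv c (upd kk a y)) * cw c (upd kk a y)))"

lemma sl_ci:
 assumes s: "slice_chart M S c a" and F: "F \<in> borel_measurable (restrict_space borel S)"
 shows "sl c a (%x. ennreal (F x)) = (\<integral>\<^sup>+y. ennreal (ci c a F y) \<partial>lborel)"
proof -
 note c = slice_chartD(1)[OF s]
 have "sl c a (%x. ennreal (F x)) = (\<integral>\<^sup>+y. unit_ind kk y * (indicator (slab c a) (upd kk a y) * ennreal (F (coord_inv c (upd kk a y))) * ennreal (cw c (upd kk a y))) \<partial>lborel)"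
  unfolding sl_def by (rule nn_integral_hyperplane) (rule slab_measurable[OF s], use F in measurable)
 also have "... = (\<integral>\<^sup>+y. ennreal (ci c a F y) \<partial>lborel)"
 proof (intro nn_integral_cong)
  fix y
  let ?u = "upd kk a y"
  show "unit_ind kk y * (indicator (slab c a) ?u * ennreal (F (coord_inv c ?u)) * ennreal (cw c ?u)) = ennreal (ci c a F y)"
  proof (cases "y $ kk \<in> {0..1} & ?u \<in> slab c a")
   case True
   then have "cw c ?u >= 0" using cw_nonneg[OF c] by (simp add: slab_def)
   then show ?thesis using True by (simp add: ci_def ennreal_mult'')
  qed (auto simp: ci_def)
 qed
 finally show ?thesis .
qed

lemma integral_surface:
 assumes mu: "is_surface_measure M S mu" and S: "S <= X" and s: "slice_chart M S c a"
  and F: "F \<in> borel_measurable (restrict_space borel S)" and F0: "!!x. x \<in> S ==> x ~: cdom c ==> F x = (0::real)"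
  and int: "integrable lborel (ci c a F)"
 shows "integrable mu F" "(\<integral>x. F x \<partial>mu) = (LBINT y. ci c a F y)"
proof -
 have setsmu: "sets mu = sets (restrict_space borel S)" and spacemu: "space mu = S"
  using mu by (simp_all add: is_surface_measure_def)
 have mb: "borel_measurable (restrict_space borel S) = (borel_measurable mu :: ('p => real) set)"
  by (rule measurable_cong_sets) (simp_all add: setsmu)
 have nn: "(\<integral>\<^sup>+x. ennreal (H x) \<partial>mu) = (\<integral>\<^sup>+y. ennreal (ci c a H y) \<partial>lborel)"
  if H: "H \<in> borel_measurable (restrict_space borel S)" "!!x. x \<in> S ==> x ~: cdom c ==> H x = (0::real)" for H
 proof -
  have "(\<integral>\<^sup>+x. ennreal (H x) \<partial>mu) = (\<integral>\<^sup>+x. ennreal (H x) * indicator (cdom c) x \<partial>mu)"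
   by (intro nn_integral_cong) (insert H(2) spacemu, auto simp: indicator_def)
  also have "... = sl c a (%x. ennreal (H x))"
   by (rule nn_integral_surface[OF mu S s]) (use H(1) in measurable)
  also have "... = (\<integral>\<^sup>+y. ennreal (ci c a H y) \<partial>lborel)" by (rule sl_ci[OF s H(1)])
  finally show ?thesis .
 qed
 have neg: "ci c a (%x. - F x) y = - ci c a F y" for y by (simp add: ci_def)
 have abs: "ci c a (%x. \<bar>F x\<bar>) y = \<bar>ci c a F y\<bar>" for y
 proof (cases "upd kk a y \<in> slab c a")
  case True
  then have "cw c (upd kk a y) >= 0" using cw_nonneg[OF slice_chartD(1)[OF s]] by (simp add: slab_def)
  then show ?thesis by (simp add: ci_def abs_mult)
 qed (simp add: ci_def)
 have "(\<integral>\<^sup>+x. ennreal \<bar>F x\<bar> \<partial>mu) = (\<integral>\<^sup>+y. ennreal \<bar>ci c a F y\<bar> \<partial>lborel)"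
  unfolding abs[symmetric] by (rule nn) (use F F0 in auto)
 then show i: "integrable mu F" using int F mb by (simp add: integrable_iff_bounded)
 have 1: "(\<integral>\<^sup>+x. ennreal (F x) \<partial>mu) = (\<integral>\<^sup>+y. ennreal (ci c a F y) \<partial>lborel)" by (rule nn[OF F F0])
 have "(\<integral>\<^sup>+x. ennreal (- F x) \<partial>mu) = (\<integral>\<^sup>+y. ennreal (ci c a (%x. - F x) y) \<partial>lborel)"
  by (rule nn) (use F F0 in auto)
 then have 2: "(\<integral>\<^sup>+x. ennreal (- F x) \<partial>mu) = (\<integral>\<^sup>+y. ennreal (- ci c a F y) \<partial>lborel)" unfolding neg .
 show "(\<integral>x. F x \<partial>mu) = (LBINT y. ci c a F y)"
  unfolding real_lebesgue_integral_def[OF i] real_lebesgue_integral_def[OF int] 1 2 ..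
qed

end

section \<open>Flux through the hyperplanes of a slab\<close>

lemma lborel_integral_eq_box:
 fixes f :: "'a::euclidean_space => real"
 assumes c: "continuous_on (cbox a b) f" and z: "!!y. y ~: cbox a b ==> f y = 0"
 shows "integrable lborel f" "(LBINT y. f y) = integral (cbox a b) f"
proof -
 have i: "set_integrable lborel (cbox a b) f"
  unfolding set_integrable_def by (rule borel_integrable_compact) (use c in auto)
 have e: "indicator (cbox a b) y *R f y = f y" for y using z by (cases "y \<in> cbox a b") auto
 show "integrable lborel f" using i unfolding set_integrable_def e .
 show "(LBINT y. f y) = integral (cbox a b) f"
  using set_borel_integral_eq_integral(2)[OF i] unfolding set_lebesgue_integral_def e .
qed

lemma continuous_upd_joint: "continuous_on S (%p. upd k (fst p) (snd p))"
 unfolding upd_def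
proof (rule continuous_on_vec_lambda)
 fix i show "continuous_on S (%p. if i = k then fst p else snd p $ i)"
  by (cases "i = k") (auto intro!: continuous_intros)
qed

text \<open>A box that carries the integrand of a thickened hyperplane integral of a function supported in the ball of
 radius \<open>R\<close>.\<close>

definition sbox :: "'n => real => (real ^ 'n::finite) set" where
 "sbox k R = cbox (\<chi> i. if i = k then 0 else - R) (\<chi> i. if i = k then 1 else R)"

lemma in_sbox: "y \<in> sbox k R \<longleftrightarrow> 0 <= y $ k & y $ k <= 1 & (ALL i. i ~= k --> \<bar>y $ i\<bar> <= R)"
 by (auto simp: sbox_def mem_box_cart abs_le_iff) (metis minus_le_iff)+

lemma slab_integral:
 fixes f :: "real ^ 'n::finite => real"
 assumes c: "continuous_on {y. y $ k = t} f" and z: "!!y. norm y > R ==> f y = 0"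
 shows "integrable lborel (%y. unit_ind k y * f (upd k t y))"
  "(LBINT y. unit_ind k y * f (upd k t y)) = integral (sbox k R) (%y. f (upd k t y))"
proof -
 have cont: "continuous_on (sbox k R) (%y. f (upd k t y))"
  by (rule continuous_on_compose2[OF c continuous_upd]) auto
 have e: "unit_ind k y * f (upd k t y) = (if y \<in> sbox k R then f (upd k t y) else 0)" for y
 proof (cases "y \<in> sbox k R")
  case False
  have "f (upd k t y) = 0" if "y $ k \<in> {0..1}"
  proof -
   obtain i where i: "i ~= k" "\<bar>y $ i\<bar> > R" using False \<open>y $ k \<in> {0..1}\<close> by (auto simp: in_sbox not_le)
   have "\<bar>upd k t y $ i\<bar> <= norm (upd k t y)" by (rule component_le_norm_cart)
   then show ?thesis using i by (intro z) simp
  qed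
  then show ?thesis using False by (auto simp: indicator_def)
 qed (auto simp: in_sbox)
 have c2: "continuous_on (sbox k R) (%y. if y \<in> sbox k R then f (upd k t y) else 0)"
  by (rule continuous_on_cong[THEN iffD1, OF refl _ cont]) simp
 show "integrable lborel (%y. unit_ind k y * f (upd k t y))" unfolding e
  by (rule lborel_integral_eq_box(1)[OF c2[unfolded sbox_def[of k R]], folded sbox_def]) simp
 have "(LBINT y. unit_ind k y * f (upd k t y)) = integral (sbox k R) (%y. if y \<in> sbox k R then f (upd k t y) else 0)"
  unfolding e
  by (rule lborel_integral_eq_box(2)[OF c2[unfolded sbox_def[of k R]], folded sbox_def]) simp
 also have "... = integral (sbox k R) (%y. f (upd k t y))" by (rule Henstock_Kurzweil_Integration.integral_cong) simp
 finally show "(LBINT y. unit_ind k y * f (upd k t y)) = integral (sbox k R) (%y. f (upd k t y))" .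
qed

lemma slab_integral_continuous:
 fixes f :: "real ^ 'n::finite => real"
 assumes c: "continuous_on {y. y $ k \<in> T} f" and z: "!!y. norm y > R ==> f y = 0"
 shows "continuous_on T (%t. LBINT y. unit_ind k y * f (upd k t y))"
proof -
 have u: "continuous_on (T \<times> sbox k R) (%(t, y). upd k t y)"
  unfolding split_beta by (rule continuous_upd_joint)
 have "continuous_on (T \<times> sbox k R) (%p. f ((%(t, y). upd k t y) p))"
  by (rule continuous_on_compose2[OF c u]) auto
 then have "continuous_on (T \<times> sbox k R) (%(t, y). f (upd k t y))" by (simp add: split_beta')
 then have "continuous_on T (%t. integral (sbox k R) (%y. f (upd k t y)))"
  unfolding sbox_def by (rule integral_continuous_on_param)
 moreover have "(LBINT y. unit_ind k y * f (upd k t y)) = integral (sbox k R) (%y. f (upd k t y))" if "t \<in> T" for t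
  by (rule slab_integral(2)[OF continuous_on_subset[OF c] z]) (use that in auto)
 ultimately show ?thesis by (subst continuous_on_cong[OF refl]) auto
qed

text \<open>The first claim is differentiation under the integral sign over a fixed box. The same computation for a
 translation in a direction \<open>j \<noteq> k\<close> gives the second one, since translations do not change the integral.\<close>

lemma slab_integral_derivative:
 fixes f :: "real ^ 'n::finite => real"
 assumes f: "Ck_on_open 1 f {y. y $ k \<in> {0<..<\<rho>}}" and z: "!!y. norm y > R ==> f y = 0" and t: "t \<in> {0<..<\<rho>}"
 shows "((%t. LBINT y. unit_ind k y * f (upd k t y)) has_real_derivative
   (LBINT y. unit_ind k y * pdv k f (upd k t y))) (at t)"
  (is "(?I has_real_derivative (LBINT y. _ * ?g (upd k t y))) _")
  and "j ~= k ==> (LBINT y. unit_ind k y * pdv j f (upd k t y)) = 0"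
  and "integrable lborel (%y. unit_ind k y * frechet_derivative f (at (upd k t y)) v)"
proof -
 let ?S = "{y. y $ k \<in> {0<..<\<rho>}}"
 have ocond: "(%y::real^'n. y $ k) -` {0<..<\<rho>} = ?S" by auto
 have oS: "open ?S" unfolding ocond[symmetric] by (rule open_vimage) (auto intro: continuous_intros)
 have d: "(f has_derivative frechet_derivative f (at y)) (at y)" if "y \<in> ?S" for y
  using Ck_on_open_SucD[of 0 f ?S y] f that by simp
 have gc: "continuous_on ?S (%y. frechet_derivative f (at y) v)" for v
  using f by (simp del: mem_Collect_eq)
 have gz: "frechet_derivative f (at y) v = 0" if "norm y > R" for y v
 proof -
  have "open {y::real^'n. norm y > R}" by (intro open_Collect_less continuous_intros)
  then have "(f has_derivative (%_. 0)) (at y)"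
   by (rule has_derivative_transform_within_open[OF has_derivative_const]) (use that z in auto)
  then show ?thesis using frechet_derivative_at by metis
 qed
 have sub: "continuous_on {y. y $ k = s} (%y. frechet_derivative f (at y) v)" if "s \<in> {0<..<\<rho>}" for s v
  by (rule continuous_on_subset[OF gc]) (use that in auto)
 have fc: "continuous_on {y. y $ k = s} f" if "s \<in> {0<..<\<rho>}" for s
  by (rule continuous_on_subset[OF Ck_on_open_continuous[OF f]]) (use that in auto)
 have G: "(LBINT y. unit_ind k y * frechet_derivative f (at (upd k t y)) v) = integral (sbox k R) (%y. frechet_derivative f (at (upd k t y)) v)" for v
  by (rule slab_integral(2)[OF sub[OF t]]) (rule gz)
 show "integrable lborel (%y. unit_ind k y * frechet_derivative f (at (upd k t y)) v)"
  by (rule slab_integral(1)[OF sub[OF t]]) (rule gz)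
 have u: "continuous_on ({0<..<\<rho>} \<times> sbox k R) (%(t, y). upd k t y)"
  unfolding split_beta by (rule continuous_upd_joint)
 have "continuous_on ({0<..<\<rho>} \<times> sbox k R) (%p. ?g ((%(t, y). upd k t y) p))"
  by (rule continuous_on_compose2[OF gc u]) auto
 then have cont: "continuous_on ({0<..<\<rho>} \<times> sbox k R) (%(t, y). ?g (upd k t y))" by (simp add: split_beta')
 have line: "upd k s y = upd k 0 y + s *R axis k 1" for s and y :: "real ^ 'n"
  by (auto simp: upd_def vec_eq_iff axis_def)
 have "((%t. integral (sbox k R) (%y. f (upd k t y))) has_real_derivative integral (sbox k R) (%y. ?g (upd k t y))) (at t within {0<..<\<rho>})"
  unfolding sbox_def
 proof (rule leibniz_rule_field_derivative[OF _ _ cont[unfolded sbox_def] t convex_real_interval(8)])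
  fix s y assume s: "s \<in> {0<..<\<rho>}"
  have "((%s. f (upd k 0 y + s *R axis k 1)) has_real_derivative ?g (upd k 0 y + s *R axis k 1)) (at s)"
   by (rule has_real_derivative_along_line) (use d[of "upd k s y"] s in \<open>simp add: line[symmetric]\<close>)
  then show "((%t. f (upd k t y)) has_real_derivative ?g (upd k s y)) (at s within {0<..<\<rho>})"
   unfolding line[symmetric] by (rule has_field_derivative_at_within)
 next
  fix s assume s: "s \<in> {0<..<\<rho>}"
  show "(%y. f (upd k s y)) integrable_on cbox (\<chi> i. if i = k then 0 else - R) (\<chi> i. if i = k then 1 else R)"
   by (rule integrable_continuous) (rule continuous_on_compose2[OF fc[OF s] continuous_upd], auto)
 qed
 then have "((%t. integral (sbox k R) (%y. f (upd k t y))) has_real_derivative integral (sbox k R) (%y. ?g (upd k t y))) (at t)"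
  unfolding at_within_open[OF t open_greaterThanLessThan] .
 then show "(?I has_real_derivative (LBINT y. unit_ind k y * ?g (upd k t y))) (at t)"
  unfolding G
  by (rule DERIV_cong_ev[OF refl _ refl, THEN iffD2, rotated])
   (rule eventually_mono[OF eventually_nhds_in_open[OF open_greaterThanLessThan t]], rule slab_integral(2)[OF fc z], assumption+)
 assume j: "j ~= k"
 let ?h = "%y. pdv j f y"
 let ?R = "R + 1"
 let ?tr = "%s y. upd k t y + s *R axis j 1 :: real ^ 'n"
 have uj: "upd k t (y + s *R axis j 1) = ?tr s y" "(y + s *R axis j 1) $ k = y $ k" for s y
  using j by (auto simp: upd_def vec_eq_iff axis_def)
 have trk: "?tr s y \<in> ?S" for s y using t j by (simp add: axis_def)
 have cj: "continuous_on (UNIV \<times> sbox k ?R) (%(s, y). ?tr s y)"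
  unfolding split_beta by (intro continuous_intros continuous_on_compose2[OF continuous_upd[of UNIV]]) auto
 have "continuous_on (UNIV \<times> sbox k ?R) (%p. ?h ((%(s, y). ?tr s y) p))"
  by (rule continuous_on_compose2[OF gc cj]) (use trk in auto)
 then have cont: "continuous_on (UNIV \<times> sbox k ?R) (%(s, y). ?h (?tr s y))" by (simp add: split_beta')
 have D: "((%s. integral (sbox k ?R) (%y. f (?tr s y))) has_real_derivative integral (sbox k ?R) (%y. ?h (?tr 0 y))) (at 0 within {-1<..<1})"
  unfolding sbox_def
 proof (rule leibniz_rule_field_derivative[OF _ _ continuous_on_subset[OF cont[unfolded sbox_def]] _ convex_real_interval(8)])
  fix s y
  show "((%s. f (?tr s y)) has_real_derivative ?h (?tr s y)) (at s within {-1<..<1})"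
   by (rule has_field_derivative_at_within, rule has_real_derivative_along_line) (rule d[OF trk])
 next
  fix s :: real
  show "(%y. f (?tr s y)) integrable_on cbox (\<chi> i. if i = k then 0 else - ?R) (\<chi> i. if i = k then 1 else ?R)"
   by (rule integrable_continuous, rule continuous_on_compose2[OF Ck_on_open_continuous[OF f]])
    (insert trk, auto intro!: continuous_intros continuous_upd)
 qed auto
 have const: "integral (sbox k ?R) (%y. f (?tr s y)) = integral (sbox k ?R) (%y. f (?tr 0 y))" if s: "\<bar>s\<bar> < 1" for s
 proof -
  have 1: "integral (sbox k ?R) (%y. f (?tr s y)) = (LBINT y. unit_ind k y * f (upd k t y + s *R axis j 1))" if s: "\<bar>s\<bar> < 1" for s
  proof (rule slab_integral(2)[symmetric])
   show "continuous_on {y. y $ k = t} (%y. f (y + s *R axis j 1))"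
    by (rule continuous_on_compose2[OF fc[OF t]]) (insert j, auto intro!: continuous_intros simp: axis_def)
   fix y :: "real ^ 'n" assume y: "norm y > ?R"
   have "norm y <= norm (y + s *R axis j 1) + norm (s *R axis j (1::real) :: real ^ 'n)"
    using norm_triangle_ineq4[of "y + s *R axis j 1" "s *R axis j 1"] by simp
   then have "norm (y + s *R axis j 1) > R" using y s by simp
   then show "f (y + s *R axis j 1) = 0" by (rule z)
  qed
  have "(LBINT y. unit_ind k y * f (upd k t y))
    = (\<integral>y. unit_ind k y * f (upd k t y) \<partial>distr lborel borel ((+) (s *R axis j 1)))"
   by (simp only: lborel_distr_plus)
  also have "... = (LBINT y. indicator {0..1} ((s *R axis j 1 + y) $ k) * f (upd k t (s *R axis j 1 + y)))"
  proof (rule integral_distr)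
   show "(%y. unit_ind k y * f (upd k t y)) \<in> borel_measurable borel"
    using borel_measurable_integrable[OF slab_integral(1)[OF fc[OF t] z]] by simp
  qed simp
  also have "... = (LBINT y. unit_ind k y * f (upd k t y + s *R axis j 1))"
   by (simp only: add.commute[of "s *R axis j 1"] uj)
  finally show ?thesis using 1[OF s] 1[of 0] by simp
 qed
 have "((%s. integral (sbox k ?R) (%y. f (?tr s y))) has_real_derivative 0) (at 0 within {-1<..<1})"
  by (rule has_field_derivative_transform_within[where f = "%_. integral (sbox k ?R) (%y. f (?tr 0 y))" and d = 1])
   (insert const, auto simp: dist_real_def)
 with D have "integral (sbox k ?R) (%y. ?h (?tr 0 y)) = 0"
  using DERIV_unique at_within_open[OF _ open_greaterThanLessThan, of "0::real" "-1" 1] by fastforce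
 moreover have "(LBINT y. unit_ind k y * ?h (upd k t y)) = integral (sbox k ?R) (%y. ?h (upd k t y))"
  by (rule slab_integral(2)[OF sub[OF t]]) (auto intro: gz)
 ultimately show "(LBINT y. unit_ind k y * ?h (upd k t y)) = 0" by simp
qed

text \<open>Only the component \<open>k\<close> contributes to the derivative of the flux; the other terms of the divergence have integral
 zero and may be added.\<close>

lemma slab_flux_derivative:
 fixes \<Phi> :: "real ^ 'n::finite => real ^ 'n"
 assumes f: "!!j. Ck_on_open 1 (%y. \<Phi> y $ j) {y. y $ k \<in> {0<..<\<rho>}}" and z: "!!y. norm y > R ==> \<Phi> y = 0" and t: "t \<in> {0<..<\<rho>}"
 shows "((%t. LBINT y. unit_ind k y * \<Phi> (upd k t y) $ k) has_real_derivative
   (LBINT y. unit_ind k y * (SUM j:UNIV. pdv j (%y. \<Phi> y $ j) (upd k t y)))) (at t)"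
  and "integrable lborel (%y. unit_ind k y * (SUM j:UNIV. pdv j (%y. \<Phi> y $ j) (upd k t y)))"
proof -
 have zj: "norm y > R ==> \<Phi> y $ j = 0" for y j using z by simp
 note d = slab_integral_derivative[OF f zj t]
 let ?a = "%j y. unit_ind k y * pdv j (%y. \<Phi> y $ j) (upd k t y)"
 have i: "integrable lborel (?a j)" for j by (rule d(3))
 have s: "(LBINT y. (SUM j:UNIV. ?a j y)) = (LBINT y. ?a k y)"
 proof -
  have "(LBINT y. (SUM j:UNIV. ?a j y)) = (SUM j:UNIV. LBINT y. ?a j y)"
   by (rule Bochner_Integration.integral_sum) (rule i)
  also have "... = (SUM j:UNIV. if j = k then LBINT y. ?a k y else 0)"
   by (rule sum.cong[OF refl]) (use d(2) in auto)
  finally show ?thesis by simp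
 qed
 show "integrable lborel (%y. unit_ind k y * (SUM j:UNIV. pdv j (%y. \<Phi> y $ j) (upd k t y)))"
  unfolding sum_distrib_left by (rule Bochner_Integration.integrable_sum) (rule i)
 show "((%t. LBINT y. unit_ind k y * \<Phi> (upd k t y) $ k) has_real_derivative
   (LBINT y. unit_ind k y * (SUM j:UNIV. pdv j (%y. \<Phi> y $ j) (upd k t y)))) (at t)"
  unfolding sum_distrib_left s by (rule d(1))
qed

section \<open>Partition of unity in the collar\<close>

lemma Ck_on_locally:
 assumes "!!y. y \<in> S ==> EX T. open T & y \<in> T & Ck_on n f (S Int T)"
 shows "Ck_on n f S"
 unfolding Ck_on_def
proof
 fix y assume y: "y \<in> S"
 then obtain T where T: "open T" "y \<in> T" "Ck_on n f (S Int T)" using assms by blast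
 then obtain W h where W: "open W" "y \<in> W" "Ck_on_open n h W" "ALL x:S Int T Int W. h x = f x"
  using y unfolding Ck_on_def by blast
 show "EX W h. open W & y \<in> W & Ck_on_open n h W & (ALL y:S Int W. h y = f y)"
  using W T Ck_on_open_subset[OF W(3), of "W Int T"] by (intro exI[of _ "W Int T"] exI[of _ h]) auto
qed

lemma positive_part_squared_C1: "Ck_on_open 1 (%s::real. (max 0 s)^2) UNIV"
 unfolding One_nat_def
proof (rule Ck_on_open_SucI)
 fix s :: real
 show "((%s. (max 0 s)^2) has_derivative (%v. v * (2 * max 0 s))) (at s)"
 proof (cases s "0::real" rule: linorder_cases)
  case less
  have "((%s. (max 0 s)^2) has_derivative (%v. 0)) (at s)"
   by (rule has_derivative_transform_within_open[of "%_. 0" _ _ _ "{..<0}"]) (use less in auto)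
  then show ?thesis using less by (simp add: max_def)
 next
  case greater
  have "((%s. s^2) has_derivative (%v. v * (2 * s))) (at s)"
   by (auto intro!: derivative_eq_intros)
  then have "((%s. (max 0 s)^2) has_derivative (%v. v * (2 * s))) (at s)"
   by (rule has_derivative_transform_within_open[of _ _ _ _ "{0<..}"]) (use greater in auto)
  then show ?thesis using greater by (simp add: max_def)
 next
  case equal
  have "(%h. (max 0 h)^2 / h) \<midarrow>0\<rightarrow> (0::real)"
  proof (rule tendsto_rabs_zero_cancel, rule tendsto_sandwich[OF _ _ tendsto_const tendsto_rabs_zero[OF tendsto_ident_at]])
   have "\<bar>(max 0 h)^2 / h\<bar> <= \<bar>h\<bar>" for h :: real
    by (cases "h <= 0") (auto simp: max_def power2_eq_square)
   then show "\<forall>\<^sub>F h in at (0::real). \<bar>(max 0 h)^2 / h\<bar> <= \<bar>h\<bar>" by simp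
  qed simp
  then have "DERIV (%s::real. (max 0 s)^2) 0 :> 0" by (simp add: DERIV_def)
  then have "((%s::real. (max 0 s)^2) has_derivative (%v. 0 * v)) (at 0)" by (simp only: has_field_derivative_def)
  moreover have "(%v::real. 0 * v) = (%v. v * (2 * max 0 0))" by (simp add: fun_eq_iff)
  ultimately show ?thesis using equal by metis
 qed
qed (auto intro!: continuous_intros)

context riem_manifold begin

lemma Ck_fun_on_continuous:
 assumes f: "Ck_fun_on M n f X" shows "continuous_on X f"
 unfolding continuous_on_eq_continuous_within
proof
 fix x assume x: "x \<in> X"
 then obtain c where c: "c \<in> atlas M" "x \<in> cdom c" using atlas_cover by blast
 obtain T where T: "open T" "cdom c = X Int T" using atlasD(1)[OF c(1)] by (auto simp: openin_open)
 have "continuous_on (rng c) (local_expr c f)"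
 proof -
  have "Ck_on n (local_expr c f) (coord c ` (X Int cdom c))" using f c(1) unfolding Ck_fun_on_def by blast
  moreover have "coord c ` (X Int cdom c) = rng c" using atlasD(4)[OF c(1)] by (auto simp: rng_def)
  ultimately show ?thesis using Ck_on_continuous by metis
 qed
 then have "continuous_on (cdom c) (%x. local_expr c f (coord c x))"
  using homeomorphism_cont1[OF atlasD(3)[OF c(1)]] by (rule continuous_on_compose2) auto
 then have "continuous_on (cdom c) f"
  by (rule continuous_on_cong[THEN iffD1, OF refl, rotated]) (use c in \<open>simp add: local_expr_def\<close>)
 then have "continuous (at x within X Int T) f" using c(2) T by (simp add: continuous_on_eq_continuous_within)
 then show "continuous (at x within X) f"
  using T c(2) at_within_Int_open[of x T X] by simp
qed

text \<open>Class C^1 suffices for a cut-off that is to be differentiated once.\<close>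

definition bump :: "('p, 'n) chart => real ^ 'n => real => 'p => real" where
 "bump c z r x = (if x \<in> cdom c then (max 0 (r^2 / 4 - (norm (coord c x - z))^2))^2 else 0)"

lemma bump_nonneg: "bump c z r x >= 0" by (simp add: bump_def)

lemma bump_pos_iff:
 assumes "r > 0"
 shows "bump c z r x > 0 \<longleftrightarrow> x \<in> cdom c & norm (coord c x - z) < r / 2"
proof -
 have "(norm (coord c x - z))^2 < r^2 / 4 \<longleftrightarrow> (norm (coord c x - z))^2 < (r / 2)^2" by (simp add: power_divide)
 also have "... \<longleftrightarrow> norm (coord c x - z) < r / 2" using assms power_less_imp_less_base[of "norm (coord c x - z)" 2 "r / 2"] power_strict_mono[of "norm (coord c x - z)" "r / 2" 2] by fastforce
 finally show ?thesis by (auto simp: bump_def max_def)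
qed

text \<open>The support is compact, hence closed, so that the extension by zero is regular in all charts.\<close>

lemma bump_C1:
 assumes c: "c \<in> atlas M" and r: "r > 0" "rng c = ball z r Int HS"
 shows "Ck_fun_on M 1 (bump c z r) X"
 unfolding Ck_fun_on_def
proof
 fix c' assume c': "c' \<in> atlas M"
 let ?\<beta> = "%y. (max 0 (r^2 / 4 - (norm (y - z))^2))^2"
 define K where "K = coord_inv c ` (cball z (r / 2) Int HS)"
 have sub: "cball z (r / 2) Int HS <= rng c" unfolding r(2) using r(1) by (intro Int_mono subset_refl) auto
 have "compact (cball z (r / 2) Int HS)" by (intro compact_Int_closed compact_cball closed_half_space)
 then have "compact K" unfolding K_def
  by (intro compact_continuous_image continuous_on_subset[OF homeomorphism_cont2[OF atlasD(3)[OF c]] sub])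
 then have "closed K" by (rule compact_imp_closed)
 then have oK: "openin (top_of_set X) (X - K)" unfolding Diff_eq by (intro openin_open_Int open_Compl)
 have zero: "bump c z r x = 0" if "x ~: K" for x
 proof (rule ccontr)
  assume "bump c z r x ~= 0"
  then have "x \<in> cdom c" "norm (coord c x - z) < r / 2" using bump_pos_iff[OF r(1)] bump_nonneg by (metis less_eq_real_def)+
  then have "coord c x \<in> cball z (r / 2) Int HS" using atlasD(5)[OF c] coord_in_rng by (auto simp: dist_norm norm_minus_commute)
  then show False using that c \<open>x \<in> cdom c\<close> unfolding K_def by (metis coord_inv_coord image_eqI)
 qed
 have b: "Ck_on_open 1 (%y. r^2 / 4 - (norm (y - z))^2) (UNIV :: (real ^ 'n) set)"
  unfolding power2_norm_eq_inner
  by (intro Ck_on_open_diff Ck_on_open_const Ck_on_open_bilinear[OF bounded_bilinear_inner] Ck_on_open_linear bounded_linear_ident open_UNIV)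
 have \<beta>: "Ck_on_open 1 ?\<beta> UNIV"
  by (rule Ck_on_open_compose[OF open_UNIV open_UNIV _ b positive_part_squared_C1]) simp
 have "Ck_on 1 (local_expr c' (bump c z r)) (rng c')"
 proof (rule Ck_on_locally)
  fix y assume y: "y \<in> rng c'"
  show "EX T. open T & y \<in> T & Ck_on 1 (local_expr c' (bump c z r)) (rng c' Int T)"
  proof (cases "coord_inv c' y \<in> cdom c")
   case True
   obtain T where T: "open T" "ov c' c = HS Int T" using ov_open[OF c' c] by (auto simp: openin_open)
   have yo: "y \<in> ov c' c" using True y ov_iff[OF c'] by blast
   have "Ck_on 1 (%y. ?\<beta> (transition c' c y)) (ov c' c)"
    by (rule Ck_on_compose[OF Ck_on_mono[OF transition_C2[OF c' c]] Ck_on_openI[OF open_UNIV \<beta> subset_UNIV]]) auto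
   moreover have "rng c' Int T <= ov c' c" using T atlasD(5)[OF c'] by auto
   ultimately have "Ck_on 1 (%y. ?\<beta> (transition c' c y)) (rng c' Int T)" by (rule Ck_on_subset)
   then have "Ck_on 1 (local_expr c' (bump c z r)) (rng c' Int T)"
   proof (rule Ck_on_cong)
    fix y assume "y \<in> rng c' Int T"
    then have "y \<in> ov c' c" using \<open>rng c' Int T <= ov c' c\<close> by blast
    then show "?\<beta> (transition c' c y) = local_expr c' (bump c z r) y"
     using ov_iff[OF c'] by (simp add: local_expr_def bump_def transition_def)
   qed
   then show ?thesis using T yo by auto
  next
   case False
   have "coord_inv c' y ~: K" using False sub c unfolding K_def by auto
   moreover have "openin (top_of_set HS) (coord c' ` (cdom c' Int (X - K)))" by (rule open_in_chart[OF c' oK])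
   then obtain T where T: "open T" "coord c' ` (cdom c' Int (X - K)) = HS Int T" by (auto simp: openin_open)
   have rK: "coord_inv c' w ~: K" if "w \<in> rng c' Int T" for w
   proof -
    have "w \<in> HS Int T" using that atlasD(5)[OF c'] by blast
    then obtain x where "x \<in> cdom c'" "x ~: K" "w = coord c' x" unfolding T(2)[symmetric] by blast
    then show ?thesis using c' by simp
   qed
   have "Ck_on 1 (local_expr c' (bump c z r)) (rng c' Int T)"
    by (rule Ck_on_cong[OF Ck_on_openI[OF open_UNIV Ck_on_open_const[of 1 0] subset_UNIV]])
     (use rK zero in \<open>simp add: local_expr_def\<close>)
   moreover have "y \<in> HS Int T" unfolding T(2)[symmetric]
    by (rule image_eqI[of _ _ "coord_inv c' y"]) (use y c' \<open>coord_inv c' y ~: K\<close> atlasD(4)[OF c'] in auto)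
   ultimately show ?thesis using T(1) by auto
  qed
 qed
 moreover have "coord c' ` (X Int cdom c') = rng c'" using atlasD(4)[OF c'] by (auto simp: rng_def)
 ultimately show "Ck_on 1 (local_expr c' (bump c z r)) (coord c' ` (X Int cdom c'))" by simp
qed

text \<open>Compactness; the open set \<open>{d > \<rho>}\<close> completes the collar charts to a cover of the manifold.\<close>

lemma finite_collar_cover:
 assumes cpt: "compact X" and \<rho>: "\<rho> > 0" and C2: "Ck_fun_on M 2 (bdist_real M) (collar M \<rho>)"
 obtains N :: nat and c z r where "!!i. i < N ==> ccoord \<rho> (c i) (z i) (r i)"
  "!!x. x \<in> X ==> bdist M x <= ennreal \<rho> ==> EX i<N. x \<in> cdom (c i) & norm (coord (c i) x - z i) < r i / 2"
proof -
 define F where "F = {V. openin (top_of_set X) V & (V Int collar M \<rho> = {} \<or>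
   (EX p. ccoord \<rho> (fst p) (fst (snd p)) (snd (snd p)) & V <= {x \<in> cdom (fst p). norm (coord (fst p) x - fst (snd p)) < snd (snd p) / 2}))}"
 have "X <= \<Union>F"
 proof
  fix x assume x: "x \<in> X"
  show "x \<in> \<Union>F"
  proof (cases "bdist M x <= ennreal \<rho>")
   case True
   obtain d z0 r where d: "ccoord \<rho> d z0 r" "x \<in> cdom d" "coord d x = z0"
    using collar_chart_exists[OF \<rho> C2 x True] by blast
   let ?V = "{y \<in> cdom d. coord d y \<in> ball z0 (r / 2)}"
   have "openin (top_of_set X) ?V" by (rule chart_open_preimage) (insert d, auto simp: ccoord_def)
   moreover have "?V <= {x \<in> cdom d. norm (coord d x - z0) < r / 2}" by (auto simp: dist_norm norm_minus_commute)
   ultimately have "?V \<in> F" unfolding F_def mem_Collect_eq using d(1)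
    by (intro conjI disjI2 exI[of _ "(d, z0, r)"]) (simp_all only: fst_conv snd_conv)
   moreover have "x \<in> ?V" using d by (simp add: ccoord_def)
   ultimately show ?thesis by blast
  next
   case False
   let ?V = "{x \<in> X. ennreal \<rho> < bdist M x}"
   have "?V \<in> F" unfolding F_def using bdist_superlevel_open[of \<rho>] by (auto simp: collar_def)
   moreover have "x \<in> ?V" using x False by (simp add: not_le)
   ultimately show ?thesis by blast
  qed
 qed
 moreover have "ALL V:F. openin (top_of_set X) V" by (simp add: F_def)
 ultimately obtain D where D: "D <= F" "finite D" "X <= \<Union>D"
  using cpt unfolding compact_eq_openin_cover by meson
 define D' where "D' = {V \<in> D. V Int collar M \<rho> ~= {}}"
 have "finite D'" using D(2) by (simp add: D'_def)
 then obtain f where f: "bij_betw f {0..<card D'} D'" using ex_bij_betw_nat_finite by blast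
 have "EX p. ccoord \<rho> (fst p) (fst (snd p)) (snd (snd p)) & f i <= {x \<in> cdom (fst p). norm (coord (fst p) x - fst (snd p)) < snd (snd p) / 2}"
  if "i < card D'" for i
 proof -
  have "f i \<in> D'" using f that by (auto simp: bij_betw_def)
  then have "f i \<in> F" "f i Int collar M \<rho> ~= {}" using D(1) by (auto simp: D'_def)
  then show ?thesis unfolding F_def by blast
 qed
 then have "ALL i:{..<card D'}. EX p. ccoord \<rho> (fst p) (fst (snd p)) (snd (snd p))
   & f i <= {x \<in> cdom (fst p). norm (coord (fst p) x - fst (snd p)) < snd (snd p) / 2}" by blast
 from bchoice[OF this] obtain P where "ALL i:{..<card D'}. ccoord \<rho> (fst (P i)) (fst (snd (P i))) (snd (snd (P i)))
   & f i <= {x \<in> cdom (fst (P i)). norm (coord (fst (P i)) x - fst (snd (P i))) < snd (snd (P i)) / 2}" ..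
 then have P: "!!i. i < card D' ==> ccoord \<rho> (fst (P i)) (fst (snd (P i))) (snd (snd (P i)))
   & f i <= {x \<in> cdom (fst (P i)). norm (coord (fst (P i)) x - fst (snd (P i))) < snd (snd (P i)) / 2}" by blast
 show ?thesis
 proof (rule that[of "card D'" "%i. fst (P i)" "%i. fst (snd (P i))" "%i. snd (snd (P i))"])
  show "ccoord \<rho> (fst (P i)) (fst (snd (P i))) (snd (snd (P i)))" if "i < card D'" for i using P[OF that] by blast
  fix x assume x: "x \<in> X" "bdist M x <= ennreal \<rho>"
  then obtain V where V: "V \<in> D" "x \<in> V" using D(3) by blast
  then have "V \<in> D'" using x by (auto simp: D'_def collar_def)
  then have "V \<in> f ` {0..<card D'}" using f by (simp add: bij_betw_def)
  then obtain i where "i < card D'" "f i = V" by auto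
  then show "EX i<card D'. x \<in> cdom (fst (P i)) & norm (coord (fst (P i)) x - fst (snd (P i))) < snd (snd (P i)) / 2"
   using P[of i] V(2) by blast
 qed
qed

end

context riem_manifold begin
abbreviation "level == parallel_hypersurface M"
abbreviation "level_measure t == surface_measure M (level t)"
end

locale collar_cover = riem_manifold M for M :: "('p::t2_space, 'n::finite) riem" +
 fixes rs :: real and N :: nat and c :: "nat => ('p, 'n) chart" and z :: "nat => real ^ 'n" and r :: "nat => real"
 assumes rs: "rs > 0" and cc: "!!i. i < N ==> ccoord rs (c i) (z i) (r i)"
  and cover: "!!x. x \<in> carrier M ==> bdist M x <= ennreal rs ==> EX i<N. x \<in> cdom (c i) & norm (coord (c i) x - z i) < r i / 2"
begin

lemma cc_atlas: "i < N ==> c i \<in> atlas M" and cc_r: "i < N ==> r i > 0" and cc_rng: "i < N ==> rng (c i) = ball (z i) (r i) Int HS"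
 using cc by (auto simp: ccoord_def)

lemma cc_coordinate:
 assumes "i < N" "x \<in> cdom (c i)" "coord (c i) x $ kk <= rs"
 shows "bdist M x = ennreal (coord (c i) x $ kk)" "bdist_real M x = coord (c i) x $ kk"
proof -
 show 1: "bdist M x = ennreal (coord (c i) x $ kk)" using cc[OF assms(1)] assms(2,3) unfolding ccoord_def by blast
 then show "bdist_real M x = coord (c i) x $ kk"
  using coord_nonneg[OF cc_atlas[OF assms(1)] assms(2)] by (simp add: bdist_real_def)
qed

lemma cc_le_iff: "i < N ==> x \<in> cdom (c i) ==> bdist M x <= ennreal rs \<longleftrightarrow> coord (c i) x $ kk <= rs"
 using cc unfolding ccoord_def by blast

definition bumpsum :: "'p => real" where "bumpsum x = (\<Sum>i<N. bump (c i) (z i) (r i) x)"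

definition chi :: "nat => 'p => real" where "chi i x = bump (c i) (z i) (r i) x / bumpsum x"

lemma bumpsum_pos:
 assumes "x \<in> X" "bdist M x <= ennreal rs" shows "bumpsum x > 0"
proof -
 obtain i where i: "i < N" "x \<in> cdom (c i) & norm (coord (c i) x - z i) < r i / 2" using cover[OF assms] by blast
 then have "bump (c i) (z i) (r i) x > 0" using bump_pos_iff[OF cc_r[OF i(1)]] by blast
 moreover have "bump (c i) (z i) (r i) x <= bumpsum x"
  unfolding bumpsum_def by (rule member_le_sum) (use i bump_nonneg in auto)
 ultimately show ?thesis by simp
qed

lemma bump_C1': "i < N ==> Ck_fun_on M 1 (bump (c i) (z i) (r i)) X"
 by (rule bump_C1[OF cc_atlas cc_r cc_rng])

lemma chi_nonneg: "chi i x >= 0"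
 unfolding chi_def bumpsum_def by (intro divide_nonneg_nonneg sum_nonneg bump_nonneg)

lemma chi_sum: "x \<in> X ==> bdist M x <= ennreal rs ==> (\<Sum>i<N. chi i x) = 1"
 using bumpsum_pos[of x] unfolding chi_def bumpsum_def by (simp flip: sum_divide_distrib)

lemma chi_zero: "i < N ==> x ~: cdom (c i) \<or> norm (coord (c i) x - z i) >= r i / 2 ==> chi i x = 0"
 using bump_pos_iff[OF cc_r, of i "c i" "z i" x] bump_nonneg[of "c i" "z i" "r i" x] unfolding chi_def by force

lemma chi_continuous: "i < N ==> continuous_on (collar M rs) (chi i)"
proof -
 assume i: "i < N"
 have s: "collar M rs <= X" by (auto simp: collar_def)
 have b: "continuous_on (collar M rs) (bump (c i) (z i) (r i))" if "i < N" for i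
  by (rule continuous_on_subset[OF Ck_fun_on_continuous[OF bump_C1'[OF that]] s])
 show "continuous_on (collar M rs) (chi i)" unfolding chi_def[abs_def] bumpsum_def[abs_def]
 proof (intro continuous_on_divide b i continuous_on_sum ballI)
  fix x assume "x \<in> collar M rs"
  then show "(\<Sum>i<N. bump (c i) (z i) (r i) x) ~= 0" using bumpsum_pos[of x] by (auto simp: collar_def bumpsum_def)
 qed simp
qed

text \<open>The part of a chart with \<open>0 < d < rs\<close>, where the solution and the distance are of class C^2.\<close>

definition inner_part :: "('p, 'n) chart => (real ^ 'n) set" where
 "inner_part c' = {y \<in> rng c'. coord_inv c' y \<in> {x \<in> X. bdist M x < ennreal rs} & y $ kk > 0}"

lemma inner_part_open: "c' \<in> atlas M ==> open (inner_part c')"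
 unfolding inner_part_def by (rule interior_part_open[OF _ bdist_sublevel_open])

lemma inner_part_sub: "inner_part c' <= rng c'" by (auto simp: inner_part_def)

lemma chi_C1:
 assumes i: "i < N" and c': "c' \<in> atlas M"
 shows "Ck_on_open 1 (local_expr c' (chi i)) (inner_part c')"
proof -
 have b: "Ck_on_open 1 (local_expr c' (bump (c i) (z i) (r i))) (inner_part c')" if "i < N" for i
 proof (rule Ck_on_open_subset[OF local_expr_C2_interior[OF c' _ bump_C1'[OF that]]])
  show "openin (top_of_set X) X" by simp
 qed (auto simp: inner_part_def)
 have "Ck_on_open 1 (%y. local_expr c' (bump (c i) (z i) (r i)) y / (\<Sum>i<N. local_expr c' (bump (c i) (z i) (r i)) y)) (inner_part c')"
 proof (intro Ck_on_open_divide Ck_on_open_sum inner_part_open c' b i)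
  fix y assume "y \<in> inner_part c'"
  then have "bumpsum (coord_inv c' y) > 0" by (intro bumpsum_pos) (auto simp: inner_part_def)
  then show "(\<Sum>i<N. local_expr c' (bump (c i) (z i) (r i)) y) ~= 0" by (simp add: bumpsum_def local_expr_def)
 qed simp
 moreover have "local_expr c' (chi i) = (%y. local_expr c' (bump (c i) (z i) (r i)) y / (\<Sum>i<N. local_expr c' (bump (c i) (z i) (r i)) y))"
  by (simp add: fun_eq_iff local_expr_def chi_def bumpsum_def)
 ultimately show ?thesis by simp
qed

lemma parallel_slice:
 assumes i: "i < N" and t: "0 <= t" "t <= rs"
 shows "slice_chart M (level t) (c i) t"
 unfolding slice_chart_def
proof (intro conjI cc_atlas[OF i] equalityI subsetI)
 fix x assume x: "x \<in> level t Int cdom (c i)"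
 then have b: "bdist M x = ennreal t" by (simp add: parallel_hypersurface_def)
 then have "coord (c i) x $ kk <= rs" using x t cc_le_iff[OF i, of x] by (auto intro: ennreal_leI)
 then have "ennreal (coord (c i) x $ kk) = ennreal t" using cc_coordinate(1)[OF i, of x] x b by simp
 then have "coord (c i) x $ kk = t" using t x coord_nonneg[OF cc_atlas[OF i], of x] by simp
 then show "x \<in> {x \<in> cdom (c i). coord (c i) x $ kk = t}" using x by simp
next
 fix x assume x: "x \<in> {x \<in> cdom (c i). coord (c i) x $ kk = t}"
 then have "x \<in> X" using atlasD(4)[OF cc_atlas[OF i]] by blast
 then show "x \<in> level t Int cdom (c i)"
  using x cc_coordinate(1)[OF i, of x] t by (simp add: parallel_hypersurface_def)
qed

lemma parallel_surface_measure:
 assumes t: "0 <= t" "t <= rs"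
 shows "is_surface_measure M (level t) (level_measure t)"
proof (rule surface_measure_is[of _ N c "%_. t"])
 show "level t <= X" by (auto simp: parallel_hypersurface_def)
 show "level t <= (\<Union>i<N. cdom (c i))"
 proof
  fix x assume "x \<in> level t"
  then have "x \<in> X" "bdist M x <= ennreal rs" using t by (auto simp: parallel_hypersurface_def intro: ennreal_leI)
  then show "x \<in> (\<Union>i<N. cdom (c i))" using cover by blast
 qed
qed (use parallel_slice t in blast)

lemma boundary_parallel: "boundary M = level 0"
proof
 show "boundary M <= level 0"
  using bdist_boundary by (auto simp: parallel_hypersurface_def boundary_def)
 show "level 0 <= boundary M"
  using bdist_interior_pos by (fastforce simp: parallel_hypersurface_def interior_of_mfd_def)
qed

end

section \<open>The data of the problem in arbitrary charts\<close>

lemma right_derivative_nonneg: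
 fixes h :: "real => real"
 assumes d: "(h has_real_derivative m) (at a within {a..<b})" and ab: "a < b" and ge: "!!s. s \<in> {a..<b} ==> h a <= h s"
 shows "m >= 0"
proof (rule tendsto_lowerbound)
 show "((%s. (h s - h a) / (s - a)) \<longlongrightarrow> m) (at a within {a..<b})" using d by (simp add: has_field_derivative_iff)
 show "\<forall>\<^sub>F s in at a within {a..<b}. 0 <= (h s - h a) / (s - a)"
  unfolding eventually_at by (rule exI[of _ 1]) (insert ge, auto intro!: divide_nonneg_nonneg)
 have "a islimpt {a<..<b}" using ab by (rule islimpt_greaterThanLessThan1)
 then have "a islimpt {a..<b}" by (rule islimpt_subset) auto
 then show "at a within {a..<b} ~= bot" by (simp add: trivial_limit_within)
qed

context riem_manifold begin

lemma interior_bdist: "interior_of_mfd M = {x \<in> X. ennreal 0 < bdist M x}"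
proof
 show "interior_of_mfd M <= {x \<in> X. ennreal 0 < bdist M x}" using bdist_interior_pos by (auto simp: interior_of_mfd_def)
 show "{x \<in> X. ennreal 0 < bdist M x} <= interior_of_mfd M" using bdist_boundary by (auto simp: interior_of_mfd_def)
qed

lemma interior_open: "openin (top_of_set X) (interior_of_mfd M)"
 unfolding interior_bdist by (rule bdist_superlevel_open)

lemma Ck_fun_on_subset: "Ck_fun_on M n f S ==> T <= S ==> Ck_fun_on M n f T"
 unfolding Ck_fun_on_def by (blast intro: Ck_on_subset)

lemma laplacian_chart:
 assumes c: "c \<in> atlas M" "x \<in> cdom c" and N: "openin (top_of_set X) N" "x \<in> N" and f: "Ck_fun_on M 2 f N"
  and i: "x \<in> interior_of_mfd M"
 shows "laplacian M f x = laplacian_in M c f x"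
proof -
 have x: "x \<in> X" using i by (simp add: interior_of_mfd_def)
 show ?thesis unfolding laplacian_def
  by (rule laplacian_in_change[OF chart_at_atlas(1)[OF x] c(1) chart_at_atlas(2)[OF x] c(2) N f])
   (use interior_iff[OF chart_at_atlas[OF x]] i in simp)
qed

text \<open>An essential supremum of a continuous function on an open set is a pointwise bound.\<close>

lemma laplacian_Linf_bound:
 assumes C: "C >= 0" "ennreal C = Linf_norm M (collar M \<rho>) (laplacian M f)"
  and f: "Ck_fun_on M 2 f (collar M \<rho>)"
  and x: "x \<in> interior_of_mfd M" "bdist M x < ennreal \<rho>"
 shows "\<bar>laplacian M f x\<bar> <= C"
proof (rule ccontr)
 assume "~ ?thesis"
 then obtain e where e: "C < e" "e < \<bar>laplacian M f x\<bar>" using dense[of C "\<bar>laplacian M f x\<bar>"] by auto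
 have "Inf {C'. null_in M {x \<in> collar M \<rho>. C' < ennreal \<bar>laplacian M f x\<bar>}} < ennreal e"
  using C e(1) unfolding Linf_norm_def by (metis ennreal_less_iff)
 then obtain C' where C': "null_in M {x \<in> collar M \<rho>. C' < ennreal \<bar>laplacian M f x\<bar>}" "C' < ennreal e"
  unfolding Inf_less_iff by blast
 let ?N = "{x \<in> X. bdist M x < ennreal \<rho>}"
 note N = bdist_sublevel_open[of "ennreal \<rho>"]
 have fN: "Ck_fun_on M 2 f ?N" by (rule Ck_fun_on_subset[OF f]) (auto simp: collar_def)
 have xX: "x \<in> X" using x(1) by (simp add: interior_of_mfd_def)
 then obtain c where c: "c \<in> atlas M" "x \<in> cdom c" using atlas_cover by blast
 define P where "P = {y \<in> rng c. coord_inv c y \<in> ?N & y $ kk > 0}"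
 have P: "open P" "P <= rng c" unfolding P_def using interior_part_open[OF c(1) N] by auto
 define L where "L y = laplacian_in M c f (coord_inv c y)" for y
 have "continuous_on P L" unfolding L_def[abs_def]
  by (rule laplacian_in_continuous[OF c(1) P]) (use local_expr_C2_interior[OF c(1) N fN] in \<open>simp add: P_def\<close>)
 then have "continuous_on P (%y. \<bar>L y\<bar>)" by (intro continuous_intros)
 then have "open (P Int (%y. \<bar>L y\<bar>) -` {e<..})" using continuous_open_preimage[OF _ P(1) open_greaterThan] by blast
 moreover have "coord c x \<in> P Int (%y. \<bar>L y\<bar>) -` {e<..}"
  using c x xX e interior_iff[OF c] laplacian_chart[OF c N _ fN x(1)] by (simp add: P_def L_def)
 moreover have "P Int (%y. \<bar>L y\<bar>) -` {e<..} <= coord c ` ({x \<in> collar M \<rho>. C' < ennreal \<bar>laplacian M f x\<bar>} Int cdom c)"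
 proof
  fix y assume y: "y \<in> P Int (%y. \<bar>L y\<bar>) -` {e<..}"
  let ?x = "coord_inv c y"
  have yr: "y \<in> rng c" "?x \<in> cdom c" "?x \<in> ?N" "y $ kk > 0" using y c by (auto simp: P_def)
  have "?x \<in> interior_of_mfd M" using interior_iff[OF c(1) yr(2)] yr c by simp
  then have "laplacian M f ?x = L y" unfolding L_def using laplacian_chart[OF c(1) yr(2) N yr(3) fN] by simp
  then have "ennreal e <= ennreal \<bar>laplacian M f ?x\<bar>" using y by (intro ennreal_leI) auto
  then have "C' < ennreal \<bar>laplacian M f ?x\<bar>" using C'(2) by (rule less_le_trans[rotated])
  moreover have "?x \<in> collar M \<rho>" using yr(3) by (auto simp: collar_def)
  ultimately show "y \<in> coord c ` ({x \<in> collar M \<rho>. C' < ennreal \<bar>laplacian M f x\<bar>} Int cdom c)"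
   using yr c by (intro image_eqI[of _ _ ?x]) auto
 qed
 moreover have "negligible (coord c ` ({x \<in> collar M \<rho>. C' < ennreal \<bar>laplacian M f x\<bar>} Int cdom c))"
  using C'(1) c(1) unfolding null_in_def by blast
 ultimately show False using negligible_subset open_not_negligible by blast
qed

lemma boundary_slice: "c \<in> atlas M ==> slice_chart M (boundary M) c 0"
proof -
 assume c: "c \<in> atlas M"
 have "x \<in> boundary M Int cdom c \<longleftrightarrow> x \<in> {x \<in> cdom c. coord c x $ kk = 0}" for x
  by (cases "x \<in> cdom c") (simp_all add: boundary_iff[OF c])
 then show ?thesis unfolding slice_chart_def using c by (intro conjI set_eqI)
qed

text \<open>Transitions preserve the boundary, so that tangent vectors remain tangent, and the half-space, so that
 \<open>m\<close> is not negative.\<close>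

lemma Jac_normal_component:
 assumes c: "c \<in> atlas M" "c' \<in> atlas M" "x \<in> cdom c" "x \<in> cdom c'" and b: "x \<in> boundary M"
 obtains m where "m > 0" "!!v. Jac c c' x v $ kk = m * v $ kk"
proof -
 let ?J = "Jac c c' x"
 have l: "linear ?J" by (rule Jac_linear[OF c])
 define m where "m = ?J (axis kk 1) $ kk"
 have y: "coord c x \<in> slab c 0 Int ov c c'" using c b boundary_iff[OF c(1,3)] by (auto simp: slab_def ov_iff)
 have tan: "?J v $ kk = 0" if "v $ kk = 0" for v
  using Jac_tangential[OF boundary_slice[OF c(1)] boundary_slice[OF c(2)] y that] c by simp
 have J: "?J v $ kk = m * v $ kk" for v
 proof -
  have "v = upd kk 0 v + v $ kk *R axis kk 1" by (auto simp: vec_eq_iff upd_def axis_def)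
  then have "?J v = ?J (upd kk 0 v + v $ kk *R axis kk 1)" by (rule arg_cong)
  also have "... = ?J (upd kk 0 v) + v $ kk *R ?J (axis kk 1)" by (simp add: linear_add[OF l] linear_scale[OF l])
  finally show ?thesis using tan[of "upd kk 0 v"] by (simp add: m_def)
 qed
 have "m ~= 0"
 proof
  assume "m = 0"
  then have "?J v $ kk = 0" for v using J by simp
  moreover obtain v where "?J v = axis kk 1" using Jac_surj[OF c] by (metis surjD)
  ultimately show False by (metis axis_nth zero_neq_one)
 qed
 moreover have "m >= 0"
 proof -
  obtain W where W: "open W" "ov c c' = HS Int W" using ov_open[OF c(1,2)] by (auto simp: openin_open)
  let ?l = "%s. coord c x + s *R axis kk 1"
  have yW: "coord c x \<in> W" "coord c x \<in> HS" using y W(2) by auto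
  obtain e where e: "e > 0" "ball (coord c x) e <= W" using W(1) yW(1) open_contains_ball by blast
  have lov: "?l s \<in> ov c c'" if "s \<in> {0..<e}" for s
   using that e(2) yW(2) unfolding W(2) by (auto simp: half_space_def dist_norm subset_eq)
  have l0: "coord c x + 0 *R axis kk 1 = coord c x" by simp
  have "(?l has_derivative (%s. s *R axis kk 1)) (at 0 within {0..<e})" by (auto intro!: derivative_eq_intros)
  moreover have "(transition c c' has_derivative ?J) (at (?l 0) within ?l ` {0..<e})"
   unfolding l0 by (rule has_derivative_subset[OF Jac_derivative[OF c]]) (use lov in blast)
  ultimately have "(transition c c' o ?l has_derivative ?J o (%s. s *R axis kk 1)) (at 0 within {0..<e})"
   by (rule diff_chain_within)
  then have "((%s. (transition c c' o ?l) s $ kk) has_derivative (%s. (?J o (%s. s *R axis kk 1)) s $ kk)) (at 0 within {0..<e})"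
   by (rule bounded_linear.has_derivative[OF bounded_linear_vec_nth])
  then have d: "((%s. transition c c' (?l s) $ kk) has_real_derivative m) (at 0 within {0..<e})"
   by (simp add: o_def J has_field_derivative_def)
  show ?thesis
  proof (rule right_derivative_nonneg[OF d e(1)])
   fix s assume "s \<in> {0..<e}"
   then have "transition c c' (?l s) \<in> ov c' c" using lov transition_in[OF c(1), of c'] by blast
   then have "transition c c' (?l s) \<in> HS" using ov_subset atlasD(5)[OF c(2)] by blast
   moreover have "transition c c' (coord c x) $ kk = 0" using c boundary_iff[OF c(2,4)] b by (simp add: transition_simps)
   ultimately show "transition c c' (?l 0) $ kk <= transition c c' (?l s) $ kk" by (simp add: half_space_def)
  qed
 qed
 ultimately show ?thesis using that[of m] J by simp
qed

text \<open>The inward unit normal is \<open>G\<^sup>-\<^sup>1 e\<^sub>k\<close> in the chart \<open>c\<close>; its image under the Jacobian has the defining properties in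
 the chart that the definition refers to.\<close>

lemma normal_derivative_chart:
 assumes c: "c \<in> atlas M" "x \<in> cdom c" and b: "x \<in> boundary M"
  and g: "matrix_inv (metric M c x) $ kk $ kk = 1" and f: "diff_at (chart_at M x) f x"
 shows "normal_derivative M f x = - (matrix_inv (metric M c x) *v dgrad c f x) $ kk"
proof -
 have xX: "x \<in> X" using b by (simp add: boundary_def)
 define c' where "c' = chart_at M x"
 have c': "c' \<in> atlas M" "x \<in> cdom c'" unfolding c'_def using chart_at_atlas[OF xX] by auto
 let ?G = "metric M c x" and ?G' = "metric M c' x" and ?J = "Jac c c' x"
 note pd = metric_posdef[OF c] and pd' = metric_posdef[OF c']
 obtain m where m: "m > 0" "!!v. ?J v $ kk = m * v $ kk" using Jac_normal_component[OF c(1) c'(1) c(2) c'(2) b] by blast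
 define e where "e = matrix_inv ?G *v axis kk (1::real)"
 have ek: "e \<bullet> (?G *v v) = v $ kk" for v
  using posdef_inner_commute[OF pd, of e v] unfolding e_def posdef_inv(3)[OF pd] by (simp add: inner_axis)
 have ekk: "e $ kk = 1" unfolding e_def using g by (simp add: matrix_vector_mult_def axis_def if_distrib cong: if_cong)
 define n where "n = - ?J e"
 have l: "linear ?J" by (rule Jac_linear[OF c(1) c'(1) c(2) c'(2)])
 have nG: "n \<bullet> (?G' *v ?J w) = - w $ kk" for w
  using metric_law[OF c(1) c'(1) c(2) c'(2), of e w] ek[of w] by (simp add: n_def)
 have nJ: "n = ?J (- e)" unfolding n_def by (simp add: linear_neg[OF l])
 have normal: "n \<bullet> (?G' *v n) = 1" using nG[of "- e"] ekk by (simp flip: nJ)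
 have tang: "n \<bullet> (?G' *v w) = 0" if w: "w $ kk = 0" for w
 proof -
  obtain v where v: "w = ?J v" using Jac_surj[OF c(1) c'(1) c(2) c'(2)] by (metis surjD)
  then have "v $ kk = 0" using w m by simp
  then show ?thesis using nG[of v] v by simp
 qed
 have neg: "n $ kk < 0" using m ekk by (simp add: n_def)
 have unique: "v = n" if v: "v \<bullet> (?G' *v v) = 1" "!!w. w $ kk = 0 ==> v \<bullet> (?G' *v w) = 0" "v $ kk < 0" for v
 proof -
  \<comment> \<open>subtract the multiple of \<open>n\<close> that makes the difference tangential\<close>
  define a where "a = v $ kk / n $ kk"
  have a: "a > 0" unfolding a_def using v(3) neg by (simp add: divide_neg_neg)
  define w where "w = v - a *R n"
  have wk: "w $ kk = 0" using neg by (simp add: w_def a_def)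
  have "w \<bullet> (?G' *v w) = v \<bullet> (?G' *v w) - a * (n \<bullet> (?G' *v w))" by (simp add: w_def inner_diff_left)
  then have "w = 0" using v(2)[OF wk] tang[OF wk] posdef_zero_iff[OF pd', of w] by simp
  then have va: "v = a *R n" by (simp add: w_def)
  then have "a * a = 1" using v(1) normal by (simp add: matrix_vector_mult_scaleR)
  then have "a = 1" using a square_eq_1_iff[of a] by auto
  then show ?thesis using va by simp
 qed
 have "outward_unit_normal M c' x = n"
  unfolding outward_unit_normal_def
 proof (rule the_equality)
  show "n \<bullet> (?G' *v n) = 1 & (ALL w. w $ kk = 0 --> n \<bullet> (?G' *v w) = 0) & n $ kk < 0"
   using normal tang neg by blast
  show "v = n" if "v \<bullet> (?G' *v v) = 1 & (ALL w. w $ kk = 0 --> v \<bullet> (?G' *v w) = 0) & v $ kk < 0" for v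
   by (rule unique) (use that in blast)+
 qed
 then have "normal_derivative M f x = dif c' f x n"
  unfolding normal_derivative_def Let_def c'_def[symmetric] dif_def rng_def by simp
 also have "... = dif c f x (- e)"
  unfolding nJ by (rule dif_change(2)[symmetric, OF c(1) c'(1) c(2) c'(2)]) (use f c'_def in simp)
 also have "... = - (dgrad c f x \<bullet> e)"
  by (subst linear_dgrad) (use dif_change(1)[OF c(1) c'(1) c(2) c'(2)] f c'_def in auto)
 also have "dgrad c f x \<bullet> e = (matrix_inv ?G *v dgrad c f x) $ kk"
  using posdef_inner_commute[OF posdef_matrix_inv[OF pd], of "dgrad c f x" "axis kk 1"] unfolding e_def
  by (simp add: inner_axis')
 finally show ?thesis .
qed

lemma C1_local_expr:
 assumes "Ck_fun_on M 1 f X" "c \<in> atlas M" shows "Ck_on (Suc 0) (local_expr c f) (rng c)"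
proof -
 have "Ck_on (Suc 0) (local_expr c f) (coord c ` (X Int cdom c))" using assms unfolding Ck_fun_on_def by simp
 moreover have "coord c ` (X Int cdom c) = rng c" using atlasD(4)[OF assms(2)] by (auto simp: rng_def)
 ultimately show ?thesis by simp
qed

lemma C1_diff_at:
 assumes f: "Ck_fun_on M 1 f X" and c: "c \<in> atlas M" "x \<in> cdom c" shows "diff_at c f x"
proof -
 from Ck_on_frechet_within(1)[OF atlasD(2)[OF c(1)] C1_local_expr[OF f c(1)] coord_in_rng[OF c(2)]]
 show ?thesis unfolding diff_at_def dif_def .
qed

lemma dgrad_continuous:
 assumes f: "Ck_fun_on M 1 f X" and c: "c \<in> atlas M"
 shows "continuous_on (rng c) (%y. dgrad c f (coord_inv c y))" "continuous_on (rng c) (local_expr c f)"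
proof -
 note C = C1_local_expr[OF f c]
 show "continuous_on (rng c) (local_expr c f)" by (rule Ck_on_continuous[OF C])
 have "continuous_on (rng c) (%y. frechet_derivative (local_expr c f) (at y within rng c) (axis i 1))" for i
  by (rule Ck_on_continuous[OF Ck_on_frechet_within(2)[OF atlasD(2)[OF c] C]])
 then have "continuous_on (rng c) (%y. dif c f (coord_inv c y) (axis i 1))" for i
  by (rule continuous_on_cong[THEN iffD1, OF refl, rotated]) (use c in \<open>simp add: dif_def\<close>)
 then show "continuous_on (rng c) (%y. dgrad c f (coord_inv c y))"
  unfolding dgrad_def by (intro continuous_on_vec_lambda)
qed

end

section \<open>A field of nonnegative divergence\<close>

text \<open>Here \<open>W\<close> and \<open>Q\<close> are the densitized gradients of \<open>u\<close> and of the distance. The terms with \<open>\<psi>' u W\<^sub>k\<close> that come from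
 the two summands of the field cancel.\<close>

lemma flux_divergence:
 fixes U \<eta> :: "real ^ 'n::finite => real" and W Q :: "real ^ 'n => real ^ 'n" and C \<rho> :: real and k :: "'n"
 defines "\<psi> == %t::real. (\<rho> - t) + C * (\<rho>^2 - t^2)"
 defines "F == %y. (2 * \<psi> (y $ k) * U y) *R W y + ((U y)^2 * (1 + 2 * C * y $ k)) *R Q y"
 assumes \<eta>: "(\<eta> has_derivative \<eta>') (at y)" and U: "(U has_derivative U') (at y)"
  and W: "!!j. ((%y. W y $ j) has_derivative W' j) (at y)" and Q: "!!j. ((%y. Q y $ j) has_derivative Q' j) (at y)"
  and div: "(SUM j:UNIV. W' j (axis j 1)) = 0" and WQ: "W y $ k = (SUM j:UNIV. Q y $ j * U' (axis j 1))"
 shows "(SUM j:UNIV. pdv j (%y. (\<eta> y *R F y) $ j) y)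
  = \<eta> y * (2 * \<psi> (y $ k) * (SUM j:UNIV. U' (axis j 1) * W y $ j)
    + (U y)^2 * (2 * C * Q y $ k + (1 + 2 * C * y $ k) * (SUM j:UNIV. Q' j (axis j 1))))
   + (SUM j:UNIV. \<eta>' (axis j 1) * F y $ j)"
proof -
 let ?t = "y $ k" and ?s = "1 + 2 * C * y $ k"
 let ?D = "%j v. \<eta> y * (2 * (- (v $ k) * ?s) * U y * W y $ j + 2 * \<psi> ?t * U' v * W y $ j + 2 * \<psi> ?t * U y * W' j v
   + 2 * U y * U' v * ?s * Q y $ j + (U y)^2 * (2 * C * v $ k) * Q y $ j + (U y)^2 * ?s * Q' j v) + \<eta>' v * F y $ j"
 have k: "((%y :: real ^ 'n. y $ k) has_derivative (%v. v $ k)) (at y)"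
  by (rule bounded_linear_imp_has_derivative[OF bounded_linear_vec_nth])
 have d: "frechet_derivative (%y. (\<eta> y *R F y) $ j) (at y) = ?D j" for j
 proof (rule frechet_derivative_at[symmetric])
  have "((%y. \<eta> y * (2 * ((\<rho> - y $ k) + C * (\<rho>^2 - (y $ k)^2)) * U y * W y $ j + (U y)^2 * (1 + 2 * C * y $ k) * Q y $ j)) has_derivative ?D j) (at y)"
   by (rule \<eta> U W Q k derivative_eq_intros refl)+
    (simp add: fun_eq_iff \<psi>_def F_def algebra_simps power2_eq_square)
  then show "((%y. (\<eta> y *R F y) $ j) has_derivative ?D j) (at y)" by (simp add: F_def \<psi>_def)
 qed
 have sk: "(SUM j:UNIV. (axis j 1 :: real ^ 'n) $ k * f j) = f k" for f :: "'n => real"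
  by (simp add: axis_def if_distrib if_distribR cong: if_cong)
 have "(SUM j:UNIV. pdv j (%y. (\<eta> y *R F y) $ j) y)
  = \<eta> y * (- 2 * ?s * U y * (SUM j:UNIV. (axis j 1 :: real ^ 'n) $ k * W y $ j) + 2 * \<psi> ?t * (SUM j:UNIV. U' (axis j 1) * W y $ j)
   + 2 * \<psi> ?t * U y * (SUM j:UNIV. W' j (axis j 1)) + 2 * U y * ?s * (SUM j:UNIV. Q y $ j * U' (axis j 1))
   + (U y)^2 * (2 * C) * (SUM j:UNIV. (axis j 1 :: real ^ 'n) $ k * Q y $ j) + (U y)^2 * ?s * (SUM j:UNIV. Q' j (axis j 1)))
   + (SUM j:UNIV. \<eta>' (axis j 1) * F y $ j)"
  unfolding d sum_distrib_left sum.distrib[symmetric] by (rule sum.cong[OF refl]) (simp add: algebra_simps)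
 also have "... = \<eta> y * (2 * \<psi> ?t * (SUM j:UNIV. U' (axis j 1) * W y $ j)
    + (U y)^2 * (2 * C * Q y $ k + ?s * (SUM j:UNIV. Q' j (axis j 1))))
   + (SUM j:UNIV. \<eta>' (axis j 1) * F y $ j)"
  unfolding sk div WQ by (simp add: algebra_simps)
 finally show ?thesis .
qed

locale steklov_collar = collar_cover M rs N c z r
 for M :: "('p::t2_space, 'n::finite) riem" and rs N c z r +
 fixes u :: "'p => real" and C \<rho> :: real
 assumes u1: "Ck_fun_on M 1 u (carrier M)" and u2: "Ck_fun_on M 2 u (interior_of_mfd M)"
  and harm: "!!x. x \<in> interior_of_mfd M ==> laplacian M u x = 0"
  and d2: "Ck_fun_on M 2 (bdist_real M) (collar M rs)"
  and C: "C >= 0" "C * rs <= 1 / 4"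
  and lapd: "!!x. x \<in> interior_of_mfd M ==> bdist M x < ennreal rs ==> \<bar>laplacian M (bdist_real M) x\<bar> <= C"
  and rho: "0 < \<rho>" "\<rho> <= rs"
begin

text \<open>The function vanishes at \<open>\<rho>\<close>, and \<open>\<psi>'' + \<psi>' \<Delta>d \<le> 0\<close> whenever \<open>\<bar>\<Delta>d\<bar> \<le> C\<close> and \<open>0 \<le> 2 C t \<le> 1\<close>.\<close>

definition psi :: "real => real" where "psi t = (\<rho> - t) + C * (\<rho>^2 - t^2)"

text \<open>The densitized gradient of the distance in a collar chart, in a form that makes sense up to \<open>d = \<rho>\<close>.\<close>

definition Qf :: "('p, 'n) chart => real ^ 'n => real ^ 'n" where
 "Qf c' y = sqrt (det (gloc c' y)) *R (matrix_inv (gloc c' y) *v axis kk 1)"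

text \<open>The field \<open>2 \<psi>(d) u \<nabla>u - u\<^sup>2 \<psi>'(d) \<nabla>d\<close> times the volume density.\<close>

definition Fl :: "('p, 'n) chart => real ^ 'n => real ^ 'n" where
 "Fl c' y = (2 * psi (y $ kk) * local_expr c' u y) *R Wf c' u y
   + ((local_expr c' u y)^2 * (1 + 2 * C * y $ kk)) *R Qf c' y"

definition cflux :: "nat => real ^ 'n => real ^ 'n" where
 "cflux i y = (if y \<in> rng (c i) then local_expr (c i) (chi i) y *R Fl (c i) y else 0)"

definition open_slab :: "nat => (real ^ 'n) set" where
 "open_slab i = {y \<in> rng (c i). 0 < y $ kk & y $ kk < \<rho>}"

lemma cw_eq:
 assumes i: "i < N" and y: "y \<in> rng (c i)" "y $ kk <= rs"
 shows "cw (c i) y = sqrt (det (gloc (c i) y))"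
proof -
 have "det (gloc (c i) y) > 0" by (rule gloc_det_pos[OF cc_atlas[OF i] y(1)])
 moreover have "matrix_inv (gloc (c i) y) $ kk $ kk = 1" by (rule ccoord_inverse_metric[OF cc[OF i] rs y])
 ultimately have "tangential_det kk (gloc (c i) y) = det (gloc (c i) y)"
  using matrix_inv_diagonal[of "gloc (c i) y" kk] by simp
 then show ?thesis by (simp add: cw_def)
qed

lemma open_slab_eq: "i < N ==> open_slab i = ball (z i) (r i) Int {y. 0 < y $ kk} Int {y. y $ kk < \<rho>}"
 unfolding open_slab_def cc_rng by (auto simp: half_space_def)

lemma open_slab_open: "i < N ==> open (open_slab i)"
 unfolding open_slab_eq by (intro open_Int open_ball open_Collect_less continuous_intros)

lemma slab_point:
 assumes i: "i < N" and y: "y \<in> rng (c i)" "y $ kk <= rs"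
 shows "coord_inv (c i) y \<in> X" "bdist M (coord_inv (c i) y) = ennreal (y $ kk)" "bdist_real M (coord_inv (c i) y) = y $ kk"
  "0 <= y $ kk" "coord_inv (c i) y \<in> collar M rs"
proof -
 note ci = cc_atlas[OF i]
 have x: "coord_inv (c i) y \<in> cdom (c i)" "coord (c i) (coord_inv (c i) y) = y" using ci y by auto
 show X: "coord_inv (c i) y \<in> X" using atlasD(4)[OF ci] x(1) by blast
 show b: "bdist M (coord_inv (c i) y) = ennreal (y $ kk)" and "bdist_real M (coord_inv (c i) y) = y $ kk"
  using cc_coordinate[OF i x(1)] x(2) y(2) by auto
 show "0 <= y $ kk" using coord_nonneg[OF ci x(1)] x(2) by simp
 show "coord_inv (c i) y \<in> collar M rs" using X b y(2) by (simp add: collar_def ennreal_leI)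
qed

lemma open_slab_inner:
 assumes i: "i < N"
 shows "open_slab i <= inner_part (c i)"
proof
 fix y assume "y \<in> open_slab i"
 then have y: "y \<in> rng (c i)" "0 < y $ kk" "y $ kk < \<rho>" by (auto simp: open_slab_def)
 then show "y \<in> inner_part (c i)" using slab_point[OF i y(1)] rho by (simp add: inner_part_def ennreal_less_iff)
qed

lemma inner_interior: "c' \<in> atlas M ==> y \<in> inner_part c' ==> coord_inv c' y \<in> interior_of_mfd M"
 using interior_iff[of c' "coord_inv c' y"] by (simp add: inner_part_def)

lemma u_C2:
 assumes c': "c' \<in> atlas M" shows "Ck_on_open 2 (local_expr c' u) (inner_part c')"
proof (rule Ck_on_open_subset[OF local_expr_C2_interior[OF c' interior_open u2]], rule subsetI)
 fix y assume "y \<in> inner_part c'"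
 then show "y \<in> {y \<in> rng c'. coord_inv c' y \<in> interior_of_mfd M & 0 < y $ kk}"
  using inner_interior[OF c', of y] by (simp add: inner_part_def)
qed

lemma d_C2: "c' \<in> atlas M ==> Ck_on_open 2 (local_expr c' (bdist_real M)) (inner_part c')"
 unfolding inner_part_def
 by (rule local_expr_C2_interior[OF _ bdist_sublevel_open Ck_fun_on_subset[OF d2]]) (auto simp: collar_def)

lemma d_gradient:
 assumes i: "i < N" and y: "y \<in> open_slab i"
 shows "dgrad (c i) (bdist_real M) (coord_inv (c i) y) = axis kk 1" "diff_at (c i) (bdist_real M) (coord_inv (c i) y)"
proof -
 note ci = cc_atlas[OF i]
 have yr: "y \<in> rng (c i)" using y by (simp add: open_slab_def)
 have "((%y. y $ kk) has_derivative (%v. v $ kk)) (at y)"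
  by (rule bounded_linear_imp_has_derivative[OF bounded_linear_vec_nth])
 then have "(local_expr (c i) (bdist_real M) has_derivative (%v. v $ kk)) (at y)"
  by (rule has_derivative_transform_within_open[OF _ open_slab_open[OF i] y])
   (insert slab_point(3)[OF i] rho, auto simp: open_slab_def local_expr_def)
 then have D: "(local_expr (c i) (bdist_real M) has_derivative (%v. v $ kk)) (at (coord (c i) (coord_inv (c i) y)) within rng (c i))"
  using ci yr by (simp add: has_derivative_at_withinI)
 note dif = diff_atI[OF ci coord_inv_in[OF ci yr] D]
 show "diff_at (c i) (bdist_real M) (coord_inv (c i) y)" by (rule dif(1))
 show "dgrad (c i) (bdist_real M) (coord_inv (c i) y) = axis kk 1"
  unfolding dgrad_def dif(2) by (auto simp: vec_eq_iff axis_def)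
qed

lemma Qf_Wf: "i < N ==> y \<in> open_slab i ==> Qf (c i) y = Wf (c i) (bdist_real M) y"
 unfolding Qf_def Wf_def using d_gradient(1) by simp

lemma inner_within: "c' \<in> atlas M ==> y \<in> inner_part c' ==> at y within rng c' = at y"
 by (rule at_within_rng[OF inner_part_open inner_part_sub])

text \<open>The equation for \<open>u\<close> and the bound on \<open>\<Delta>d\<close>, in divergence form in a collar chart.\<close>

lemma chart_data:
 assumes i: "i < N" and y: "y \<in> open_slab i"
 shows "(local_expr (c i) (chi i) has_derivative frechet_derivative (local_expr (c i) (chi i)) (at y)) (at y)"
  "(local_expr (c i) u has_derivative frechet_derivative (local_expr (c i) u) (at y)) (at y)"
  "((%y. Wf (c i) u y $ j) has_derivative frechet_derivative (%y. Wf (c i) u y $ j) (at y)) (at y)"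
  "((%y. Qf (c i) y $ j) has_derivative frechet_derivative (%y. Qf (c i) y $ j) (at y)) (at y)"
  "(SUM j:UNIV. pdv j (%y. Wf (c i) u y $ j) y) = 0"
  "\<bar>SUM j:UNIV. pdv j (%y. Qf (c i) y $ j) y\<bar> <= C * sqrt (det (gloc (c i) y))"
  "dgrad (c i) u (coord_inv (c i) y) $ j = pdv j (local_expr (c i) u) y"
  "dgrad (c i) (chi i) (coord_inv (c i) y) $ j = pdv j (local_expr (c i) (chi i)) y"
proof -
 note ci = cc_atlas[OF i]
 have yi: "y \<in> inner_part (c i)" using open_slab_inner[OF i] y by blast
 have yr: "y \<in> rng (c i)" using y by (simp add: open_slab_def)
 note io = inner_part_open[OF ci] inner_part_sub[of "c i"]
 have D1: "(f has_derivative frechet_derivative f (at y)) (at y)" if "Ck_on_open 1 f S" "y \<in> S" for f :: "real ^ 'n => real" and S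
  using Ck_on_open_SucD[of 0 f S y] that by simp
 show "(local_expr (c i) (chi i) has_derivative frechet_derivative (local_expr (c i) (chi i)) (at y)) (at y)"
  by (rule D1[OF chi_C1[OF i ci] yi])
 show "(local_expr (c i) u has_derivative frechet_derivative (local_expr (c i) u) (at y)) (at y)"
  by (rule D1[OF Ck_on_open_mono[OF u_C2[OF ci]] yi]) simp
 show "((%y. Wf (c i) u y $ j) has_derivative frechet_derivative (%y. Wf (c i) u y $ j) (at y)) (at y)" for j
  by (rule D1[OF Wf_C1[OF ci io u_C2[OF ci]] yi])
 have WQ: "((%y. Qf (c i) y $ j) has_derivative frechet_derivative (%y. Wf (c i) (bdist_real M) y $ j) (at y)) (at y)" for j
  by (rule has_derivative_transform_within_open[OF D1[OF Wf_C1[OF ci io d_C2[OF ci]] yi] open_slab_open[OF i] y])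
   (use Qf_Wf[OF i] in simp)
 then have Qe: "frechet_derivative (%y. Qf (c i) y $ j) (at y) = frechet_derivative (%y. Wf (c i) (bdist_real M) y $ j) (at y)" for j
  using frechet_derivative_at by metis
 show "((%y. Qf (c i) y $ j) has_derivative frechet_derivative (%y. Qf (c i) y $ j) (at y)) (at y)" for j
  using WQ Qe by simp
 have int: "coord_inv (c i) y \<in> interior_of_mfd M" by (rule inner_interior[OF ci yi])
 have x: "coord_inv (c i) y \<in> cdom (c i)" using ci yr by simp
 have sd: "sqrt (det (gloc (c i) y)) > 0" using gloc_det_pos[OF ci yr] by simp
 have lap: "(SUM j:UNIV. pdv j (%y. Wf (c i) f y $ j) y) = sqrt (det (gloc (c i) y)) * laplacian_in M (c i) f (coord_inv (c i) y)" for f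
  unfolding laplacian_in_eq[OF ci io yi] using sd by simp
 have "laplacian_in M (c i) u (coord_inv (c i) y) = 0"
  using laplacian_chart[OF ci x interior_open int u2 int] harm[OF int] by simp
 then show "(SUM j:UNIV. pdv j (%y. Wf (c i) u y $ j) y) = 0" unfolding lap by simp
 have b: "bdist M (coord_inv (c i) y) < ennreal rs" using yi by (simp add: inner_part_def)
 have "laplacian M (bdist_real M) (coord_inv (c i) y) = laplacian_in M (c i) (bdist_real M) (coord_inv (c i) y)"
  by (rule laplacian_chart[OF ci x bdist_sublevel_open _ Ck_fun_on_subset[OF d2] int])
   (insert b yi, auto simp: collar_def inner_part_def)
 then have "\<bar>laplacian_in M (c i) (bdist_real M) (coord_inv (c i) y)\<bar> <= C" using lapd[OF int b] by simp
 then show "\<bar>SUM j:UNIV. pdv j (%y. Qf (c i) y $ j) y\<bar> <= C * sqrt (det (gloc (c i) y))"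
  unfolding Qe lap using sd by (simp add: abs_mult mult.commute)
 show "dgrad (c i) u (coord_inv (c i) y) $ j = pdv j (local_expr (c i) u) y"
  "dgrad (c i) (chi i) (coord_inv (c i) y) $ j = pdv j (local_expr (c i) (chi i)) y" for j
  using ci yr inner_within[OF ci yi] by (simp_all add: dgrad_def dif_def)
qed

lemma psi_nonneg: "0 <= t ==> t <= \<rho> ==> psi t >= 0"
 unfolding psi_def using C(1) by (intro add_nonneg_nonneg mult_nonneg_nonneg) (auto intro: power_mono)

lemma cflux_divergence:
 assumes i: "i < N" and y: "y \<in> open_slab i"
 shows "(SUM j:UNIV. pdv j (%y. cflux i y $ j) y)
  >= (SUM j:UNIV. pdv j (local_expr (c i) (chi i)) y * Fl (c i) y $ j)"
proof -
 note ci = cc_atlas[OF i] and D = chart_data[OF i y]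
 have yr: "y \<in> rng (c i)" "0 < y $ kk" "y $ kk < \<rho>" using y by (auto simp: open_slab_def)
 have pd: "posdef (gloc (c i) y)" by (rule gloc_posdef[OF ci yr(1)])
 let ?g = "sqrt (det (gloc (c i) y))" and ?U = "local_expr (c i) u"
 have sd: "?g > 0" using gloc_det_pos[OF ci yr(1)] by simp
 have WQ: "Wf (c i) u y $ kk = (SUM j:UNIV. Qf (c i) y $ j * pdv j ?U y)"
  unfolding Wf_def Qf_def
  by (simp add: matrix_vector_mult_def axis_def if_distrib D(7) posdef_sym[OF posdef_matrix_inv[OF pd], of kk] sum_distrib_left mult.assoc cong: if_cong)
 have ginv: "matrix_inv (gloc (c i) y) $ kk $ kk = 1"
  by (rule ccoord_inverse_metric[OF cc[OF i] rs yr(1)]) (use yr rho in simp)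
 have Qk: "Qf (c i) y $ kk = ?g" unfolding Qf_def using ginv by (simp add: matrix_vector_mult_def axis_def if_distrib cong: if_cong)
 have "(SUM j:UNIV. pdv j ?U y * Wf (c i) u y $ j)
   = ?g * (dgrad (c i) u (coord_inv (c i) y) \<bullet> (matrix_inv (gloc (c i) y) *v dgrad (c i) u (coord_inv (c i) y)))"
  unfolding Wf_def inner_vec_def by (simp add: D(7) sum_distrib_left mult_ac)
 then have grad: "(SUM j:UNIV. pdv j ?U y * Wf (c i) u y $ j) >= 0"
  using posdef_nonneg[OF posdef_matrix_inv[OF pd]] sd by simp
 \<comment> \<open>\<open>- \<psi>'' - \<psi>' \<Delta>d = 2 C + (1 + 2 C t) \<Delta>d \<ge> 2 C - (1 + 2 C t) C\<close>\<close>
 have "2 * C * y $ kk <= 1" using C yr rho mult_left_mono[of "y $ kk" rs C] by simp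
 then have "C * (1 + 2 * C * y $ kk) <= 2 * C" using C mult_left_mono[of "1 + 2 * C * y $ kk" 2 C] by simp
 moreover have "(1 + 2 * C * y $ kk) * - (C * ?g) <= (1 + 2 * C * y $ kk) * (SUM j:UNIV. pdv j (%y. Qf (c i) y $ j) y)"
  using D(6) C yr by (intro mult_left_mono) auto
 ultimately have lap: "2 * C * Qf (c i) y $ kk + (1 + 2 * C * y $ kk) * (SUM j:UNIV. pdv j (%y. Qf (c i) y $ j) y) >= 0"
  unfolding Qk using mult_right_mono[of "C * (1 + 2 * C * y $ kk)" "2 * C" ?g] sd by (simp add: algebra_simps)
 have e: "frechet_derivative (%y. cflux i y $ j) (at y) = frechet_derivative (%y. (local_expr (c i) (chi i) y *R Fl (c i) y) $ j) (at y)" for j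
 proof -
  have eq: "cflux i w $ j = (local_expr (c i) (chi i) w *R Fl (c i) w) $ j" if "w \<in> open_slab i" for w
   using that by (simp add: cflux_def open_slab_def)
  have "((%y. cflux i y $ j) has_derivative f') (at y) \<longleftrightarrow> ((%y. (local_expr (c i) (chi i) y *R Fl (c i) y) $ j) has_derivative f') (at y)" for f'
   by (rule iffI) (erule has_derivative_transform_within_open[OF _ open_slab_open[OF i] y], simp only: eq)+
  then show ?thesis by (simp add: frechet_derivative_def)
 qed
 have "(SUM j:UNIV. pdv j (%y. cflux i y $ j) y)
  = local_expr (c i) (chi i) y * (2 * psi (y $ kk) * (SUM j:UNIV. pdv j ?U y * Wf (c i) u y $ j)
    + (?U y)^2 * (2 * C * Qf (c i) y $ kk + (1 + 2 * C * y $ kk) * (SUM j:UNIV. pdv j (%y. Qf (c i) y $ j) y)))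
   + (SUM j:UNIV. pdv j (local_expr (c i) (chi i)) y * Fl (c i) y $ j)"
  unfolding e Fl_def psi_def by (rule flux_divergence[OF D(1,2,3,4,5) WQ])
 moreover have "local_expr (c i) (chi i) y * (2 * psi (y $ kk) * (SUM j:UNIV. pdv j ?U y * Wf (c i) u y $ j)
    + (?U y)^2 * (2 * C * Qf (c i) y $ kk + (1 + 2 * C * y $ kk) * (SUM j:UNIV. pdv j (%y. Qf (c i) y $ j) y))) >= 0"
  by (rule mult_nonneg_nonneg[OF _ add_nonneg_nonneg[OF mult_nonneg_nonneg[OF _ grad] mult_nonneg_nonneg[OF zero_le_power2 lap]]])
   (insert psi_nonneg[of "y $ kk"] yr chi_nonneg[of i], auto simp: local_expr_def)
 ultimately show ?thesis by linarith
qed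

end

section \<open>Monotonicity of the flux and the estimate in L^2\<close>

lemma continuous_on_extend_zero:
 fixes f :: "'a::real_normed_vector => 'b::real_normed_vector"
 assumes c: "continuous_on (S Int ball z r) f" and r: "r > 0" and zero: "!!y. y \<in> S ==> r / 2 <= norm (y - z) ==> f y = 0"
 shows "continuous_on S f"
proof -
 let ?B = "{y. r / 2 < norm (y - z)}"
 have oB: "open ?B" by (intro open_Collect_less continuous_intros)
 have S: "S = (S Int ball z r) Un (S Int ?B)" using r by (auto simp: dist_norm norm_minus_commute)
 have "continuous_on (S Int ?B) f"
  by (rule continuous_on_cong[THEN iffD1, OF refl _ continuous_on_const[of _ 0]]) (use zero in auto)
 with c have "continuous_on ((S Int ball z r) Un (S Int ?B)) f"
  by (rule continuous_on_Un_local_open[rotated 2]) (metis S openin_open_Int open_ball oB)+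
 then show ?thesis using S by simp
qed

lemma Ck_on_open_extend_zero:
 fixes f :: "real ^ 'n::finite => 'b::real_normed_vector"
 assumes c: "Ck_on_open n f (S Int ball z r)" and S: "open S" and r: "r > 0" and zero: "!!y. y \<in> S ==> r / 2 <= norm (y - z) ==> f y = 0"
 shows "Ck_on_open n f S"
proof (rule Ck_on_openD[OF Ck_on_locally S])
 fix y assume y: "y \<in> S"
 let ?B = "{y. r / 2 < norm (y - z)}"
 have oB: "open ?B" by (intro open_Collect_less continuous_intros)
 show "EX T. open T & y \<in> T & Ck_on n f (S Int T)"
 proof (cases "y \<in> ball z r")
  case True
  have "Ck_on n f (S Int ball z r)" by (rule Ck_on_openI[OF open_Int[OF S open_ball] c subset_refl])
  then show ?thesis using True by (intro exI[of _ "ball z r"]) simp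
 next
  case False
  have "Ck_on n f (S Int ?B)"
   by (rule Ck_on_cong[OF Ck_on_openI[OF open_UNIV Ck_on_open_const[of n 0] subset_UNIV]]) (use zero in auto)
  then show ?thesis using False oB r by (intro exI[of _ ?B]) (auto simp: dist_norm norm_minus_commute)
 qed
qed

context riem_manifold begin

lemma chart_function_measurable:
 fixes F :: "'p => real"
 assumes S: "S <= X" and c: "c \<in> atlas M" and F: "continuous_on (S Int cdom c) F" and zero: "!!x. x \<in> S ==> x ~: cdom c ==> F x = 0"
 shows "F \<in> borel_measurable (restrict_space borel S)"
proof (rule borel_measurableI)
 fix U :: "real set" assume U: "open U"
 obtain T0 where T0: "open T0" "cdom c = X Int T0" using atlasD(1)[OF c] by (auto simp: openin_open)
 have A: "S Int cdom c = S Int T0" using S T0 by blast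
 obtain T where T: "open T" "T Int (S Int cdom c) = F -` U Int (S Int cdom c)"
  using F U unfolding continuous_on_open_invariant by blast
 have "F -` U Int S = S Int (if 0 \<in> U then (T Int T0) Un - T0 else T Int T0)"
 proof (rule set_eqI)
  fix x
  show "x \<in> F -` U Int S \<longleftrightarrow> x \<in> S Int (if 0 \<in> U then (T Int T0) Un - T0 else T Int T0)"
  proof (cases "x \<in> S Int cdom c")
   case True
   then have "x \<in> F -` U \<longleftrightarrow> x \<in> T" using T(2) by blast
   moreover have "x \<in> T0" "x \<in> S" using True A by auto
   ultimately show ?thesis by auto
  next
   case False
   then have "x \<in> S ==> x ~: T0" "x \<in> S ==> F x = 0" using A zero[of x] by blast+
   then show ?thesis by (cases "x \<in> S") auto
  qed
 qed
 moreover have "(if 0 \<in> U then (T Int T0) Un - T0 else T Int T0) \<in> sets borel" using T(1) T0(1) by auto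
 ultimately show "F -` U Int space (restrict_space borel S) \<in> sets (restrict_space borel S)"
  by (auto simp: space_restrict_space sets_restrict_space)
qed

end

context steklov_collar begin

lemma chi_local_continuous:
 assumes i: "i < N" shows "continuous_on {y \<in> rng (c i). y $ kk <= rs} (local_expr (c i) (chi i))"
 unfolding local_expr_def o_def
 by (rule continuous_on_compose2[OF chi_continuous[OF i] continuous_on_subset[OF homeomorphism_cont2[OF atlasD(3)[OF cc_atlas[OF i]]]]])
  (use slab_point(5)[OF i] in auto)

lemma Fl_continuous:
 assumes i: "i < N" shows "continuous_on {y \<in> rng (c i). y $ kk <= rs} (Fl (c i))"
proof -
 note ci = cc_atlas[OF i]
 let ?S = "{y \<in> rng (c i). y $ kk <= rs}"
 have sub: "?S <= rng (c i)" by blast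
 have sq: "continuous_on ?S (%y. sqrt (det (gloc (c i) y)))"
  by (rule continuous_on_cong[THEN iffD1, OF refl _ continuous_on_subset[OF cw_continuous[OF ci] sub]]) (simp add: cw_eq[OF i])
 have g: "continuous_on ?S (%y. matrix_inv (gloc (c i) y) *v v y)" if "continuous_on ?S v" for v :: "real ^ 'n => real ^ 'n"
  unfolding matrix_vector_mult_def
  by (intro continuous_on_vec_lambda continuous_on_sum continuous_on_mult continuous_on_subset[OF ginv_continuous[OF ci] sub] continuous_on_component that)
 have u: "continuous_on ?S (local_expr (c i) u)" "continuous_on ?S (%y. dgrad (c i) u (coord_inv (c i) y))"
  using dgrad_continuous[OF u1 ci] continuous_on_subset[OF _ sub] by blast+
 have k: "continuous_on ?S (%y. y $ kk)" by (intro continuous_intros)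
 show ?thesis unfolding Fl_def[abs_def] Wf_def Qf_def psi_def
  by (intro continuous_on_add continuous_on_scaleR continuous_on_mult continuous_on_power continuous_on_const continuous_on_diff u k sq g)
qed

lemma cflux_zero: "i < N ==> r i / 2 <= norm (y - z i) ==> cflux i y = 0"
 using chi_zero[of i "coord_inv (c i) y"] cc_atlas[of i] by (auto simp: cflux_def local_expr_def)

lemma outside_ball: "i < N ==> norm (y::real^'n) > norm (z i) + r i ==> r i / 2 <= norm (y - z i)"
 using norm_triangle_ineq2[of y "z i"] cc_r[of i] by simp

lemma cflux_continuous:
 assumes i: "i < N" shows "continuous_on {y. y $ kk \<in> {0..\<rho>}} (cflux i)"
proof (rule continuous_on_extend_zero[of _ "z i" "r i"])
 let ?S = "{y \<in> rng (c i). y $ kk <= rs}"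
 have "continuous_on ?S (%y. local_expr (c i) (chi i) y *R Fl (c i) y)"
  by (intro continuous_on_scaleR chi_local_continuous Fl_continuous i)
 then have "continuous_on ?S (cflux i)" by (rule continuous_on_cong[THEN iffD1, OF refl, rotated]) (simp add: cflux_def)
 then show "continuous_on ({y. y $ kk \<in> {0..\<rho>}} Int ball (z i) (r i)) (cflux i)"
  by (rule continuous_on_subset) (insert cc_rng[OF i] rho, auto simp: half_space_def)
qed (use cflux_zero[OF i] cc_r[OF i] in auto)

lemma slab_ball: "i < N ==> {y. y $ kk \<in> {0<..<\<rho>}} Int ball (z i) (r i) = open_slab i"
 by (auto simp: open_slab_eq)

lemma full_slab_open: "open {y :: real ^ 'n. y $ kk \<in> {0<..<\<rho>}}"
proof -
 have "{y :: real ^ 'n. y $ kk \<in> {0<..<\<rho>}} = {y. 0 < y $ kk} Int {y. y $ kk < \<rho>}" by auto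
 then show ?thesis by (simp only:) (intro open_Int open_Collect_less continuous_intros)
qed

lemma cflux_C1:
 assumes i: "i < N" shows "Ck_on_open 1 (%y. cflux i y $ j) {y. y $ kk \<in> {0<..<\<rho>}}"
proof (rule Ck_on_open_extend_zero[of _ _ _ "z i" "r i"])
 note ci = cc_atlas[OF i] and o = open_slab_open[OF i] and s = open_slab_inner[OF i]
 have sr: "open_slab i <= rng (c i)" by (auto simp: open_slab_def)
 have u: "Ck_on_open 2 (local_expr (c i) u) (open_slab i)" by (rule Ck_on_open_subset[OF u_C2[OF ci] s])
 have u': "Ck_on_open 1 (local_expr (c i) u) (open_slab i)" by (rule Ck_on_open_mono[OF u]) simp
 have Q: "Ck_on_open 1 (%y. Qf (c i) y $ j) (open_slab i)"
  by (rule Ck_on_open_cong[OF o, THEN iffD1, OF _ Wf_C1[OF ci o sr Ck_on_open_subset[OF d_C2[OF ci] s]]]) (simp add: Qf_Wf[OF i])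
 have k: "Ck_on_open 1 (%y. y $ kk) (open_slab i)" by (rule Ck_on_open_linear[OF bounded_linear_vec_nth o])
 have F: "Ck_on_open 1 (%y. local_expr (c i) (chi i) y * (2 * ((\<rho> - y $ kk) + C * (\<rho> * \<rho> - y $ kk * y $ kk)) * local_expr (c i) u y * Wf (c i) u y $ j
   + (local_expr (c i) u y * local_expr (c i) u y) * (1 + 2 * C * y $ kk) * Qf (c i) y $ j)) (open_slab i)"
  by (intro Ck_on_open_bilinear[OF bounded_bilinear_mult o] Ck_on_open_add[OF o] Ck_on_open_diff[OF o] Ck_on_open_const k u' Q
   Wf_C1[OF ci o sr u] Ck_on_open_subset[OF chi_C1[OF i ci] s])
 show "Ck_on_open 1 (%y. cflux i y $ j) ({y. y $ kk \<in> {0<..<\<rho>}} Int ball (z i) (r i))"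
  unfolding slab_ball[OF i]
  by (rule Ck_on_open_cong[OF o, THEN iffD1, OF _ F])
   (simp add: cflux_def open_slab_def Fl_def psi_def power2_eq_square)
qed (use cflux_zero[OF i] cc_r[OF i] full_slab_open in auto)

text \<open>The part of the divergence of a localized field that contains the derivative of the cut-off.\<close>

definition cut :: "nat => real ^ 'n => real" where
 "cut i y = (if y \<in> rng (c i) then (SUM j:UNIV. pdv j (local_expr (c i) (chi i)) y * Fl (c i) y $ j) else 0)"

lemma cut_slab_continuous:
 assumes i: "i < N" shows "continuous_on (open_slab i) (cut i)"
proof -
 note ci = cc_atlas[OF i]
 have "Ck_on_open (Suc 0) (local_expr (c i) (chi i)) (open_slab i)"
  using Ck_on_open_subset[OF chi_C1[OF i ci] open_slab_inner[OF i]] by simp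
 then have d: "continuous_on (open_slab i) (%y. frechet_derivative (local_expr (c i) (chi i)) (at y) v)" for v by simp
 have F: "continuous_on (open_slab i) (Fl (c i))"
  by (rule continuous_on_subset[OF Fl_continuous[OF i]]) (insert rho, auto simp: open_slab_def)
 have "continuous_on (open_slab i) (%y. SUM j:UNIV. pdv j (local_expr (c i) (chi i)) y * Fl (c i) y $ j)"
  by (intro continuous_on_sum continuous_on_mult d continuous_on_component F)
 then show ?thesis by (rule continuous_on_cong[THEN iffD1, OF refl, rotated]) (simp add: cut_def open_slab_def)
qed

text \<open>The cut-offs are nonnegative, so they are critical wherever they vanish.\<close>

lemma chi_minimum_derivative:
 assumes "(f has_derivative f') (at y)" "open S" "y \<in> S" "f y = 0" "!!w. w \<in> S ==> f w >= (0::real)"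
 shows "f' = (%v. 0)"
 by (rule differential_zero_maxmin[of y S f f']) (use assms in auto)

lemma cut_zero:
 assumes i: "i < N" and y: "y \<in> {y. y $ kk \<in> {0<..<\<rho>}}" "r i / 2 <= norm (y - z i)" shows "cut i y = 0"
proof (cases "y \<in> rng (c i)")
 case True
 then have ys: "y \<in> open_slab i" using y by (simp add: open_slab_def)
 have "chi i (coord_inv (c i) y) = 0" using chi_zero[OF i, of "coord_inv (c i) y"] y True cc_atlas[OF i] by simp
 then have "frechet_derivative (local_expr (c i) (chi i)) (at y) = (%v. 0)"
  by (intro chi_minimum_derivative[OF chart_data(1)[OF i ys] open_slab_open[OF i] ys]) (auto simp: local_expr_def chi_nonneg)
 then show ?thesis by (simp add: cut_def)
qed (simp add: cut_def)

lemma cut_continuous: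
 assumes i: "i < N" shows "continuous_on {y. y $ kk \<in> {0<..<\<rho>}} (cut i)"
 by (rule continuous_on_extend_zero[of _ "z i" "r i"])
  (use cut_zero[OF i] cc_r[OF i] cut_slab_continuous[OF i] slab_ball[OF i] in auto)

lemma cflux_divergence_ge_cut:
 assumes i: "i < N" and y: "y \<in> {y. y $ kk \<in> {0<..<\<rho>}}"
 shows "cut i y <= (SUM j:UNIV. pdv j (%y. cflux i y $ j) y)"
proof (cases "y \<in> rng (c i)")
 case True
 then show ?thesis using cflux_divergence[OF i, of y] y by (simp add: cut_def open_slab_def)
next
 case False
 let ?B = "{y. r i / 2 < norm (y - z i)}"
 have oB: "open ?B" by (intro open_Collect_less continuous_intros)
 have "y \<in> ?B" using False y cc_rng[OF i] cc_r[OF i] by (auto simp: half_space_def dist_norm norm_minus_commute)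
 then have "((%y. cflux i y $ j) has_derivative (%v. 0)) (at y)" for j
  by (intro has_derivative_transform_within_open[OF has_derivative_const[of 0] oB]) (use cflux_zero[OF i] in auto)
 then have "frechet_derivative (%y. cflux i y $ j) (at y) = (%v. 0)" for j using frechet_derivative_at by metis
 then show ?thesis using False by (simp add: cut_def)
qed

text \<open>The terms with a derivative of a cut-off cancel in the sum over the charts.\<close>

definition Zf :: "nat => 'p => real" where
 "Zf i x = (if x \<in> cdom (c i) then cut i (coord (c i) x) / cw (c i) (coord (c i) x) else 0)"

lemma inner_diff_at:
 assumes c': "c' \<in> atlas M" and f: "Ck_on_open 1 (local_expr c' f) (inner_part c')" and x: "x \<in> cdom c'" "coord c' x \<in> inner_part c'"
 shows "diff_at c' f x" "(local_expr c' f has_derivative (%v. dgrad c' f x \<bullet> v)) (at (coord c' x))"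
proof -
 have d: "(local_expr c' f has_derivative frechet_derivative (local_expr c' f) (at (coord c' x))) (at (coord c' x))"
  using Ck_on_open_SucD[of 0 "local_expr c' f" "inner_part c'"] f x by simp
 note D = diff_atI[OF c' x(1) has_derivative_at_withinI[OF d]]
 show da: "diff_at c' f x" by (rule D(1))
 have "frechet_derivative (local_expr c' f) (at (coord c' x)) v = dgrad c' f x \<bullet> v" for v using linear_dgrad[OF da] D(2) by simp
 then show "(local_expr c' f has_derivative (%v. dgrad c' f x \<bullet> v)) (at (coord c' x))" using d by presburger
qed

lemma chart_at_inner:
 assumes t: "0 < t" "t < \<rho>" and x: "x \<in> level t"
 shows "chart_at M x \<in> atlas M" "x \<in> cdom (chart_at M x)" "coord (chart_at M x) x \<in> inner_part (chart_at M x)"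
proof -
 have xX: "x \<in> X" and b: "bdist M x = ennreal t" using x by (auto simp: parallel_hypersurface_def)
 show c0: "chart_at M x \<in> atlas M" "x \<in> cdom (chart_at M x)" using chart_at_atlas[OF xX] by auto
 have "x \<in> interior_of_mfd M" using xX b t by (simp add: interior_bdist)
 then show "coord (chart_at M x) x \<in> inner_part (chart_at M x)"
  using interior_iff[OF c0] b t rho xX c0 by (simp add: inner_part_def ennreal_less_iff)
qed

lemma Zf_eq:
 assumes t: "0 < t" "t < \<rho>" and x: "x \<in> level t" and i: "i < N"
 shows "Zf i x = 2 * psi t * u x * Gam (chart_at M x) (chi i) u x + (u x)^2 * (1 + 2 * C * t) * Gam (chart_at M x) (chi i) (bdist_real M) x"
proof -
 define c0 where "c0 = chart_at M x"
 note c0 = chart_at_inner(1,2)[OF t x, folded c0_def] and y0 = chart_at_inner(3)[OF t x, folded c0_def]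
 have chi0: "diff_at c0 (chi i) x" "(local_expr c0 (chi i) has_derivative (%v. dgrad c0 (chi i) x \<bullet> v)) (at (coord c0 x))"
  using inner_diff_at[OF c0(1) chi_C1[OF i c0(1)] c0(2) y0] by auto
 have u0: "diff_at c0 u x" by (rule C1_diff_at[OF u1 c0])
 have d0: "diff_at c0 (bdist_real M) x" by (rule inner_diff_at(1)[OF c0(1) Ck_on_open_mono[OF d_C2[OF c0(1)]] c0(2) y0]) simp
 show ?thesis
 proof (cases "x \<in> cdom (c i)")
  case True
  note ci = cc_atlas[OF i]
  let ?y = "coord (c i) x"
  have xi: "coord_inv (c i) ?y = x" using ci True by simp
  have yk: "?y $ kk = t" using parallel_slice[OF i, of t] t rho True x by (auto simp: slice_chart_def)
  have ys: "?y \<in> open_slab i" using yk t True by (simp add: open_slab_def)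
  have cw: "cw (c i) ?y = sqrt (det (gloc (c i) ?y))" by (rule cw_eq[OF i]) (use True yk t rho in auto)
  have pos: "cw (c i) ?y > 0" unfolding cw using gloc_det_pos[OF ci coord_in_rng[OF True]] by simp
  have gm: "gloc (c i) ?y = metric M (c i) x" using xi by (simp add: gloc_def)
  have "cut i ?y = dgrad (c i) (chi i) x \<bullet> Fl (c i) ?y"
   using chart_data(8)[OF i ys] True xi by (simp add: cut_def inner_vec_def)
  also have "... = cw (c i) ?y * (2 * psi t * u x * Gam (c i) (chi i) u x + (u x)^2 * (1 + 2 * C * t) * Gam (c i) (chi i) (bdist_real M) x)"
   unfolding Fl_def Qf_Wf[OF i ys] Wf_def cw gm yk xi Gam_def
   by (simp add: inner_add_right local_expr_def xi algebra_simps)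
  finally have "Zf i x = 2 * psi t * u x * Gam (c i) (chi i) u x + (u x)^2 * (1 + 2 * C * t) * Gam (c i) (chi i) (bdist_real M) x"
   using True pos by (simp add: Zf_def)
  moreover have "Gam (c i) (chi i) u x = Gam c0 (chi i) u x" by (rule Gam_change[OF ci c0(1) True c0(2) chi0(1) u0])
  moreover have "Gam (c i) (chi i) (bdist_real M) x = Gam c0 (chi i) (bdist_real M) x" by (rule Gam_change[OF ci c0(1) True c0(2) chi0(1) d0])
  ultimately show ?thesis unfolding c0_def by simp
 next
  case False
  have "(%v. dgrad c0 (chi i) x \<bullet> v) = (%v. 0)"
   by (rule chi_minimum_derivative[OF chi0(2) inner_part_open[OF c0(1)] y0])
    (insert chi_zero[OF i] False c0, auto simp: local_expr_def chi_nonneg)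
  then have "dgrad c0 (chi i) x = 0" by (metis inner_eq_zero_iff)
  then show ?thesis using False unfolding c0_def[symmetric] by (simp add: Zf_def Gam_def)
 qed
qed

text \<open>The terms are linear in the differentials of the cut-offs and do not depend on the charts; the cut-offs add
 up to one.\<close>

lemma Zf_sum:
 assumes t: "0 < t" "t < \<rho>" and x: "x \<in> level t"
 shows "(\<Sum>i<N. Zf i x) = 0"
proof -
 define c0 where "c0 = chart_at M x"
 note c0 = chart_at_inner(1,2)[OF t x, folded c0_def] and y0 = chart_at_inner(3)[OF t x, folded c0_def]
 have "((%y. \<Sum>i<N. local_expr c0 (chi i) y) has_derivative (%v. \<Sum>i<N. dgrad c0 (chi i) x \<bullet> v)) (at (coord c0 x))"
  by (rule has_derivative_sum) (use inner_diff_at(2)[OF c0(1) chi_C1[OF _ c0(1)] c0(2) y0] in blast)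
 moreover have "((%y. \<Sum>i<N. local_expr c0 (chi i) y) has_derivative (%v. 0)) (at (coord c0 x))"
  by (rule has_derivative_transform_within_open[OF has_derivative_const[of 1] inner_part_open[OF c0(1)] y0])
   (insert chi_sum, auto simp: local_expr_def inner_part_def)
 ultimately have "(%v. \<Sum>i<N. dgrad c0 (chi i) x \<bullet> v) = (%v. 0)" by (rule has_derivative_unique)
 then have "!!v. (\<Sum>i<N. dgrad c0 (chi i) x) \<bullet> v = 0" by (simp add: inner_sum_left fun_eq_iff)
 then have "(\<Sum>i<N. Gam c0 (chi i) f x) = 0" for f by (simp add: Gam_def flip: inner_sum_left)
 then show ?thesis using Zf_eq[OF t x] unfolding c0_def[symmetric] by (simp add: sum.distrib flip: sum_distrib_left)
qed

lemma parallel_sub: "level t <= X" by (auto simp: parallel_hypersurface_def)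

lemma cut_integral:
 assumes t: "0 < t" "t < \<rho>" and i: "i < N"
 shows "integrable lborel (%y. unit_ind kk y * cut i (upd kk t y))"
  "integrable (level_measure t) (Zf i)"
  "(\<integral>x. Zf i x \<partial>level_measure t) = (LBINT y. unit_ind kk y * cut i (upd kk t y))"
proof -
 let ?S = "level t"
 note ci = cc_atlas[OF i]
 have t': "0 <= t" "t <= rs" using t rho by auto
 note s = parallel_slice[OF i t'] and mu = parallel_surface_measure[OF t']
 show 1: "integrable lborel (%y. unit_ind kk y * cut i (upd kk t y))"
 proof (rule slab_integral(1)[of _ _ _ "norm (z i) + r i"])
  show "continuous_on {y. y $ kk = t} (cut i)" by (rule continuous_on_subset[OF cut_continuous[OF i]]) (use t in auto)
  fix y :: "real ^ 'n" assume "norm y > norm (z i) + r i"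
  then have "norm (y - z i) > r i" using norm_triangle_ineq2[of y "z i"] by simp
  then have "y ~: rng (c i)" using cc_rng[OF i] by (auto simp: dist_norm norm_minus_commute)
  then show "cut i y = 0" by (simp add: cut_def)
 qed
 have pos: "cw (c i) y > 0" if "y \<in> rng (c i)" for y using tangential_det_pos[OF ci that] by (simp add: cw_def)
 have e: "ci (c i) t (Zf i) y = unit_ind kk y * cut i (upd kk t y)" for y
 proof (cases "upd kk t y \<in> rng (c i)")
  case True
  then show ?thesis using pos[OF True] ci by (simp add: ci_def slab_def Zf_def)
 qed (simp add: ci_def slab_def cut_def)
 have m: "Zf i \<in> borel_measurable (restrict_space borel ?S)"
 proof (rule chart_function_measurable[OF parallel_sub ci])
  have sub: "coord (c i) x \<in> open_slab i" if "x \<in> ?S Int cdom (c i)" for x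
   using that t s unfolding slice_chart_def by (auto simp: open_slab_def)
  have co: "continuous_on (?S Int cdom (c i)) (coord (c i))"
   by (rule continuous_on_subset[OF homeomorphism_cont1[OF atlasD(3)[OF ci]]]) blast
  have "continuous_on (?S Int cdom (c i)) (%x. cut i (coord (c i) x) / cw (c i) (coord (c i) x))"
  proof (intro continuous_on_divide ballI)
   show "continuous_on (?S Int cdom (c i)) (%x. cut i (coord (c i) x))"
    by (rule continuous_on_compose2[OF cut_slab_continuous[OF i] co]) (use sub in blast)
   show "continuous_on (?S Int cdom (c i)) (%x. cw (c i) (coord (c i) x))"
    by (rule continuous_on_compose2[OF cw_continuous[OF ci] co]) auto
   show "cw (c i) (coord (c i) x) ~= 0" if "x \<in> ?S Int cdom (c i)" for x using pos[of "coord (c i) x"] that by simp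
  qed
  then show "continuous_on (?S Int cdom (c i)) (Zf i)"
   by (rule continuous_on_cong[THEN iffD1, OF refl, rotated]) (simp add: Zf_def)
 qed (simp add: Zf_def)
 note I = integral_surface[OF mu parallel_sub s m, unfolded e]
 show "integrable (surface_measure M ?S) (Zf i)" by (rule I(1)) (insert 1, auto simp: Zf_def)
 show "(\<integral>x. Zf i x \<partial>surface_measure M ?S) = (LBINT y. unit_ind kk y * cut i (upd kk t y))"
  by (rule I(2)) (insert 1, auto simp: Zf_def)
qed

definition flux :: "real => real" where
 "flux t = (\<Sum>i<N. LBINT y. unit_ind kk y * cflux i (upd kk t y) $ kk)"

lemma cflux_far: "i < N ==> norm y > norm (z i) + r i ==> cflux i y = 0"
 by (rule cflux_zero[OF _ outside_ball])

text \<open>The derivative of the flux is the integral of the localized divergences. These are at least the cut-off terms,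
 which add up to zero as integrals over one and the same hypersurface.\<close>

lemma flux_mono: "flux 0 <= flux \<rho>"
proof (rule DERIV_nonneg_imp_increasing_open[of 0 \<rho> flux])
 show "0 <= \<rho>" using rho by simp
 show "continuous_on {0..\<rho>} flux" unfolding flux_def[abs_def]
 proof (rule continuous_on_sum)
  fix i assume "i \<in> {..<N}"
  then have i: "i < N" by simp
  show "continuous_on {0..\<rho>} (%t. LBINT y. unit_ind kk y * cflux i (upd kk t y) $ kk)"
  proof (rule slab_integral_continuous[of _ _ _ "norm (z i) + r i"])
   show "continuous_on {y. y $ kk \<in> {0..\<rho>}} (%y. cflux i y $ kk)" by (rule continuous_on_component[OF cflux_continuous[OF i]])
  qed (simp add: cflux_far[OF i])
 qed
 fix t assume t: "0 < t" "t < \<rho>"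
 let ?D = "%i y. unit_ind kk y * (SUM j:UNIV. pdv j (%y. cflux i y $ j) (upd kk t y))"
 let ?L = "%i y. unit_ind kk y * cut i (upd kk t y)"
 let ?mu = "level_measure t"
 have t': "t \<in> {0<..<\<rho>}" "0 <= t" "t <= rs" using t rho by auto
 have d: "((%t. LBINT y. unit_ind kk y * cflux i (upd kk t y) $ kk) has_real_derivative (LBINT y. ?D i y)) (at t)"
  "integrable lborel (?D i)" if i: "i < N" for i
  by (rule slab_flux_derivative[OF cflux_C1[OF i] cflux_far[OF i] t'(1)], assumption)+
 have "(flux has_real_derivative (\<Sum>i<N. LBINT y. ?D i y)) (at t)"
  unfolding flux_def[abs_def] by (rule DERIV_sum) (use d in simp)
 moreover have "(\<Sum>i<N. LBINT y. ?D i y) >= 0"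
 proof -
  have "0 = (\<integral>x. (\<Sum>i<N. Zf i x) \<partial>?mu)"
  proof -
   have sp: "space ?mu = level t" using parallel_surface_measure[OF t'(2,3)] by (simp add: is_surface_measure_def)
   have "(\<integral>x. (\<Sum>i<N. Zf i x) \<partial>?mu) = (\<integral>x. 0 \<partial>?mu)"
    by (rule Bochner_Integration.integral_cong[OF refl]) (simp add: sp Zf_sum[OF t])
   then show ?thesis by simp
  qed
  also have "... = (\<Sum>i<N. \<integral>x. Zf i x \<partial>?mu)"
   by (rule Bochner_Integration.integral_sum) (use cut_integral(2)[OF t] in simp)
  also have "... = (\<Sum>i<N. LBINT y. ?L i y)" using cut_integral(3)[OF t] by simp
  also have "... <= (\<Sum>i<N. LBINT y. ?D i y)"
  proof (rule sum_mono)
   fix i assume "i \<in> {..<N}"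
   then have i: "i < N" by simp
   show "(LBINT y. ?L i y) <= (LBINT y. ?D i y)"
    by (rule integral_mono[OF cut_integral(1)[OF t i] d(2)[OF i]])
     (insert cflux_divergence_ge_cut[OF i] t', auto intro!: mult_left_mono)
  qed
  finally show ?thesis .
 qed
 ultimately show "EX y. (flux has_real_derivative y) (at t) & 0 <= y" by blast
qed

text \<open>The hypothesis is that the field has the normal component \<open>K u\<^sup>2\<close> at level \<open>t\<close>.\<close>

lemma flux_value:
 assumes t: "0 <= t" "t <= \<rho>"
  and Z: "!!i y. i < N ==> y \<in> rng (c i) ==> y $ kk = t ==> Fl (c i) y $ kk = K * (local_expr (c i) u y)^2 * cw (c i) y"
 shows "integrable (level_measure t) (%x. K * (u x)^2)"
  "flux t = (\<integral>x. K * (u x)^2 \<partial>level_measure t)"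
proof -
 let ?S = "level t"
 have t': "t <= rs" using t rho by simp
 note mu = parallel_surface_measure[OF t(1) t']
 have sp: "space (surface_measure M ?S) = ?S" using mu by (simp add: is_surface_measure_def)
 have Sc: "?S <= collar M rs" using t' by (auto simp: parallel_hypersurface_def collar_def ennreal_leI)
 let ?F = "%i x. chi i x * (K * (u x)^2)"
 have I: "integrable (surface_measure M ?S) (?F i)"
  "(\<integral>x. ?F i x \<partial>surface_measure M ?S) = (LBINT y. unit_ind kk y * cflux i (upd kk t y) $ kk)"
  if i: "i < N" for i
 proof -
  note ci = cc_atlas[OF i]
  have e: "ci (c i) t (?F i) y = unit_ind kk y * cflux i (upd kk t y) $ kk" for y
  proof (cases "upd kk t y \<in> rng (c i)")
   case True
   then show ?thesis using Z[OF i True] by (simp add: ci_def slab_def cflux_def local_expr_def)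
  qed (simp add: ci_def slab_def cflux_def)
  have m: "?F i \<in> borel_measurable (restrict_space borel ?S)"
   by (intro borel_measurable_continuous_on_restrict continuous_on_mult continuous_on_const continuous_on_power
    continuous_on_subset[OF chi_continuous[OF i] Sc] continuous_on_subset[OF Ck_fun_on_continuous[OF u1] parallel_sub])
  have int: "integrable lborel (%y. unit_ind kk y * cflux i (upd kk t y) $ kk)"
  proof (rule slab_integral(1)[of _ _ _ "norm (z i) + r i"])
   show "continuous_on {y. y $ kk = t} (%y. cflux i y $ kk)"
    by (rule continuous_on_component[OF continuous_on_subset[OF cflux_continuous[OF i]]]) (use t in auto)
  qed (simp add: cflux_far[OF i])
  note II = integral_surface[OF mu parallel_sub parallel_slice[OF i t(1) t'] m, unfolded e]
  show "integrable (surface_measure M ?S) (?F i)" by (rule II(1)) (use int chi_zero[OF i] in auto)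
  show "(\<integral>x. ?F i x \<partial>surface_measure M ?S) = (LBINT y. unit_ind kk y * cflux i (upd kk t y) $ kk)"
   by (rule II(2)) (use int chi_zero[OF i] in auto)
 qed
 have s: "(\<Sum>i<N. ?F i x) = K * (u x)^2" if "x \<in> ?S" for x
  using chi_sum[of x] that Sc by (auto simp: collar_def simp flip: sum_distrib_right)
 have "integrable (surface_measure M ?S) (%x. \<Sum>i<N. ?F i x)" by (rule Bochner_Integration.integrable_sum) (use I(1) in simp)
 then show "integrable (surface_measure M ?S) (%x. K * (u x)^2)"
  by (rule Bochner_Integration.integrable_cong[OF refl, THEN iffD1, rotated]) (simp add: sp s)
 have "(\<integral>x. K * (u x)^2 \<partial>surface_measure M ?S) = (\<integral>x. (\<Sum>i<N. ?F i x) \<partial>surface_measure M ?S)"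
  by (rule Bochner_Integration.integral_cong[OF refl]) (simp add: sp s)
 also have "... = (\<Sum>i<N. \<integral>x. ?F i x \<partial>surface_measure M ?S)"
  by (rule Bochner_Integration.integral_sum) (use I(1) in simp)
 finally show "flux t = (\<integral>x. K * (u x)^2 \<partial>surface_measure M ?S)" using I(2) by (simp add: flux_def)
qed

lemma Qf_normal: "i < N ==> y \<in> rng (c i) ==> y $ kk <= rs ==> Qf (c i) y $ kk = cw (c i) y"
 using ccoord_inverse_metric[OF cc rs] cw_eq by (simp add: Qf_def matrix_vector_mult_def axis_def if_distrib cong: if_cong)

lemma flux_end:
 "integrable (level_measure \<rho>) (%x. (1 + 2 * C * \<rho>) * (u x)^2)"
 "flux \<rho> = (\<integral>x. (1 + 2 * C * \<rho>) * (u x)^2 \<partial>level_measure \<rho>)"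
proof -
 have "Fl (c i) y $ kk = (1 + 2 * C * \<rho>) * (local_expr (c i) u y)^2 * cw (c i) y" if "i < N" "y \<in> rng (c i)" "y $ kk = \<rho>" for i y
  using Qf_normal[OF that(1,2)] that(3) rho by (simp add: Fl_def psi_def)
 from flux_value[OF _ _ this] rho show
  "integrable (level_measure \<rho>) (%x. (1 + 2 * C * \<rho>) * (u x)^2)"
  "flux \<rho> = (\<integral>x. (1 + 2 * C * \<rho>) * (u x)^2 \<partial>level_measure \<rho>)" by simp_all
qed

lemma robin_in_chart:
 assumes i: "i < N" and y: "y \<in> rng (c i)" "y $ kk = 0"
  and robin: "!!x. x \<in> boundary M ==> normal_derivative M u x = \<sigma> * u x"
 shows "(matrix_inv (gloc (c i) y) *v dgrad (c i) u (coord_inv (c i) y)) $ kk = - \<sigma> * u (coord_inv (c i) y)"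
proof -
 note ci = cc_atlas[OF i]
 let ?x = "coord_inv (c i) y"
 have x: "?x \<in> cdom (c i)" "coord (c i) ?x = y" using ci y by auto
 have b: "?x \<in> boundary M" using boundary_iff[OF ci x(1)] x(2) y(2) by simp
 then have xX: "?x \<in> X" by (simp add: boundary_def)
 have "matrix_inv (metric M (c i) ?x) $ kk $ kk = 1"
  using ccoord_inverse_metric[OF cc[OF i] rs y(1)] y(2) rs by (simp add: gloc_def)
 from normal_derivative_chart[OF ci x(1) b this C1_diff_at[OF u1 chart_at_atlas[OF xX]]] robin[OF b]
 show ?thesis by (simp add: gloc_def)
qed

lemma flux_start:
 assumes robin: "!!x. x \<in> boundary M ==> normal_derivative M u x = \<sigma> * u x"
 shows "integrable (surface_measure M (boundary M)) (%x. (1 - 2 * \<sigma> * psi 0) * (u x)^2)"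
  "flux 0 = (\<integral>x. (1 - 2 * \<sigma> * psi 0) * (u x)^2 \<partial>surface_measure M (boundary M))"
proof -
 have "Fl (c i) y $ kk = (1 - 2 * \<sigma> * psi 0) * (local_expr (c i) u y)^2 * cw (c i) y" if i: "i < N" and y: "y \<in> rng (c i)" "y $ kk = 0" for i y
 proof -
  let ?x = "coord_inv (c i) y"
  have "(matrix_inv (gloc (c i) y) *v dgrad (c i) u ?x) $ kk = - \<sigma> * u ?x" by (rule robin_in_chart[OF i y robin])
  then have "Wf (c i) u y $ kk = - \<sigma> * u ?x * cw (c i) y" using cw_eq[OF i y(1)] y(2) rs by (simp add: Wf_def)
  then show ?thesis using Qf_normal[OF i y(1)] y(2) rs by (simp add: Fl_def local_expr_def power2_eq_square algebra_simps)
 qed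
 from flux_value[OF _ _ this] rho show "integrable (surface_measure M (boundary M)) (%x. (1 - 2 * \<sigma> * psi 0) * (u x)^2)"
  "flux 0 = (\<integral>x. (1 - 2 * \<sigma> * psi 0) * (u x)^2 \<partial>surface_measure M (boundary M))"
  unfolding boundary_parallel by simp_all
qed

text \<open>With \<open>\<sigma> \<rho> \<le> 1/4\<close> and \<open>C \<rho> \<le> 1/4\<close> the factor at the boundary is \<open>1 - 2 \<sigma> \<rho> - 2 \<sigma> C \<rho>\<^sup>2 \<ge> 3/8\<close>, and
 \<open>(8/3) (1 + 2 s) \<le> 4 (1 + s) \<le> 4 e\<^sup>s\<close> for \<open>0 \<le> s \<le> 1\<close>.\<close>

lemma L2_bound:
 assumes robin: "!!x. x \<in> boundary M ==> normal_derivative M u x = \<sigma> * u x"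
  and \<sigma>: "\<sigma> > 0" "\<sigma> * \<rho> <= 1 / 4"
 shows "L2_norm_sq (surface_measure M (boundary M)) u
  <= ennreal (4 * exp (C * \<rho>)) * L2_norm_sq (level_measure \<rho>) u"
proof -
 let ?mu = "surface_measure M (boundary M)" and ?nu = "level_measure \<rho>"
 have C\<rho>: "0 <= C * \<rho>" "C * \<rho> <= 1 / 4" using C rho mult_left_mono[of \<rho> rs C] by auto
 have "\<sigma> * (C * \<rho>^2) = (\<sigma> * \<rho>) * (C * \<rho>)" by (simp add: power2_eq_square)
 also have "... <= 1 / 4 * (1 / 4)" by (rule mult_mono[OF \<sigma>(2) C\<rho>(2)]) (use C\<rho> in auto)
 finally have k: "1 - 2 * \<sigma> * psi 0 >= 3 / 8" using \<sigma>(2) by (simp add: psi_def algebra_simps)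
 have int: "integrable ?mu (%x. (u x)^2)" "integrable ?nu (%x. (u x)^2)"
  using flux_start(1)[OF robin] flux_end(1) k C\<rho> by simp_all
 have L: "L2_norm_sq ?mu u = ennreal (\<integral>x. (u x)^2 \<partial>?mu)" "L2_norm_sq ?nu u = ennreal (\<integral>x. (u x)^2 \<partial>?nu)"
  unfolding L2_norm_sq_def by (rule nn_integral_eq_integral, use int in simp, simp)+
 have "3 / 8 * (\<integral>x. (u x)^2 \<partial>?mu) <= (1 - 2 * \<sigma> * psi 0) * (\<integral>x. (u x)^2 \<partial>?mu)"
  by (rule mult_right_mono[OF k]) (simp add: integral_nonneg_AE)
 also have "... <= (1 + 2 * C * \<rho>) * (\<integral>x. (u x)^2 \<partial>?nu)"
 proof -
  have "flux 0 = (\<integral>x. (1 - 2 * \<sigma> * psi 0) * (u x)^2 \<partial>?mu)" by (rule flux_start(2)) (rule robin)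
  then show ?thesis using flux_mono unfolding flux_end(2) by simp
 qed
 finally have "(\<integral>x. (u x)^2 \<partial>?mu) <= 8 / 3 * (1 + 2 * C * \<rho>) * (\<integral>x. (u x)^2 \<partial>?nu)" by (simp add: algebra_simps)
 also have "... <= 4 * exp (C * \<rho>) * (\<integral>x. (u x)^2 \<partial>?nu)"
 proof (rule mult_right_mono)
  show "8 / 3 * (1 + 2 * C * \<rho>) <= 4 * exp (C * \<rho>)" using exp_ge_add_one_self[of "C * \<rho>"] C\<rho> by argo
 qed (simp add: integral_nonneg_AE)
 finally show ?thesis unfolding L by (simp flip: ennreal_mult' add: ennreal_leI)
qed

end

section \<open>Maximum principle and the estimate of the supremum\<close>

text \<open>The derivative of \<open>t \<mapsto> f (y + t x)\<close> vanishes at zero; a positive second derivative would make \<open>f\<close> increase.\<close>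

lemma maximum_second_derivative:
 fixes f :: "real ^ 'n::finite => real"
 assumes S: "open S" "y \<in> S" and f: "Ck_on_open 2 f S" and max: "!!w. w \<in> S ==> f w <= f y"
 shows "frechet_derivative f (at y) = (%v. 0)"
  and "(SUM i:UNIV. SUM j:UNIV. x $ i * x $ j * pdv i (%w. pdv j f w) y) <= 0"
proof -
 have f2: "Ck_on_open (Suc (Suc 0)) f S" using f by (simp add: numeral_2_eq_2)
 have d: "(f has_derivative frechet_derivative f (at w)) (at w)" if "w \<in> S" for w by (rule Ck_on_open_SucD[OF f2 that])
 show zero: "frechet_derivative f (at y) = (%v. 0)"
  by (rule differential_zero_maxmin[OF S(2,1) d[OF S(2)]]) (use max in blast)
 have d2: "((%w. frechet_derivative f (at w) v) has_derivative frechet_derivative (%w. frechet_derivative f (at w) v) (at y)) (at y)" for v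
  by (rule Ck_on_open_SucD[of 0, OF _ S(2)]) (use f2 in simp)
 have lin: "frechet_derivative f (at w) x = (SUM j:UNIV. x $ j * pdv j f w)" if "w \<in> S" for w x
 proof -
  have l: "linear (frechet_derivative f (at w))" using d[OF that] has_derivative_linear by blast
  have "frechet_derivative f (at w) x = frechet_derivative f (at w) (SUM j:UNIV. x $ j *R axis j 1)"
   using basis_expansion[of x] by (simp add: scalar_mult_eq_scaleR)
  then show ?thesis by (simp add: linear_sum[OF l] linear_scale[OF l])
 qed
 let ?q = "SUM i:UNIV. SUM j:UNIV. x $ i * x $ j * pdv i (%w. pdv j f w) y"
 let ?l = "%t. y + t *R x"
 let ?g = "%t. f (?l t)" and ?g' = "%t. frechet_derivative f (at (?l t)) x"
 obtain U where U: "open U" "0 \<in> U" "!!t. t \<in> U ==> ?l t \<in> S"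
 proof
  show "open (?l -` S)" by (intro open_vimage S(1) continuous_intros)
 qed (use S(2) in auto)
 obtain e where e: "e > 0" "ball 0 e <= U" using U(1,2) open_contains_ball by blast
 have g: "(?g has_real_derivative ?g' t) (at t)" if "t \<in> U" for t
  by (rule has_real_derivative_along_line) (rule d[OF U(3)[OF that]])
 have "((%w. SUM j:UNIV. x $ j * pdv j f w) has_derivative
   (%v. SUM j:UNIV. x $ j * frechet_derivative (%w. pdv j f w) (at y) v)) (at (y + 0 *R x))"
  by (intro has_derivative_sum has_derivative_mult_right) (use d2 in simp)
 from has_real_derivative_along_line[OF this]
 have "((%t. SUM j:UNIV. x $ j * pdv j f (?l t)) has_real_derivative
   (SUM j:UNIV. x $ j * frechet_derivative (%w. pdv j f w) (at y) x)) (at 0)" .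
 moreover have "(SUM j:UNIV. x $ j * frechet_derivative (%w. pdv j f w) (at y) x) = ?q"
 proof -
  have "frechet_derivative (%w. pdv j f w) (at y) x
    = (SUM i:UNIV. x $ i * pdv i (%w. pdv j f w) y)" for j
  proof -
   have l: "linear (frechet_derivative (%w. pdv j f w) (at y))" using d2 has_derivative_linear by blast
   have "frechet_derivative (%w. pdv j f w) (at y) x
     = frechet_derivative (%w. pdv j f w) (at y) (SUM i:UNIV. x $ i *R axis i 1)"
    using basis_expansion[of x] by (simp add: scalar_mult_eq_scaleR)
   then show ?thesis by (simp add: linear_sum[OF l] linear_scale[OF l])
  qed
  then have "(SUM j:UNIV. x $ j * frechet_derivative (%w. pdv j f w) (at y) x)
   = (SUM j:UNIV. SUM i:UNIV. x $ i * x $ j * pdv i (%w. pdv j f w) y)"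
   by (simp add: sum_distrib_left mult_ac)
  also have "... = ?q" by (rule sum.swap)
  finally show ?thesis .
 qed
 ultimately have q: "((%t. SUM j:UNIV. x $ j * pdv j f (?l t)) has_real_derivative ?q) (at 0)" by simp
 have "(?g' has_real_derivative ?q) (at 0)"
  unfolding has_field_derivative_def
  by (rule has_derivative_transform_within_open[OF q[unfolded has_field_derivative_def] U(1,2)]) (use lin U(3) in simp)
 show "?q <= 0"
 proof (rule ccontr)
  assume "~ ?q <= 0"
  then obtain \<delta> where \<delta>: "\<delta> > 0" "!!h. h > 0 ==> h < \<delta> ==> ?g' 0 < ?g' (0 + h)"
   using DERIV_pos_inc_right[OF \<open>(?g' has_real_derivative ?q) (at 0)\<close>] by auto
  define h where "h = min \<delta> e / 2"
  have h: "h > 0" "h < \<delta>" "h < e" using \<delta>(1) e(1) by (auto simp: h_def)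
  have "?g 0 < ?g h"
  proof (rule DERIV_pos_imp_increasing_open[OF h(1)])
   fix t assume t: "0 < t" "t < h"
   have "0 < ?g' t" using \<delta>(2)[of t] t h zero by simp
   moreover have "t \<in> U" using t h e(2) by (auto simp: subset_eq dist_real_def)
   ultimately show "EX m. (?g has_real_derivative m) (at t) & 0 < m" using g by blast
  next
   have "isCont ?g t" if "t \<in> {0..h}" for t
    by (rule DERIV_isCont[OF g]) (insert that h e(2), auto simp: subset_eq dist_real_def)
   then show "continuous_on {0..h} ?g" by (intro continuous_at_imp_continuous_on) blast
  qed
  moreover have "?g h <= f y" by (rule max[OF U(3)]) (insert h e(2), auto simp: subset_eq dist_real_def)
  ultimately show False by simp
 qed
qed

text \<open>At an interior maximum the first derivatives vanish, and the contraction of a positive definite matrix with the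
 Hessian is not positive.\<close>

lemma divergence_at_maximum:
 fixes f :: "real ^ 'n::finite => real" and A :: "real ^ 'n => real ^ 'n ^ 'n"
 assumes S: "open S" "y \<in> S" and f: "Ck_on_open 2 f S" and max: "!!w. w \<in> S ==> f w <= f y"
  and A: "!!j l. ((%w. A w $ j $ l) has_derivative A' j l) (at y)" and pd: "posdef (A y)"
  and V: "!!w j. w \<in> S ==> V w $ j = (SUM l:UNIV. A w $ j $ l * pdv l f w)"
  and V': "!!j. ((%w. V w $ j) has_derivative V' j) (at y)"
 shows "(SUM j:UNIV. V' j (axis j 1)) <= 0"
proof -
 let ?H = "%l. frechet_derivative (%w. pdv l f w) (at y)"
 have f2: "Ck_on_open (Suc (Suc 0)) f S" using f by (simp add: numeral_2_eq_2)
 have d2: "((%w. pdv l f w) has_derivative ?H l) (at y)" for l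
  by (rule Ck_on_open_SucD[of 0, OF _ S(2)]) (use f2 in simp)
 note M = maximum_second_derivative[OF S f max]
 have "V' j = (%v. SUM l:UNIV. A y $ j $ l * ?H l v)" for j
 proof (rule has_derivative_unique[OF V'])
  have "((%w. SUM l:UNIV. A w $ j $ l * pdv l f w) has_derivative
   (%v. SUM l:UNIV. A y $ j $ l * ?H l v + A' j l v * pdv l f y)) (at y)"
   by (intro has_derivative_sum has_derivative_mult A d2)
  then have "((%w. SUM l:UNIV. A w $ j $ l * pdv l f w) has_derivative
   (%v. SUM l:UNIV. A y $ j $ l * ?H l v)) (at y)" using M(1) by simp
  then show "((%w. V w $ j) has_derivative (%v. SUM l:UNIV. A y $ j $ l * ?H l v)) (at y)"
   by (rule has_derivative_transform_within_open[OF _ S]) (simp add: V)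
 qed
 then have "(SUM j:UNIV. V' j (axis j 1)) = (SUM j:UNIV. SUM l:UNIV. A y $ j $ l * ?H l (axis j 1))" by simp
 also have "... <= 0" by (rule posdef_nsd_contraction[OF pd]) (use M(2) in simp)
 finally show ?thesis .
qed

lemma posdef_scaleR:
 assumes "posdef G" "a > 0" shows "posdef (a *R G)"
 unfolding posdef_def
proof (intro conjI allI impI)
 show "transpose (a *R G) = a *R G" using posdef_sym[OF assms(1)] by (simp add: vec_eq_iff transpose_def)
 fix v :: "real ^ 'a" assume "v ~= 0"
 then have "v \<bullet> (G *v v) > 0" using assms(1) by (simp add: posdef_def)
 then show "0 < v \<bullet> (a *R G *v v)" using assms(2) by (simp add: scaleR_matrix_vector_assoc[symmetric])
qed

context steklov_collar begin

lemma bdist_continuous: "continuous_on (collar M rs) (bdist_real M)"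
 unfolding continuous_on_eq_continuous_within
proof
 fix x assume x: "x \<in> collar M rs"
 then obtain i where i: "i < N" "x \<in> cdom (c i)" using cover[of x] by (auto simp: collar_def)
 note ci = cc_atlas[OF i(1)]
 obtain T where T: "open T" "cdom (c i) = X Int T" using atlasD(1)[OF ci] by (auto simp: openin_open)
 have KT: "collar M rs Int T <= cdom (c i)" using T(2) by (auto simp: collar_def)
 have "continuous_on (collar M rs Int T) (%x. coord (c i) x $ kk)"
  by (rule continuous_on_component[OF continuous_on_subset[OF homeomorphism_cont1[OF atlasD(3)[OF ci]] KT]])
 then have "continuous_on (collar M rs Int T) (bdist_real M)"
 proof (rule continuous_on_cong[THEN iffD1, OF refl, rotated])
  fix y assume y: "y \<in> collar M rs Int T"
  then have "coord (c i) y $ kk <= rs" using cc_le_iff[OF i(1), of y] KT by (auto simp: collar_def)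
  then show "coord (c i) y $ kk = bdist_real M y" using cc_coordinate(2)[OF i(1), of y] KT y by auto
 qed
 moreover have xT: "x \<in> T" using i(2) T(2) by blast
 ultimately have "continuous (at x within collar M rs Int T) (bdist_real M)" using x by (simp add: continuous_on_eq_continuous_within)
 then show "continuous (at x within collar M rs) (bdist_real M)" using at_within_Int_open[OF xT T(1)] by simp
qed

lemma collar_compact:
 assumes "compact X" shows "compact (collar M \<rho>)"
proof (rule closedin_compact[OF assms])
 have "collar M \<rho> = X - {x \<in> X. ennreal \<rho> < bdist M x}" by (auto simp: collar_def not_less)
 then show "closedin (top_of_set X) (collar M \<rho>)"
  using bdist_superlevel_open[of \<rho>] by (simp add: closedin_diff)
qed

text \<open>The comparison function is strictly superharmonic in the distance, so that multiples of it
 cannot touch a harmonic function from above at an interior point.\<close>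

lemma no_interior_maximum:
 fixes lam \<kappa> A s :: real
 assumes i: "i < N" and y0: "y0 \<in> open_slab i" and lam: "lam > 0" and \<kappa>: "\<kappa> > 0" and A: "A >= 0" "2 * A * \<rho> * C + C < 2 * A"
  and max: "!!y. y \<in> open_slab i ==> s * local_expr (c i) u y - lam * (1 - \<kappa> * (y $ kk + A * (y $ kk)^2))
    <= s * local_expr (c i) u y0 - lam * (1 - \<kappa> * (y0 $ kk + A * (y0 $ kk)^2))"
 shows False
proof -
 note ci = cc_atlas[OF i] and o = open_slab_open[OF i] and D = chart_data[OF i y0]
 have sub: "open_slab i <= rng (c i)" by (auto simp: open_slab_def)
 let ?U = "local_expr (c i) u"
 let ?f = "%y. s * ?U y - lam * (1 - \<kappa> * (y $ kk + A * (y $ kk * y $ kk)))"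
 let ?A = "%y. sqrt (det (gloc (c i) y)) *R matrix_inv (gloc (c i) y)"
 let ?V = "%y. s *R Wf (c i) u y + (lam * \<kappa> * (1 + 2 * A * y $ kk)) *R Qf (c i) y"
 let ?V' = "%j v. s * frechet_derivative (%y. Wf (c i) u y $ j) (at y0) v
   + (lam * \<kappa> * (1 + 2 * A * y0 $ kk) * frechet_derivative (%y. Qf (c i) y $ j) (at y0) v + lam * \<kappa> * (2 * A * v $ kk) * Qf (c i) y0 $ j)"
 have yr: "y0 \<in> rng (c i)" "0 < y0 $ kk" "y0 $ kk < \<rho>" using y0 by (auto simp: open_slab_def)
 have k: "Ck_on_open n (%y :: real ^ 'n. y $ kk) (open_slab i)" for n by (rule Ck_on_open_linear[OF bounded_linear_vec_nth o])
 have u: "Ck_on_open 2 ?U (open_slab i)" by (rule Ck_on_open_subset[OF u_C2[OF ci] open_slab_inner[OF i]])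
 have f: "Ck_on_open 2 ?f (open_slab i)"
  by (intro Ck_on_open_diff[OF o] Ck_on_open_bilinear[OF bounded_bilinear_mult o] Ck_on_open_add[OF o] Ck_on_open_const k u)
 have kd: "((%y :: real ^ 'n. y $ kk) has_derivative (%v. v $ kk)) (at y)" for y
  by (rule bounded_linear_imp_has_derivative[OF bounded_linear_vec_nth])
 have "(SUM j:UNIV. ?V' j (axis j 1)) <= 0"
 proof (rule divergence_at_maximum[OF o y0 f, where A = ?A and V = ?V])
  show "?f w <= ?f y0" if "w \<in> open_slab i" for w using max[OF that] by (simp add: power2_eq_square)
  show "((%w. ?A w $ j $ l) has_derivative frechet_derivative (%w. ?A w $ j $ l) (at y0)) (at y0)" for j l
  proof (rule Ck_on_open_SucD[of 0, OF _ y0])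
   show "Ck_on_open (Suc 0) (%w. ?A w $ j $ l) (open_slab i)"
    using Ck_on_open_bilinear[OF bounded_bilinear_mult o sqrt_det_C1[OF ci o sub] ginv_C1[OF ci o sub]] by simp
  qed
  show "posdef (?A y0)"
   by (rule posdef_scaleR[OF posdef_matrix_inv[OF gloc_posdef[OF ci yr(1)]]]) (use gloc_det_pos[OF ci yr(1)] in simp)
  show "((%w. ?V w $ j) has_derivative ?V' j) (at y0)" for j
  proof -
   have "((%w. s * Wf (c i) u w $ j + (lam * \<kappa> * (1 + 2 * A * w $ kk)) * Qf (c i) w $ j) has_derivative ?V' j) (at y0)"
    by (rule D(3,4) kd derivative_eq_intros refl)+ (simp add: fun_eq_iff)
   then show ?thesis by simp
  qed
  fix w j assume w: "w \<in> open_slab i"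
  have uw: "(?U has_derivative frechet_derivative ?U (at w)) (at w)" by (rule chart_data(2)[OF i w])
  have fw: "frechet_derivative ?f (at w) = (%v. s * frechet_derivative ?U (at w) v + lam * \<kappa> * (1 + 2 * A * w $ kk) * v $ kk)"
   by (rule frechet_derivative_at[symmetric], (rule uw kd derivative_eq_intros refl)+) (simp add: fun_eq_iff algebra_simps)
  have ax: "(axis l 1 :: real ^ 'n) $ kk = axis kk 1 $ l" for l by (simp add: axis_def)
  show "?V w $ j = (SUM l:UNIV. ?A w $ j $ l * pdv l ?f w)"
   unfolding fw Wf_def Qf_def
   by (simp add: matrix_vector_mult_def chart_data(7)[OF i w] ax sum_distrib_left sum.distrib algebra_simps)
 qed
 moreover have "(SUM j:UNIV. ?V' j (axis j 1)) > 0"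
 proof -
  let ?Q = "SUM j:UNIV. pdv j (%y. Qf (c i) y $ j) y0" and ?g = "sqrt (det (gloc (c i) y0))"
  have g: "?g > 0" using gloc_det_pos[OF ci yr(1)] by simp
  have Qk: "Qf (c i) y0 $ kk = ?g" using Qf_normal[OF i yr(1)] cw_eq[OF i yr(1)] yr rho by simp
  have sk: "(SUM j:UNIV. (axis j 1 :: real ^ 'n) $ kk * h j) = h kk" for h :: "'n => real"
   by (simp add: axis_def if_distrib if_distribR cong: if_cong)
  have "(SUM j:UNIV. ?V' j (axis j 1)) = s * (SUM j:UNIV. pdv j (%y. Wf (c i) u y $ j) y0)
    + (lam * \<kappa> * (1 + 2 * A * y0 $ kk) * ?Q + lam * \<kappa> * (2 * A) * (SUM j:UNIV. (axis j 1 :: real ^ 'n) $ kk * Qf (c i) y0 $ j))"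
   unfolding sum_distrib_left sum.distrib[symmetric] by (rule sum.cong[OF refl]) (simp add: algebra_simps)
  then have e: "(SUM j:UNIV. ?V' j (axis j 1)) = lam * \<kappa> * ((1 + 2 * A * y0 $ kk) * ?Q + 2 * A * ?g)"
   unfolding D(5) sk Qk by (simp add: algebra_simps)
  have pos: "0 <= 1 + 2 * A * y0 $ kk" using A yr by simp
  have "(1 + 2 * A * y0 $ kk) * - (C * ?g) <= (1 + 2 * A * y0 $ kk) * ?Q"
   using D(6) by (intro mult_left_mono pos) auto
  moreover have "(1 + 2 * A * y0 $ kk) * C <= C + 2 * A * \<rho> * C"
  proof -
   have "A * y0 $ kk * C <= A * \<rho> * C" using yr A C by (intro mult_right_mono mult_left_mono) auto
   then show ?thesis by (simp add: algebra_simps)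
  qed
  then have "(1 + 2 * A * y0 $ kk) * C < 2 * A" using A(2) by linarith
  then have "(1 + 2 * A * y0 $ kk) * C * ?g < 2 * A * ?g" using g by (rule mult_strict_right_mono)
  ultimately have "(1 + 2 * A * y0 $ kk) * ?Q + 2 * A * ?g > 0" by (simp add: algebra_simps)
  then show ?thesis unfolding e using lam \<kappa> by simp
 qed
 ultimately show False by linarith
qed

text \<open>Where the comparison function touches \<open>s u\<close> from above at the boundary, compare the derivatives along the
 inward normal.\<close>

lemma no_boundary_maximum:
 fixes lam \<kappa> A s :: real
 assumes i: "i < N" and y0: "y0 \<in> rng (c i)" "y0 $ kk = 0"
  and robin: "!!x. x \<in> boundary M ==> normal_derivative M u x = \<sigma> * u x"
  and touch: "s * local_expr (c i) u y0 = lam"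
  and le: "!!y. y \<in> rng (c i) ==> y $ kk <= \<rho> ==> s * local_expr (c i) u y <= lam * (1 - \<kappa> * (y $ kk + A * (y $ kk)^2))"
 shows "\<kappa> * lam <= \<sigma> * lam"
proof -
 note ci = cc_atlas[OF i]
 let ?x = "coord_inv (c i) y0" and ?U = "local_expr (c i) u"
 have x: "?x \<in> cdom (c i)" "coord (c i) ?x = y0" using ci y0 by auto
 have g: "matrix_inv (metric M (c i) ?x) $ kk $ kk = 1"
  using ccoord_inverse_metric[OF cc[OF i] rs y0(1)] y0(2) rs by (simp add: gloc_def)
 define e where "e = matrix_inv (metric M (c i) ?x) *v axis kk (1::real)"
 have ek: "e $ kk = 1" unfolding e_def using g by (simp add: matrix_vector_mult_def axis_def if_distrib cong: if_cong)
 have "dgrad (c i) u ?x \<bullet> e = (matrix_inv (metric M (c i) ?x) *v dgrad (c i) u ?x) $ kk"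
  using posdef_inner_commute[OF posdef_matrix_inv[OF metric_posdef[OF ci x(1)]], of "dgrad (c i) u ?x" "axis kk 1"]
  unfolding e_def by (simp add: inner_axis')
 then have due: "dif (c i) u ?x e = - \<sigma> * u ?x"
  using linear_dgrad[OF C1_diff_at[OF u1 ci x(1)], of e] robin_in_chart[OF i y0 robin] by (simp add: gloc_def)
 obtain W where W: "open W" "rng (c i) = HS Int W" using atlasD(2)[OF ci] by (auto simp: openin_open)
 let ?l = "%t. y0 + t *R e"
 have "open (?l -` W)" "0 \<in> ?l -` W" using y0(1) W by (auto intro!: open_vimage continuous_intros)
 then obtain b0 where b0: "b0 > 0" "ball 0 b0 <= ?l -` W" using open_contains_ball by blast
 define b where "b = min b0 \<rho>"
 have bpos: "b > 0" using b0 rho by (simp add: b_def)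
 have lr: "?l t \<in> rng (c i)" "?l t $ kk = t" "t <= \<rho>" if "t \<in> {0..<b}" for t
 proof -
  show k: "?l t $ kk = t" using y0(2) ek by simp
  then show "?l t \<in> rng (c i)" using that b0(2) unfolding W(2) by (auto simp: half_space_def b_def dist_real_def subset_eq)
  show "t <= \<rho>" using that by (simp add: b_def)
 qed
 have D: "(?U has_derivative dif (c i) u ?x) (at (?l 0) within ?l ` {0..<b})"
  using C1_diff_at[OF u1 ci x(1)] x(2) lr(1) unfolding diff_at_def by (auto intro: has_derivative_subset)
 have "(?l has_derivative (%t. t *R e)) (at 0 within {0..<b})" by (auto intro!: derivative_eq_intros)
 from diff_chain_within[OF this D]
 have 1: "((%t. ?U (?l t)) has_derivative (%t. dif (c i) u ?x (t *R e))) (at 0 within {0..<b})" by (simp add: o_def)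
 have e: "(%t. dif (c i) u ?x (t *R e)) = (*) (- \<sigma> * u ?x)"
  using linear_dgrad[OF C1_diff_at[OF u1 ci x(1)]] due by (simp add: fun_eq_iff)
 have 2: "((%t. ?U (?l t)) has_real_derivative (- \<sigma> * u ?x)) (at 0 within {0..<b})"
  using 1 unfolding has_field_derivative_def e .
 let ?h = "%t. lam * (1 - \<kappa> * (t + A * t^2)) - s * ?U (?l t)"
 have "(?h has_real_derivative (\<sigma> * (s * u ?x) - \<kappa> * lam)) (at 0 within {0..<b})"
  by (rule 2 derivative_eq_intros refl)+ (simp add: algebra_simps)
 then have "0 <= \<sigma> * (s * u ?x) - \<kappa> * lam"
 proof (rule right_derivative_nonneg[OF _ bpos])
  fix t assume t: "t \<in> {0..<b}"
  have "?h 0 = 0" using touch by simp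
  also have "0 <= ?h t" using le[OF lr(1)[OF t]] lr(2,3)[OF t] by simp
  finally show "?h 0 <= ?h t" .
 qed
 then show ?thesis using touch by (simp add: local_expr_def)
qed

text \<open>The signs \<open>s = 1\<close> and \<open>s = - 1\<close> together give the bound for \<open>\<bar>u\<bar>\<close>.\<close>

lemma boundary_le_parallel:
 assumes cpt: "compact X" and robin: "!!x. x \<in> boundary M ==> normal_derivative M u x = \<sigma> * u x"
  and \<sigma>: "\<sigma> > 0" "\<sigma> * \<rho> <= 1 / 4"
  and B: "B >= 0" "!!y. y \<in> level \<rho> ==> s * u y <= B" and x: "x \<in> boundary M"
 shows "s * u x <= 2 * B"
proof -
 \<comment> \<open>\<open>\<kappa> > \<sigma>\<close> excludes a maximum on the boundary, \<open>A > C\<close> gives strict superharmonicity, and \<open>\<kappa> (\<rho> + A \<rho>\<^sup>2) \<le> 1/2\<close>\<close>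
 define \<kappa> A where "\<kappa> = 4 * \<sigma> / 3" and "A = C + 1 / (4 * rs)"
 define \<phi> where "\<phi> t = 1 - \<kappa> * (t + A * t^2)" for t
 have A: "A > C" "A * rs <= 1 / 2" using C rs by (auto simp: A_def field_simps)
 have A0: "A >= 0" using A C by simp
 have \<phi>: "\<phi> t >= 1 / 2" if t: "0 <= t" "t <= \<rho>" for t
 proof -
  have "A * t <= A * rs" using t rho A0 by (intro mult_left_mono) auto
  then have "1 + A * t <= 3 / 2" using A by simp
  moreover have "\<sigma> * t <= 1 / 4" using \<sigma> t mult_left_mono[of t \<rho> \<sigma>] by linarith
  ultimately have "(\<sigma> * t) * (1 + A * t) <= 1 / 4 * (3 / 2)" using t A0 \<sigma> by (intro mult_mono) auto
  moreover have "\<phi> t = 1 - 4 / 3 * ((\<sigma> * t) * (1 + A * t))"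
   by (simp add: \<phi>_def \<kappa>_def field_simps power2_eq_square)
  ultimately show ?thesis by linarith
 qed
 have "2 * A * \<rho> * C + C < 2 * A"
 proof -
  have "\<rho> * C <= 1 / 4" using rho C mult_right_mono[of \<rho> rs C] by (simp add: mult.commute)
  then have "2 * A * (\<rho> * C) <= 2 * A * (1 / 4)" using A0 by (intro mult_left_mono) auto
  moreover have "2 * A * \<rho> * C = 2 * A * (\<rho> * C)" by simp
  ultimately show ?thesis using A(1) C(1) by linarith
 qed
 note A2 = this
 let ?K = "collar M \<rho>"
 have Ks: "?K <= collar M rs" using rho by (auto simp: collar_def intro: order_trans ennreal_leI)
 have dK: "0 <= bdist_real M y" "bdist_real M y <= \<rho>" "bdist M y = ennreal (bdist_real M y)" if "y \<in> ?K" for y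
 proof -
  have "bdist M y <= ennreal \<rho>" using that by (simp add: collar_def)
  then show "bdist_real M y <= \<rho>" using rho by (simp add: bdist_real_def enn2real_leI)
  show "bdist M y = ennreal (bdist_real M y)" using \<open>bdist M y <= ennreal \<rho>\<close> unfolding bdist_real_def
   by (metis ennreal_enn2real ennreal_less_top le_less_trans)
 qed (simp add: bdist_real_def)
 have xK: "x \<in> ?K" and x0: "bdist_real M x = 0"
  using x bdist_boundary[OF x] by (auto simp: collar_def boundary_def bdist_real_def)
 let ?q = "%y. s * u y / \<phi> (bdist_real M y)"
 have "continuous_on ?K ?q" unfolding \<phi>_def
 proof (intro continuous_on_divide continuous_on_mult continuous_on_diff continuous_on_add continuous_on_power continuous_on_const
   continuous_on_subset[OF Ck_fun_on_continuous[OF u1]] continuous_on_subset[OF bdist_continuous Ks] ballI)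
  show "?K <= X" by (auto simp: collar_def)
  show "1 - \<kappa> * (bdist_real M y + A * (bdist_real M y)^2) ~= 0" if "y \<in> ?K" for y
   using \<phi>[OF dK(1,2)[OF that]] by (simp add: \<phi>_def)
 qed
 then obtain p where p: "p \<in> ?K" "!!y. y \<in> ?K ==> ?q y <= ?q p"
  using continuous_attains_sup[OF collar_compact[OF cpt]] xK by blast
 define lam where "lam = ?q p"
 have le: "s * u y <= lam * \<phi> (bdist_real M y)" if y: "y \<in> ?K" for y
  using p(2)[OF y] \<phi>[OF dK(1,2)[OF y]] by (simp add: lam_def pos_divide_le_eq)
 have sx: "s * u x <= lam" using le[OF xK] x0 by (simp add: \<phi>_def)
 show ?thesis
 proof (cases "lam > 0")
  case False
  then show ?thesis using sx B(1) by simp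
 next
  case True
  have pe: "s * u p = lam * \<phi> (bdist_real M p)" using \<phi>[OF dK(1,2)[OF p(1)]] by (simp add: lam_def)
  have pX: "p \<in> X" "bdist M p <= ennreal rs" using p(1) Ks by (auto simp: collar_def)
  then obtain i where i: "i < N" "p \<in> cdom (c i)" using cover by blast
  note ci = cc_atlas[OF i(1)]
  let ?y0 = "coord (c i) p"
  have yk: "?y0 $ kk = bdist_real M p" using cc_coordinate(2)[OF i] cc_le_iff[OF i] pX by simp
  have pU: "local_expr (c i) u ?y0 = u p" using ci i by (simp add: local_expr_def)
  have chart_le: "s * local_expr (c i) u y <= lam * \<phi> (y $ kk)" if y: "y \<in> rng (c i)" "y $ kk <= \<rho>" for y
  proof -
   note P = slab_point[OF i(1) y(1) order_trans[OF y(2) rho(2)]]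
   have "coord_inv (c i) y \<in> ?K" using P(1,2) y(2) by (simp add: collar_def ennreal_leI)
   from le[OF this] show ?thesis using P(3) by (simp add: local_expr_def)
  qed
  have "bdist_real M p = \<rho>"
  proof (rule ccontr)
   assume n: "bdist_real M p ~= \<rho>"
   show False
   proof (cases "bdist_real M p = 0")
    case True
    have "\<kappa> * lam <= \<sigma> * lam"
     by (rule no_boundary_maximum[OF i(1), where ?y0.0 = ?y0 and A = A and s = s])
      (insert i yk True robin pU pe chart_le, auto simp: \<phi>_def)
    then show False using \<open>lam > 0\<close> \<sigma> by (simp add: \<kappa>_def)
   next
    case False
    have "?y0 \<in> open_slab i" using False n dK(1,2)[OF p(1)] yk i(2) by (simp add: open_slab_def)
    then show False
    proof (rule no_interior_maximum[OF i(1) _ \<open>lam > 0\<close> _ A0 A2, where \<kappa> = \<kappa> and s = s])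
     show "\<kappa> > 0" using \<sigma> by (simp add: \<kappa>_def)
     fix y assume "y \<in> open_slab i"
     then have "s * local_expr (c i) u y <= lam * \<phi> (y $ kk)" using chart_le by (simp add: open_slab_def)
     then show "s * local_expr (c i) u y - lam * (1 - \<kappa> * (y $ kk + A * (y $ kk)^2))
       <= s * local_expr (c i) u ?y0 - lam * (1 - \<kappa> * (?y0 $ kk + A * (?y0 $ kk)^2))"
      using pe pU yk by (simp add: \<phi>_def)
    qed
   qed
  qed
  then have "p \<in> level \<rho>" using dK(3)[OF p(1)] pX by (simp add: parallel_hypersurface_def)
  then have "s * u p <= B" by (rule B(2))
  moreover have "lam * (1 / 2) <= s * u p"
   unfolding pe using \<phi>[OF dK(1,2)[OF p(1)]] True by (intro mult_left_mono) auto
  ultimately show ?thesis using sx by linarith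
 qed
qed

lemma sup_bound:
 assumes cpt: "compact X" and robin: "!!x. x \<in> boundary M ==> normal_derivative M u x = \<sigma> * u x"
  and \<sigma>: "\<sigma> > 0" "\<sigma> * \<rho> <= 1 / 4"
 shows "(SUP x\<in>boundary M. ennreal \<bar>u x\<bar>) <= 2 * (SUP x\<in>level \<rho>. ennreal \<bar>u x\<bar>)"
proof (rule SUP_least)
 fix x assume x: "x \<in> boundary M"
 let ?B = "SUP x\<in>level \<rho>. ennreal \<bar>u x\<bar>"
 show "ennreal \<bar>u x\<bar> <= 2 * ?B"
 proof (cases "?B = top")
  case True
  show ?thesis unfolding True by (simp add: ennreal_mult_top)
 next
  case False
  define B where "B = enn2real ?B"
  have Be: "ennreal B = ?B" unfolding B_def by (rule ennreal_enn2real, rule top.not_eq_extremum[THEN iffD1]) (rule False)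
  have B0: "B >= 0" by (simp add: B_def)
  have le: "\<bar>u y\<bar> <= B" if "y \<in> level \<rho>" for y
  proof -
   have "ennreal \<bar>u y\<bar> <= ennreal B" unfolding Be using that by (rule SUP_upper)
   then show ?thesis using B0 by simp
  qed
  have "s * u x <= 2 * B" if "\<bar>s\<bar> = 1" for s
  proof (rule boundary_le_parallel[OF cpt robin \<sigma> B0 _ x])
   fix y assume "y \<in> level \<rho>"
   moreover have "s * u y <= \<bar>u y\<bar>" using that abs_ge_self[of "s * u y"] by (simp add: abs_mult)
   ultimately show "s * u y <= B" using le by fastforce
  qed
  from this[of 1] this[of "-1"] have "\<bar>u x\<bar> <= 2 * B" by simp
  then have "ennreal \<bar>u x\<bar> <= ennreal (2 * B)" by (rule ennreal_leI)
  also have "... = 2 * ?B" using Be B0 by (simp add: ennreal_mult)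
  finally show ?thesis .
 qed
qed

end

section \<open>The theorem\<close>

theorem theorem8p3:
  fixes M :: "('p::t2_space, 'n::finite) riem"
    and u :: "'p \<Rightarrow> real" and \<sigma> \<rho>_star C\<^sub>H \<rho>\<^sub>\<sigma> :: real
  assumes "riemannian_manifold_with_boundary M" and "compact (carrier M)"
    and "\<sigma> \<ge> 1"
    and "steklov_solution M \<sigma> u"
    and "\<rho>_star > 0"
    and "Ck_fun_on M 2 (bdist_real M) (collar M \<rho>_star)"
    and "C\<^sub>H \<ge> 0" and "ennreal C\<^sub>H = Linf_norm M (collar M \<rho>_star) (laplacian M (bdist_real M))"
    and "C\<^sub>H * \<rho>_star \<le> 1 / 4"
    and "\<rho>\<^sub>\<sigma> = min \<rho>_star (1 / (4 * \<sigma>))"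
  shows "(SUP x\<in>boundary M. ennreal \<bar>u x\<bar>)
           \<le> 2 * (SUP x\<in>parallel_hypersurface M \<rho>\<^sub>\<sigma>. ennreal \<bar>u x\<bar>) \<and>
         L2_norm_sq (surface_measure M (boundary M)) u
           \<le> ennreal (4 * exp (C\<^sub>H * \<rho>\<^sub>\<sigma>)) *
               L2_norm_sq (surface_measure M (parallel_hypersurface M \<rho>\<^sub>\<sigma>)) u \<and>
         ennreal (4 * exp (C\<^sub>H * \<rho>\<^sub>\<sigma>)) *
             L2_norm_sq (surface_measure M (parallel_hypersurface M \<rho>\<^sub>\<sigma>)) u
           \<le> 6 * L2_norm_sq (surface_measure M (parallel_hypersurface M \<rho>\<^sub>\<sigma>)) u"
proof -
  interpret riem_manifold M by unfold_locales (rule assms(1))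
  obtain N and c :: "nat \<Rightarrow> ('p, 'n) chart" and z :: "nat \<Rightarrow> real ^ 'n" and r :: "nat \<Rightarrow> real" where cov: "\<And>i. i < N \<Longrightarrow> ccoord \<rho>_star (c i) (z i) (r i)"
    "\<And>x. x \<in> carrier M \<Longrightarrow> bdist M x \<le> ennreal \<rho>_star \<Longrightarrow> \<exists>i<N. x \<in> cdom (c i) \<and> norm (coord (c i) x - z i) < r i / 2"
  proof (rule finite_collar_cover[OF assms(2,5,6)], goal_cases)
    case (1 N c z r)
    show ?case by (rule 1(1)[of N c z r]) (rule 1(2,3); assumption)+
  qed
  have sol: "Ck_fun_on M 2 u (interior_of_mfd M)" "Ck_fun_on M 1 u (carrier M)"
    "\<And>x. x \<in> interior_of_mfd M \<Longrightarrow> laplacian M u x = 0"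
    and robin: "\<And>x. x \<in> boundary M \<Longrightarrow> normal_derivative M u x = \<sigma> * u x"
    using assms(4) unfolding steklov_solution_def by auto
  have \<rho>: "0 < \<rho>\<^sub>\<sigma>" "\<rho>\<^sub>\<sigma> \<le> \<rho>_star" "\<rho>\<^sub>\<sigma> \<le> 1 / (4 * \<sigma>)" using assms(3,5,10) by auto
  interpret steklov_collar M \<rho>_star N c z r u C\<^sub>H \<rho>\<^sub>\<sigma>
    by unfold_locales (fact assms(5) cov sol assms(6,7,9) \<rho> laplacian_Linf_bound[OF assms(7,8,6)])+
  have \<sigma>: "\<sigma> > 0" "\<sigma> * \<rho>\<^sub>\<sigma> \<le> 1 / 4" using assms(3) \<rho>(3) by (auto simp: field_simps)
  have "C\<^sub>H * \<rho>\<^sub>\<sigma> \<le> 1 / 4" using mult_left_mono[OF \<rho>(2) assms(7)] assms(9) by linarith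
  then have "exp (C\<^sub>H * \<rho>\<^sub>\<sigma>) \<le> exp (1 / 4)" by simp
  \<comment> \<open>\<open>e\<^sup>1\<^sup>/\<^sup>4 \<le> 1 + 1/4 + (1/4)\<^sup>2 \<le> 3/2\<close>\<close>
  also have "exp (1 / 4) \<le> (3 / 2 :: real)" using exp_bound[of "1 / 4 :: real"] by (simp add: power2_eq_square)
  finally have "ennreal (4 * exp (C\<^sub>H * \<rho>\<^sub>\<sigma>)) \<le> ennreal 6" by (intro ennreal_leI) simp
  then have "ennreal (4 * exp (C\<^sub>H * \<rho>\<^sub>\<sigma>)) * L2_norm_sq (surface_measure M (parallel_hypersurface M \<rho>\<^sub>\<sigma>)) u
      \<le> 6 * L2_norm_sq (surface_measure M (parallel_hypersurface M \<rho>\<^sub>\<sigma>)) u"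
    by (intro mult_right_mono) simp_all
  with sup_bound[OF assms(2) robin \<sigma>] L2_bound[OF robin \<sigma>] show ?thesis by simp
qed

end
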